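(* Let $\mathbb{M}$ be a compact, two-point homogeneous Riemannian manifold of dimension $d$, and let $k_m$ be a kernel of polyharmonic or related type on $\mathbb{M}$ (of order $m>d/2$), with associated elliptic operator $\mathcal{L}_m$ and associated finite-dimensional space $\Pi_{\mathcal{J}}$, such that $\mathcal{L}_m$ annihilates $\Pi_{\mathcal{J}}$. Let $\rho>0$ be a fixed mesh ratio. There exist positive constants $h^*$, $\nu$ and $C$, depending only on $\mathbb{M}$ and $k_m$, such that if $\Xi\subset\mathbb{M}$ is a finite set with mesh ratio $h/q\le\rho$ that is sufficiently dense, i.e. $h=h(\Xi,\mathbb{M})\le h^*$, then for every $\zeta\in\Xi$ the coefficients of the Lagrange function $$\chi_\zeta=\sum_{\xi\in\Xi}A_{\zeta,\xi}\,k_m(\cdot,\xi)+p_\zeta\in S(k_m,\Xi,\Pi_{\mathcal{J}}),\qquad p_\zeta\in\Pi_{\mathcal{J}},$$ satisfy, for all $\xi\in\Xi$, $$|A_{\zeta,\xi}|\le C\,q^{d-2m}\exp\left(-\nu\,\frac{\mathrm{dist}(\xi,\zeta)}{h}\right).$$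
   Context: $\mathrm{dist}$ is the Riemannian distance on $\mathbb{M}$ and $L_2(\mathbb{M})$ is taken with respect to the Riemannian volume measure $\mu$. For a finite set $\Xi\subset\mathbb{M}$: $h=h(\Xi,\mathbb{M})=\sup_{x\in\mathbb{M}}\mathrm{dist}(x,\Xi)$ (mesh norm or fill distance), $q=\frac12\min_{\xi\neq\zeta\in\Xi}\mathrm{dist}(\xi,\zeta)$ (separation radius), and $h/q$ is the mesh ratio. Kernels of polyharmonic or related type: let $\Delta$ be the Laplace--Beltrami operator on $\mathbb{M}$, with $L_2$-orthonormal eigenfunctions $(\psi_j)_{j\in\mathbb{N}}$ and corresponding eigenvalues $\lambda_j$. Let $\mathcal{J}\subset\mathbb{N}$ be finite and $\Pi_{\mathcal{J}}=\mathrm{span}\{\psi_j: j\in\mathcal{J}\}$. Let $\mathcal{L}_m=Q(\Delta)=\sum_{j=0}^m b_j\Delta^j$ with $Q$ a real polynomial of degree exactly $m$. A kernel $k_m:\mathbb{M}\times\mathbb{M}\to\mathbb{R}$ is of polyharmonic or related type (with operator $\mathcal{L}_m$ and space $\Pi_{\mathcal{J}}$) if it acts as Green's function for $\mathcal{L}_m$ in the sense that, for smooth $f$, $$f=\int_{\mathbb{M}}k_m(\cdot,\alpha)\,\mathcal{L}_m[f-p_f](\alpha)\,d\mu(\alpha)+p_f,\qquad p_f=\sum_{j\in\mathcal{J}}\langle f,\psi_j\rangle_{L_2(\mathbb{M})}\psi_j,$$ and $Q(\lambda_j)>0$ for all $j\notin\mathcal{J}$ (the numbers $Q(\lambda_j)$,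 $j\notin\mathcal{J}$, are required to lie on one side of $0$; by replacing $k_m$ by $-k_m$ if needed this side is taken to be the positive one). "$\mathcal{L}_m$ annihilates $\Pi_{\mathcal{J}}$" means $\mathcal{L}_m p=0$ for all $p\in\Pi_{\mathcal{J}}$. The kernel space is $$S(k_m,\Xi,\Pi_{\mathcal{J}})=\Big\{\sum_{\xi\in\Xi}a_\xi k_m(\cdot,\xi)+p\;:\;p\in\Pi_{\mathcal{J}},\ \sum_{\xi\in\Xi}a_\xi r(\xi)=0\text{ for all }r\in\Pi_{\mathcal{J}}\Big\}.$$ When $\Xi$ is unisolvent for $\Pi_{\mathcal{J}}$ (i.e. $p\in\Pi_{\mathcal{J}}$ and $p|_\Xi=0$ imply $p=0$), which is the case for all sufficiently dense $\Xi$, the Lagrange function $\chi_\zeta$ ($\zeta\in\Xi$) is the unique element of $S(k_m,\Xi,\Pi_{\mathcal{J}})$ with $\chi_\zeta(\xi)=\delta_{\zeta,\xi}$ for all $\xi\in\Xi$; its coefficients $A_{\zeta,\xi}$ (satisfying $\sum_\xi A_{\zeta,\xi}r(\xi)=0$ for $r\in\Pi_{\mathcal{J}}$) are uniquely determined.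
   Formalization: The kernel k_m is additionally assumed continuous on M×M: the Green's function identity fixes k_m(x,·) only up to null sets, and changing its values on countably many pairs of centers can destroy the existence of the Lagrange functions. *)

theory Defs
  imports "HOL-Analysis.Analysis" "HOL-Computational_Algebra.Polynomial"
begin

section \<open>Smooth functions between normed spaces\<close>

text \<open>Order-\<open>n\<close> differentiability on a set that is meant to be open: \<open>C\<^sup>n\<close> in terms of iterated
  directional derivatives.\<close>

fun Cn_on :: "nat \<Rightarrow> 'a::real_normed_vector set \<Rightarrow> ('a \<Rightarrow> 'b::real_normed_vector) \<Rightarrow> bool" where
  "Cn_on 0 S f \<longleftrightarrow> continuous_on S f"
| "Cn_on (Suc n) S f \<longleftrightarrow>
     (\<forall>x\<in>S. f differentiable (at x)) \<and>
     (\<forall>v. Cn_on n S (\<lambda>x. frechet_derivative f (at x) v))"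

definition smooth_on :: "'a::real_normed_vector set \<Rightarrow> ('a \<Rightarrow> 'b::real_normed_vector) \<Rightarrow> bool" where
  "smooth_on S f \<longleftrightarrow> (\<forall>n. Cn_on n S f)"

definition partial_deriv :: "'d::finite \<Rightarrow> (real^'d \<Rightarrow> real) \<Rightarrow> real^'d \<Rightarrow> real" where
  "partial_deriv i f x = frechet_derivative f (at x) (axis i 1)"


section \<open>Riemannian manifolds\<close>

text \<open>The manifold is the whole type \<open>'a\<close>. A chart is a pair of a domain and a coordinate map, the
  latter being relevant on the domain only. The metric tensor is given by its Gram matrix in each
  chart of the atlas, as a function of the coordinates. The dimension is \<open>CARD('d)\<close>.\<close>

type_synonym ('a, 'd) chart = "'a set \<times> ('a \<Rightarrow> real^'d)"

record ('a, 'd::finite) riem =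
  atlas :: "('a, 'd) chart set"
  gram :: "('a, 'd) chart \<Rightarrow> real^'d \<Rightarrow> real^'d^'d"

abbreviation cdom :: "('a, 'd::finite) chart \<Rightarrow> 'a set" where "cdom \<equiv> fst"
abbreviation coord :: "('a, 'd::finite) chart \<Rightarrow> 'a \<Rightarrow> real^'d" where "coord \<equiv> snd"

definition param :: "('a, 'd::finite) chart \<Rightarrow> real^'d \<Rightarrow> 'a" where
  "param c = inv_into (cdom c) (coord c)"

text \<open>Some chart around a point. The notions below that use it (speed of a curve,
  Laplace--Beltrami operator) do not depend on the choice.\<close>

definition chart_at :: "('a, 'd::finite) riem \<Rightarrow> 'a \<Rightarrow> ('a, 'd) chart" where
  "chart_at R p = (SOME c. c \<in> atlas R \<and> p \<in> cdom c)"

definition smooth_function :: "('a, 'd::finite) riem \<Rightarrow> ('a \<Rightarrow> real) \<Rightarrow> bool" where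
  "smooth_function R f \<longleftrightarrow> (\<forall>c\<in>atlas R. smooth_on (coord c ` cdom c) (f \<circ> param c))"

definition smooth_map :: "('a::topological_space, 'd::finite) riem \<Rightarrow> ('a \<Rightarrow> 'a) \<Rightarrow> bool" where
  "smooth_map R \<Phi> \<longleftrightarrow> continuous_on UNIV \<Phi> \<and>
     (\<forall>c\<in>atlas R. \<forall>c'\<in>atlas R.
        smooth_on (coord c ` (cdom c \<inter> \<Phi> -` cdom c')) (coord c' \<circ> \<Phi> \<circ> param c))"

text \<open>\<open>\<Phi>\<close> pulls the metric tensor back to itself.\<close>

definition preserves_metric :: "('a, 'd::finite) riem \<Rightarrow> ('a \<Rightarrow> 'a) \<Rightarrow> bool" where
  "preserves_metric R \<Phi> \<longleftrightarrow>
     (\<forall>c\<in>atlas R. \<forall>c'\<in>atlas R. \<forall>p \<in> cdom c \<inter> \<Phi> -` cdom c'.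
        let J = jacobian (coord c' \<circ> \<Phi> \<circ> param c) (at (coord c p)) in
        gram R c (coord c p) = transpose J ** gram R c' (coord c' (\<Phi> p)) ** J)"

text \<open>\<open>C\<^sup>1\<close> arcs on \<open>{a..b}\<close>, with one-sided derivatives at the end points.\<close>

definition C1_arc :: "('a::topological_space, 'd::finite) riem \<Rightarrow> real \<Rightarrow> real \<Rightarrow> (real \<Rightarrow> 'a) \<Rightarrow> bool" where
  "C1_arc R a b \<gamma> \<longleftrightarrow> continuous_on {a..b} \<gamma> \<and>
     (\<forall>c\<in>atlas R. \<exists>D. continuous_on {t\<in>{a..b}. \<gamma> t \<in> cdom c} D \<and>
        (\<forall>t\<in>{t\<in>{a..b}. \<gamma> t \<in> cdom c}.
           ((coord c \<circ> \<gamma>) has_vector_derivative D t) (at t within {a..b})))"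

definition speed :: "('a, 'd::finite) riem \<Rightarrow> real \<Rightarrow> real \<Rightarrow> (real \<Rightarrow> 'a) \<Rightarrow> real \<Rightarrow> real" where
  "speed R a b \<gamma> t =
     (let c = chart_at R (\<gamma> t);
          v = vector_derivative (coord c \<circ> \<gamma>) (at t within {a..b})
      in sqrt (v \<bullet> (gram R c (coord c (\<gamma> t)) *v v)))"

definition arc_length :: "('a, 'd::finite) riem \<Rightarrow> real \<Rightarrow> real \<Rightarrow> (real \<Rightarrow> 'a) \<Rightarrow> real" where
  "arc_length R a b \<gamma> = integral {a..b} (speed R a b \<gamma>)"

text \<open>The lengths of all piecewise \<open>C\<^sup>1\<close> curves from \<open>x\<close> to \<open>y\<close>.\<close>

definition curve_lengths :: "('a::topological_space, 'd::finite) riem \<Rightarrow> 'a \<Rightarrow> 'a \<Rightarrow> real set" where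
  "curve_lengths R x y =
     {(\<Sum>i<n. arc_length R (t i) (t (Suc i)) \<gamma>) | (n::nat) t \<gamma>.
        \<gamma> (t 0) = x \<and> \<gamma> (t n) = y \<and>
        (\<forall>i<n. t i < t (Suc i) \<and> C1_arc R (t i) (t (Suc i)) \<gamma>)}"

text \<open>Applying \<open>smooth_map\<close> and \<open>preserves_metric\<close> to the identity expresses that coordinate changes
  are smooth and that the Gram matrices of different charts define one metric tensor. The distance
  of the type is required to be the Riemannian distance, which always induces the manifold
  topology.\<close>

definition riemannian_manifold :: "('a::metric_space, 'd::finite) riem \<Rightarrow> bool" where
  "riemannian_manifold R \<longleftrightarrow>
     (\<Union>c\<in>atlas R. cdom c) = UNIV \<and>
     (\<forall>c\<in>atlas R.
        open (cdom c) \<and> open (coord c ` cdom c) \<and>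
        homeomorphism (cdom c) (coord c ` cdom c) (coord c) (param c) \<and>
        smooth_on (coord c ` cdom c) (gram R c) \<and>
        (\<forall>x\<in>coord c ` cdom c.
           transpose (gram R c x) = gram R c x \<and>
           (\<forall>v. v \<noteq> 0 \<longrightarrow> v \<bullet> (gram R c x *v v) > 0))) \<and>
     smooth_map R id \<and> preserves_metric R id \<and>
     connected (UNIV :: 'a set) \<and>
     (\<forall>x y. dist x y = Inf (curve_lengths R x y))"

definition riemannian_isometry :: "('a::metric_space, 'd::finite) riem \<Rightarrow> ('a \<Rightarrow> 'a) \<Rightarrow> bool" where
  "riemannian_isometry R \<Phi> \<longleftrightarrow>
     bij \<Phi> \<and> smooth_map R \<Phi> \<and> smooth_map R (inv \<Phi>) \<and> preserves_metric R \<Phi>"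

definition two_point_homogeneous :: "('a::metric_space, 'd::finite) riem \<Rightarrow> bool" where
  "two_point_homogeneous R \<longleftrightarrow>
     (\<forall>x1 x2 y1 y2. dist x1 x2 = dist y1 y2 \<longrightarrow>
        (\<exists>\<Phi>. riemannian_isometry R \<Phi> \<and> \<Phi> x1 = y1 \<and> \<Phi> x2 = y2))"

text \<open>The measure is determined by its values on Borel subsets of chart domains.\<close>

definition riemannian_volume :: "('a::metric_space, 'd::finite) riem \<Rightarrow> 'a measure \<Rightarrow> bool" where
  "riemannian_volume R \<mu> \<longleftrightarrow> sets \<mu> = sets borel \<and>
     (\<forall>c\<in>atlas R. \<forall>B\<in>sets borel. B \<subseteq> cdom c \<longrightarrow>
        emeasure \<mu> B =
          (\<integral>\<^sup>+x. ennreal (sqrt (det (gram R c x))) * indicator (coord c ` B) x \<partial>lborel))"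

text \<open>\<open>\<Delta>f = |G|\<^sup>-\<^sup>1\<^sup>/\<^sup>2 \<Sum>\<^sub>i \<partial>\<^sub>i (|G|\<^sup>1\<^sup>/\<^sup>2 \<Sum>\<^sub>j G\<^sup>i\<^sup>j \<partial>\<^sub>j f)\<close>, that is, \<open>div grad\<close>, which has non-positive
  eigenvalues. The opposite sign convention amounts to replacing \<open>Q(X)\<close> by \<open>Q(-X)\<close> below.\<close>

definition laplace_beltrami :: "('a, 'd::finite) riem \<Rightarrow> ('a \<Rightarrow> real) \<Rightarrow> 'a \<Rightarrow> real" where
  "laplace_beltrami R f p =
     (let c = chart_at R p;
          w = (\<lambda>x. sqrt (det (gram R c x)));
          grad = (\<lambda>i x. \<Sum>j\<in>UNIV. matrix_inv (gram R c x) $ i $ j * partial_deriv j (f \<circ> param c) x)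
      in (\<Sum>i\<in>UNIV. partial_deriv i (\<lambda>x. w x * grad i x) (coord c p)) / w (coord c p))"

definition poly_laplace :: "('a, 'd::finite) riem \<Rightarrow> real poly \<Rightarrow> ('a \<Rightarrow> real) \<Rightarrow> 'a \<Rightarrow> real" where
  "poly_laplace R Q f p = (\<Sum>j\<le>degree Q. coeff Q j * ((laplace_beltrami R ^^ j) f) p)"


section \<open>Kernels of polyharmonic or related type\<close>

text \<open>An orthonormal basis of \<open>L\<^sub>2(\<mu>)\<close> consisting of smooth eigenfunctions; the last clause is
  completeness.\<close>

definition laplace_eigenbasis ::
    "('a::metric_space, 'd::finite) riem \<Rightarrow> 'a measure \<Rightarrow> (nat \<Rightarrow> 'a \<Rightarrow> real) \<Rightarrow> (nat \<Rightarrow> real) \<Rightarrow> bool" where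
  "laplace_eigenbasis R \<mu> \<psi> ev \<longleftrightarrow>
     (\<forall>j. smooth_function R (\<psi> j)) \<and>
     (\<forall>j x. laplace_beltrami R (\<psi> j) x = ev j * \<psi> j x) \<and>
     (\<forall>i j. (\<integral>x. \<psi> i x * \<psi> j x \<partial>\<mu>) = (if i = j then 1 else 0)) \<and>
     (\<forall>f. f \<in> borel_measurable \<mu> \<and> integrable \<mu> (\<lambda>x. (f x)\<^sup>2) \<and>
        (\<forall>j. (\<integral>x. f x * \<psi> j x \<partial>\<mu>) = 0) \<longrightarrow> (AE x in \<mu>. f x = 0))"

definition eigenspan :: "(nat \<Rightarrow> 'a \<Rightarrow> real) \<Rightarrow> nat set \<Rightarrow> ('a \<Rightarrow> real) set" where
  "eigenspan \<psi> J = {(\<lambda>x. \<Sum>j\<in>J. c j * \<psi> j x) | c. True}"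

definition eigenproj ::
    "'a measure \<Rightarrow> (nat \<Rightarrow> 'a \<Rightarrow> real) \<Rightarrow> nat set \<Rightarrow> ('a \<Rightarrow> real) \<Rightarrow> 'a \<Rightarrow> real" where
  "eigenproj \<mu> \<psi> J f x = (\<Sum>j\<in>J. (\<integral>y. f y * \<psi> j y \<partial>\<mu>) * \<psi> j x)"

text \<open>The reproducing identity determines \<open>k x\<close> only up to null sets, so kernels are taken to be
  continuous.\<close>

definition polyharmonic_kernel ::
    "('a::metric_space, 'd::finite) riem \<Rightarrow> 'a measure \<Rightarrow> (nat \<Rightarrow> 'a \<Rightarrow> real) \<Rightarrow> (nat \<Rightarrow> real) \<Rightarrow>
     nat set \<Rightarrow> real poly \<Rightarrow> ('a \<Rightarrow> 'a \<Rightarrow> real) \<Rightarrow> bool" where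
  "polyharmonic_kernel R \<mu> \<psi> ev J Q k \<longleftrightarrow>
     finite J \<and>
     (\<forall>j. j \<notin> J \<longrightarrow> poly Q (ev j) > 0) \<and>
     continuous_on UNIV (\<lambda>(x, y). k x y) \<and>
     (\<forall>f. smooth_function R f \<longrightarrow>
        (\<forall>x. f x =
           (\<integral>\<alpha>. k x \<alpha> * poly_laplace R Q (\<lambda>y. f y - eigenproj \<mu> \<psi> J f y) \<alpha> \<partial>\<mu>)
           + eigenproj \<mu> \<psi> J f x))"


section \<open>Point sets and Lagrange functions\<close>

definition fill_distance :: "'a::metric_space set \<Rightarrow> real" where
  "fill_distance X = (SUP x. infdist x X)"

definition separation_radius :: "'a::metric_space set \<Rightarrow> real" where
  "separation_radius X = Min {dist \<xi> \<zeta> | \<xi> \<zeta>. \<xi> \<in> X \<and> \<zeta> \<in> X \<and> \<xi> \<noteq> \<zeta>} / 2"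

definition kernel_sum ::
    "('a \<Rightarrow> 'a \<Rightarrow> real) \<Rightarrow> 'a set \<Rightarrow> ('a \<Rightarrow> real) \<Rightarrow> ('a \<Rightarrow> real) \<Rightarrow> 'a \<Rightarrow> real" where
  "kernel_sum k X A p x = (\<Sum>\<xi>\<in>X. A \<xi> * k x \<xi>) + p x"

definition annihilates :: "'a set \<Rightarrow> ('a \<Rightarrow> real) \<Rightarrow> ('a \<Rightarrow> real) set \<Rightarrow> bool" where
  "annihilates X A P \<longleftrightarrow> (\<forall>r\<in>P. (\<Sum>\<xi>\<in>X. A \<xi> * r \<xi>) = 0)"

definition kernel_space ::
    "('a \<Rightarrow> 'a \<Rightarrow> real) \<Rightarrow> 'a set \<Rightarrow> ('a \<Rightarrow> real) set \<Rightarrow> ('a \<Rightarrow> real) set" where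
  "kernel_space k X P = {kernel_sum k X A p | A p. p \<in> P \<and> annihilates X A P}"

definition is_lagrange ::
    "('a \<Rightarrow> 'a \<Rightarrow> real) \<Rightarrow> 'a set \<Rightarrow> ('a \<Rightarrow> real) set \<Rightarrow> 'a \<Rightarrow> ('a \<Rightarrow> real) \<Rightarrow> bool" where
  "is_lagrange k X P \<zeta> u \<longleftrightarrow>
     u \<in> kernel_space k X P \<and> (\<forall>\<xi>\<in>X. u \<xi> = (if \<xi> = \<zeta> then 1 else 0))"

end

theory Submission
  imports Defs
begin

text \<open>For smooth functions with \<open>h\<close>-dense zeros, \<open>h\<close> small, the energy \<open>E f f = \<integral> f L f\<close> dominates the
 \<open>m\<close>-th Sobolev norm. The coefficients of the Lagrange function at \<open>\<zeta>\<close> satisfy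
 \<open>(\<Sum>A\<^sub>\<xi> g(\<xi>) - E f g)\<^sup>2 \<le> (E f f - A\<^sub>\<zeta>) E g g\<close> for every smooth \<open>f\<close> with the same data; hence a bump \<open>g\<close>
 at \<open>\<xi>\<close> of width about \<open>q\<close>, away from the support of \<open>f\<close>, bounds \<open>A\<^sub>\<xi>\<close> by the excess \<open>E f f - A\<^sub>\<zeta>\<close>. Cutting off
 the difference to a near-minimiser enlarges the support of \<open>f\<close> by \<open>h\<close> and contracts the excess by a fixed
 factor, so that \<open>n \<approx> dist(\<xi>,\<zeta>)/h\<close> steps from a bump at \<open>\<zeta>\<close> give the exponential decay.\<close>

text \<open>For a general v the energy of a cut-off product \<theta> v is not controlled by that of
  v, since derivatives of \<theta> meet lower derivatives of v. It is controlled when v has h-dense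
  zeros and \<theta> varies on the same scale h: then h^(2j) \<open>H j v\<close> \<le> C h^(2m)
  \<open>E v v\<close> for all j \<le> m, and the powers of h lost in differentiating \<theta>
  cancel. This is why layers have width h, whereas bumps have width about q. Sobolev norms appear in
  two forms. The spectral one, \<open>H\<close>, turns interpolation between orders into
  inequalities between powers of an eigenvalue; the coordinate one, \<open>sob\<close>, handles
  products and supports. Elliptic regularity in charts connects them. The number
  \<open>A \<zeta>\<close> is a lower bound for the energy of smooth interpolants of the data at
  \<zeta>. A kernel sum is not known to be smooth, so no smooth minimiser is at hand: truncated
  eigenfunction expansions, corrected by bumps, come within any \<epsilon>, and \<epsilon> is
  removed at the very end. A bump of width q has energy of order q^(d-2m). This enters twice under a
  square root: once through the starting bump at \<zeta>, once through the test bump at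
  \<xi>.\<close>

abbreviation (input) "pd \<equiv> partial_deriv"

subsection \<open>Smooth functions\<close>

lemma has_derivative_cong_open:
 assumes "open S" "x \<in> S" "\<And>y. y \<in> S ==> f y = g y"
 shows "(f has_derivative D) (at x) \<longleftrightarrow> (g has_derivative D) (at x)"
 using assms has_derivative_transform_within_open by metis

lemma frechet_derivative_cong_open:
 assumes "open S" "x \<in> S" "\<And>y. y \<in> S ==> f y = g y"
 shows "frechet_derivative f (at x) = frechet_derivative g (at x)"
 unfolding frechet_derivative_def using has_derivative_cong_open[OF assms] by simp

lemma differentiable_cong_open:
 assumes "open S" "x \<in> S" "\<And>y. y \<in> S ==> f y = g y"
 shows "f differentiable (at x) \<longleftrightarrow> g differentiable (at x)"
 unfolding differentiable_def using has_derivative_cong_open[OF assms] by simp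

lemma Cn_on_cong:
 assumes "open S" "\<And>x. x \<in> S ==> f x = g x"
 shows "Cn_on n S f \<longleftrightarrow> Cn_on n S g"
 using assms(2)
proof (induction n arbitrary: f g)
 case 0
 then show ?case by (simp cong: continuous_on_cong)
next
 case (Suc n)
 have "Cn_on n S (%x. frechet_derivative f (at x) v) \<longleftrightarrow> Cn_on n S (%x. frechet_derivative g (at x) v)" for v
  by (rule Suc.IH) (use frechet_derivative_cong_open[OF assms(1) _ Suc.prems] in auto)
 then show ?case
  using differentiable_cong_open[OF assms(1) _ Suc.prems] by auto
qed

lemma Cn_on_subset: "Cn_on n S f ==> T \<subseteq> S ==> Cn_on n T f"
 by (induction n arbitrary: f) (auto intro: continuous_on_subset)

lemma Cn_on_SucD: "Cn_on (Suc n) S f ==> Cn_on n S f"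
proof (induction n arbitrary: f)
 case 0
 then show ?case
  by (auto intro!: continuous_at_imp_continuous_on simp: differentiable_imp_continuous_within)
next
 case (Suc n)
 have "\<forall>x\<in>S. f differentiable (at x)" "\<And>v. Cn_on (Suc n) S (%x. frechet_derivative f (at x) v)"
  using Suc.prems Cn_on.simps(2)[of "Suc n" S f] by blast+
 then show ?case using Suc.IH Cn_on.simps(2)[of n S f] by blast
qed

lemma Cn_on_imp_continuous_on: "Cn_on n S f ==> continuous_on S f"
proof (induction n)
 case (Suc n)
 then show ?case using Cn_on_SucD by blast
qed simp

lemma Cn_on_const [simp]: "Cn_on n S (%x. c)"
 by (induction n arbitrary: c) auto

lemma frechet_derivative_linear_compose:
 assumes "bounded_linear L" "f differentiable (at x)"
 shows "frechet_derivative (%x. L (f x)) (at x) = (%v. L (frechet_derivative f (at x) v))"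
 using assms by (metis bounded_linear.has_derivative frechet_derivative_at frechet_derivative_works)

lemma differentiable_linear_compose:
 assumes "bounded_linear L" "f differentiable (at x)"
 shows "(%x. L (f x)) differentiable (at x)"
 using assms unfolding differentiable_def by (blast intro: bounded_linear.has_derivative)

lemma Cn_on_linear_compose:
 assumes "open S" "bounded_linear L" "Cn_on n S f"
 shows "Cn_on n S (%x. L (f x))"
 using assms(3)
proof (induction n arbitrary: f)
 case 0
 then show ?case using assms(2) by (auto intro: bounded_linear.continuous_on)
next
 case (Suc n)
 have "Cn_on n S (%x. frechet_derivative (%x. L (f x)) (at x) v)" for v
  using Cn_on_cong[OF assms(1), of "%x. frechet_derivative (%x. L (f x)) (at x) v"
    "%x. L (frechet_derivative f (at x) v)" n]
   Suc.IH[of "%x. frechet_derivative f (at x) v"] Suc.prems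
  by (simp add: frechet_derivative_linear_compose[OF assms(2)])
 then show ?case using Suc.prems assms(2) by (auto intro: differentiable_linear_compose)
qed

lemma Cn_on_add:
 assumes "open S" "Cn_on n S f" "Cn_on n S g"
 shows "Cn_on n S (%x. f x + g x)"
 using assms(2,3)
proof (induction n arbitrary: f g)
 case 0
 then show ?case by (auto intro: continuous_on_add)
next
 case (Suc n)
 have d: "((%x. f x + g x) has_derivative (%v. frechet_derivative f (at x) v + frechet_derivative g (at x) v)) (at x)"
  if "x \<in> S" for x
  using that Suc.prems by (auto intro!: has_derivative_add simp: frechet_derivative_works)
 have "Cn_on n S (%x. frechet_derivative f (at x) v + frechet_derivative g (at x) v)" for v
  using Suc.prems by (intro Suc.IH) auto
 then have "Cn_on n S (%x. frechet_derivative (%x. f x + g x) (at x) v)" for v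
  using Cn_on_cong[OF assms(1), of "%x. frechet_derivative (%x. f x + g x) (at x) v"]
   frechet_derivative_at[OF d, symmetric] by simp
 then show ?case using d by (auto simp: differentiable_def)
qed

lemma Cn_on_bilinear:
 assumes "open S" "bounded_bilinear B" "Cn_on n S f" "Cn_on n S g"
 shows "Cn_on n S (%x. B (f x) (g x))"
 using assms(3,4)
proof (induction n arbitrary: f g)
 case 0
 then show ?case using bounded_bilinear.continuous_on[OF assms(2)] by auto
next
 case (Suc n)
 have d: "((%x. B (f x) (g x)) has_derivative
   (%v. B (f x) (frechet_derivative g (at x) v) + B (frechet_derivative f (at x) v) (g x))) (at x)"
  if "x \<in> S" for x
  using that Suc.prems by (intro bounded_bilinear.FDERIV[OF assms(2)]) (auto simp: frechet_derivative_works)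
 have "Cn_on n S (%x. B (f x) (frechet_derivative g (at x) v) + B (frechet_derivative f (at x) v) (g x))" for v
  using Suc.prems by (intro Cn_on_add[OF assms(1)] Suc.IH Cn_on_SucD[OF Suc.prems(1)] Cn_on_SucD[OF Suc.prems(2)]) auto
 then have "Cn_on n S (%x. frechet_derivative (%x. B (f x) (g x)) (at x) v)" for v
  using Cn_on_cong[OF assms(1), of "%x. frechet_derivative (%x. B (f x) (g x)) (at x) v"]
   frechet_derivative_at[OF d, symmetric] by simp
 then show ?case using d by (auto simp: differentiable_def)
qed

lemma Cn_on_sum:
 assumes "open S" "\<And>i. i \<in> I ==> Cn_on n S (f i)"
 shows "Cn_on n S (%x. \<Sum>i\<in>I. f i x)"
 using assms(2) by (induction I rule: infinite_finite_induct) (auto intro: Cn_on_add[OF assms(1)])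

text \<open>\<open>Cn_on\<close> differentiates in fixed directions only, whereas the chain rule
  produces the moving direction D\<phi>(x) v. Expanding it over \<open>Basis\<close> gives a finite
  sum of products of a C^n coefficient and a derivative of g in a fixed direction, to which the
  induction applies; hence the euclidean domain of g.\<close>

lemma Cn_on_compose:
 fixes g :: "'b::euclidean_space => 'c::real_normed_vector"
 assumes "open S" "open T" "\<phi> ` S \<subseteq> T" "Cn_on n S \<phi>" "Cn_on n T g"
 shows "Cn_on n S (%x. g (\<phi> x))"
 using assms(5,4)
proof (induction n arbitrary: g)
 case 0
 then show ?case using assms(3) continuous_on_compose2 by auto
next
 case (Suc n)
 have d: "((%x. g (\<phi> x)) has_derivative
   (%v. \<Sum>b\<in>Basis. (frechet_derivative \<phi> (at x) v \<bullet> b) *\<^sub>R frechet_derivative g (at (\<phi> x)) b)) (at x)"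
  if "x \<in> S" for x
 proof -
  have g: "(g has_derivative frechet_derivative g (at (\<phi> x))) (at (\<phi> x))"
   using Suc.prems that assms(3) by (auto simp: frechet_derivative_works)
  have "((%x. g (\<phi> x)) has_derivative (%v. frechet_derivative g (at (\<phi> x)) (frechet_derivative \<phi> (at x) v))) (at x)"
   using that Suc.prems has_derivative_compose[of \<phi> "frechet_derivative \<phi> (at x)" x UNIV g "frechet_derivative g (at (\<phi> x))"] g
   by (auto simp: frechet_derivative_works)
  moreover have "frechet_derivative g (at (\<phi> x)) w = (\<Sum>b\<in>Basis. (w \<bullet> b) *\<^sub>R frechet_derivative g (at (\<phi> x)) b)" for w
  proof -
   interpret linear "frechet_derivative g (at (\<phi> x))"
    using g has_derivative_linear by blast
   have "frechet_derivative g (at (\<phi> x)) w = frechet_derivative g (at (\<phi> x)) (\<Sum>b\<in>Basis. (w \<bullet> b) *\<^sub>R b)"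
    by (simp add: euclidean_representation)
   also have "... = (\<Sum>b\<in>Basis. (w \<bullet> b) *\<^sub>R frechet_derivative g (at (\<phi> x)) b)"
    by (simp only: sum scale)
   finally show ?thesis .
  qed
  ultimately show ?thesis by (rule has_derivative_eq_rhs[OF _ ext])
 qed
 have "Cn_on n S (%x. \<Sum>b\<in>Basis. (frechet_derivative \<phi> (at x) v \<bullet> b) *\<^sub>R frechet_derivative g (at (\<phi> x)) b)" for v
 proof (rule Cn_on_sum[OF assms(1)])
  fix b :: 'b
  have *: "Cn_on n S (%x. frechet_derivative \<phi> (at x) v \<bullet> b)"
   using Cn_on_linear_compose[OF assms(1) bounded_linear_inner_left[of b], of n "%x. frechet_derivative \<phi> (at x) v"]
    Suc.prems(2) by simp
  have **: "Cn_on n S (%x. frechet_derivative g (at (\<phi> x)) b)"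
   using Suc.IH[of "%y. frechet_derivative g (at y) b", OF _ Cn_on_SucD[OF Suc.prems(2)]] Suc.prems(1) by simp
  show "Cn_on n S (%x. (frechet_derivative \<phi> (at x) v \<bullet> b) *\<^sub>R frechet_derivative g (at (\<phi> x)) b)"
   using Cn_on_bilinear[OF assms(1) bounded_bilinear_scaleR * **] .
 qed
 then have "Cn_on n S (%x. frechet_derivative (%x. g (\<phi> x)) (at x) v)" for v
  using Cn_on_cong[OF assms(1), of "%x. frechet_derivative (%x. g (\<phi> x)) (at x) v"]
   frechet_derivative_at[OF d, symmetric] by simp
 then show ?case using d by (auto simp: differentiable_def)
qed

lemma Cn_on_Un:
 assumes "open S" "open T" "Cn_on n S f" "Cn_on n T f"
 shows "Cn_on n (S \<union> T) f"
 using assms(3,4) by (induction n arbitrary: f) (auto intro: continuous_on_open_Un assms(1,2))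

lemma Cn_on_linear:
 assumes "open S" "bounded_linear L"
 shows "Cn_on n S L"
proof (cases n)
 case 0
 then show ?thesis using assms(2) linear_continuous_on by auto
next
 case (Suc k)
 have d: "(L has_derivative L) (at x)" for x
  using assms(2) by (simp add: bounded_linear_imp_has_derivative)
 then have "frechet_derivative L (at x) = L" for x using frechet_derivative_at by metis
 then show ?thesis using d Suc by (auto simp: differentiable_def)
qed

lemma smooth_on_cong: "open S ==> (\<And>x. x \<in> S ==> f x = g x) ==> smooth_on S f \<longleftrightarrow> smooth_on S g"
 unfolding smooth_on_def using Cn_on_cong by metis

lemma smooth_on_subset: "smooth_on S f ==> T \<subseteq> S ==> smooth_on T f"
 unfolding smooth_on_def using Cn_on_subset by metis

lemma smooth_on_continuous: "smooth_on S f ==> continuous_on S f"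
 unfolding smooth_on_def using Cn_on_imp_continuous_on by metis

lemma smooth_on_differentiable: "smooth_on S f ==> x \<in> S ==> f differentiable (at x)"
 unfolding smooth_on_def using Cn_on.simps(2)[of 0 S f] by metis

lemma smooth_on_frechet: "smooth_on S f ==> smooth_on S (%x. frechet_derivative f (at x) v)"
 unfolding smooth_on_def using Cn_on.simps(2)[of _ S f] by metis

lemma smooth_on_const [simp]: "smooth_on S (%x. c)"
 by (simp add: smooth_on_def)

lemma smooth_on_linear: "open S ==> bounded_linear L ==> smooth_on S L"
 unfolding smooth_on_def using Cn_on_linear by metis

lemma smooth_on_linear_compose:
 "open S ==> bounded_linear L ==> smooth_on S f ==> smooth_on S (%x. L (f x))"
 unfolding smooth_on_def using Cn_on_linear_compose[of S L _ f] by metis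

lemma smooth_on_add: "open S ==> smooth_on S f ==> smooth_on S g ==> smooth_on S (%x. f x + g x)"
 unfolding smooth_on_def using Cn_on_add[of S _ f g] by metis

lemma smooth_on_scaleR:
 "open S ==> smooth_on S f ==> smooth_on S g ==> smooth_on S (%x. f x *\<^sub>R g x)"
 unfolding smooth_on_def using Cn_on_bilinear[OF _ bounded_bilinear_scaleR, of S _ f g] by metis

lemma smooth_on_mult:
 fixes f g :: "'a::real_normed_vector => real"
 shows "open S ==> smooth_on S f ==> smooth_on S g ==> smooth_on S (%x. f x * g x)"
 using smooth_on_scaleR[of S f g] by simp

lemma smooth_on_minus: "open S ==> smooth_on S f ==> smooth_on S (%x. - f x)"
 using smooth_on_scaleR[of S "%x. - 1" f] by simp

lemma smooth_on_diff: "open S ==> smooth_on S f ==> smooth_on S g ==> smooth_on S (%x. f x - g x)"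
 using smooth_on_add[of S f "%x. - g x"] smooth_on_minus[of S g] by simp

lemma smooth_on_sum:
 "open S ==> (\<And>i. i \<in> I ==> smooth_on S (f i)) ==> smooth_on S (%x. \<Sum>i\<in>I. f i x)"
 by (induction I rule: infinite_finite_induct) (auto intro: smooth_on_add)

lemma smooth_on_prod:
 fixes f :: "'i => 'a::real_normed_vector => real"
 shows "open S ==> (\<And>i. i \<in> I ==> smooth_on S (f i)) ==> smooth_on S (%x. \<Prod>i\<in>I. f i x)"
 by (induction I rule: infinite_finite_induct) (auto intro: smooth_on_mult)

lemma smooth_on_compose:
 fixes g :: "'b::euclidean_space => 'c::real_normed_vector"
 assumes "open S" "open T" "\<phi> ` S \<subseteq> T" "smooth_on S \<phi>" "smooth_on T g"
 shows "smooth_on S (%x. g (\<phi> x))"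
 using assms(4,5) Cn_on_compose[OF assms(1-3), of _ g] unfolding smooth_on_def by blast

lemma smooth_on_Un:
 "open S ==> open T ==> smooth_on S f ==> smooth_on T f ==> smooth_on (S \<union> T) f"
 unfolding smooth_on_def using Cn_on_Un by metis

text \<open>Smoothness is local because \<open>Cn_on\<close> takes derivatives in a full
  neighbourhood of each point (\<open>at x\<close>), never within S. This is what glues expressions
  in different charts together.\<close>

lemma smooth_on_openI:
 assumes "\<And>x. x \<in> S ==> \<exists>U. open U \<and> x \<in> U \<and> smooth_on U f"
 shows "smooth_on S f"
proof -
 have K: "Cn_on n S f" if "\<And>x. x \<in> S ==> \<exists>U. open U \<and> x \<in> U \<and> Cn_on n U f" for n S
  and f :: "'a => 'b" using that
 proof (induction n arbitrary: f)
  case 0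
  then show ?case
   by (metis Cn_on.simps(1) continuous_at_imp_continuous_on continuous_on_eq_continuous_at)
 next
  case (Suc n)
  have "Cn_on n S (%x. frechet_derivative f (at x) v)" for v
   by (rule Suc.IH) (use Suc.prems in \<open>force\<close>)
  moreover have "\<forall>x\<in>S. f differentiable (at x)" using Suc.prems by force
  ultimately show ?case by simp
 qed
 show ?thesis unfolding smooth_on_def
 proof
  fix n
  show "Cn_on n S f" by (rule K[of S n f]) (use assms[unfolded smooth_on_def] in blast)
 qed
qed

lemma smooth_on_component:
 "open S ==> smooth_on S f ==> smooth_on S (%x. f x $ i)"
 by (rule smooth_on_linear_compose[OF _ bounded_linear_vec_nth])

subsection \<open>Functions of one real variable\<close>

text \<open>Made for inductions on n in which the derivative is built from the function itself:
  \<open>inverse\<close> has derivative -(1/x)^2, \<open>sqrt\<close> has derivative 1/(2 sqrt x),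
  and a member of the family \<open>flat\<close> has a derivative in the same family.\<close>

lemma Cn_on_SucI_deriv:
 fixes f :: "real => real"
 assumes "open S" "\<And>x. x \<in> S ==> (f has_real_derivative f' x) (at x)" "Cn_on n S f'"
 shows "Cn_on (Suc n) S f"
proof -
 have "frechet_derivative f (at x) v = f' x * v" if "x \<in> S" for x v
  using frechet_derivative_at[OF assms(2)[OF that, unfolded has_field_derivative_def]] by metis
 moreover have "Cn_on n S (%x. f' x * v)" for v
  using Cn_on_linear_compose[OF assms(1) bounded_linear_mult_left assms(3)] .
 ultimately have "Cn_on n S (%x. frechet_derivative f (at x) v)" for v
  using Cn_on_cong[OF assms(1), of "%x. frechet_derivative f (at x) v" "%x. f' x * v"] by simp
 then show ?thesis
  using assms(2) by (auto simp: differentiable_def has_field_derivative_def)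
qed

lemma smooth_on_inverse_real: "smooth_on {x::real. x \<noteq> 0} inverse"
proof -
 have op: "open {x::real. x \<noteq> 0}" by (simp add: open_Collect_neq)
 have "Cn_on n {x::real. x \<noteq> 0} inverse" for n
 proof (induction n)
  case 0
  then show ?case by (auto intro!: continuous_intros)
 next
  case (Suc n)
  show ?case
  proof (rule Cn_on_SucI_deriv[OF op])
   show "(inverse has_real_derivative (- (inverse x * inverse x))) (at x)" if "x \<in> {x. x \<noteq> 0}" for x :: real
    using that DERIV_inverse[of x] by (simp add: power2_eq_square)
   show "Cn_on n {x::real. x \<noteq> 0} (%x. - (inverse x * inverse x))"
    using Cn_on_linear_compose[OF op bounded_linear_minus[OF bounded_linear_ident]
      Cn_on_bilinear[OF op bounded_bilinear_mult Suc Suc]] .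
  qed
 qed
 then show ?thesis by (simp add: smooth_on_def)
qed

lemma smooth_on_inverse:
 fixes f :: "'a::real_normed_vector => real"
 assumes "open S" "smooth_on S f" "\<And>x. x \<in> S ==> f x \<noteq> 0"
 shows "smooth_on S (%x. inverse (f x))"
 by (rule smooth_on_compose[OF assms(1) _ _ assms(2) smooth_on_inverse_real])
  (use assms(3) in \<open>auto simp: open_Collect_neq\<close>)

lemma smooth_on_divide:
 fixes f :: "'a::real_normed_vector => real"
 assumes "open S" "smooth_on S f" "smooth_on S g" "\<And>x. x \<in> S ==> g x \<noteq> 0"
 shows "smooth_on S (%x. f x / g x)"
 unfolding divide_inverse by (intro smooth_on_mult smooth_on_inverse assms)

lemma smooth_on_sqrt_real: "smooth_on {0<..} sqrt"
proof -
 have "Cn_on n {0<..} sqrt" for n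
 proof (induction n)
  case 0
  then show ?case by (auto intro!: continuous_intros)
 next
  case (Suc n)
  show ?case
  proof (rule Cn_on_SucI_deriv)
   show "(sqrt has_real_derivative (inverse (sqrt x) * (1/2))) (at x)" if "x \<in> {0<..}" for x :: real
    using that DERIV_real_sqrt[of x] by (simp add: field_simps)
   have "Cn_on n {0<..} (%x. inverse (sqrt x))"
    by (rule Cn_on_compose[of _ "{x. x \<noteq> 0}"])
     (use Suc smooth_on_inverse_real in \<open>auto simp: smooth_on_def open_Collect_neq\<close>)
   then show "Cn_on n {0<..} (%x. inverse (sqrt x) * (1/2))"
    using Cn_on_linear_compose[OF _ bounded_linear_mult_left] by (metis open_greaterThan)
  qed simp
 qed
 then show ?thesis by (simp add: smooth_on_def)
qed

lemma smooth_on_sqrt: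
 assumes "open S" "smooth_on S f" "\<And>x. x \<in> S ==> f x > 0"
 shows "smooth_on S (%x. sqrt (f x))"
 by (rule smooth_on_compose[OF assms(1) _ _ assms(2) smooth_on_sqrt_real]) (use assms(3) in auto)

text \<open>The classical smooth function exp(-1/x), multiplied by a polynomial in 1/x so that the
  family is closed under differentiation.\<close>

definition flat :: "real poly => real => real" where
 "flat p x = (if x \<le> 0 then 0 else poly p (inverse x) * exp (- inverse x))"

lemma tendsto_poly_exp_0: "((%x::real. poly p x * exp (- x)) \<longlongrightarrow> 0) at_top"
proof -
 have "((%x. \<Sum>i\<le>degree p. coeff p i * (x ^ i / exp x)) \<longlongrightarrow> (\<Sum>i\<le>degree p. coeff p i * 0)) at_top"
  by (intro tendsto_sum tendsto_mult tendsto_const tendsto_power_div_exp_0)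
 then show ?thesis
  by (simp add: poly_altdef sum_distrib_right sum_divide_distrib exp_minus field_simps)
qed

lemma flat_tendsto_0: "(flat p \<longlongrightarrow> 0) (at 0)"
proof -
 have "((%x. poly p (inverse x) * exp (- inverse x)) \<longlongrightarrow> 0) (at_right 0)"
  using filterlim_compose[OF tendsto_poly_exp_0 filterlim_inverse_at_top_right] .
 then have r: "(flat p \<longlongrightarrow> 0) (at_right 0)"
  by (rule Lim_transform_eventually) (auto simp: flat_def eventually_at_right_less intro!: eventually_at_rightI[of 0 1])
 have l: "(flat p \<longlongrightarrow> 0) (at_left 0)"
  by (rule Lim_transform_eventually[OF tendsto_const])
   (auto simp: flat_def intro!: eventually_at_leftI[of "-1" 0])
 show ?thesis using r l by (simp add: filterlim_at_split)
qed

lemma flat_has_derivative: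
 "(flat p has_real_derivative flat ([:0, 0, 1:] * (p - pderiv p)) x) (at x)"
proof (cases "x = 0")
 case True
 \<comment> \<open>The difference quotient at 0 again belongs to the family, so its limit is an
   instance of \<open>flat_tendsto_0\<close>.\<close>
 have "(%h. (flat p (0 + h) - flat p 0) / h) = flat ([:0, 1:] * p)"
  by (auto simp: flat_def fun_eq_iff field_simps)
 then show ?thesis
  unfolding True DERIV_def using flat_tendsto_0[of "[:0, 1:] * p"] by (simp add: flat_def)
next
 case False
 show ?thesis
 proof (cases "x < 0")
  case True
  have "((%x. 0) has_real_derivative 0) (at x)" by simp
  then have "(flat p has_real_derivative 0) (at x)"
   by (rule DERIV_cong_ev[THEN iffD1, rotated -1])
    (use True in \<open>auto simp: flat_def intro!: eventually_nhds_in_open[of "{..<0}", THEN eventually_mono]\<close>)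
  then show ?thesis using True by (simp add: flat_def)
 next
  case f: False
  with False have x: "x > 0" by simp
  have "((%x. poly p (inverse x) * exp (- inverse x)) has_real_derivative
    poly (pderiv p) (inverse x) * (- (inverse x)\<^sup>2) * exp (- inverse x)
    + poly p (inverse x) * (exp (- inverse x) * (inverse x)\<^sup>2)) (at x)"
   using x by (auto intro!: derivative_eq_intros DERIV_chain2[OF poly_DERIV] simp: power2_eq_square field_simps)
  then have "(flat p has_real_derivative
    poly (pderiv p) (inverse x) * (- (inverse x)\<^sup>2) * exp (- inverse x)
    + poly p (inverse x) * (exp (- inverse x) * (inverse x)\<^sup>2)) (at x)"
   by (rule DERIV_cong_ev[THEN iffD1, rotated -1])
    (use x in \<open>auto simp: flat_def intro!: eventually_nhds_in_open[of "{0<..}", THEN eventually_mono]\<close>)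
  then show ?thesis using x by (simp add: flat_def power2_eq_square algebra_simps)
 qed
qed

lemma smooth_on_flat: "smooth_on UNIV (flat p)"
proof -
 have "Cn_on n UNIV (flat p)" for n
 proof (induction n arbitrary: p)
  case 0
  show ?case using flat_has_derivative DERIV_isCont continuous_at_imp_continuous_on
   by (metis Cn_on.simps(1))
 next
  case (Suc n)
  show ?case by (rule Cn_on_SucI_deriv[OF open_UNIV flat_has_derivative Suc])
 qed
 then show ?thesis by (simp add: smooth_on_def)
qed

definition smooth_step :: "real => real" where
 "smooth_step x = flat 1 x / (flat 1 x + flat 1 (1 - x))"

lemma flat_nonneg: "flat 1 x \<ge> 0" and flat_pos: "x > 0 ==> flat 1 x > 0"
 by (auto simp: flat_def)

lemma smooth_step_denom: "flat 1 x + flat 1 (1 - x) > 0"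
 using flat_nonneg[of x] flat_nonneg[of "1-x"] flat_pos[of x] flat_pos[of "1-x"] by linarith

lemma smooth_step_0: "x \<le> 0 ==> smooth_step x = 0"
 and smooth_step_1: "x \<ge> 1 ==> smooth_step x = 1"
 by (auto simp: smooth_step_def flat_def)

lemma smooth_step_bounds: "0 \<le> smooth_step x" "smooth_step x \<le> 1"
 using smooth_step_denom[of x] flat_nonneg[of x] flat_nonneg[of "1-x"] by (auto simp: smooth_step_def)

lemma smooth_on_smooth_step: "smooth_on UNIV smooth_step"
proof -
 have "smooth_on UNIV (%x. flat 1 (1 - x))"
  by (rule smooth_on_compose[OF open_UNIV open_UNIV _ _ smooth_on_flat])
   (use smooth_on_diff[OF open_UNIV smooth_on_const smooth_on_linear[OF open_UNIV bounded_linear_ident]] in auto)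
 then show ?thesis
  unfolding smooth_step_def[abs_def] using smooth_step_denom
  by (intro smooth_on_divide smooth_on_add smooth_on_flat) (auto simp: less_imp_neq[symmetric])
qed

subsection \<open>Partial derivatives\<close>

lemma frechet_derivative_vec:
 fixes f :: "real^'d => real"
 assumes "f differentiable (at x)"
 shows "frechet_derivative f (at x) v = (\<Sum>i\<in>UNIV. v $ i * pd i f x)"
proof -
 interpret linear "frechet_derivative f (at x)"
  using assms by (rule linear_frechet_derivative)
 have "v = (\<Sum>i\<in>UNIV. v $ i *\<^sub>R axis i 1)"
  by (simp add: vec_eq_iff axis_def if_distrib[where f="%z. _ * z"] cong: if_cong)
 then have "frechet_derivative f (at x) v = frechet_derivative f (at x) (\<Sum>i\<in>UNIV. v $ i *\<^sub>R axis i 1)"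
  by simp
 also have "... = (\<Sum>i\<in>UNIV. v $ i * pd i f x)"
  unfolding sum partial_deriv_def by (intro sum.cong refl) (simp add: scale)
 finally show ?thesis .
qed

lemma has_derivative_partial:
 fixes f :: "real^'d => real"
 assumes "f differentiable (at x)"
 shows "(f has_derivative (%v. \<Sum>i\<in>UNIV. v $ i * pd i f x)) (at x)"
proof -
 have "frechet_derivative f (at x) = (%v. \<Sum>i\<in>UNIV. v $ i * pd i f x)"
  using frechet_derivative_vec[OF assms] by (intro ext)
 then show ?thesis using assms frechet_derivative_works by metis
qed

lemma partial_deriv_eqI:
 "(f has_derivative D) (at x) ==> pd i f x = D (axis i 1)"
 unfolding partial_deriv_def using frechet_derivative_at by metis

lemma partial_deriv_cong:
 assumes "open S" "x \<in> S" "\<And>y. y \<in> S ==> f y = g y"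
 shows "pd i f x = pd i g x"
 unfolding partial_deriv_def using frechet_derivative_cong_open[OF assms] by simp

lemma partial_deriv_const [simp]: "pd i (%x. c) x = 0"
 using partial_deriv_eqI[OF has_derivative_const] .

lemma partial_deriv_add:
 assumes "f differentiable (at x)" "g differentiable (at x)"
 shows "pd i (%x. f x + g x) x = pd i f x + pd i g x"
 using partial_deriv_eqI[OF has_derivative_add[OF assms[unfolded frechet_derivative_works]], of i]
 by (simp add: partial_deriv_def)

lemma partial_deriv_mult:
 assumes "f differentiable (at x)" "g differentiable (at x)"
 shows "pd i (%x. f x * g x) x = f x * pd i g x + pd i f x * g x"
 using partial_deriv_eqI[OF has_derivative_mult[OF assms[unfolded frechet_derivative_works]], of i]
 by (simp add: partial_deriv_def)

lemma partial_deriv_cmult: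
 assumes "f differentiable (at x)"
 shows "pd i (%x. c * f x) x = c * pd i f x"
 using partial_deriv_mult[OF differentiable_const assms, of i c] by simp

lemma partial_deriv_minus:
 assumes "f differentiable (at x)"
 shows "pd i (%x. - f x) x = - pd i f x"
 using partial_deriv_cmult[OF assms, of i "-1"] by simp

lemma partial_deriv_diff:
 assumes "f differentiable (at x)" "g differentiable (at x)"
 shows "pd i (%x. f x - g x) x = pd i f x - pd i g x"
 using partial_deriv_add[OF assms(1) differentiable_minus[OF assms(2)], of i] partial_deriv_minus[OF assms(2), of i]
 by simp

lemma partial_deriv_sum:
 assumes "finite I" "\<And>k. k \<in> I ==> f k differentiable (at x)"
 shows "pd i (%x. \<Sum>k\<in>I. f k x) x = (\<Sum>k\<in>I. pd i (f k) x)"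
 using assms by (induction I rule: finite_induct) (auto simp: partial_deriv_add)

lemma smooth_on_partial: "smooth_on S f ==> smooth_on S (pd i f)"
 unfolding partial_deriv_def[abs_def] by (rule smooth_on_frechet)

text \<open>Symmetry of the second partial derivatives: the second difference quotient is a value of
 either mixed derivative at points that converge to the base point.\<close>

lemma partial_deriv_axis:
 fixes f :: "real^'d => real"
 assumes "f differentiable (at (x + s *\<^sub>R axis i 1))"
 shows "((%s. f (x + s *\<^sub>R axis i 1)) has_real_derivative pd i f (x + s *\<^sub>R axis i 1)) (at s)"
proof -
 have "((%s. x + s *\<^sub>R axis i 1) has_derivative (%h. h *\<^sub>R axis i (1::real))) (at s)"
  by (auto intro!: derivative_eq_intros)
 from has_derivative_compose[OF this, of f] assms
 have "((%s. f (x + s *\<^sub>R axis i 1)) has_derivative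
  (%h. frechet_derivative f (at (x + s *\<^sub>R axis i 1)) (h *\<^sub>R axis i 1))) (at s)"
  by (simp add: frechet_derivative_works)
 moreover have "frechet_derivative f (at (x + s *\<^sub>R axis i 1)) (h *\<^sub>R axis i 1) = pd i f (x + s *\<^sub>R axis i 1) * h" for h
  unfolding partial_deriv_def
  using linear_scale[OF linear_frechet_derivative[OF assms], of h "axis i 1"] by simp
 ultimately show ?thesis by (simp add: has_field_derivative_def)
qed

lemma second_difference_mvt:
 fixes f :: "real^'d => real"
 assumes "smooth_on (ball x e) f" "h > 0" "2 * h < e"
 shows "\<exists>s t. 0 < s \<and> s < h \<and> 0 < t \<and> t < h \<and>
  f (x + h *\<^sub>R axis i 1 + h *\<^sub>R axis j 1) - f (x + h *\<^sub>R axis i 1) - f (x + h *\<^sub>R axis j 1) + f x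
  = h * h * pd j (pd i f) (x + s *\<^sub>R axis i 1 + t *\<^sub>R axis j 1)"
proof -
 have inb: "x + s *\<^sub>R axis i 1 + t *\<^sub>R axis j 1 \<in> ball x e" if "0 \<le> s" "s \<le> h" "0 \<le> t" "t \<le> h" for s t
 proof -
  have "norm (s *\<^sub>R axis i (1::real) + t *\<^sub>R axis j 1) \<le> \<bar>s\<bar> + \<bar>t\<bar>"
   by (rule norm_triangle_le) simp
  also have "... < e" using that assms by linarith
  finally have "norm (s *\<^sub>R axis i (1::real) + t *\<^sub>R axis j 1) < e" .
  moreover have "dist x (x + s *\<^sub>R axis i 1 + t *\<^sub>R axis j 1) = norm (- (s *\<^sub>R axis i (1::real) + t *\<^sub>R axis j 1))"
   unfolding dist_norm by (rule arg_cong[of _ _ norm]) simp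
  ultimately show ?thesis by (simp only: norm_minus_cancel mem_ball)
 qed
 \<comment> \<open>The increment in direction j as a function of the displacement in direction i:
   the second difference is g(h) - g(0), and the mean value theorem is used once in each
   direction.\<close>
 define g where "g = (%s. f (x + h *\<^sub>R axis j 1 + s *\<^sub>R axis i 1) - f (x + s *\<^sub>R axis i 1))"
 define g' where "g' = (%s. pd i f (x + h *\<^sub>R axis j 1 + s *\<^sub>R axis i 1) - pd i f (x + s *\<^sub>R axis i 1))"
 have "(g has_real_derivative g' s) (at s)" if "0 \<le> s" "s \<le> h" for s
  unfolding g_def g'_def
  using inb[of s h] inb[of s 0] that assms
  by (intro DERIV_diff partial_deriv_axis smooth_on_differentiable[OF assms(1)]) (auto simp: add_ac)
 then obtain s where s: "0 < s" "s < h" "g h - g 0 = (h - 0) * g' s"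
  using MVT2[of 0 h g g'] assms by blast
 define k where "k = (%t. pd i f (x + s *\<^sub>R axis i 1 + t *\<^sub>R axis j 1))"
 define k' where "k' = (%t. pd j (pd i f) (x + s *\<^sub>R axis i 1 + t *\<^sub>R axis j 1))"
 have "(k has_real_derivative k' t) (at t)" if "0 \<le> t" "t \<le> h" for t
  unfolding k_def k'_def
  using inb[of s t] that s
  by (intro partial_deriv_axis smooth_on_differentiable[OF smooth_on_partial[OF assms(1)]]) auto
 then obtain t where t: "0 < t" "t < h" "k h - k 0 = (h - 0) * k' t"
  using MVT2[of 0 h k k'] assms(2) by blast
 have "g' s = k h - k 0" by (simp add: g'_def k_def add_ac)
 then have "g h - g 0 = h * h * k' t"
  using s t by simp
 then show ?thesis using s(1,2) t(1,2) unfolding g_def k'_def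
  by (intro exI[of _ s] exI[of _ t]) (simp add: add_ac)
qed

lemma partial_deriv_commute:
 fixes f :: "real^'d => real"
 assumes "open S" "smooth_on S f" "x \<in> S"
 shows "pd i (pd j f) x = pd j (pd i f) x"
proof -
 obtain e where e: "e > 0" "ball x e \<subseteq> S" using assms open_contains_ball by blast
 have sm: "smooth_on (ball x e) f" using smooth_on_subset assms e by blast
 define h where "h = (%n::nat. e / (2 * real (n + 2)))"
 have h: "h n > 0" "2 * h n < e" for n
  using e by (auto simp: h_def field_simps intro: add_pos_nonneg)
 define D where "D = (%n. (f (x + h n *\<^sub>R axis i 1 + h n *\<^sub>R axis j 1) - f (x + h n *\<^sub>R axis i 1)
   - f (x + h n *\<^sub>R axis j 1) + f x) / (h n * h n))"
 have h0: "h \<longlonglongrightarrow> 0"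
  using tendsto_mult[OF tendsto_const[of "e/2"] LIMSEQ_ignore_initial_segment[OF lim_inverse_n, of 2]]
  by (simp add: h_def[abs_def] field_simps)
 have lim: "D \<longlonglongrightarrow> pd b (pd a f) x"
  if ab: "(a = i \<and> b = j) \<or> (a = j \<and> b = i)" for a b
 proof -
  have "\<forall>n. \<exists>s t. 0 < s \<and> s < h n \<and> 0 < t \<and> t < h n \<and>
   D n = pd b (pd a f) (x + s *\<^sub>R axis a 1 + t *\<^sub>R axis b 1)"
  proof
   fix n
   from second_difference_mvt[OF sm h, of n a b] obtain s t where st: "0 < s" "s < h n" "0 < t" "t < h n"
    "f (x + h n *\<^sub>R axis a 1 + h n *\<^sub>R axis b 1) - f (x + h n *\<^sub>R axis a 1) - f (x + h n *\<^sub>R axis b 1) + f x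
    = h n * h n * pd b (pd a f) (x + s *\<^sub>R axis a 1 + t *\<^sub>R axis b 1)"
    by blast
   have "D n = (f (x + h n *\<^sub>R axis a 1 + h n *\<^sub>R axis b 1) - f (x + h n *\<^sub>R axis a 1) - f (x + h n *\<^sub>R axis b 1) + f x) / (h n * h n)"
    using ab by (auto simp: D_def algebra_simps)
   then have "D n = pd b (pd a f) (x + s *\<^sub>R axis a 1 + t *\<^sub>R axis b 1)"
    using st(5) h(1)[of n] by simp
   then show "\<exists>s t. 0 < s \<and> s < h n \<and> 0 < t \<and> t < h n \<and>
    D n = pd b (pd a f) (x + s *\<^sub>R axis a 1 + t *\<^sub>R axis b 1)"
    using st by blast
  qed
  then obtain s t where st: "\<And>n. 0 < s n" "\<And>n. s n < h n" "\<And>n. 0 < t n" "\<And>n. t n < h n"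
   and D: "\<And>n. D n = pd b (pd a f) (x + s n *\<^sub>R axis a 1 + t n *\<^sub>R axis b 1)"
   by metis
  have "s \<longlonglongrightarrow> 0" "t \<longlonglongrightarrow> 0"
   using st by (auto intro!: tendsto_sandwich[OF _ _ tendsto_const h0] eventuallyI simp: less_imp_le)
  then have "(%n. x + s n *\<^sub>R axis a 1 + t n *\<^sub>R axis b 1) \<longlonglongrightarrow> x + 0 *\<^sub>R axis a 1 + 0 *\<^sub>R axis b 1"
   by (intro tendsto_intros)
  then have "(%n. x + s n *\<^sub>R axis a 1 + t n *\<^sub>R axis b 1) \<longlonglongrightarrow> x" by simp
  moreover have "isCont (pd b (pd a f)) x"
   using smooth_on_continuous[OF smooth_on_partial[OF smooth_on_partial[OF assms(2)]]] assms
   by (simp add: continuous_on_eq_continuous_at)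
  ultimately show ?thesis
   unfolding D using isCont_tendsto_compose by blast
 qed
 show ?thesis using LIMSEQ_unique[OF lim[of i j] lim[of j i]] by simp
qed

text \<open>The squared norm of the tensor of n-th derivatives. Index tuples are ordered, so a mixed
  derivative is counted once for each ordering and the recursion needs no multi-indices.\<close>

fun jet :: "nat => (real^'d::finite => real) => real^'d => real" where
 "jet 0 f x = (f x)\<^sup>2"
| "jet (Suc n) f x = (\<Sum>i\<in>UNIV. jet n (pd i f) x)"

text \<open>\<open>sjet n h f x = (\<Sum>i\<le>n. h\<^sup>2\<^sup>i * jet i f x)\<close>, see \<open>sjet_eq\<close>; the recursive form makes it
 submultiplicative by induction.\<close>

fun sjet :: "nat => real => (real^'d::finite => real) => real^'d => real" where
 "sjet 0 h f x = (f x)\<^sup>2"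
| "sjet (Suc n) h f x = (f x)\<^sup>2 + h\<^sup>2 * (\<Sum>i\<in>UNIV. sjet n h (pd i f) x)"

lemma jet_nonneg [simp]: "jet n f x \<ge> 0"
 by (induction n arbitrary: f) (auto intro: sum_nonneg)

lemma sjet_nonneg [simp]: "sjet n h f x \<ge> 0"
 by (induction n arbitrary: f) (auto intro!: sum_nonneg add_nonneg_nonneg mult_nonneg_nonneg)

lemma sjet_eq: "sjet n h f x = (\<Sum>i\<le>n. h ^ (2 * i) * jet i f x)"
proof (induction n arbitrary: f)
 case (Suc n)
 have "sjet (Suc n) h f x = (f x)\<^sup>2 + h\<^sup>2 * (\<Sum>k\<in>UNIV. \<Sum>i\<le>n. h ^ (2 * i) * jet i (pd k f) x)"
  by (simp add: Suc.IH)
 also have "... = (f x)\<^sup>2 + (\<Sum>i\<le>n. h ^ (2 * Suc i) * jet (Suc i) f x)"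
  by (subst sum.swap) (simp add: sum_distrib_left power2_eq_square mult_ac)
 also have "... = (\<Sum>i\<le>Suc n. h ^ (2 * i) * jet i f x)"
  by (subst sum.atMost_Suc_shift) simp
 finally show ?case .
qed simp

lemma jet_le_sjet: "i \<le> n ==> jet i f x \<le> sjet n 1 f x"
 unfolding sjet_eq by (rule order_trans[OF _ member_le_sum[of i]]) auto

lemma sjet_mono: "n \<le> m ==> sjet n h f x \<le> sjet m h f x"
 unfolding sjet_eq by (rule sum_mono2) auto

lemma sjet_partial_le: "sjet n 1 (pd i f) x \<le> sjet (Suc n) 1 f x"
proof -
 have "sjet n 1 (pd i f) x \<le> (\<Sum>i\<in>UNIV. sjet n 1 (pd i f) x)"
  by (rule member_le_sum) auto
 then show ?thesis by (simp add: add_increasing)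
qed

text \<open>For h \<le> 1 the smallest weight in the scaled jet is that of the top order. This is
  how estimates at scale h return to unscaled norms, at the price of h^(2n).\<close>

lemma sjet_unit_le:
 assumes "0 < h" "h \<le> 1"
 shows "h ^ (2 * n) * sjet n 1 f x \<le> sjet n h f x"
 unfolding sjet_eq sum_distrib_left using assms
 by (intro sum_mono) (auto intro!: mult_right_mono power_decreasing)

lemma jet_cong:
 assumes "open S" "x \<in> S" "\<And>y. y \<in> S ==> f y = g y"
 shows "jet n f x = jet n g x"
 using assms(3)
proof (induction n arbitrary: f g)
 case (Suc n)
 have "jet n (pd i f) x = jet n (pd i g) x" for i
  by (rule Suc.IH) (rule partial_deriv_cong[OF assms(1) _ Suc.prems])
 then show ?case by simp
qed (use assms in simp)

lemma sjet_cong: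
 assumes "open S" "x \<in> S" "\<And>y. y \<in> S ==> f y = g y"
 shows "sjet n h f x = sjet n h g x"
 unfolding sjet_eq using jet_cong[OF assms] by simp

lemma continuous_on_jet: "smooth_on S f ==> continuous_on S (jet n f)"
proof (induction n arbitrary: f)
 case 0
 show ?case by (simp add: continuous_on_power[OF smooth_on_continuous[OF 0]])
next
 case (Suc n)
 show ?case using Suc.IH[OF smooth_on_partial[OF Suc.prems]] by (auto intro: continuous_on_sum)
qed

lemma continuous_on_sjet: "smooth_on S f ==> continuous_on S (sjet n h f)"
 unfolding sjet_eq[abs_def] by (intro continuous_intros continuous_on_jet)

lemma sq_add_le: "((a::real) + b)\<^sup>2 \<le> 2 * (a\<^sup>2 + b\<^sup>2)"
 using sum_squares_bound[of a b] by (simp add: power2_sum)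

lemma sjet_add_le:
 assumes "open S" "smooth_on S f" "smooth_on S g" "x \<in> S"
 shows "sjet n h (%x. f x + g x) x \<le> 2 * (sjet n h f x + sjet n h g x)"
 using assms(2,3)
proof (induction n arbitrary: f g)
 case 0
 show ?case using sq_add_le[of "f x" "g x"] by simp
next
 case (Suc n)
 have "sjet n h (pd i (%x. f x + g x)) x \<le>
   2 * (sjet n h (pd i f) x + sjet n h (pd i g) x)" for i
 proof -
  have "sjet n h (pd i (%x. f x + g x)) x = sjet n h (%x. pd i f x + pd i g x) x"
   by (rule sjet_cong[OF assms(1,4)]) (rule partial_deriv_add; use Suc.prems smooth_on_differentiable in blast)
  then show ?thesis using Suc.IH[OF smooth_on_partial[OF Suc.prems(1)] smooth_on_partial[OF Suc.prems(2)]] by simp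
 qed
 then have "(\<Sum>i\<in>UNIV. sjet n h (pd i (%x. f x + g x)) x) \<le>
   (\<Sum>i\<in>UNIV. 2 * (sjet n h (pd i f) x + sjet n h (pd i g) x))"
  by (intro sum_mono)
 then have "h\<^sup>2 * (\<Sum>i\<in>UNIV. sjet n h (pd i (%x. f x + g x)) x) \<le>
   h\<^sup>2 * (\<Sum>i\<in>UNIV. 2 * (sjet n h (pd i f) x + sjet n h (pd i g) x))"
  by (rule mult_left_mono) simp
 then show ?case using sq_add_le[of "f x" "g x"]
  by (simp add: sum.distrib sum_distrib_left[symmetric] algebra_simps)
qed

lemma sjet_cmult:
 assumes "open S" "smooth_on S f" "x \<in> S"
 shows "sjet n h (%x. c * f x) x = c\<^sup>2 * sjet n h f x"
 using assms(2)
proof (induction n arbitrary: f)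
 case 0
 show ?case by (simp add: power_mult_distrib)
next
 case (Suc n)
 have "sjet n h (pd i (%x. c * f x)) x = c\<^sup>2 * sjet n h (pd i f) x" for i
 proof -
  have "sjet n h (pd i (%x. c * f x)) x = sjet n h (%x. c * pd i f x) x"
   by (rule sjet_cong[OF assms(1,3)]) (rule partial_deriv_cmult; use Suc.prems smooth_on_differentiable in blast)
  then show ?thesis using Suc.IH[OF smooth_on_partial[OF Suc.prems(1)]] by simp
 qed
 then show ?case by (simp add: sum_distrib_left[symmetric] power_mult_distrib algebra_simps)
qed

lemma sjet_sum_le:
 assumes "open S" "finite I" "\<And>k. k \<in> I ==> smooth_on S (f k)" "x \<in> S"
 shows "sjet n h (%x. \<Sum>k\<in>I. f k x) x \<le> 2 ^ card I * (\<Sum>k\<in>I. sjet n h (f k) x)"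
 using assms(2,3)
proof (induction I rule: finite_induct)
 case empty
 have "sjet n h (%x. 0) x = 0"
  using sjet_cmult[OF assms(1) smooth_on_const[of S "0::real"] assms(4), of n h 0] by simp
 then show ?case by simp
next
 case (insert k I)
 have "sjet n h (%x. f k x + (\<Sum>k\<in>I. f k x)) x \<le> 2 * (sjet n h (f k) x + sjet n h (%x. \<Sum>k\<in>I. f k x) x)"
  by (rule sjet_add_le[OF assms(1) _ _ assms(4)]) (use insert.prems assms(1) in \<open>auto intro: smooth_on_sum\<close>)
 also have "... \<le> 2 * (2 ^ card I * sjet n h (f k) x + 2 ^ card I * (\<Sum>k\<in>I. sjet n h (f k) x))"
  using insert mult_right_mono[of 1 "2 ^ card I" "sjet n h (f k) x"]
  by (intro mult_left_mono add_mono) auto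
 finally show ?case using insert by (simp add: algebra_simps)
qed

text \<open>The weight h^2 in the recursion matches the one derivative taken by the product rule, so
  the constant does not see h. It obeys C(n+1) = 1 + 4 C(n) \<le> 5 C(n): two terms of the product
  rule, each with the factor 2 of \<open>sjet_add_le\<close>, and 1 for the undifferentiated
  product.\<close>

lemma sjet_mult_le:
 fixes f g :: "real^'d::finite => real"
 assumes "open S" "smooth_on S f" "smooth_on S g" "x \<in> S"
 shows "sjet n h (%x. f x * g x) x \<le> 5 ^ n * sjet n h f x * sjet n h g x"
 using assms(2,3)
proof (induction n arbitrary: f g)
 case 0
 show ?case by (simp add: power_mult_distrib)
next
 case (Suc n)
 define C :: real where "C = 5 ^ n"
 have C: "C \<ge> 1" by (simp add: C_def)
 have IH: "sjet n h (%x. f x * g x) x \<le> C * sjet n h f x * sjet n h g x"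
  if "smooth_on S f" "smooth_on S g" for f g
  using Suc.IH[OF that] unfolding C_def .
  define F where "F = sjet (Suc n) h f x"
  define G where "G = sjet (Suc n) h g x"
  have FG: "F \<ge> 0" "G \<ge> 0" by (auto simp: F_def G_def simp del: sjet.simps)
  have i: "sjet n h (pd i (%x. f x * g x)) x \<le>
    2 * (C * F * sjet n h (pd i g) x + C * sjet n h (pd i f) x * G)" for i
  proof -
   have "sjet n h (pd i (%x. f x * g x)) x =
     sjet n h (%x. f x * pd i g x + pd i f x * g x) x"
    by (rule sjet_cong[OF assms(1,4)]) (rule partial_deriv_mult; use Suc.prems assms(4) smooth_on_differentiable in blast)
   also have "... \<le> 2 * (sjet n h (%x. f x * pd i g x) x + sjet n h (%x. pd i f x * g x) x)"
    by (rule sjet_add_le[OF assms(1) _ _ assms(4)]) (intro smooth_on_mult assms(1) Suc.prems smooth_on_partial)+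
   also have "... \<le> 2 * (C * sjet n h f x * sjet n h (pd i g) x + C * sjet n h (pd i f) x * sjet n h g x)"
    by (intro mult_left_mono add_mono IH Suc.prems smooth_on_partial) auto
   also have "... \<le> 2 * (C * F * sjet n h (pd i g) x + C * sjet n h (pd i f) x * G)"
    unfolding F_def G_def
    by (intro mult_left_mono add_mono mult_right_mono sjet_mono mult_nonneg_nonneg sjet_nonneg) (use C in auto)
   finally show ?thesis .
  qed
  define P where "P = h\<^sup>2 * (\<Sum>i\<in>UNIV. sjet n h (pd i f) x)"
  define R where "R = h\<^sup>2 * (\<Sum>i\<in>UNIV. sjet n h (pd i g) x)"
  have PR: "P \<le> F" "R \<le> G" "(f x)\<^sup>2 \<le> F" "(g x)\<^sup>2 \<le> G"
   unfolding P_def R_def F_def G_def by (auto intro!: sum_nonneg mult_nonneg_nonneg)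
  have "h\<^sup>2 * (\<Sum>i\<in>UNIV. sjet n h (pd i (%x. f x * g x)) x) \<le>
    h\<^sup>2 * (\<Sum>i\<in>UNIV. 2 * (C * F * sjet n h (pd i g) x + C * sjet n h (pd i f) x * G))"
   by (intro mult_left_mono sum_mono i) simp
  also have "... = 2 * (C * F * R + C * P * G)"
   unfolding P_def R_def by (simp add: sum.distrib sum_distrib_left sum_distrib_right algebra_simps)
  also have "... \<le> 2 * (C * F * G + C * F * G)"
   using PR FG C by (intro mult_left_mono add_mono mult_right_mono mult_left_mono) auto
  finally have 1: "h\<^sup>2 * (\<Sum>i\<in>UNIV. sjet n h (pd i (%x. f x * g x)) x) \<le> 4 * C * F * G" by simp
  have "(f x * g x)\<^sup>2 \<le> F * G"
   using mult_mono[OF PR(3,4)] FG by (simp add: power_mult_distrib)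
  then have "sjet (Suc n) h (%x. f x * g x) x \<le> (1 + 4 * C) * F * G"
   using 1 by (simp add: algebra_simps)
  also have "... \<le> 5 ^ Suc n * F * G"
   using C FG by (intro mult_right_mono) (auto simp: C_def)
  finally show ?case unfolding F_def G_def .
qed

subsection \<open>Cutoff functions\<close>

lemma smooth_on_deriv: "smooth_on UNIV f ==> smooth_on UNIV (deriv f)"
 for f :: "real => real"
proof -
 assume f: "smooth_on UNIV f"
 have "deriv f = (%x. frechet_derivative f (at x) 1)"
 proof
  fix x
  obtain D where D: "(f has_real_derivative D) (at x)"
   using smooth_on_differentiable[OF f, of x] real_differentiable_def by auto
  then show "deriv f x = frechet_derivative f (at x) 1"
   using DERIV_imp_deriv[OF D] frechet_derivative_at[OF D[unfolded has_field_derivative_def]]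
   by (metis mult.right_neutral)
 qed
 then show ?thesis using smooth_on_frechet[OF f, of 1] by simp
qed

lemma smooth_on_has_deriv: "smooth_on UNIV f ==> (f has_real_derivative deriv f x) (at x)"
 for f :: "real => real"
 using smooth_on_differentiable[of UNIV f x] DERIV_deriv_iff_real_differentiable real_differentiable_def by auto

text \<open>Every derivative is constant on each of the two half-lines outside the unit interval,
  where the step itself is constant, and is continuous on the compact interval between them.\<close>

lemma bounded_derivs_smooth_step: "\<exists>B\<ge>0. \<forall>x. \<bar>(deriv ^^ k) smooth_step x\<bar> \<le> B"
proof -
 have sm: "smooth_on UNIV ((deriv ^^ k) smooth_step)" for k
  by (induction k) (auto intro: smooth_on_deriv smooth_on_smooth_step)
 have const: "\<exists>c\<in>{0,1}. \<forall>x\<in>S. (deriv ^^ k) smooth_step x = c" if "S = {..<0} \<or> S = {1<..}" for S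
 proof (induction k)
  case 0
  show ?case using that smooth_step_0 smooth_step_1 by auto
 next
  case (Suc k)
  then obtain c where c: "\<forall>x\<in>S. (deriv ^^ k) smooth_step x = c" by blast
  have "(deriv ^^ Suc k) smooth_step x = 0" if "x \<in> S" for x
  proof -
   have "((deriv ^^ k) smooth_step has_real_derivative 0) (at x)"
    by (rule DERIV_cong_ev[THEN iffD1, OF refl _ refl DERIV_const[of c]])
     (use c that \<open>S = {..<0} \<or> S = {1<..}\<close> in \<open>auto intro!: eventually_nhds_in_open[of S, THEN eventually_mono]\<close>)
   then show ?thesis using DERIV_imp_deriv by fastforce
  qed
  then show ?case by auto
 qed
 obtain c1 where c1: "c1 \<in> {0,1}" "\<forall>x<0. (deriv ^^ k) smooth_step x = c1" using const[of "{..<0}"] by auto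
 obtain c2 where c2: "c2 \<in> {0,1}" "\<forall>x>1. (deriv ^^ k) smooth_step x = c2" using const[of "{1<..}"] by auto
 have "compact ((deriv ^^ k) smooth_step ` {0..1})"
  using smooth_on_continuous[OF sm[of k]] by (intro compact_continuous_image) (auto intro: continuous_on_subset)
 from compact_imp_bounded[OF this, unfolded bounded_iff]
 obtain B where B': "\<forall>y\<in>(deriv ^^ k) smooth_step ` {0..1}. norm y \<le> B" ..
 have B: "\<bar>(deriv ^^ k) smooth_step x\<bar> \<le> B" if "x \<in> {0..1}" for x
  using B' that by simp
 have "\<bar>(deriv ^^ k) smooth_step x\<bar> \<le> \<bar>B\<bar> + 1" for x
  using c1 c2 B[of x] by (cases "x < 0"; cases "x > 1") auto
 then show ?thesis by (intro exI[of _ "\<bar>B\<bar> + 1"]) auto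
qed

lemma smooth_on_affine_comp:
 fixes F :: "real => real"
 assumes "smooth_on UNIV F"
 shows "smooth_on UNIV (%x::real^'d::finite. F (c * x $ i + b))"
 by (rule smooth_on_compose[OF open_UNIV open_UNIV _ _ assms])
  (auto intro: smooth_on_add[OF open_UNIV smooth_on_mult[OF open_UNIV smooth_on_const
    smooth_on_component[OF open_UNIV smooth_on_linear[OF open_UNIV bounded_linear_ident]]] smooth_on_const])

lemma partial_deriv_affine_comp:
 fixes F :: "real => real"
 assumes "smooth_on UNIV F"
 shows "pd j (%x::real^'d::finite. F (c * x $ i + b)) x = (if i = j then c else 0) * deriv F (c * x $ i + b)"
proof -
 have "((%x::real^'d. c * x $ i + b) has_derivative (%v. c * v $ i)) (at x)"
  by (auto intro!: derivative_eq_intros bounded_linear.has_derivative[OF bounded_linear_vec_nth])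
 from has_derivative_compose[OF this smooth_on_has_deriv[OF assms, unfolded has_field_derivative_def]]
 have "((%x::real^'d. F (c * x $ i + b)) has_derivative (%v. deriv F (c * x $ i + b) * (c * v $ i))) (at x)" .
 from partial_deriv_eqI[OF this, of j] show ?thesis by (simp add: axis_def)
qed

text \<open>Scale invariance: each differentiation of a function of x/h produces 1/h, which the
  weight h^2 of the squared derivative cancels. Differentiation also raises k, so the induction is
  over all k; the sign s serves both the rising and the falling ramp.\<close>

lemma sjet_step_le:
 "\<exists>B\<ge>0. \<forall>h>0. \<forall>s b i (x::real^'d::finite). \<bar>s\<bar> = 1 -->
   sjet n h (%x. (deriv ^^ k) smooth_step (s / h * x $ i + b)) x \<le> B"
proof (induction n arbitrary: k)
 case 0
 obtain B where "B \<ge> 0" "\<forall>x. \<bar>(deriv ^^ k) smooth_step x\<bar> \<le> B" using bounded_derivs_smooth_step by blast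
 then show ?case by (intro exI[of _ "B\<^sup>2"]) (auto intro!: power2_le_iff_abs_le[THEN iffD2])
next
 case (Suc n)
 obtain B where B: "B \<ge> 0" "\<forall>x. \<bar>(deriv ^^ k) smooth_step x\<bar> \<le> B" using bounded_derivs_smooth_step by blast
 obtain D where D0: "D \<ge> 0" and D': "\<forall>h>0. \<forall>s b i (x::real^'d). \<bar>s\<bar> = 1 -->
   sjet n h (%x. (deriv ^^ Suc k) smooth_step (s / h * x $ i + b)) x \<le> D"
  using Suc.IH[of "Suc k"] by (elim exE conjE)
 note D = D0 D'[rule_format]
 have sm: "smooth_on UNIV ((deriv ^^ k) smooth_step)" for k
  by (induction k) (auto intro: smooth_on_deriv smooth_on_smooth_step)
 show ?case
 proof (intro exI[of _ "B\<^sup>2 + real CARD('d) * D"] conjI allI impI)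
  fix h s b :: real and i :: 'd and x :: "real^'d" assume h: "h > 0" and s: "\<bar>s\<bar> = 1"
  let ?F = "%k x. (deriv ^^ k) smooth_step (s / h * x $ i + b)"
  have "h\<^sup>2 * sjet n h (pd j (?F k)) x \<le> D" for j
  proof -
   have "pd j (?F k) = (%x. (if i = j then s / h else 0) * ?F (Suc k) x)"
    using partial_deriv_affine_comp[OF sm[of k], of j "s/h" i b] by auto
   then have "h\<^sup>2 * sjet n h (pd j (?F k)) x = h\<^sup>2 * (if i = j then s / h else 0)\<^sup>2 * sjet n h (?F (Suc k)) x"
    using sjet_cmult[OF open_UNIV smooth_on_affine_comp[OF sm[of "Suc k"], of "s/h" i b]] by simp
   also have "h\<^sup>2 * (if i = j then s / h else 0)\<^sup>2 = (if i = j then 1 else 0)"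
    using h s by (auto simp: power_divide power2_abs[of s, symmetric] simp del: power2_abs)
   finally show ?thesis using D(2)[OF h s, of i b x] D(1) by (auto split: if_splits)
  qed
  then have "(\<Sum>j\<in>UNIV. h\<^sup>2 * sjet n h (pd j (?F k)) x) \<le> (\<Sum>j\<in>(UNIV::'d set). D)"
   by (intro sum_mono)
  moreover have "(?F k x)\<^sup>2 \<le> B\<^sup>2" using B by (auto intro!: power2_le_iff_abs_le[THEN iffD2])
  ultimately show "sjet (Suc n) h (?F k) x \<le> B\<^sup>2 + real CARD('d) * D"
   by (simp add: sum_distrib_left)
 qed (use D in auto)
qed

text \<open>Per coordinate a rising and a falling ramp. The ramps have width h whatever the plateau,
  whose half-width is \<kappa> h; this separation keeps the derivative bounds independent of
  \<kappa>, that is, of the number of layers already passed.\<close>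

definition cutoff :: "real^'d::finite => real => real => real^'d => real" where
 "cutoff x0 h \<kappa> x = (\<Prod>i\<in>UNIV. smooth_step (1 / h * x $ i + (\<kappa> + 1 - x0 $ i / h)) *
   smooth_step (- 1 / h * x $ i + (\<kappa> + 1 + x0 $ i / h)))"

lemma smooth_on_cutoff: "smooth_on UNIV (cutoff x0 h \<kappa>)"
 unfolding cutoff_def[abs_def]
 by (intro smooth_on_prod smooth_on_mult open_UNIV smooth_on_affine_comp smooth_on_smooth_step)

lemma cutoff_bounds: "0 \<le> cutoff x0 h \<kappa> x" "cutoff x0 h \<kappa> x \<le> 1"
 unfolding cutoff_def
 by (auto intro!: prod_nonneg prod_le_1 smooth_step_bounds mult_nonneg_nonneg mult_le_one)

definition box_nhd :: "real^'d::finite => real => (real^'d) set" where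
 "box_nhd x0 s = {x. \<forall>i. \<bar>x $ i - x0 $ i\<bar> \<le> s}"

lemma cutoff_eq_1:
 assumes "h > 0" "x \<in> box_nhd x0 (\<kappa> * h)"
 shows "cutoff x0 h \<kappa> x = 1"
 unfolding cutoff_def
proof (intro prod.neutral ballI)
 fix i
 have "\<bar>x $ i - x0 $ i\<bar> \<le> \<kappa> * h" using assms by (simp add: box_nhd_def)
 then have "\<bar>(x $ i - x0 $ i) / h\<bar> \<le> \<kappa>" using assms(1) by (simp add: field_simps)
 then have "1 / h * x $ i + (\<kappa> + 1 - x0 $ i / h) \<ge> 1" "- 1 / h * x $ i + (\<kappa> + 1 + x0 $ i / h) \<ge> 1"
  by (auto simp: diff_divide_distrib abs_le_iff)
 then show "smooth_step (1 / h * x $ i + (\<kappa> + 1 - x0 $ i / h)) *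
   smooth_step (- 1 / h * x $ i + (\<kappa> + 1 + x0 $ i / h)) = 1" by (simp add: smooth_step_1)
qed

lemma cutoff_eq_0:
 assumes "h > 0" "x \<notin> box_nhd x0 ((\<kappa> + 1) * h)"
 shows "cutoff x0 h \<kappa> x = 0"
proof -
 obtain i where "\<bar>x $ i - x0 $ i\<bar> > (\<kappa> + 1) * h" using assms(2) by (auto simp: box_nhd_def not_le)
 then have "\<bar>(x $ i - x0 $ i) / h\<bar> > \<kappa> + 1" using assms(1) by (simp add: field_simps)
 then have "1 / h * x $ i + (\<kappa> + 1 - x0 $ i / h) \<le> 0 \<or> - 1 / h * x $ i + (\<kappa> + 1 + x0 $ i / h) \<le> 0"
  by (auto simp: diff_divide_distrib abs_if split: if_splits)
 then have "smooth_step (1 / h * x $ i + (\<kappa> + 1 - x0 $ i / h)) *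
   smooth_step (- 1 / h * x $ i + (\<kappa> + 1 + x0 $ i / h)) = 0" using smooth_step_0 by auto
 then show ?thesis unfolding cutoff_def by (intro prod_zero) auto
qed

text \<open>The bound depends on the order alone, not on width, plateau or centre. It is the origin
  of the layer-independent constant in the contraction argument. The product over coordinates is
  handled one factor at a time by \<open>sjet_mult_le\<close>.\<close>

lemma sjet_cutoff_le:
 "\<exists>B>0. \<forall>h>0. \<forall>x0 \<kappa> (x::real^'d::finite). sjet n h (cutoff x0 h \<kappa>) x \<le> B"
proof -
 define C :: real where "C = 5 ^ n"
 have C: "C \<ge> 0" by (simp add: C_def)
 have C2: "sjet n h (%x. f x * g x) x \<le> C * sjet n h f x * sjet n h g x"
  if "smooth_on UNIV f" "smooth_on UNIV g" for h f g and x :: "real^'d"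
  unfolding C_def by (rule sjet_mult_le[OF open_UNIV that UNIV_I])
 obtain B0 where B0: "B0 \<ge> 0" and B0': "\<forall>h>0. \<forall>s b i (x::real^'d). \<bar>s\<bar> = 1 -->
   sjet n h (%x. (deriv ^^ 0) smooth_step (s / h * x $ i + b)) x \<le> B0"
  using sjet_step_le[where 'd='d, of n 0] by (elim exE conjE)
 have B0f: "sjet n h (%x. smooth_step (1 / h * x $ i + b)) x \<le> B0"
  and B0g: "sjet n h (%x. smooth_step (- 1 / h * x $ i + b)) x \<le> B0"
  if "h > 0" for h b i and x :: "real^'d"
  using B0'[rule_format, OF that, of 1 i b x] B0'[rule_format, OF that, of "-1" i b x]
  by simp_all
 have sm: "smooth_on UNIV (%x::real^'d. smooth_step (s * x $ i + b))" for s b i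
  by (rule smooth_on_affine_comp[OF smooth_on_smooth_step])
 have "\<exists>B\<ge>0. \<forall>h>0. \<forall>x0 \<kappa> (x::real^'d). sjet n h (%x. \<Prod>i\<in>I. smooth_step (1 / h * x $ i + (\<kappa> + 1 - x0 $ i / h)) *
   smooth_step (- 1 / h * x $ i + (\<kappa> + 1 + x0 $ i / h))) x \<le> B" if "finite I" for I
  using that
 proof (induction I rule: finite_induct)
  case empty
  have J: "jet k (%x. 1) (x::real^'d) = (if k = 0 then 1 else 0)" for k x
  proof -
   have "jet k (%x. 0) (x::real^'d) = 0" for k
    by (induction k) (simp_all cong: sum.cong add: partial_deriv_const[abs_def])
   then show ?thesis by (cases k) (simp_all add: partial_deriv_const[abs_def])
  qed
  have "sjet n h (%x. 1) (x::real^'d) = 1" for h x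
   unfolding sjet_eq J by (simp add: if_distrib[where f="%z. _ * z"] cong: if_cong)
  then show ?case by (intro exI[of _ 1]) simp
 next
  case (insert j I)
  obtain B where B0': "B \<ge> 0" and B': "\<forall>h>0. \<forall>x0 \<kappa> (x::real^'d). sjet n h (%x. \<Prod>i\<in>I. smooth_step (1 / h * x $ i + (\<kappa> + 1 - x0 $ i / h)) *
   smooth_step (- 1 / h * x $ i + (\<kappa> + 1 + x0 $ i / h))) x \<le> B" using insert.IH by (elim exE conjE)
  note B = B0' B'[rule_format]
  show ?case
  proof (intro exI[of _ "C * (C * B0 * B0) * B"] conjI allI impI)
   fix h \<kappa> :: real and x0 x :: "real^'d" assume h: "h > 0"
   let ?f = "%x. smooth_step (1 / h * x $ j + (\<kappa> + 1 - x0 $ j / h))"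
   let ?g = "%x. smooth_step (- 1 / h * x $ j + (\<kappa> + 1 + x0 $ j / h))"
   let ?p = "%x. \<Prod>i\<in>I. smooth_step (1 / h * x $ i + (\<kappa> + 1 - x0 $ i / h)) *
     smooth_step (- 1 / h * x $ i + (\<kappa> + 1 + x0 $ i / h))"
   have "sjet n h (%x. ?f x * ?g x) x \<le> C * sjet n h ?f x * sjet n h ?g x"
    by (intro C2 sm)
   also have "... \<le> C * B0 * B0"
    by (intro mult_mono B0f B0g h C order_refl mult_nonneg_nonneg sjet_nonneg B0)
   finally have 1: "sjet n h (%x. ?f x * ?g x) x \<le> C * B0 * B0" .
   have "sjet n h (%x. (?f x * ?g x) * ?p x) x \<le> C * sjet n h (%x. ?f x * ?g x) x * sjet n h ?p x"
    by (intro C2 smooth_on_mult sm smooth_on_prod open_UNIV)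
   also have "... \<le> C * (C * B0 * B0) * B"
    by (intro mult_mono 1 C B h order_refl mult_nonneg_nonneg sjet_nonneg B0)
   finally show "sjet n h (%x. \<Prod>i\<in>insert j I. smooth_step (1 / h * x $ i + (\<kappa> + 1 - x0 $ i / h)) *
     smooth_step (- 1 / h * x $ i + (\<kappa> + 1 + x0 $ i / h))) x \<le> C * (C * B0 * B0) * B"
    using insert by simp
  qed (use B B0 C in auto)
 qed
 from this[of UNIV] obtain B where B: "B \<ge> 0" "\<forall>h>0. \<forall>x0 \<kappa> (x::real^'d). sjet n h (cutoff x0 h \<kappa>) x \<le> B"
  unfolding cutoff_def[abs_def] by auto
 then show ?thesis by (intro exI[of _ "B + 1"]) (auto intro!: add_increasing2)
qed

lemma box_nhd_cbox: "box_nhd x0 s = cbox (x0 - vec s) (x0 + vec s)"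
 by (auto simp: box_nhd_def mem_box_cart abs_le_iff algebra_simps)

lemma compact_box_nhd [simp]: "compact (box_nhd x0 s)"
 by (simp add: box_nhd_cbox)

lemma box_nhd_mono: "s \<le> t ==> box_nhd x0 s \<subseteq> box_nhd x0 t"
 by (auto simp: box_nhd_def intro: order_trans)

subsection \<open>Integration over compact sets\<close>

text \<open>Integrals are confined to sets that are compact in all uses, so that every integrability
  condition reduces to continuity on the set.\<close>

definition cint :: "(real^'d::finite) set => (real^'d => real) => real" where
 "cint K f = (LINT x:K|lborel. f x)"

lemma cint_integrable: "compact K ==> continuous_on K f ==> set_integrable lborel K f"
 for f :: "real^'d::finite => real"
 unfolding set_integrable_def by (rule borel_integrable_compact)

lemma cint_cong: "(\<And>x. x \<in> K ==> f x = g x) ==> cint K f = cint K g"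
 unfolding cint_def set_lebesgue_integral_def by (intro Bochner_Integration.integral_cong refl) (auto simp: indicator_def)

lemma cint_add:
 "compact K ==> continuous_on K f ==> continuous_on K g ==> cint K (%x. f x + g x) = cint K f + cint K g"
 unfolding cint_def by (intro set_integral_add cint_integrable)

lemma cint_cmult: "cint K (%x. c * f x) = c * cint K f"
 unfolding cint_def by simp

lemma cint_diff:
 "compact K ==> continuous_on K f ==> continuous_on K g ==> cint K (%x. f x - g x) = cint K f - cint K g"
 unfolding cint_def by (intro set_integral_diff cint_integrable)

lemma cint_0 [simp]: "cint K (%x. 0) = 0"
 by (simp add: cint_def)

lemma cint_sum:
 assumes "compact K" "\<And>i. i \<in> I ==> continuous_on K (f i)"
 shows "cint K (%x. \<Sum>i\<in>I. f i x) = (\<Sum>i\<in>I. cint K (f i))"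
 using assms(2)
proof (induction I rule: infinite_finite_induct)
 case (insert i I)
 then have "cint K (%x. f i x + (\<Sum>i\<in>I. f i x)) = cint K (f i) + cint K (%x. \<Sum>i\<in>I. f i x)"
  by (intro cint_add assms(1) continuous_on_sum) auto
 then show ?case using insert by simp
qed auto

lemma cint_mono:
 assumes "compact K" "continuous_on K f" "continuous_on K g" "\<And>x. x \<in> K ==> f x \<le> g x"
 shows "cint K f \<le> cint K g"
 unfolding cint_def by (intro set_integral_mono cint_integrable assms)

lemma cint_nonneg: "(\<And>x. x \<in> K ==> f x \<ge> 0) ==> cint K f \<ge> 0"
 unfolding cint_def set_lebesgue_integral_def
 by (rule Bochner_Integration.integral_nonneg) (auto simp: indicator_def)

lemma cint_subset_mono:
 assumes "compact K" "compact L" "K \<subseteq> L" "continuous_on L f" "\<And>x. x \<in> L ==> f x \<ge> 0"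
 shows "cint K f \<le> cint L f"
 unfolding cint_def
 using cint_integrable[OF assms(2,4)] assms(3,5)
  cint_integrable[OF assms(1) continuous_on_subset[OF assms(4,3)]]
 by (auto simp: set_lebesgue_integral_def set_integrable_def indicator_def intro!: integral_mono)

lemma cint_eq_support:
 assumes "K \<subseteq> L" "\<And>x. x \<in> L ==> x \<notin> K ==> f x = 0"
 shows "cint L f = cint K f"
 unfolding cint_def set_lebesgue_integral_def
 by (intro Bochner_Integration.integral_cong refl) (use assms in \<open>auto simp: indicator_def\<close>)

lemma partial_deriv_outside:
 assumes "closed K" "\<And>x. x \<notin> K ==> u x = 0" "x \<notin> K"
 shows "pd i u x = 0"
 using partial_deriv_cong[of "- K" x u "%x. 0" i] assms by (simp add: open_Compl)

text \<open>On \<Omega> the product is smooth, off K it vanishes identically, and these two open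
  sets cover the space. So values of g outside \<Omega> do not matter.\<close>

lemma smooth_on_extend:
 fixes u g :: "'a::real_normed_vector => real"
 assumes "closed K" "K \<subseteq> \<Omega>" "open \<Omega>" "smooth_on \<Omega> u" "\<And>x. x \<notin> K ==> u x = 0" "smooth_on \<Omega> g"
 shows "smooth_on UNIV (%x. u x * g x)"
proof -
 have "smooth_on (- K) (%x. u x * g x) \<longleftrightarrow> smooth_on (- K) (%x. 0 :: real)"
  by (rule smooth_on_cong) (use assms in auto)
 then have "smooth_on (\<Omega> \<union> - K) (%x. u x * g x)"
  using assms smooth_on_mult[OF assms(3,4,6)] by (intro smooth_on_Un) auto
 moreover have "\<Omega> \<union> - K = UNIV" using assms by auto
 ultimately show ?thesis by simp
qed

text \<open>The integral of a derivative vanishes: pass to the limit in the translation invariance of the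
 difference quotients.\<close>

lemma cint_partial_deriv_0:
 fixes F :: "real^'d::finite => real"
 assumes K: "compact K" and F: "smooth_on UNIV F" and F0: "\<And>x. x \<notin> K ==> F x = 0"
 shows "cint K (pd i F) = 0"
proof -
 define D where "D = pd i F"
 have D0: "D x = 0" if "x \<notin> K" for x
  unfolding D_def using partial_deriv_outside[OF compact_imp_closed[OF K] F0 that] .
 have Dc: "continuous_on UNIV D" unfolding D_def
  by (rule smooth_on_continuous[OF smooth_on_partial[OF F]])
 have Fc: "continuous_on UNIV F" by (rule smooth_on_continuous[OF F])
 from compact_imp_bounded[OF K, unfolded bounded_iff]
 obtain r where r: "\<forall>x\<in>K. norm x \<le> r" ..
 from compact_imp_bounded[OF compact_continuous_image[OF continuous_on_subset[OF Dc] K], unfolded bounded_iff]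
 obtain M where M: "\<forall>y\<in>D ` K. norm y \<le> M" by auto
 have M': "\<bar>D x\<bar> \<le> \<bar>M\<bar>" for x
  using M D0[of x] by (cases "x \<in> K") auto
 \<comment> \<open>Translations by at most 1 keep the supports of all difference quotients in this
   ball, which makes \<bar>M\<bar> times its indicator an integrable majorant.\<close>
 define B where "B = cball (0::real^'d) (r + 1)"
 have Bc: "compact B" by (simp add: B_def)
 define e :: "real^'d" where "e = axis i 1"
 have ne: "norm e = 1" by (simp add: e_def norm_axis_1)
 define f where "f = (%n x. (F (x + (1 / Suc n) *\<^sub>R e) - F x) * Suc n)"
 have mvt: "\<exists>t. 0 < t \<and> t < s \<and> F (x + s *\<^sub>R e) - F x = s * D (x + t *\<^sub>R e)" if "s > 0" for x s
 proof -
  have "((%t. F (x + t *\<^sub>R e)) has_real_derivative D (x + t *\<^sub>R e)) (at t)" for t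
   unfolding e_def D_def by (rule partial_deriv_axis) (use smooth_on_differentiable[OF F] in auto)
  then show ?thesis using MVT2[of 0 s "%t. F (x + t *\<^sub>R e)" "%t. D (x + t *\<^sub>R e)"] that by auto
 qed
 have fmv: "\<exists>t. 0 < t \<and> t < 1 / Suc n \<and> f n x = D (x + t *\<^sub>R e)" for n x
  using mvt[of "1 / Suc n" x] by (auto simp: f_def)
 have fint: "integrable lborel F"
 proof -
  have "integrable lborel (%x. indicator K x *\<^sub>R F x)"
   by (rule borel_integrable_compact[OF K]) (use Fc continuous_on_subset in auto)
  moreover have "(%x. indicator K x *\<^sub>R F x) = F" using F0 by (auto simp: fun_eq_iff indicator_def)
  ultimately show ?thesis by simp
 qed
 have tr: "integrable lborel (%x. F (x + v))" "(\<integral>x. F (x + v) \<partial>lborel) = (\<integral>x. F x \<partial>lborel)" for v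
 proof -
  have Fm: "F \<in> borel_measurable borel" using Fc by (rule borel_measurable_continuous_onI)
  have "integrable (distr lborel borel ((+) v)) F" "(\<integral>x. F x \<partial>distr lborel borel ((+) v)) = (\<integral>x. F x \<partial>lborel)"
   using fint by (simp_all add: lborel_distr_plus)
  then show "integrable lborel (%x. F (x + v))" "(\<integral>x. F (x + v) \<partial>lborel) = (\<integral>x. F x \<partial>lborel)"
   using Fm by (simp_all add: integrable_distr_eq integral_distr add.commute)
 qed
 have f0: "(\<integral>x. f n x \<partial>lborel) = 0" for n
  unfolding f_def using tr fint by simp
 have fb: "norm (f n x) \<le> \<bar>M\<bar> * indicator B x" for n x
 proof (cases "x \<in> B")
  case True
  obtain t where "f n x = D (x + t *\<^sub>R e)" using fmv by blast
  then show ?thesis using True M' by simp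
 next
  case False
  have "x + (1 / Suc n) *\<^sub>R e \<notin> K"
  proof
   assume "x + (1 / Suc n) *\<^sub>R e \<in> K"
   then have "norm (x + (1 / Suc n) *\<^sub>R e) \<le> r" using r by blast
   then have "norm x \<le> r + norm ((1 / Suc n) *\<^sub>R e)"
    using norm_triangle_ineq4[of "x + (1 / Suc n) *\<^sub>R e" "(1 / Suc n) *\<^sub>R e"] by simp
   also have "... \<le> r + 1" using ne by simp
   finally show False using False by (simp add: B_def)
  qed
  moreover have "x \<notin> K" using False bspec[OF r, of x] by (auto simp: B_def)
  ultimately show ?thesis using False F0 by (simp add: f_def)
 qed
 have lim: "(%n. f n x) \<longlonglongrightarrow> D x" for x
 proof -
  have "\<forall>n. \<exists>t. 0 < t \<and> t < 1 / Suc n \<and> f n x = D (x + t *\<^sub>R e)" using fmv by simp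
  from choice[OF this]
  obtain t where "\<forall>n. 0 < t n \<and> t n < 1 / Suc n \<and> f n x = D (x + t n *\<^sub>R e)" ..
  then have t: "\<And>n. 0 < t n" "\<And>n. t n < 1 / Suc n" "\<And>n. f n x = D (x + t n *\<^sub>R e)" by auto
  have "t \<longlonglongrightarrow> 0"
   by (rule tendsto_sandwich[OF _ _ tendsto_const LIMSEQ_inverse_real_of_nat])
    (use t in \<open>auto intro!: eventuallyI less_imp_le simp: inverse_eq_divide\<close>)
  then have "(%n. x + t n *\<^sub>R e) \<longlonglongrightarrow> x + 0 *\<^sub>R e" by (intro tendsto_intros)
  then have "(%n. x + t n *\<^sub>R e) \<longlonglongrightarrow> x" by simp
  moreover have "isCont D x" using Dc by (simp add: continuous_on_eq_continuous_at)
  ultimately show ?thesis unfolding t(3) using isCont_tendsto_compose by blast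
 qed
 have "(%n. \<integral>x. f n x \<partial>lborel) \<longlonglongrightarrow> (\<integral>x. D x \<partial>lborel)"
 proof (rule integral_dominated_convergence[where w="%x. \<bar>M\<bar> * indicator B x"])
  have "continuous_on UNIV (f n)" for n unfolding f_def
   by (intro continuous_intros continuous_on_compose2[OF Fc]) auto
  then show "\<And>n. f n \<in> borel_measurable lborel" by (simp add: borel_measurable_continuous_onI)
  show "integrable lborel (%x. \<bar>M\<bar> * indicator B x :: real)"
   using borel_integrable_compact[OF Bc continuous_on_const[of B "1::real"]] by simp
 qed (use Dc lim fb in \<open>auto simp: borel_measurable_continuous_onI\<close>)
 then have "(\<integral>x. D x \<partial>lborel) = 0" unfolding f0 by (simp add: LIMSEQ_const_iff)
 moreover have "(%x. indicator K x *\<^sub>R D x) = D" using D0 by (auto simp: fun_eq_iff indicator_def)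
 ultimately show ?thesis unfolding cint_def set_lebesgue_integral_def D_def[symmetric] by simp
qed

lemma integration_by_parts:
 fixes u g :: "real^'d::finite => real"
 assumes "compact K" "K \<subseteq> \<Omega>" "open \<Omega>" "smooth_on \<Omega> u" "\<And>x. x \<notin> K ==> u x = 0" "smooth_on \<Omega> g"
 shows "cint K (%x. pd i u x * g x) = - cint K (%x. u x * pd i g x)"
proof -
 have d: "pd i (%x. u x * g x) x = u x * pd i g x + pd i u x * g x" if "x \<in> K" for x
  using that assms smooth_on_differentiable by (intro partial_deriv_mult) blast+
 have c: "continuous_on K f" if "smooth_on \<Omega> f" for f :: "real^'d => real"
  using smooth_on_continuous[OF that] assms(2) continuous_on_subset by blast
 have "0 = cint K (pd i (%x. u x * g x))"
  using cint_partial_deriv_0[OF assms(1) smooth_on_extend[OF compact_imp_closed[OF assms(1)] assms(2-6)]] assms(5) by simp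
 also have "... = cint K (%x. u x * pd i g x + pd i u x * g x)"
  by (rule cint_cong[OF d])
 also have "... = cint K (%x. u x * pd i g x) + cint K (%x. pd i u x * g x)"
  by (intro cint_add assms(1) c smooth_on_mult smooth_on_partial assms)
 finally show ?thesis by simp
qed

lemma compact_continuous_bound:
 fixes f :: "'a::topological_space => real"
 assumes "compact K" "continuous_on K f"
 shows "\<exists>B>0. \<forall>x\<in>K. \<bar>f x\<bar> \<le> B"
proof -
 from compact_imp_bounded[OF compact_continuous_image[OF assms(2,1)], unfolded bounded_iff]
 obtain B where B: "\<forall>y\<in>f ` K. norm y \<le> B" ..
 have "\<bar>f x\<bar> \<le> \<bar>B\<bar> + 1" if "x \<in> K" for x
  using bspec[OF B, of "f x"] that by simp
 then show ?thesis by (intro exI[of _ "\<bar>B\<bar> + 1"]) auto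
qed

text \<open>Inequalities with an unnamed constant that is uniform over the class P. Chains of
  Sobolev estimates can then be composed without carrying constants along.\<close>

definition dominated :: "('b => bool) => ('b => real) => ('b => real) => bool" where
 "dominated P F G \<longleftrightarrow> (\<exists>C>0. \<forall>u. P u --> F u \<le> C * G u)"

lemma dominatedI: "C > 0 ==> (\<And>u. P u ==> F u \<le> C * G u) ==> dominated P F G"
 by (auto simp: dominated_def)

lemma dominated_le: "(\<And>u. P u ==> F u \<le> G u) ==> dominated P F G"
 by (rule dominatedI[of 1]) auto

lemma dominated_trans: assumes FG: "dominated P F G" and GH: "dominated P G H" shows "dominated P F H"
proof -
 from FG obtain C where C: "C > 0" "\<forall>u. P u --> F u \<le> C * G u" unfolding dominated_def by (elim exE conjE)
 from GH obtain D where D: "D > 0" "\<forall>u. P u --> G u \<le> D * H u" unfolding dominated_def by (elim exE conjE)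
 show ?thesis
  by (rule dominatedI[of "C * D"]) (use C D in \<open>auto simp: mult.assoc intro: order_trans[OF _ mult_left_mono]\<close>)
qed

lemma dominated_le_trans: "(\<And>u. P u ==> F u \<le> G u) ==> dominated P G H ==> dominated P F H"
 by (rule dominated_trans[OF dominated_le])

lemma dominated_trans_le: "dominated P F G ==> (\<And>u. P u ==> G u \<le> H u) ==> dominated P F H"
 by (rule dominated_trans[OF _ dominated_le])

lemma dominated_cmult: assumes "dominated P F H" "c > 0" shows "dominated P (%u. c * F u) H"
proof -
 from assms(1) obtain C where C: "C > 0" "\<forall>u. P u --> F u \<le> C * H u" unfolding dominated_def by (elim exE conjE)
 show ?thesis by (rule dominatedI[of "c * C"]) (use C assms(2) in \<open>auto simp: mult.assoc\<close>)
qed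

lemma dominated_add: assumes F: "dominated P F H" and G: "dominated P G H" shows "dominated P (%u. F u + G u) H"
proof -
 from F obtain C where C: "C > 0" "\<forall>u. P u --> F u \<le> C * H u" unfolding dominated_def by (elim exE conjE)
 from G obtain D where D: "D > 0" "\<forall>u. P u --> G u \<le> D * H u" unfolding dominated_def by (elim exE conjE)
 show ?thesis by (rule dominatedI[of "C + D"]) (use C D in \<open>auto simp: distrib_right intro: add_mono\<close>)
qed

lemma dominated_sum:
 assumes "finite I" "\<And>i. i \<in> I ==> dominated P (F i) H" "\<And>u. P u ==> 0 \<le> H u"
 shows "dominated P (%u. \<Sum>i\<in>I. F i u) H"
 using assms by (induction I rule: finite_induct) (auto intro: dominated_add dominated_le)

lemma dominated_comp: "dominated P F G ==> (\<And>u. R u ==> P (\<phi> u)) ==> dominated R (%u. F (\<phi> u)) (%u. G (\<phi> u))"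
 unfolding dominated_def by blast

section \<open>Squared Sobolev norms on compact sets of the coordinate space\<close>

definition sob :: "nat => (real^'d::finite) set => (real^'d => real) => real" where
 "sob n K f = cint K (sjet n 1 f)"

lemma sob_nonneg [simp]: "sob n K f \<ge> 0"
 unfolding sob_def by (rule cint_nonneg) simp

context
 fixes K \<Omega> :: "(real^'d::finite) set"
 assumes K: "compact K" "K \<subseteq> \<Omega>" "open \<Omega>"
begin

lemma cont_K: "smooth_on \<Omega> f ==> continuous_on K f"
 using smooth_on_continuous K continuous_on_subset by blast

lemma sjet_cont_K: "smooth_on \<Omega> f ==> continuous_on K (sjet n h f)"
 using continuous_on_sjet K continuous_on_subset by blast

lemma jet_cont_K: "smooth_on \<Omega> f ==> continuous_on K (jet n f)"
 using continuous_on_jet K continuous_on_subset by blast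

lemma sob_mono: "smooth_on \<Omega> f ==> n \<le> m ==> sob n K f \<le> sob m K f"
 unfolding sob_def by (intro cint_mono K sjet_cont_K sjet_mono)

lemma sob_subset: "smooth_on \<Omega> f ==> compact L ==> L \<subseteq> K ==> sob n L f \<le> sob n K f"
 unfolding sob_def by (intro cint_subset_mono K sjet_cont_K) auto

lemma sob_partial: "smooth_on \<Omega> f ==> sob n K (pd i f) \<le> sob (Suc n) K f"
 unfolding sob_def by (intro cint_mono K sjet_cont_K sjet_partial_le smooth_on_partial)

lemma sob_0: "sob 0 K f = cint K (%x. (f x)\<^sup>2)"
 unfolding sob_def by (rule cint_cong) simp

lemma sob_Suc: 
 assumes "smooth_on \<Omega> f" shows "sob (Suc n) K f = cint K (%x. (f x)\<^sup>2) + (\<Sum>i\<in>UNIV. sob n K (pd i f))"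
proof -
 have "sob (Suc n) K f = cint K (%x. (f x)\<^sup>2 + (\<Sum>i\<in>UNIV. sjet n 1 (pd i f) x))"
  unfolding sob_def by (rule cint_cong) simp
 also have "... = cint K (%x. (f x)\<^sup>2) + cint K (%x. \<Sum>i\<in>UNIV. sjet n 1 (pd i f) x)"
  by (intro cint_add K continuous_intros cont_K sjet_cont_K smooth_on_partial assms)
 also have "cint K (%x. \<Sum>i\<in>UNIV. sjet n 1 (pd i f) x) = (\<Sum>i\<in>UNIV. cint K (sjet n 1 (pd i f)))"
  by (intro cint_sum K sjet_cont_K smooth_on_partial assms)
 finally show ?thesis by (simp add: sob_def)
qed

lemma sob_cong: 
 assumes "\<And>x. x \<in> \<Omega> ==> f x = g x" shows "sob n K f = sob n K g"
 unfolding sob_def using K by (intro cint_cong sjet_cong[of \<Omega>] assms) auto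

lemma sob_add:
 assumes "smooth_on \<Omega> f" "smooth_on \<Omega> g"
 shows "sob n K (%x. f x + g x) \<le> 2 * (sob n K f + sob n K g)"
proof -
 have "sob n K (%x. f x + g x) \<le> cint K (%x. 2 * (sjet n 1 f x + sjet n 1 g x))"
  unfolding sob_def using K
  by (intro cint_mono K sjet_cont_K smooth_on_add assms continuous_intros sjet_add_le[of \<Omega>]) auto
 also have "... = 2 * (sob n K f + sob n K g)"
  unfolding cint_cmult sob_def by (subst cint_add) (intro K sjet_cont_K assms refl)+
 finally show ?thesis .
qed

lemma sob_sum:
 assumes "finite I" "\<And>k. k \<in> I ==> smooth_on \<Omega> (f k)"
 shows "sob n K (%x. \<Sum>k\<in>I. f k x) \<le> 2 ^ card I * (\<Sum>k\<in>I. sob n K (f k))"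
proof -
 have "sob n K (%x. \<Sum>k\<in>I. f k x) \<le> cint K (%x. 2 ^ card I * (\<Sum>k\<in>I. sjet n 1 (f k) x))"
  unfolding sob_def using K
  by (intro cint_mono K sjet_cont_K smooth_on_sum assms continuous_intros sjet_sum_le[of \<Omega>]) auto
 also have "... = 2 ^ card I * (\<Sum>k\<in>I. sob n K (f k))"
  unfolding cint_cmult sob_def by (subst cint_sum) (intro K sjet_cont_K assms refl | assumption)+
 finally show ?thesis .
qed

lemma dominated_sob_add:
 assumes "\<And>u. P u ==> smooth_on \<Omega> (F u)" "\<And>u. P u ==> smooth_on \<Omega> (G u)"
  and "dominated P (%u. sob n K (F u)) S" "dominated P (%u. sob n K (G u)) S"
 shows "dominated P (%u. sob n K (%x. F u x + G u x)) S"
 by (rule dominated_le_trans[OF sob_add dominated_cmult[OF dominated_add]]) (simp_all add: assms)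

lemma dominated_sob_sum:
 assumes "\<And>u k. P u ==> smooth_on \<Omega> (F k u)" "\<And>k. dominated P (%u. sob n K (F k u)) S" "\<And>u. P u ==> 0 \<le> S u"
 shows "dominated P (%u. sob n K (%x. \<Sum>k\<in>(UNIV :: 'k::finite set). F k u x)) S"
 by (rule dominated_le_trans[OF sob_sum dominated_cmult[OF dominated_sum]]) (simp_all add: assms)

lemma sob_mult:
 assumes "smooth_on \<Omega> a"
 shows "dominated (smooth_on \<Omega>) (%f. sob n K (%x. a x * f x)) (sob n K)"
proof -
 from compact_continuous_bound[OF K(1) sjet_cont_K[OF assms, of n 1]]
 obtain B where B0: "B > 0" and B': "\<forall>x\<in>K. \<bar>sjet n 1 a x\<bar> \<le> B" by (elim exE conjE)
 note B = B0 B'[rule_format]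
 show ?thesis
 proof (rule dominatedI[of "5 ^ n * B"])
  fix f :: "real^'d => real" assume f: "smooth_on \<Omega> f"
  have "sjet n 1 (%x. a x * f x) x \<le> 5 ^ n * B * sjet n 1 f x" if "x \<in> K" for x
  proof -
   have "sjet n 1 (%x. a x * f x) x \<le> 5 ^ n * sjet n 1 a x * sjet n 1 f x"
    using K that by (intro sjet_mult_le[of \<Omega>] assms f) auto
   also have "... \<le> 5 ^ n * B * sjet n 1 f x"
    using B(2)[OF that] by (intro mult_right_mono mult_left_mono) auto
   finally show ?thesis .
  qed
  then have "sob n K (%x. a x * f x) \<le> cint K (%x. 5 ^ n * B * sjet n 1 f x)"
   unfolding sob_def using K
   by (intro cint_mono K sjet_cont_K smooth_on_mult assms f continuous_intros) auto
  then show "sob n K (%x. a x * f x) \<le> 5 ^ n * B * sob n K f"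
   unfolding cint_cmult sob_def .
 qed (use B in auto)
qed

end

subsection \<open>Regularity of second order elliptic operators\<close>

text \<open>The coordinate form of the Laplace-Beltrami operator: w stands for the volume density
  and a for the inverse metric. Ellipticity is assumed pointwise and becomes uniform on compact sets
  in \<open>coercive\<close>.\<close>

locale elliptic_op =
 fixes \<Omega> :: "(real^'d::finite) set" and w :: "real^'d => real" and a :: "'d => 'd => real^'d => real"
 assumes op: "open \<Omega>" and sm_w: "smooth_on \<Omega> w" and sm_a: "\<And>i j. smooth_on \<Omega> (a i j)"
  and w_pos: "\<And>x. x \<in> \<Omega> ==> w x > 0"
  and a_sym: "\<And>i j x. x \<in> \<Omega> ==> a i j x = a j i x"
  and a_pos: "\<And>x v. x \<in> \<Omega> ==> v \<noteq> 0 ==> (\<Sum>i\<in>UNIV. \<Sum>j\<in>UNIV. a i j x * v $ i * v $ j) > 0"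
begin

definition Lap :: "(real^'d => real) => real^'d => real" where
 "Lap u x = (\<Sum>i\<in>UNIV. pd i (%y. w y * (\<Sum>j\<in>UNIV. a i j y * pd j u y)) x) / w x"

definition flux :: "'d => (real^'d => real) => real^'d => real" where
 "flux i u y = w y * (\<Sum>j\<in>UNIV. a i j y * pd j u y)"

text \<open>The carre du champ, that is, the inner product of du and dv in the inverse
  metric.\<close>

definition Gam :: "(real^'d => real) => (real^'d => real) => real^'d => real" where
 "Gam u v x = (\<Sum>i\<in>UNIV. \<Sum>j\<in>UNIV. a i j x * pd i u x * pd j v x)"

text \<open>The first order coefficients that appear when the divergence is expanded into second
  derivatives.\<close>

definition drift :: "'d => real^'d => real" where
 "drift j x = (\<Sum>i\<in>UNIV. pd i (%y. w y * a i j y) x) / w x"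

lemmas smooth_intros = smooth_on_mult[OF op] smooth_on_add[OF op] smooth_on_diff[OF op] smooth_on_sum[OF op]
 smooth_on_partial sm_w sm_a smooth_on_const smooth_on_minus[OF op]

lemma smooth_flux: "smooth_on \<Omega> u ==> smooth_on \<Omega> (flux i u)"
 unfolding flux_def[abs_def] by (intro smooth_intros)

lemma smooth_Lap: "smooth_on \<Omega> u ==> smooth_on \<Omega> (Lap u)"
 unfolding Lap_def[abs_def] by (intro smooth_on_divide[OF op] smooth_intros) (use w_pos in force)+

lemma smooth_Gam: "smooth_on \<Omega> u ==> smooth_on \<Omega> v ==> smooth_on \<Omega> (Gam u v)"
 unfolding Gam_def[abs_def] by (intro smooth_intros)

lemma smooth_drift: "smooth_on \<Omega> (drift j)"
 unfolding drift_def[abs_def] by (intro smooth_on_divide[OF op] smooth_intros) (use w_pos in force)+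

lemma diffble: "smooth_on \<Omega> u ==> x \<in> \<Omega> ==> u differentiable (at x)"
 by (rule smooth_on_differentiable)

lemma Lap_flux: "x \<in> \<Omega> ==> w x * Lap u x = (\<Sum>i\<in>UNIV. pd i (flux i u) x)"
 using w_pos[of x] by (simp add: Lap_def flux_def[abs_def])

lemma Lap_cong:
 assumes "open S" "x \<in> S" "\<And>y. y \<in> S ==> u y = v y"
 shows "Lap u x = Lap v x"
proof -
 have "pd j u y = pd j v y" if "y \<in> S" for j y
  using partial_deriv_cong[OF assms(1) that assms(3)] .
 then have "pd i (%y. w y * (\<Sum>j\<in>UNIV. a i j y * pd j u y)) x =
   pd i (%y. w y * (\<Sum>j\<in>UNIV. a i j y * pd j v y)) x" for i
  by (intro partial_deriv_cong[OF assms(1,2)]) simp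
 then show ?thesis by (simp add: Lap_def)
qed

lemma partial_flux:
 assumes u: "smooth_on \<Omega> u" and x: "x \<in> \<Omega>"
 shows "pd k (flux i u) x =
  (\<Sum>j\<in>UNIV. pd k (%y. w y * a i j y) x * pd j u x)
  + w x * (\<Sum>j\<in>UNIV. a i j x * pd k (pd j u) x)"
proof -
 have "flux i u = (%y. \<Sum>j\<in>UNIV. (w y * a i j y) * pd j u y)"
  by (auto simp: flux_def sum_distrib_left mult.assoc)
 then have "pd k (flux i u) x = (\<Sum>j\<in>UNIV. pd k (%y. (w y * a i j y) * pd j u y) x)"
  by (simp only:) (rule partial_deriv_sum, simp, rule diffble[OF _ x], intro smooth_intros u)
 also have "... = (\<Sum>j\<in>UNIV. w x * a i j x * pd k (pd j u) x
   + pd k (%y. w y * a i j y) x * pd j u x)"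
  by (intro sum.cong refl partial_deriv_mult diffble[OF _ x] smooth_intros u)
 finally show ?thesis by (simp add: sum.distrib sum_distrib_left mult.assoc)
qed

lemma Lap_nondiv:
 assumes u: "smooth_on \<Omega> u" and x: "x \<in> \<Omega>"
 shows "Lap u x = (\<Sum>i\<in>UNIV. \<Sum>j\<in>UNIV. a i j x * pd i (pd j u) x)
  + (\<Sum>j\<in>UNIV. drift j x * pd j u x)"
proof -
 have "w x * Lap u x = (\<Sum>i\<in>UNIV. \<Sum>j\<in>UNIV. pd i (%y. w y * a i j y) x * pd j u x)
  + w x * (\<Sum>i\<in>UNIV. \<Sum>j\<in>UNIV. a i j x * pd i (pd j u) x)"
  unfolding Lap_flux[OF x] by (simp add: partial_flux[OF u x] sum.distrib sum_distrib_left)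
 also have "(\<Sum>i\<in>UNIV. \<Sum>j\<in>UNIV. pd i (%y. w y * a i j y) x * pd j u x)
   = (\<Sum>j\<in>UNIV. w x * drift j x * pd j u x)"
  using w_pos[OF x] by (subst sum.swap) (simp add: drift_def sum_distrib_right)
 also have "... = w x * (\<Sum>j\<in>UNIV. drift j x * pd j u x)"
  by (simp add: sum_distrib_left mult.assoc)
 finally have "w x * Lap u x = w x * ((\<Sum>i\<in>UNIV. \<Sum>j\<in>UNIV. a i j x * pd i (pd j u) x)
  + (\<Sum>j\<in>UNIV. drift j x * pd j u x))" by (simp add: algebra_simps)
 then show ?thesis using w_pos[OF x] by simp
qed

lemma Gam_sym: "x \<in> \<Omega> ==> Gam u v x = Gam v u x"
 unfolding Gam_def by (subst sum.swap) (simp add: a_sym[of x] mult_ac)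

lemma Gam_nonneg: "x \<in> \<Omega> ==> Gam u u x \<ge> 0"
 using a_pos[of x "\<chi> i. pd i u x"]
 by (cases "(\<chi> i. pd i u x) = 0") (auto simp: Gam_def vec_eq_iff less_imp_le)

text \<open>The Leibniz rule of a second order operator: the cross terms assemble into twice
  \<open>Gam\<close>. On the manifold this identity is turned around and serves as a chart-free
  definition of the inner product of gradients.\<close>

lemma Lap_mult:
 assumes u: "smooth_on \<Omega> u" and v: "smooth_on \<Omega> v" and x: "x \<in> \<Omega>"
 shows "Lap (%x. u x * v x) x = u x * Lap v x + v x * Lap u x + 2 * Gam u v x"
proof -
 note d = diffble[OF _ x]
 have p: "pd j (%x. u x * v x) y = u y * pd j v y + pd j u y * v y" if "y \<in> \<Omega>" for j y
  using that u v by (intro partial_deriv_mult diffble)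
 have pp: "pd i (pd j (%x. u x * v x)) x =
   u x * pd i (pd j v) x + pd i u x * pd j v x
   + pd j u x * pd i v x + v x * pd i (pd j u) x" for i j
 proof -
  have "pd i (pd j (%x. u x * v x)) x =
    pd i (%y. u y * pd j v y + pd j u y * v y) x"
   by (rule partial_deriv_cong[OF op x p])
  also have "... = pd i (%y. u y * pd j v y) x + pd i (%y. pd j u y * v y) x"
   by (intro partial_deriv_add d smooth_intros u v)
  also have "pd i (%y. u y * pd j v y) x =
    u x * pd i (pd j v) x + pd i u x * pd j v x"
   by (intro partial_deriv_mult d smooth_intros u v)
  also have "pd i (%y. pd j u y * v y) x =
    pd j u x * pd i v x + pd i (pd j u) x * v x"
   by (intro partial_deriv_mult d smooth_intros u v)
  finally show ?thesis by (simp add: mult.commute)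
 qed
 have "Lap (%x. u x * v x) x = (\<Sum>i\<in>UNIV. \<Sum>j\<in>UNIV. a i j x * (u x * pd i (pd j v) x + pd i u x * pd j v x
   + pd j u x * pd i v x + v x * pd i (pd j u) x))
  + (\<Sum>j\<in>UNIV. drift j x * (u x * pd j v x + pd j u x * v x))"
  using u v by (subst Lap_nondiv[OF _ x]) (auto intro: smooth_intros simp: pp p[OF x])
 also have "... = u x * Lap v x + v x * Lap u x + Gam u v x + Gam v u x"
  unfolding Lap_nondiv[OF u x] Lap_nondiv[OF v x] Gam_def
  by (simp add: sum.distrib sum_distrib_left algebra_simps)
 finally show ?thesis using Gam_sym[OF x, of u v] by simp
qed

lemma weak_form:
 assumes K: "compact K" "K \<subseteq> \<Omega>" and u: "smooth_on \<Omega> u" "\<And>x. x \<notin> K ==> u x = 0" and g: "smooth_on \<Omega> g"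
 shows "cint K (%x. w x * (u x * Lap g x)) = - cint K (%x. w x * Gam u g x)"
proof -
 note c = cont_K[OF K op]
 have "cint K (%x. w x * (u x * Lap g x)) = cint K (%x. \<Sum>i\<in>UNIV. u x * pd i (flux i g) x)"
  using Lap_flux[of _ g] K(2) by (intro cint_cong) (simp add: sum_distrib_left[symmetric] mult.left_commute subset_iff)
 also have "... = (\<Sum>i\<in>UNIV. cint K (%x. u x * pd i (flux i g) x))"
  by (intro cint_sum K c smooth_intros u smooth_flux g)
 also have "... = (\<Sum>i\<in>UNIV. - cint K (%x. pd i u x * flux i g x))"
  using integration_by_parts[OF K op u smooth_flux[OF g]] by simp
 also have "... = - (\<Sum>i\<in>UNIV. cint K (%x. pd i u x * flux i g x))"
  by (simp add: sum_negf)
 also have "(\<Sum>i\<in>UNIV. cint K (%x. pd i u x * flux i g x)) = cint K (%x. \<Sum>i\<in>UNIV. pd i u x * flux i g x)"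
  by (intro cint_sum[symmetric] K c smooth_intros u smooth_flux g)
 also have "... = cint K (%x. w x * Gam u g x)"
  by (rule cint_cong) (simp add: Gam_def flux_def sum_distrib_left mult_ac)
 finally show ?thesis .
qed

text \<open>The quadratic form is continuous and positive on the compact product of K with the unit
  sphere; its minimum there extends to all vectors by homogeneity of degree two.\<close>

lemma coercive:
 assumes K: "compact K" "K \<subseteq> \<Omega>"
 shows "\<exists>c>0. \<forall>x\<in>K. \<forall>v :: 'd => real. c * (\<Sum>i\<in>UNIV. (v i)\<^sup>2) \<le> w x * (\<Sum>i\<in>UNIV. \<Sum>j\<in>UNIV. a i j x * v i * v j)"
proof (cases "K = {}")
 case False
 define q where "q = (%(x, v::real^'d). w x * (\<Sum>i\<in>UNIV. \<Sum>j\<in>UNIV. a i j x * v $ i * v $ j))"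
 define S where "S = K \<times> sphere (0::real^'d) 1"
 have "continuous_on S q"
  unfolding q_def S_def case_prod_unfold
  by (intro continuous_intros continuous_on_compose2[OF cont_K[OF K op sm_a] continuous_on_fst[OF continuous_on_id]]
    continuous_on_compose2[OF cont_K[OF K op sm_w] continuous_on_fst[OF continuous_on_id]]) auto
 moreover have "compact S" unfolding S_def by (intro compact_Times K compact_sphere)
 moreover have "S \<noteq> {}" using False by (auto simp: S_def)
 ultimately obtain p where p: "p \<in> S" "\<forall>y\<in>S. q p \<le> q y"
  using continuous_attains_inf[of S q] by blast
 have "snd p \<noteq> 0" "fst p \<in> \<Omega>" using p(1) K by (auto simp: S_def)
 then have "q p > 0" by (simp add: q_def case_prod_unfold a_pos w_pos)
 moreover have "q p * (\<Sum>i\<in>UNIV. (v i)\<^sup>2) \<le> w x * (\<Sum>i\<in>UNIV. \<Sum>j\<in>UNIV. a i j x * v i * v j)"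
  if x: "x \<in> K" for x and v :: "'d => real"
 proof (cases "(\<chi> i. v i) = 0")
  case True
  then show ?thesis by (simp add: vec_eq_iff)
 next
  case False
  define V where "V = (\<chi> i. v i)"
  define n where "n = norm V"
  have n: "n > 0" using False by (simp add: n_def V_def)
  have "n\<^sup>2 = V \<bullet> V" by (simp add: n_def power2_norm_eq_inner)
  also have "... = (\<Sum>i\<in>UNIV. (v i)\<^sup>2)" by (simp add: V_def inner_vec_def power2_eq_square)
  finally have n2: "n\<^sup>2 = (\<Sum>i\<in>UNIV. (v i)\<^sup>2)" .
  have "(x, V /\<^sub>R n) \<in> S" using x n by (simp add: S_def n_def)
  then have "n\<^sup>2 * q p \<le> n\<^sup>2 * q (x, V /\<^sub>R n)" using p by (intro mult_left_mono) auto
  also have "q (x, V /\<^sub>R n) = w x * (\<Sum>i\<in>UNIV. \<Sum>j\<in>UNIV. a i j x * v i * v j) / n\<^sup>2"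
   by (simp add: q_def V_def sum_distrib_left sum_divide_distrib power2_eq_square divide_inverse mult_ac)
  also have "n\<^sup>2 * ... = w x * (\<Sum>i\<in>UNIV. \<Sum>j\<in>UNIV. a i j x * v i * v j)"
   using n by simp
  finally show ?thesis unfolding n2 by (simp only: mult.commute[of "q p"])
 qed
 ultimately show ?thesis by blast
qed (auto intro: exI[of _ 1])

lemma partial_commute: "smooth_on \<Omega> u ==> x \<in> \<Omega> ==>
  pd i (pd j u) x = pd j (pd i u) x"
 using partial_deriv_commute[OF op] by blast

text \<open>Two integrations by parts and the symmetry of third derivatives exchange one index
  between the factors. Summed over i and k, with g a component of the flux, this replaces the full
  matrix of second derivatives by its trace times the divergence of the flux.\<close>

lemma double_parts:
 assumes K: "compact K" "K \<subseteq> \<Omega>" and u: "smooth_on \<Omega> u" "\<And>x. x \<notin> K ==> u x = 0" and g: "smooth_on \<Omega> g"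
 shows "cint K (%x. pd i (pd k u) x * pd k g x) =
  cint K (%x. pd k (pd k u) x * pd i g x)"
proof -
 note z = partial_deriv_outside[OF compact_imp_closed[OF K(1)]]
 have z2: "pd j (pd k u) x = 0" if "x \<notin> K" for x j
  by (rule z[OF z[OF u(2)] that])
 note ibp = integration_by_parts[OF K op smooth_on_partial[OF smooth_on_partial[OF u(1)]] z2 g]
 have "cint K (%x. pd k (pd i (pd k u)) x * g x) =
   cint K (%x. pd i (pd k (pd k u)) x * g x)"
  using K(2) by (intro cint_cong) (simp add: partial_commute[OF smooth_on_partial[OF u(1)]] subset_iff)
 then show ?thesis using ibp[of k i] ibp[of i k] by simp
qed

definition supp_in :: "(real^'d) set => (real^'d => real) => bool" where
 "supp_in K u \<longleftrightarrow> smooth_on \<Omega> u \<and> (\<forall>x. x \<notin> K --> u x = 0)"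

text \<open>Coercivity applied for each k to the vector of derivatives u_ik bounds all second
  derivatives by the sum of u_ik w a_ij u_jk. Up to first order terms R, the factor w a_ij u_jk is
  the k-th derivative of the flux, and \<open>double_parts\<close> then turns the integral into that
  of (sum of u_kk) times w \<open>Lap u\<close>. Young's inequality finishes.\<close>

lemma H2_estimate:
 assumes K: "compact K" "K \<subseteq> \<Omega>"
 shows "dominated (supp_in K) (%u. cint K (jet 2 u)) (%u. cint K (%x. (Lap u x)\<^sup>2) + sob 1 K u)"
proof -
 note c = cont_K[OF K op]
 from coercive[OF K] obtain c0 where c0: "c0 > 0"
  and co: "\<forall>x\<in>K. \<forall>v :: 'd => real. c0 * (\<Sum>i\<in>UNIV. (v i)\<^sup>2) \<le> w x * (\<Sum>i\<in>UNIV. \<Sum>j\<in>UNIV. a i j x * v i * v j)"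
  by (elim exE conjE)
 from compact_continuous_bound[OF K(1) c[OF sm_w]] obtain W where W: "W > 0" "\<forall>x\<in>K. \<bar>w x\<bar> \<le> W"
  by (elim exE conjE)
 define A where "A = (%x. \<Sum>k\<in>UNIV. \<Sum>i\<in>UNIV. \<Sum>j\<in>UNIV. (pd k (%y. w y * a i j y) x)\<^sup>2)"
 have "continuous_on K A" unfolding A_def by (intro continuous_intros c smooth_intros)
 from compact_continuous_bound[OF K(1) this] obtain B where B: "B > 0" "\<forall>x\<in>K. \<bar>A x\<bar> \<le> B"
  by (elim exE conjE)
 \<comment> \<open>Young's inequality is used twice, each time at the cost of s times
   \<open>jet 2 u\<close>; together 2 s = c0 / 2, which the left hand side absorbs.\<close>
 define s where "s = c0 / 4"
 have s: "s > 0" using c0 by (simp add: s_def)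
 define D where "D = real CARD('d) * W\<^sup>2 / s + B / s"
 have D: "D > 0" using W B s by (simp add: D_def add_nonneg_pos)
 show ?thesis
 proof (rule dominatedI[of "2 * D / c0"])
  fix u assume "supp_in K u"
  then have u: "smooth_on \<Omega> u" and u0: "\<forall>x. x \<notin> K --> u x = 0" by (auto simp: supp_in_def)
  let ?p = "%i k. pd i (pd k u)"
  \<comment> \<open>The part of the differentiated flux in which the derivative falls on the
    coefficients: only first derivatives of u survive.\<close>
  define R where "R = (%i k x. \<Sum>j\<in>UNIV. pd k (%y. w y * a i j y) x * pd j u x)"
  have smR: "smooth_on \<Omega> (R i k)" for i k unfolding R_def by (intro smooth_intros u)
  have fl: "w x * (\<Sum>j\<in>UNIV. a i j x * ?p j k x) = pd k (flux i u) x - R i k x" if "x \<in> K" for x i k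
   using that K(2) partial_flux[OF u, of x k i] partial_commute[OF u, of x k] by (auto simp: R_def)
  define E where "E = (%x. (\<Sum>k\<in>UNIV. ?p k k x) * (w x * Lap u x) - (\<Sum>k\<in>UNIV. \<Sum>i\<in>UNIV. ?p i k x * R i k x))"
  have j2: "jet 2 u x = (\<Sum>k\<in>UNIV. \<Sum>i\<in>UNIV. (?p i k x)\<^sup>2)" for x
   by (simp add: numeral_2_eq_2)
  have E: "E x \<le> 2 * s * jet 2 u x + D * ((Lap u x)\<^sup>2 + sjet 1 1 u x)" if x: "x \<in> K" for x
  proof -
   have yng: "p * q \<le> s * p\<^sup>2 + q\<^sup>2 / s" for p q :: real
   proof -
    have "0 \<le> (sqrt s * p - q / sqrt s)\<^sup>2" by simp
    also have "... = s * p\<^sup>2 + q\<^sup>2 / s - 2 * (p * q)"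
     using s by (simp add: power2_diff power_mult_distrib power_divide)
    moreover have "0 \<le> s * p\<^sup>2 + q\<^sup>2 / s" using s by simp
    ultimately show ?thesis by linarith
   qed
   have diag: "(\<Sum>k\<in>UNIV. (?p k k x)\<^sup>2) \<le> jet 2 u x"
    unfolding j2 by (intro sum_mono) (rule member_le_sum[of _ UNIV "%i. (?p i _ x)\<^sup>2"], auto)
   have wL: "(w x * Lap u x)\<^sup>2 \<le> W\<^sup>2 * (Lap u x)\<^sup>2"
   proof -
    have "(w x)\<^sup>2 \<le> W\<^sup>2" using W x by (auto intro!: power2_le_iff_abs_le[THEN iffD2])
    then show ?thesis by (simp add: power_mult_distrib mult_right_mono)
   qed
   have "(\<Sum>k\<in>UNIV. ?p k k x) * (w x * Lap u x) = (\<Sum>k\<in>UNIV. ?p k k x * (w x * Lap u x))"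
    by (simp add: sum_distrib_right)
   also have "... \<le> (\<Sum>k\<in>(UNIV::'d set). s * (?p k k x)\<^sup>2 + (w x * Lap u x)\<^sup>2 / s)"
    by (intro sum_mono yng)
   also have "... = s * (\<Sum>k\<in>UNIV. (?p k k x)\<^sup>2) + real CARD('d) * ((w x * Lap u x)\<^sup>2 / s)"
    by (simp add: sum.distrib sum_distrib_left)
   also have "... \<le> s * jet 2 u x + real CARD('d) * (W\<^sup>2 * (Lap u x)\<^sup>2 / s)"
    using s diag wL by (intro add_mono mult_left_mono divide_right_mono) auto
   finally have 1: "(\<Sum>k\<in>UNIV. ?p k k x) * (w x * Lap u x) \<le> s * jet 2 u x + real CARD('d) * (W\<^sup>2 * (Lap u x)\<^sup>2 / s)" .
   have RR: "(R i k x)\<^sup>2 \<le> (\<Sum>j\<in>UNIV. (pd k (%y. w y * a i j y) x)\<^sup>2) * sjet 1 1 u x" for i k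
   proof -
    have "(R i k x)\<^sup>2 \<le> (\<Sum>j\<in>UNIV. (pd k (%y. w y * a i j y) x)\<^sup>2) * (\<Sum>j\<in>UNIV. (pd j u x)\<^sup>2)"
     unfolding R_def by (rule Cauchy_Schwarz_ineq_sum)
    also have "... \<le> (\<Sum>j\<in>UNIV. (pd k (%y. w y * a i j y) x)\<^sup>2) * sjet 1 1 u x"
     by (intro mult_left_mono sum_nonneg) auto
    finally show ?thesis .
   qed
   have "- (\<Sum>k\<in>UNIV. \<Sum>i\<in>UNIV. ?p i k x * R i k x) = (\<Sum>k\<in>UNIV. \<Sum>i\<in>UNIV. ?p i k x * (- R i k x))"
    by (simp add: sum_negf)
   also have "... \<le> (\<Sum>k\<in>UNIV. \<Sum>i\<in>UNIV. s * (?p i k x)\<^sup>2 + (- R i k x)\<^sup>2 / s)"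
    by (intro sum_mono yng)
   also have "... = s * jet 2 u x + (\<Sum>k\<in>UNIV. \<Sum>i\<in>UNIV. (R i k x)\<^sup>2) / s"
    by (simp add: j2 sum.distrib sum_distrib_left sum_divide_distrib)
   also have "(\<Sum>k\<in>UNIV. \<Sum>i\<in>UNIV. (R i k x)\<^sup>2) \<le> A x * sjet 1 1 u x"
    unfolding A_def sum_distrib_right[of _ _ "sjet 1 1 u x"] sum_distrib_right[of _ UNIV "sjet 1 1 u x"]
    by (intro sum_mono order_trans[OF RR]) (simp add: sum_distrib_right)
   also have "A x * sjet 1 1 u x \<le> B * sjet 1 1 u x"
    using bspec[OF B(2) x] by (intro mult_right_mono) (auto simp del: sjet.simps)
   finally have 2: "- (\<Sum>k\<in>UNIV. \<Sum>i\<in>UNIV. ?p i k x * R i k x) \<le> s * jet 2 u x + B * sjet 1 1 u x / s"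
    using s by (simp add: divide_right_mono)
   have 3: "0 \<le> real CARD('d) * W\<^sup>2 / s * sjet 1 1 u x" "0 \<le> B / s * (Lap u x)\<^sup>2"
    using s B by (auto simp del: sjet.simps)
   have "E x \<le> s * jet 2 u x + real CARD('d) * (W\<^sup>2 * (Lap u x)\<^sup>2 / s) + (s * jet 2 u x + B * sjet 1 1 u x / s)"
    unfolding E_def using 1 2 by linarith
   also have "... \<le> ... + real CARD('d) * W\<^sup>2 / s * sjet 1 1 u x + B / s * (Lap u x)\<^sup>2"
    using 3 by linarith
   also have "... = 2 * s * jet 2 u x + D * ((Lap u x)\<^sup>2 + sjet 1 1 u x)"
    unfolding D_def by (simp add: algebra_simps del: sjet.simps)
   finally show ?thesis .
  qed
  have "c0 * cint K (jet 2 u) = cint K (%x. \<Sum>k\<in>UNIV. c0 * (\<Sum>i\<in>UNIV. (?p i k x)\<^sup>2))"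
   unfolding cint_cmult[symmetric] by (intro cint_cong) (simp add: j2 sum_distrib_left)
  also have "... \<le> cint K (%x. \<Sum>k\<in>UNIV. \<Sum>i\<in>UNIV. ?p i k x * (w x * (\<Sum>j\<in>UNIV. a i j x * ?p j k x)))"
  proof (intro cint_mono K continuous_intros c smooth_intros u sum_mono)
   fix x k assume "x \<in> K"
   then show "c0 * (\<Sum>i\<in>UNIV. (?p i k x)\<^sup>2) \<le> (\<Sum>i\<in>UNIV. ?p i k x * (w x * (\<Sum>j\<in>UNIV. a i j x * ?p j k x)))"
    using co[rule_format, of x "%i. ?p i k x"] by (simp add: sum_distrib_left mult_ac)
  qed
  also have "... = cint K (%x. \<Sum>k\<in>UNIV. \<Sum>i\<in>UNIV. ?p i k x * pd k (flux i u) x - ?p i k x * R i k x)"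
   by (intro cint_cong sum.cong refl) (simp add: fl right_diff_distrib)
  also have "... = (\<Sum>k\<in>UNIV. \<Sum>i\<in>UNIV. cint K (%x. ?p i k x * pd k (flux i u) x) - cint K (%x. ?p i k x * R i k x))"
   by (subst cint_sum cint_diff, (intro K continuous_intros c smooth_intros u smooth_flux smR)+)+ simp
  also have "... = (\<Sum>k\<in>UNIV. \<Sum>i\<in>UNIV. cint K (%x. ?p k k x * pd i (flux i u) x) - cint K (%x. ?p i k x * R i k x))"
   using double_parts[OF K u u0[rule_format] smooth_flux[OF u]] by simp
  also have "... = cint K (%x. \<Sum>k\<in>UNIV. \<Sum>i\<in>UNIV. ?p k k x * pd i (flux i u) x - ?p i k x * R i k x)"
   by (subst cint_sum cint_diff, (intro K continuous_intros c smooth_intros u smooth_flux smR)+)+ simp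
  also have "... = cint K E"
  proof (rule cint_cong)
   fix x assume "x \<in> K"
   then have "w x * Lap u x = (\<Sum>i\<in>UNIV. pd i (flux i u) x)" using K Lap_flux by blast
   then show "(\<Sum>k\<in>UNIV. \<Sum>i\<in>UNIV. ?p k k x * pd i (flux i u) x - ?p i k x * R i k x) = E x"
    unfolding E_def by (simp add: sum_subtractf sum_product)
  qed
  also have "... \<le> cint K (%x. 2 * s * jet 2 u x + D * ((Lap u x)\<^sup>2 + sjet 1 1 u x))"
   unfolding E_def
   by (rule cint_mono[OF K(1) _ _ E[unfolded E_def]])
    (intro continuous_intros c smooth_intros u smooth_Lap smR jet_cont_K[OF K op] sjet_cont_K[OF K op])+
  also have "... = cint K (%x. 2 * s * jet 2 u x) + cint K (%x. D * ((Lap u x)\<^sup>2 + sjet 1 1 u x))"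
   by (intro cint_add K continuous_intros c u smooth_Lap jet_cont_K[OF K op] sjet_cont_K[OF K op])
  also have "... = 2 * s * cint K (jet 2 u) + D * (cint K (%x. (Lap u x)\<^sup>2) + sob 1 K u)"
  proof -
   have "cint K (%x. (Lap u x)\<^sup>2 + sjet 1 1 u x) = cint K (%x. (Lap u x)\<^sup>2) + cint K (sjet 1 1 u)"
    by (intro cint_add K continuous_intros c u smooth_Lap sjet_cont_K[OF K op])
   then show ?thesis unfolding sob_def cint_cmult by (simp only:)
  qed
  finally have "c0 * cint K (jet 2 u) \<le> c0 / 2 * cint K (jet 2 u) + D * (cint K (%x. (Lap u x)\<^sup>2) + sob 1 K u)"
   by (simp add: s_def)
  then show "cint K (jet 2 u) \<le> 2 * D / c0 * (cint K (%x. (Lap u x)\<^sup>2) + sob 1 K u)"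
   using c0 by (simp add: field_simps)
 qed (use D c0 in simp)
qed


lemma sob_partial2:
 assumes K: "compact K" "K \<subseteq> \<Omega>" and u: "smooth_on \<Omega> u"
 shows "sob n K (pd i (pd j u)) \<le> sob (Suc (Suc n)) K u"
 using sob_partial[OF K op smooth_on_partial[OF u], of n i j] sob_partial[OF K op u, of "Suc n" j] by linarith

lemma second_order_bound:
 assumes K: "compact K" "K \<subseteq> \<Omega>" and al: "\<And>i j. smooth_on \<Omega> (\<alpha> i j)" and be: "\<And>j. smooth_on \<Omega> (\<beta> j)"
 shows "dominated (smooth_on \<Omega>) (%u. sob n K (%x. (\<Sum>i\<in>UNIV. \<Sum>j\<in>UNIV. \<alpha> i j x * pd i (pd j u) x)
  + (\<Sum>j\<in>UNIV. \<beta> j x * pd j u x))) (sob (n + 2) K)"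
proof -
 have 1: "dominated (smooth_on \<Omega>) (%u. sob n K (%x. \<alpha> i j x * pd i (pd j u) x)) (sob (n + 2) K)" for i j
  using dominated_trans_le[OF dominated_comp[OF sob_mult[OF K op al], where \<phi>="%u. pd i (pd j u)"]]
   sob_partial2[OF K] by (simp add: smooth_on_partial)
 have 2: "dominated (smooth_on \<Omega>) (%u. sob n K (%x. \<beta> j x * pd j u x)) (sob (n + 2) K)" for j
 proof (rule dominated_trans_le[OF dominated_comp[OF sob_mult[OF K op be], where \<phi>="pd j"]])
  show "sob n K (pd j u) \<le> sob (n + 2) K u" if "smooth_on \<Omega> u" for u
   using sob_partial[OF K op that, of n j] sob_mono[OF K op that, of "Suc n" "n + 2"] by simp
 qed (rule smooth_on_partial)
 show ?thesis
  by (intro dominated_sob_add[OF K op] dominated_sob_sum[OF K op] 1 2 smooth_intros al be sob_nonneg)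
qed

lemma sob_Lap:
 assumes K: "compact K" "K \<subseteq> \<Omega>"
 shows "dominated (smooth_on \<Omega>) (%u. sob n K (Lap u)) (sob (n + 2) K)"
 by (rule dominated_le_trans[OF eq_refl[OF sob_cong[OF K op Lap_nondiv]] second_order_bound[OF K sm_a smooth_drift]])

text \<open>Third derivatives of u commute and cancel; what remains is a second order operator whose
  coefficients are derivatives of those of \<open>Lap\<close>.\<close>

lemma Lap_partial_commutator:
 assumes u: "smooth_on \<Omega> u" and x: "x \<in> \<Omega>"
 shows "Lap (pd k u) x = pd k (Lap u) x +
  ((\<Sum>i\<in>UNIV. \<Sum>j\<in>UNIV. - pd k (a i j) x * pd i (pd j u) x)
   + (\<Sum>j\<in>UNIV. - pd k (drift j) x * pd j u x))"
proof -
 note d = diffble[OF _ x] and si = smooth_intros smooth_drift u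
 have "pd k (Lap u) x = pd k (%x. (\<Sum>i\<in>UNIV. \<Sum>j\<in>UNIV. a i j x * pd i (pd j u) x)
  + (\<Sum>j\<in>UNIV. drift j x * pd j u x)) x"
  by (rule partial_deriv_cong[OF op x Lap_nondiv[OF u]])
 also have "... = pd k (%x. \<Sum>i\<in>UNIV. \<Sum>j\<in>UNIV. a i j x * pd i (pd j u) x) x
  + pd k (%x. \<Sum>j\<in>UNIV. drift j x * pd j u x) x"
  by (intro partial_deriv_add d si)
 also have "pd k (%x. \<Sum>i\<in>UNIV. \<Sum>j\<in>UNIV. a i j x * pd i (pd j u) x) x =
  (\<Sum>i\<in>UNIV. pd k (%x. \<Sum>j\<in>UNIV. a i j x * pd i (pd j u) x) x)"
  by (intro partial_deriv_sum d si finite)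
 also have "... = (\<Sum>i\<in>UNIV. \<Sum>j\<in>UNIV. pd k (%x. a i j x * pd i (pd j u) x) x)"
  by (intro sum.cong refl partial_deriv_sum d si finite)
 also have "... = (\<Sum>i\<in>UNIV. \<Sum>j\<in>UNIV. a i j x * pd k (pd i (pd j u)) x
   + pd k (a i j) x * pd i (pd j u) x)"
  by (intro sum.cong refl partial_deriv_mult d si)
 also have "pd k (%x. \<Sum>j\<in>UNIV. drift j x * pd j u x) x =
  (\<Sum>j\<in>UNIV. pd k (%x. drift j x * pd j u x) x)"
  by (intro partial_deriv_sum d si finite)
 also have "... = (\<Sum>j\<in>UNIV. drift j x * pd k (pd j u) x + pd k (drift j) x * pd j u x)"
  by (intro sum.cong refl partial_deriv_mult d si)
 finally have 1: "pd k (Lap u) x =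
  (\<Sum>i\<in>UNIV. \<Sum>j\<in>UNIV. a i j x * pd k (pd i (pd j u)) x
   + pd k (a i j) x * pd i (pd j u) x)
  + (\<Sum>j\<in>UNIV. drift j x * pd k (pd j u) x + pd k (drift j) x * pd j u x)" .
 have 2: "pd i (pd j (pd k u)) x = pd k (pd i (pd j u)) x" for i j
 proof -
  have "pd i (pd j (pd k u)) x = pd i (pd k (pd j u)) x"
   by (rule partial_deriv_cong[OF op x]) (rule partial_commute[OF u])
  then show ?thesis using partial_commute[OF smooth_on_partial[OF u] x] by simp
 qed
 have 3: "pd j (pd k u) x = pd k (pd j u) x" for j
  by (rule partial_commute[OF u x])
 show ?thesis
  unfolding 1 Lap_nondiv[OF smooth_on_partial[OF u] x] 2 3[symmetric]
  by (simp add: sum.distrib sum_negf)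
qed

text \<open>The equation is differentiated: the estimate at level n is applied to
  \<open>pd k u\<close>, whose support is still in K. The commutator costs
  \<open>sob (n + 2)\<close>, one order below the goal of the next level and hence part of its right
  hand side.\<close>

lemma higher_estimate:
 assumes K: "compact K" "K \<subseteq> \<Omega>"
 shows "dominated (supp_in K) (%u. sob (n + 2) K u) (%u. sob n K (Lap u) + sob (n + 1) K u)"
proof (induction n)
 case 0
 have s2: "sob 2 K u = sob 1 K u + cint K (jet 2 u)" if "smooth_on \<Omega> u" for u
 proof -
  have "sob 2 K u = cint K (%x. sjet 1 1 u x + jet 2 u x)"
   unfolding sob_def by (intro cint_cong) (simp add: sjet_eq numeral_2_eq_2)
  also have "... = sob 1 K u + cint K (jet 2 u)"
   unfolding sob_def by (intro cint_add K sjet_cont_K[OF K op] jet_cont_K[OF K op] that)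
  finally show ?thesis .
 qed
 have "dominated (supp_in K) (%u. sob 1 K u + cint K (jet 2 u)) (%u. sob 0 K (Lap u) + sob 1 K u)"
  by (rule dominated_add[OF dominated_le H2_estimate[OF K, folded sob_0[OF K op]]]) simp
 then have "dominated (supp_in K) (sob 2 K) (%u. sob 0 K (Lap u) + sob 1 K u)"
  by (rule dominated_le_trans[OF eq_refl[OF s2], rotated]) (simp add: supp_in_def)
 then show ?case by (simp add: numeral_2_eq_2)
next
 case (Suc n)
 define R where "R = (%k u x. ((\<Sum>i\<in>UNIV. \<Sum>j\<in>UNIV. - pd k (a i j) x * pd i (pd j u) x)
   + (\<Sum>j\<in>UNIV. - pd k (drift j) x * pd j u x)))"
 let ?S = "%u. sob (Suc n) K (Lap u) + sob (Suc n + 1) K u"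
 have sm: "smooth_on \<Omega> u" if "supp_in K u" for u using that by (simp add: supp_in_def)
 have smR: "smooth_on \<Omega> (R k u)" if "supp_in K u" for k u
  unfolding R_def by (intro smooth_intros smooth_drift sm[OF that])
 have R: "dominated (supp_in K) (%u. sob n K (R k u)) ?S" for k
 proof (rule dominated_trans_le)
  show "dominated (supp_in K) (%u. sob n K (R k u)) (sob (n + 2) K)"
   unfolding R_def by (rule dominated_comp[OF second_order_bound[OF K], where \<phi>="%u. u"])
    (intro smooth_intros smooth_drift sm | assumption)+
 qed simp
 have D: "dominated (supp_in K) (%u. sob (n + 2) K (pd k u)) ?S" for k
 proof (rule dominated_trans[OF dominated_comp[OF Suc, where \<phi>="pd k"] dominated_add])
  show "supp_in K (pd k u)" if "supp_in K u" for u
   using that partial_deriv_outside[OF compact_imp_closed[OF K(1)]] by (auto simp: supp_in_def intro: smooth_on_partial)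
  have "dominated (supp_in K) (%u. sob n K (%x. pd k (Lap u) x + R k u x)) ?S"
   by (intro dominated_sob_add[OF K op] R dominated_le order_trans[OF sob_partial[OF K op]] smR smooth_on_partial smooth_Lap sm) auto
  then show "dominated (supp_in K) (%u. sob n K (Lap (pd k u))) ?S"
   by (rule dominated_le_trans[rotated])
    (use Lap_partial_commutator[OF sm] in \<open>simp add: R_def eq_refl[OF sob_cong[OF K op]]\<close>)
  show "dominated (supp_in K) (%u. sob (n + 1) K (pd k u)) ?S"
   using sob_partial[OF K op sm, of _ "n + 1" k] by (intro dominated_le) (simp add: add_increasing)
 qed
 have "dominated (supp_in K) (%u. sob (Suc n + 1) K u + (\<Sum>k\<in>UNIV. sob (n + 2) K (pd k u))) ?S"
  by (intro dominated_add dominated_sum D dominated_le) auto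
 then show ?case
  by (rule dominated_le_trans[rotated])
   (use sob_Suc[OF K op sm, of _ "n + 2"] sob_mono[OF K op sm, of _ 0 "n + 2"] in \<open>simp add: sob_0[OF K op]\<close>)
qed

text \<open>Interior regularity: the estimate for compactly supported functions applied to \<open>\<eta> f\<close>.\<close>

lemma interior_estimate:
 fixes \<eta> :: "real^'d => real"
 assumes K': "compact K'" "K' \<subseteq> \<Omega>" and K: "compact K" "K \<subseteq> U" "open U" "U \<subseteq> K'"
  and eta: "smooth_on UNIV \<eta>" "\<And>x. x \<in> U ==> \<eta> x = 1" "\<And>x. x \<notin> K' ==> \<eta> x = 0"
 shows "dominated (smooth_on \<Omega>) (%f. sob (n + 2) K f) (%f. sob n K' (Lap f) + sob (n + 1) K' f)"
proof -
 have eta': "smooth_on \<Omega> \<eta>" by (rule smooth_on_subset[OF eta(1)]) simp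
 let ?S = "%f. sob n K' (Lap f) + sob (n + 1) K' f"
 define G where "G = (%j x. \<Sum>i\<in>UNIV. 2 * (a i j x * pd i \<eta> x))"
 have smG: "smooth_on \<Omega> (G j)" for j unfolding G_def by (intro smooth_intros eta')
 have L: "Lap (%x. \<eta> x * f x) x = \<eta> x * Lap f x + (Lap \<eta> x * f x + (\<Sum>j\<in>UNIV. G j x * pd j f x))"
  if "smooth_on \<Omega> f" "x \<in> \<Omega>" for f x
 proof -
  have "2 * Gam \<eta> f x = (\<Sum>j\<in>UNIV. G j x * pd j f x)"
   unfolding Gam_def G_def by (subst sum.swap) (simp add: sum_distrib_left sum_distrib_right mult_ac)
  then show ?thesis using Lap_mult[OF eta' that] by (simp add: mult.commute)
 qed
 have 1: "dominated (smooth_on \<Omega>) (%f. sob n K' (%x. b x * F f x)) ?S"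
  if "smooth_on \<Omega> b" "\<And>f. smooth_on \<Omega> f ==> smooth_on \<Omega> (F f)" "\<And>f. smooth_on \<Omega> f ==> sob n K' (F f) \<le> ?S f" for b F
  by (rule dominated_trans_le[OF dominated_comp[where \<phi>=F, OF sob_mult[OF K' op that(1)] that(2)] that(3)])
 have "dominated (smooth_on \<Omega>) (%f. sob n K' (%x. \<eta> x * Lap f x + (Lap \<eta> x * f x + (\<Sum>j\<in>UNIV. G j x * pd j f x)))) ?S"
  using sob_mono[OF K' op, of _ n "n + 1"] sob_partial[OF K' op, of _ n]
  by (intro dominated_sob_add[OF K' op] dominated_sob_sum[OF K' op] 1 smooth_intros eta' smG smooth_Lap)
   (simp_all add: add_increasing)
 then have 2: "dominated (smooth_on \<Omega>) (%f. sob n K' (Lap (%x. \<eta> x * f x))) ?S"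
  by (rule dominated_le_trans[OF eq_refl[OF sob_cong[OF K' op L]], rotated 2])
 have 3: "dominated (smooth_on \<Omega>) (%f. sob (n + 1) K' (%x. \<eta> x * f x)) ?S"
  by (rule dominated_trans_le[OF sob_mult[OF K' op eta']]) simp
 have "dominated (smooth_on \<Omega>) (%f. sob (n + 2) K' (%x. \<eta> x * f x)) ?S"
  by (rule dominated_trans[OF dominated_comp[OF higher_estimate[OF K'], where \<phi>="%f x. \<eta> x * f x"] dominated_add[OF 2 3]])
   (simp add: supp_in_def eta(3) smooth_on_mult[OF op eta'])
 moreover have "sob (n + 2) K f \<le> sob (n + 2) K' (%x. \<eta> x * f x)" if "smooth_on \<Omega> f" for f
 proof -
  have "sob (n + 2) K f = sob (n + 2) K (%x. \<eta> x * f x)"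
   unfolding sob_def using K eta(2) by (intro cint_cong sjet_cong[of U]) auto
  also have "... \<le> sob (n + 2) K' (%x. \<eta> x * f x)" using K by (intro sob_subset[OF K' op] smooth_intros eta' that) auto
  finally show ?thesis .
 qed
 ultimately show ?thesis by (rule dominated_le_trans[rotated])
qed

end

subsection \<open>Poincare inequalities\<close>

definition dird :: "real^'d::finite => (real^'d => real) => real^'d => real" where
 "dird e f x = (\<Sum>j\<in>UNIV. e $ j * pd j f x)"

lemma smooth_dird: "open S ==> smooth_on S f ==> smooth_on S (dird e f)"
 unfolding dird_def[abs_def] by (intro smooth_on_sum smooth_on_mult smooth_on_partial smooth_on_const)

lemma smooth_dird_pow: "open S ==> smooth_on S f ==> smooth_on S ((dird e ^^ k) f)"
 by (induction k) (auto intro: smooth_dird)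

lemma dird_cong:
 assumes "open S" "x \<in> S" "\<And>y. y \<in> S ==> f y = g y"
 shows "dird e f x = dird e g x"
 unfolding dird_def using partial_deriv_cong[OF assms] by simp

lemma dird_pow_sum:
 assumes S: "open S" "x \<in> S" and f: "\<And>j. smooth_on S (f j)"
 shows "(dird e ^^ k) (%x. \<Sum>j\<in>(UNIV::'d::finite set). c j * f j x) x = (\<Sum>j\<in>UNIV. c j * (dird e ^^ k) (f j) x)"
 using S(2)
proof (induction k arbitrary: x)
 case (Suc k)
 have sm: "smooth_on S ((dird e ^^ k) (f j))" for j by (rule smooth_dird_pow[OF S(1) f])
 have "(dird e ^^ Suc k) (%x. \<Sum>j\<in>UNIV. c j * f j x) x = dird e (%x. \<Sum>j\<in>UNIV. c j * (dird e ^^ k) (f j) x) x"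
  using dird_cong[OF S(1) Suc.prems Suc.IH] by simp
 also have "... = (\<Sum>i\<in>UNIV. e $ i * (\<Sum>j\<in>UNIV. c j * pd i ((dird e ^^ k) (f j)) x))"
  unfolding dird_def[of e "%x. \<Sum>j\<in>UNIV. c j * (dird e ^^ k) (f j) x"]
 proof (intro sum.cong refl arg_cong2[of _ _ _ _ "(*)"])
  fix i
  have "pd i (%x. \<Sum>j\<in>UNIV. c j * (dird e ^^ k) (f j) x) x =
    (\<Sum>j\<in>UNIV. pd i (%x. c j * (dird e ^^ k) (f j) x) x)"
   by (intro partial_deriv_sum smooth_on_differentiable[OF _ Suc.prems] smooth_on_mult S sm smooth_on_const finite)
  also have "... = (\<Sum>j\<in>UNIV. c j * pd i ((dird e ^^ k) (f j)) x)"
   by (intro sum.cong refl partial_deriv_cmult smooth_on_differentiable[OF sm Suc.prems])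
  finally show "pd i (%x. \<Sum>j\<in>UNIV. c j * (dird e ^^ k) (f j) x) x =
   (\<Sum>j\<in>UNIV. c j * pd i ((dird e ^^ k) (f j)) x)" .
 qed
 also have "... = (\<Sum>j\<in>UNIV. c j * dird e ((dird e ^^ k) (f j)) x)"
  unfolding dird_def[of e "(dird e ^^ k) _"] sum_distrib_left by (subst sum.swap) (simp add: mult_ac)
 finally show ?case by simp
qed simp

text \<open>Peeling off the innermost directional derivative matches the recursion of
  \<open>jet\<close>, and Cauchy-Schwarz over the components of e gives one factor \<bar>e\<bar>^2
  for each derivative.\<close>

lemma dird_pow_le_jet:
 assumes S: "open S" "x \<in> S"
 shows "smooth_on S f ==> ((dird e ^^ k) f x)\<^sup>2 \<le> (norm e)\<^sup>2 ^ k * jet k f x"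
proof (induction k arbitrary: f)
 case (Suc k)
 have sm: "smooth_on S (pd j f)" for j by (rule smooth_on_partial[OF Suc.prems])
 have "(dird e ^^ Suc k) f x = (dird e ^^ k) (%x. \<Sum>j\<in>UNIV. e $ j * pd j f x) x"
  by (simp only: funpow_Suc_right o_apply dird_def[abs_def])
 also have "... = (\<Sum>j\<in>UNIV. e $ j * (dird e ^^ k) (pd j f) x)"
  by (rule dird_pow_sum[OF S sm])
 finally have "((dird e ^^ Suc k) f x)\<^sup>2 \<le> (\<Sum>j\<in>UNIV. (e $ j)\<^sup>2) * (\<Sum>j\<in>UNIV. ((dird e ^^ k) (pd j f) x)\<^sup>2)"
  using Cauchy_Schwarz_ineq_sum[of "%j. e $ j" "%j. (dird e ^^ k) (pd j f) x" UNIV] by simp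
 also have "(\<Sum>j\<in>UNIV. (e $ j)\<^sup>2) = (norm e)\<^sup>2"
  unfolding power2_norm_eq_inner by (simp add: inner_vec_def power2_eq_square)
 also have "(norm e)\<^sup>2 * (\<Sum>j\<in>UNIV. ((dird e ^^ k) (pd j f) x)\<^sup>2)
   \<le> (norm e)\<^sup>2 * (\<Sum>j\<in>UNIV. (norm e)\<^sup>2 ^ k * jet k (pd j f) x)"
  by (intro mult_left_mono sum_mono Suc.IH sm) simp
 also have "... = (norm e)\<^sup>2 ^ Suc k * jet (Suc k) f x"
  by (simp add: sum_distrib_left mult.assoc)
 finally show ?case .
qed simp

lemma dird_has_derivative:
 assumes "f differentiable (at (x + t *\<^sub>R e))"
 shows "((%t. f (x + t *\<^sub>R e)) has_real_derivative dird e f (x + t *\<^sub>R e)) (at t)"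
proof -
 have 1: "((%t. x + t *\<^sub>R e) has_derivative (%h. h *\<^sub>R e)) (at t)"
  by (auto intro!: derivative_eq_intros)
 have "((%t. f (x + t *\<^sub>R e)) has_derivative (%h. \<Sum>i\<in>UNIV. (h *\<^sub>R e) $ i * pd i f (x + t *\<^sub>R e))) (at t)"
  by (rule has_derivative_compose[OF 1 has_derivative_partial[OF assms]])
 moreover have "(%h. \<Sum>i\<in>UNIV. (h *\<^sub>R e) $ i * pd i f (x + t *\<^sub>R e)) = (*) (dird e f (x + t *\<^sub>R e))"
  by (auto simp: dird_def sum_distrib_right sum_distrib_left mult_ac)
 ultimately show ?thesis by (simp add: has_field_derivative_def)
qed

lemma has_integral_inverse_sqrt: "((%t. 1 / sqrt (1 - t)) has_integral 2) {0..1::real}"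
proof -
 have "((%t. 1 / sqrt (1 - t)) has_integral ((- 2 * sqrt (1 - 1)) - (- 2 * sqrt (1 - 0)))) {0..1::real}"
 proof (rule fundamental_theorem_of_calculus_interior)
  show "continuous_on {0..1} (%t::real. - 2 * sqrt (1 - t))" by (intro continuous_intros)
  fix x :: real assume "x \<in> {0<..<1}"
  then show "((%t. - 2 * sqrt (1 - t)) has_vector_derivative 1 / sqrt (1 - x)) (at x)"
   unfolding has_real_derivative_iff_has_vector_derivative[symmetric]
   by (auto intro!: derivative_eq_intros simp: field_simps)
 qed simp
 then show ?thesis by simp
qed

text \<open>Taylor's formula from 0 to the zero at 1. The remainder is split against (1-t)^(-1/2),
  whose integral is 2, instead of the constant 1. The factor \<open>sqrt (1 - t)\<close> kept in the
  weight is needed later: the volume change (1-t)^(-d) along rays is then compensated whenever 2 m >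
  d, including d = 2 m - 1, where the plain splitting would leave a divergent 1/(1-t).\<close>

lemma taylor_point:
 fixes H :: "nat => real => real"
 assumes H: "\<And>k t. t \<in> {0..1} ==> (H k has_real_derivative H (Suc k) t) (at t)"
  and m: "m \<ge> 1" and H0: "H 0 1 = 0"
 shows "(H 0 0)\<^sup>2 \<le> real m * (\<Sum>k=1..<m. (H k 0)\<^sup>2)
   + 2 * real m * integral {0..1} (%t. ((1 - t) ^ (m - 1))\<^sup>2 * sqrt (1 - t) * (H m t)\<^sup>2)"
proof -
 have Hc: "continuous_on {0..1} (H k)" for k
  using H DERIV_isCont continuous_at_imp_continuous_on by meson
 define i where "i = (%t. ((1 - t) ^ (m - 1) / fact (m - 1)) *\<^sub>R H m t)"
 define X where "X = H 0 1 - (\<Sum>k<m. ((1 - 0) ^ k / fact k) *\<^sub>R H k 0)"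
 have iX: "(i has_integral X) {0..1}"
  unfolding i_def X_def
 proof (rule Taylor_has_integral)
  fix k t assume "k < m" "0 \<le> t" "t \<le> (1::real)"
  then show "(H k has_vector_derivative H (Suc k) t) (at t within {0..1})"
   using H[of t k] by (auto simp: has_real_derivative_iff_has_vector_derivative intro: has_vector_derivative_at_within)
 qed (use m in auto)
 define Q where "Q = (%t. ((1 - t) ^ (m - 1))\<^sup>2 * sqrt (1 - t) * (H m t)\<^sup>2)"
 define I where "I = integral {0..1} Q"
 have Qc: "continuous_on {0..1} Q" unfolding Q_def by (intro continuous_intros Hc)
 have Qi: "(Q has_integral I) {0..1}"
  unfolding I_def using integrable_continuous_real[OF Qc] by (rule integrable_integral)
 have I0: "I \<ge> 0" by (rule has_integral_nonneg[OF Qi]) (simp add: Q_def)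
 \<comment> \<open>Young's inequality with a free parameter in place of Cauchy-Schwarz; the choice l
   = \<bar>X\<bar> / 2 below converts it into X^2 \<le> 2 I.\<close>
 have Xl: "\<bar>X\<bar> \<le> l + I / (2 * l)" if l: "l > 0" for l
 proof -
  \<comment> \<open>At t = 1 the quotient 1 / sqrt 0 is 0 by convention, while the remainder
    integrand need not vanish there when m = 1. The value at this one point is raised so that the
    pointwise bound holds throughout; the integral is unaffected.\<close>
  define W where "W = (%t. if t = 1 then 2 / l * \<bar>H m 1\<bar> else 1 / sqrt (1 - t))"
  have "(W has_integral 2) {0..1}"
   by (rule has_integral_spike_finite[OF _ _ has_integral_inverse_sqrt, of "{1}"]) (auto simp: W_def)
  then have R: "((%t. l / 2 * W t + 1 / (2 * l) * Q t) has_integral (l / 2 * 2 + 1 / (2 * l) * I)) {0..1}"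
   by (intro has_integral_add has_integral_mult_right Qi)
  have b: "norm (i t) \<le> l / 2 * W t + 1 / (2 * l) * Q t" if t: "t \<in> {0..1}" for t
  proof -
   define q where "q = (1 - t) ^ (m - 1) * \<bar>H m t\<bar>"
   have iq: "norm (i t) \<le> q"
   proof -
    have "norm (i t) = q / fact (m - 1)" using t by (simp add: i_def q_def abs_mult)
    also have "... \<le> q / 1" using t by (intro divide_left_mono) (auto simp: q_def fact_ge_1)
    finally show ?thesis by simp
   qed
   have Qq: "Q t = sqrt (1 - t) * q\<^sup>2" by (simp add: Q_def q_def power_mult_distrib)
   show ?thesis
   proof (cases "t = 1")
    case True
    have "q \<le> \<bar>H m 1\<bar>" using True by (cases "m - 1 = 0") (auto simp: q_def power_0_left)
    then show ?thesis using iq l True Qq by (simp add: W_def)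
   next
    case False
    define u where "u = sqrt (1 - t)"
    have u: "u > 0" using False t by (simp add: u_def)
    have "0 \<le> (l - u * q)\<^sup>2" by simp
    then have "2 * l * u * q \<le> l\<^sup>2 + u\<^sup>2 * q\<^sup>2" by (simp add: power2_diff power_mult_distrib mult_ac)
    then have "q \<le> l / 2 * (1 / u) + 1 / (2 * l) * (u * q\<^sup>2)"
     using u l by (simp add: field_simps power2_eq_square)
    then show ?thesis using iq False Qq by (simp add: W_def u_def)
   qed
  qed
  have "norm X \<le> l / 2 * 2 + 1 / (2 * l) * I"
   using integral_norm_bound_integral[OF has_integral_integrable[OF iX] has_integral_integrable[OF R] b]
    integral_unique[OF iX] integral_unique[OF R] by simp
  then show ?thesis by simp
 qed
 have X2: "X\<^sup>2 \<le> 2 * I"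
 proof (cases "X = 0")
  case False
  then have x: "\<bar>X\<bar> > 0" by simp
  have "\<bar>X\<bar> \<le> \<bar>X\<bar> / 2 + I / \<bar>X\<bar>" using Xl[of "\<bar>X\<bar> / 2"] x by simp
  then have "\<bar>X\<bar> / 2 \<le> I / \<bar>X\<bar>" by linarith
  then have "\<bar>X\<bar> / 2 * \<bar>X\<bar> \<le> I / \<bar>X\<bar> * \<bar>X\<bar>" using x by (intro mult_right_mono) auto
  then show ?thesis using x by (simp add: power2_eq_square)
 qed (use I0 in simp)
 define b where "b = (%k. if k = 0 then X else H k 0 / fact k)"
 have "{..<m} = insert 0 {1..<m}" using m by auto
 then have s: "(\<Sum>k<m. g k) = g 0 + (\<Sum>k=1..<m. g k)" for g :: "nat => real" by simp
 have "- H 0 0 = (\<Sum>k<m. b k)"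
  using H0 unfolding X_def s b_def by (simp add: scaleR_conv_of_real)
 then have "(H 0 0)\<^sup>2 = (\<Sum>k<m. b k)\<^sup>2" by (metis power2_minus)
 also have "... \<le> (\<Sum>k<m. (b k)\<^sup>2) * card {..<m}" by (rule sum_squared_le_sum_of_squares)
 also have "... = m * (X\<^sup>2 + (\<Sum>k=1..<m. (b k)\<^sup>2))" unfolding s by (simp add: b_def)
 also have "... \<le> m * (2 * I + (\<Sum>k=1..<m. (H k 0)\<^sup>2))"
 proof (intro mult_left_mono add_mono sum_mono X2)
  fix k assume "k \<in> {1..<m}"
  then have "(b k)\<^sup>2 = (H k 0)\<^sup>2 / (fact k)\<^sup>2" by (simp add: b_def power_divide)
  also have "... \<le> (H k 0)\<^sup>2 / 1" by (intro divide_left_mono) (auto simp: fact_ge_1)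
  finally show "(b k)\<^sup>2 \<le> (H k 0)\<^sup>2" by simp
 qed simp
 finally show ?thesis unfolding I_def Q_def by (simp add: algebra_simps)
qed

lemma nn_cint:
 assumes "compact K" "continuous_on K f" "\<And>x. x \<in> K ==> f x \<ge> 0"
 shows "(\<integral>\<^sup>+x. ennreal (indicator K x * f x) \<partial>lborel) = ennreal (cint K f)"
 unfolding cint_def set_lebesgue_integral_def
 using cint_integrable[OF assms(1,2)] assms(3)
 by (subst nn_integral_eq_integral) (auto simp: set_integrable_def indicator_def)

lemma borel_measurable_restrict:
 "compact K ==> continuous_on K f ==> (%x. indicator K x * f x) \<in> borel_measurable borel"
 for f :: "real^'d::finite => real"
 using cint_integrable[of K f] by (auto simp: set_integrable_def)

lemma nn_integral_scale:
 fixes \<Phi> :: "real^'d::finite => ennreal"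
 assumes [measurable]: "\<Phi> \<in> borel_measurable borel" and c: "c > 0"
 shows "(\<integral>\<^sup>+z. \<Phi> (t + c *\<^sub>R z) \<partial>lborel) = ennreal ((1 / c) ^ CARD('d)) * (\<integral>\<^sup>+z. \<Phi> z \<partial>lborel)"
proof -
 have "(\<integral>\<^sup>+z. \<Phi> z \<partial>lborel) = (\<integral>\<^sup>+z. \<Phi> z \<partial>density (distr lborel borel (%x. t + c *\<^sub>R x)) (%_. ennreal (\<bar>c\<bar>^DIM(real^'d))))"
  using c lborel_affine[of c t] by simp
 also have "... = ennreal (c ^ CARD('d)) * (\<integral>\<^sup>+z. \<Phi> (t + c *\<^sub>R z) \<partial>lborel)"
  using c by (simp add: nn_integral_density nn_integral_distr nn_integral_cmult)
 finally have "ennreal ((1 / c) ^ CARD('d)) * (\<integral>\<^sup>+z. \<Phi> z \<partial>lborel) =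
   (ennreal ((1 / c) ^ CARD('d)) * ennreal (c ^ CARD('d))) * (\<integral>\<^sup>+z. \<Phi> (t + c *\<^sub>R z) \<partial>lborel)"
  by (simp add: mult.assoc)
 also have "ennreal ((1 / c) ^ CARD('d)) * ennreal (c ^ CARD('d)) = 1"
  using c by (simp add: ennreal_mult[symmetric] power_divide)
 finally show ?thesis by simp
qed

lemma nn_integral_inverse_sqrt: "(\<integral>\<^sup>+t. ennreal (indicator {0..1::real} t * (1 / sqrt (1 - t))) \<partial>lborel) = 2"
proof -
 have "((%t. indicator {0..1::real} t * (1 / sqrt (1 - t))) has_integral 2) UNIV"
  using has_integral_restrict_UNIV[THEN iffD2, OF has_integral_inverse_sqrt]
  by (rule has_integral_eq[rotated]) (auto simp: indicator_def)
 then have "(\<integral>\<^sup>+t. ennreal (indicator {0..1::real} t * (1 / sqrt (1 - t))) \<partial>lborel) = ennreal 2"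
  by (intro nn_integral_has_integral_lborel) (auto simp: indicator_def)
 then show ?thesis by simp
qed

text \<open>For a function vanishing at the centre of a ball, no lower order term is needed in the
 Poincare inequality provided that \<open>2 m > d\<close>: Taylor expansion along the rays to the centre.\<close>

lemma point_poincare:
 fixes f :: "real^'d::finite => real"
 assumes m: "CARD('d) < 2 * m" and S: "open S" "cball y r \<subseteq> S" and f: "smooth_on S f" "f y = 0" and r: "r > 0"
 shows "cint (cball y r) (%z. (f z)\<^sup>2) \<le> 4 * real m * (\<Sum>k=1..m. r ^ (2 * k) * cint (cball y r) (jet k f))"
proof -
 have m1: "m \<ge> 1" using m by (cases m) auto
 define B where "B = cball y r"
 have B: "compact B" "B \<subseteq> S" using S by (auto simp: B_def)
 have jc: "continuous_on B (jet k f)" for k by (rule jet_cont_K[OF B S(1) f(1)])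
 have fc: "continuous_on B f" by (rule cont_K[OF B S(1) f(1)])
 define \<Phi> where "\<Phi> = (%z. ennreal (indicator B z * jet m f z))"
 have \<Phi>m [measurable]: "\<Phi> \<in> borel_measurable borel"
  unfolding \<Phi>_def using borel_measurable_restrict[OF B(1) jc] by measurable
 define wt where "wt = (%t::real. ((1 - t) ^ (m - 1))\<^sup>2 * sqrt (1 - t) * r ^ (2 * m))"
 let ?S = "%z. real m * (\<Sum>k=1..<m. r ^ (2 * k) * jet k f z)" and ?T = "2 * r ^ (2 * m) * cint B (jet m f)" and ?N = "\<integral>\<^sup>+z. \<Phi> z \<partial>lborel" and ?p = "%t z. t *\<^sub>R y + (1 - t) *\<^sub>R z"
 \<comment> \<open>The Taylor remainder along the segment from z to y, with the directional
   derivative replaced by the jet and the length of the segment by r.\<close>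
 define J where "J = (%z. \<integral>\<^sup>+t. ennreal (indicator {0..1} t * wt t) * \<Phi> (?p t z) \<partial>lborel)"
 have wtm [measurable]: "wt \<in> borel_measurable borel" unfolding wt_def by measurable
 have pw: "ennreal (indicator B z * (f z)\<^sup>2) \<le>
   ennreal (indicator B z * ?S z) + ennreal (2 * real m) * J z" for z
 proof (cases "z \<in> B")
  case True
  define e where "e = y - z"
  have ne: "norm e \<le> r" using True by (simp add: B_def e_def dist_norm)
  have inB: "z + t *\<^sub>R e \<in> B" if "t \<in> {0..1}" for t
  proof -
   have "z + t *\<^sub>R e - y = - (1 - t) *\<^sub>R e" by (simp add: e_def algebra_simps)
   then have "norm (z + t *\<^sub>R e - y) = \<bar>1 - t\<bar> * norm e" by (simp add: abs_minus_commute)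
   also have "... \<le> 1 * r" using that ne r by (intro mult_mono) auto
   finally show ?thesis by (simp add: B_def dist_norm norm_minus_commute)
  qed
  define H where "H = (%k t. (dird e ^^ k) f (z + t *\<^sub>R e))"
  have dH: "(H k has_real_derivative H (Suc k) t) (at t)" if "t \<in> {0..1}" for k t
   unfolding H_def funpow.simps o_apply using inB[OF that] B(2)
   by (intro dird_has_derivative smooth_on_differentiable[OF smooth_dird_pow[OF S(1) f(1)]]) auto
  have bH: "(H k t)\<^sup>2 \<le> r ^ (2 * k) * jet k f (z + t *\<^sub>R e)" if "t \<in> {0..1}" for k t
  proof -
   have "(H k t)\<^sup>2 \<le> (norm e)\<^sup>2 ^ k * jet k f (z + t *\<^sub>R e)"
    unfolding H_def using inB[OF that] B(2) by (intro dird_pow_le_jet[OF S(1) _ f(1)]) auto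
   also have "... \<le> r ^ (2 * k) * jet k f (z + t *\<^sub>R e)"
    unfolding power_mult[symmetric] using ne by (intro mult_right_mono power_mono) auto
   finally show ?thesis .
  qed
  define Q where "Q = (%t. ((1 - t) ^ (m - 1))\<^sup>2 * sqrt (1 - t) * (H m t)\<^sup>2)"
  have "(H 0 0)\<^sup>2 \<le> real m * (\<Sum>k=1..<m. (H k 0)\<^sup>2) + 2 * real m * integral {0..1} Q"
   unfolding Q_def using m1 f(2) by (intro taylor_point[of H m] dH) (auto simp: H_def e_def)
  also have "... \<le> ?S z + 2 * real m * integral {0..1} Q"
   using bH[of 0] by (intro add_mono mult_left_mono sum_mono) auto
  finally have 1: "(f z)\<^sup>2 \<le> ?S z + 2 * real m * integral {0..1} Q"
   by (simp add: H_def)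
  have Qc: "continuous_on {0..1} Q"
  proof -
   have "continuous_on {0..1} (H m)"
    using dH DERIV_isCont continuous_at_imp_continuous_on by meson
   then show ?thesis unfolding Q_def by (intro continuous_intros)
  qed
  have Qi: "set_integrable lborel {0..1} Q"
   unfolding set_integrable_def using borel_integrable_compact[OF compact_Icc Qc] .
  have Q0: "Q t \<ge> 0" if "t \<in> {0..1}" for t using that by (simp add: Q_def)
  have "ennreal (integral {0..1} Q) = ennreal (LINT t|lborel. indicator {0..1} t *\<^sub>R Q t)"
   using set_borel_integral_eq_integral(2)[OF Qi] by (simp add: set_lebesgue_integral_def)
  also have "... = (\<integral>\<^sup>+t. ennreal (indicator {0..1} t *\<^sub>R Q t) \<partial>lborel)"
   using Qi Q0 by (intro nn_integral_eq_integral[symmetric]) (auto simp: set_integrable_def indicator_def)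
  also have "... \<le> J z"
   unfolding J_def
  proof (rule nn_integral_mono)
   fix t :: real
   show "ennreal (indicator {0..1} t *\<^sub>R Q t) \<le> ennreal (indicator {0..1} t * wt t) * \<Phi> (?p t z)"
   proof (cases "t \<in> {0..1}")
    case t: True
    have "?p t z = z + t *\<^sub>R e" by (simp add: e_def algebra_simps)
    moreover have "Q t \<le> wt t * jet m f (z + t *\<^sub>R e)"
     unfolding Q_def wt_def mult.assoc using bH[OF t, of m] t by (intro mult_left_mono) auto
    moreover have "wt t \<ge> 0" using t r by (simp add: wt_def)
    ultimately show ?thesis using t inB[OF t] by (simp add: \<Phi>_def ennreal_mult[symmetric] ennreal_leI)
   qed simp
  qed
  finally have 2: "ennreal (integral {0..1} Q) \<le> J z" .
  have I0: "integral {0..1} Q \<ge> 0" by (rule integral_nonneg[OF integrable_continuous_real[OF Qc] Q0])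
  have s0: "0 \<le> ?S z"
   using r by (intro mult_nonneg_nonneg sum_nonneg) auto
  have "ennreal ((f z)\<^sup>2) \<le> ennreal (?S z) + ennreal (2 * real m) * ennreal (integral {0..1} Q)"
   using 1 I0 s0 by (simp add: ennreal_mult[symmetric] ennreal_plus[symmetric] ennreal_leI del: ennreal_plus)
  also have "... \<le> ennreal (?S z) + ennreal (2 * real m) * J z"
   by (intro add_left_mono mult_left_mono 2) simp
  finally show ?thesis using True by simp
 qed simp
 \<comment> \<open>After exchanging the integrals, z is mapped to t y + (1-t) z, a contraction by 1
   - t towards y, so the inner integral produces the factor (1-t)^(-d).\<close>
 have Jint: "(\<integral>\<^sup>+z. J z \<partial>lborel) \<le> ennreal ?T"
 proof -
  have "(\<integral>\<^sup>+z. J z \<partial>lborel) = (\<integral>\<^sup>+t. (\<integral>\<^sup>+z. ennreal (indicator {0..1} t * wt t) * \<Phi> (?p t z) \<partial>lborel) \<partial>lborel)"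
   unfolding J_def by (rule lborel_pair.Fubini') measurable
  also have "... \<le> (\<integral>\<^sup>+t. ennreal (indicator {0..1::real} t * (1 / sqrt (1 - t))) * (ennreal (r ^ (2 * m)) * ?N) \<partial>lborel)"
  proof (rule nn_integral_mono)
   fix t :: real
   have "(\<integral>\<^sup>+z. ennreal (indicator {0..1} t * wt t) * \<Phi> (?p t z) \<partial>lborel)
    = ennreal (indicator {0..1} t * wt t) * (\<integral>\<^sup>+z. \<Phi> (?p t z) \<partial>lborel)"
    by (rule nn_integral_cmult) measurable
   also have "... \<le> ennreal (indicator {0..1::real} t * (1 / sqrt (1 - t))) * (ennreal (r ^ (2 * m)) * ?N)"
   proof (cases "t \<in> {0..<1}")
    case True
    define c where "c = 1 - t"
    have c: "0 < c" "c \<le> 1" using True by (auto simp: c_def)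
    \<comment> \<open>The hypothesis on dimensions enters here: d \<le> 2 m - 1 and c \<le> 1, so
      the weight beats the Jacobian up to the integrable factor 1 / sqrt c.\<close>
    have "(c ^ (m - 1))\<^sup>2 * c = c ^ (2 * m - 1)"
     using m1 by (cases m) (simp_all add: power_mult[symmetric] mult.commute)
    also have "... \<le> c ^ CARD('d)" using c m by (intro power_decreasing) auto
    finally have cc: "(c ^ (m - 1))\<^sup>2 * c / c ^ CARD('d) \<le> 1" using c by simp
    have "(c ^ (m - 1))\<^sup>2 * (c / sqrt c) * (1 / c) ^ CARD('d) = (c ^ (m - 1))\<^sup>2 * c / c ^ CARD('d) * (1 / sqrt c)"
     by (simp add: power_divide mult_ac)
    then have "(c ^ (m - 1))\<^sup>2 * sqrt c * (1 / c) ^ CARD('d) = (c ^ (m - 1))\<^sup>2 * c / c ^ CARD('d) * (1 / sqrt c)"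
     unfolding real_div_sqrt[OF less_imp_le[OF c(1)]] .
    also have "... \<le> 1 * (1 / sqrt c)" using c by (intro mult_right_mono cc) auto
    finally have "(c ^ (m - 1))\<^sup>2 * sqrt c * (1 / c) ^ CARD('d) * r ^ (2 * m) \<le> 1 * (1 / sqrt c) * r ^ (2 * m)"
     using r by (intro mult_right_mono) auto
    then have "wt t * (1 / c) ^ CARD('d) \<le> 1 / sqrt c * r ^ (2 * m)"
     unfolding wt_def c_def[symmetric] by (simp add: mult_ac)
    moreover have "wt t \<ge> 0" using True r by (simp add: wt_def)
    ultimately have "ennreal (wt t) * ennreal ((1 / c) ^ CARD('d)) \<le> ennreal (1 / sqrt c) * ennreal (r ^ (2 * m))"
     using c r by (simp add: ennreal_mult[symmetric] ennreal_leI)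
    then have "ennreal (wt t) * ennreal ((1 / c) ^ CARD('d)) * ?N \<le> ennreal (1 / sqrt c) * ennreal (r ^ (2 * m)) * ?N"
     by (rule mult_right_mono) simp
    then show ?thesis using True nn_integral_scale[OF \<Phi>m c(1), of "t *\<^sub>R y"] by (simp add: c_def mult.assoc)
   next
    case False
    then have "indicator {0..1} t * wt t = 0" by (auto simp: indicator_def wt_def)
    then show ?thesis by (simp only: ennreal_0 mult_zero_left zero_le)
   qed
   finally show "(\<integral>\<^sup>+z. ennreal (indicator {0..1} t * wt t) * \<Phi> (?p t z) \<partial>lborel) \<le>
    ennreal (indicator {0..1::real} t * (1 / sqrt (1 - t))) * (ennreal (r ^ (2 * m)) * ?N)" .
  qed
  also have "... = 2 * (ennreal (r ^ (2 * m)) * ?N)"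
   by (subst nn_integral_multc) (measurable, simp only: nn_integral_inverse_sqrt)
  also have "?N = ennreal (cint B (jet m f))"
   unfolding \<Phi>_def by (rule nn_cint[OF B(1) jc]) simp
  also have "2 * (ennreal (r ^ (2 * m)) * ennreal (cint B (jet m f))) = ennreal ?T"
   using r cint_nonneg[of B "jet m f"] by (simp add: ennreal_mult mult.assoc)
  finally show ?thesis .
 qed
 have Jm [measurable]: "J \<in> borel_measurable borel"
  unfolding J_def by measurable
 have sc: "continuous_on B ?S"
  by (intro continuous_intros jc)
 have P0: "0 \<le> cint B ?S"
  using r by (intro cint_nonneg mult_nonneg_nonneg sum_nonneg) auto
 have R0: "0 \<le> ?T"
  using r by (intro mult_nonneg_nonneg cint_nonneg) auto
 have "ennreal (cint B (%z. (f z)\<^sup>2)) = (\<integral>\<^sup>+z. ennreal (indicator B z * (f z)\<^sup>2) \<partial>lborel)"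
  by (rule nn_cint[symmetric, OF B(1)]) (intro continuous_intros fc, simp)
 also have "... \<le> (\<integral>\<^sup>+z. ennreal (indicator B z * ?S z) + ennreal (2 * real m) * J z \<partial>lborel)"
  by (rule nn_integral_mono[OF pw])
 also have "... = (\<integral>\<^sup>+z. ennreal (indicator B z * ?S z) \<partial>lborel) + ennreal (2 * real m) * (\<integral>\<^sup>+z. J z \<partial>lborel)"
  using borel_measurable_restrict[OF B(1) sc] by (subst nn_integral_add) (auto simp: nn_integral_cmult)
 also have "(\<integral>\<^sup>+z. ennreal (indicator B z * ?S z) \<partial>lborel) =
   ennreal (cint B ?S)"
  using r by (intro nn_cint[OF B(1) sc] mult_nonneg_nonneg sum_nonneg) auto
 also have "ennreal (2 * real m) * (\<integral>\<^sup>+z. J z \<partial>lborel) \<le> ennreal (2 * real m) * ennreal ?T"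
  by (intro mult_left_mono Jint) simp
 also have "ennreal (cint B ?S) + ennreal (2 * real m) * ennreal ?T
   = ennreal (cint B ?S + 2 * real m * ?T)"
  using P0 R0 by (simp add: ennreal_mult[symmetric] ennreal_plus[symmetric] del: ennreal_plus)
 finally have "ennreal (cint B (%z. (f z)\<^sup>2)) \<le> ennreal (cint B ?S + 2 * real m * ?T)"
  by (simp add: add_left_mono)
 then have "cint B (%z. (f z)\<^sup>2) \<le> cint B ?S + 2 * real m * ?T"
  using P0 R0 by (subst (asm) ennreal_le_iff) auto
 also have "cint B ?S = real m * (\<Sum>k=1..<m. r ^ (2 * k) * cint B (jet k f))"
  unfolding cint_cmult by (subst cint_sum[OF B(1)]) (intro continuous_intros jc, simp add: cint_cmult)
 also have "... \<le> 4 * real m * (\<Sum>k=1..<m. r ^ (2 * k) * cint B (jet k f))"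
  using r by (intro mult_right_mono sum_nonneg mult_nonneg_nonneg cint_nonneg) auto
 also have "4 * real m * (\<Sum>k=1..<m. r ^ (2 * k) * cint B (jet k f)) + 2 * real m * ?T =
   4 * real m * (\<Sum>k=1..m. r ^ (2 * k) * cint B (jet k f))"
 proof -
  have "{1..m} = insert m {1..<m}" using m1 by auto
  then show ?thesis by (simp add: algebra_simps)
 qed
 finally show ?thesis unfolding B_def by simp
qed

text \<open>The points where \<open>f\<close> vanishes may be arbitrarily clustered, so a sum over them has no bounded
 overlap; averaging over the centres instead avoids any selection of points.\<close>

lemma averaged_poincare:
 fixes f :: "real^'d::finite => real"
 assumes m: "CARD('d) < 2 * m" and \<Omega>: "open \<Omega>" "box_nhd x0 (s + 4 * \<rho>) \<subseteq> \<Omega>" and f: "smooth_on \<Omega> f"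
  and \<rho>: "\<rho> > 0"
  and zeros: "\<And>x. x \<in> box_nhd x0 (s + \<rho>) ==> \<exists>y. dist x y \<le> \<rho> \<and> f y = 0"
 shows "cint (box_nhd x0 s) (%z. (f z)\<^sup>2) \<le> 3 ^ CARD('d) *
  (4 * real m * (\<Sum>k=1..m. (2 * \<rho>) ^ (2 * k) * cint (box_nhd x0 (s + 4 * \<rho>)) (jet k f)))"
proof -
 let ?K0 = "box_nhd x0 s" and ?A = "box_nhd x0 (s + \<rho>)" and ?K2 = "box_nhd x0 (s + 4 * \<rho>)"
 have K2: "compact ?K2" "?K2 \<subseteq> \<Omega>" using \<Omega> by auto
 have comp: "\<bar>x $ i - z $ i\<bar> \<le> dist x z" for x z :: "real^'d" and i
  using component_le_norm_cart[of "x - z" i] by (simp add: dist_norm)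
 have cb: "cball x t \<subseteq> box_nhd x0 (u + t)" if "x \<in> box_nhd x0 u" for x t u
 proof
  fix z assume z: "z \<in> cball x t"
  have "\<bar>z $ i - x0 $ i\<bar> \<le> u + t" for i
  proof -
   have "\<bar>x $ i - x0 $ i\<bar> \<le> u" using that by (simp add: box_nhd_def)
   moreover have "\<bar>x $ i - z $ i\<bar> \<le> t" using comp[where x=x and z=z and i=i] z by simp
   ultimately show ?thesis by linarith
  qed
  then show "z \<in> box_nhd x0 (u + t)" by (simp add: box_nhd_def)
 qed
 define g where "g = (%z. 4 * real m * (\<Sum>k=1..m. (2 * \<rho>) ^ (2 * k) * jet k f z))"
 have fc: "continuous_on ?K2 (%z. (f z)\<^sup>2)" by (intro continuous_intros cont_K[OF K2 \<Omega>(1) f])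
 have gc: "continuous_on ?K2 g"
  unfolding g_def by (intro continuous_intros jet_cont_K[OF K2 \<Omega>(1) f])
 have g0: "g z \<ge> 0" for z unfolding g_def using \<rho> by (intro mult_nonneg_nonneg sum_nonneg) auto
 define F where "F = (%z. ennreal (indicator ?K2 z * (f z)\<^sup>2))"
 define G where "G = (%z. ennreal (indicator ?K2 z * g z))"
 have [measurable]: "F \<in> borel_measurable borel" "G \<in> borel_measurable borel"
  unfolding F_def G_def using borel_measurable_restrict[OF K2(1) fc] borel_measurable_restrict[OF K2(1) gc] by measurable
 let ?F = "%x z. if dist x z \<le> \<rho> then F z else 0" and ?G = "%x z. if dist x z \<le> 3 * \<rho> then G z else 0"
 \<comment> \<open>The ball of radius \<rho> about x lies in the ball of radius 2\<rho> about a
   nearby zero y, which lies in the ball of radius 3\<rho> about x. As x itself ranges over a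
   \<rho>-enlargement of the box, the larger box needs the margin 4\<rho>.\<close>
 have local: "(\<integral>\<^sup>+z. ?F x z \<partial>lborel) \<le> (\<integral>\<^sup>+z. ?G x z \<partial>lborel)"
  if x: "x \<in> ?A" for x
 proof -
  obtain y where y: "dist x y \<le> \<rho>" "f y = 0" using zeros[OF x] by blast
  let ?Y = "cball y (2 * \<rho>)" and ?X = "cball x (3 * \<rho>)"
  have XK: "?X \<subseteq> ?K2" using cb[OF x, of "3 * \<rho>"] by (simp add: algebra_simps)
  have YX: "?Y \<subseteq> ?X"
  proof
   fix z assume "z \<in> ?Y"
   then show "z \<in> ?X" using dist_triangle[of x z y] y by (simp add: algebra_simps)
  qed
  have Y\<Omega>: "?Y \<subseteq> \<Omega>" using YX XK K2 by blast
  have cY: "continuous_on ?Y h" if "continuous_on ?K2 h" for h :: "real^'d => real"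
   using that YX XK continuous_on_subset by blast
  have jc: "continuous_on ?Y (jet k f)" for k by (intro cY jet_cont_K[OF K2 \<Omega>(1) f])
  have "(\<integral>\<^sup>+z. ?F x z \<partial>lborel) \<le> (\<integral>\<^sup>+z. ennreal (indicator ?Y z * (f z)\<^sup>2) \<partial>lborel)"
  proof (rule nn_integral_mono)
   fix z
   have "z \<in> ?Y" if "dist x z \<le> \<rho>" using that dist_triangle[of y z x] y by (simp add: dist_commute)
   then show "?F x z \<le> ennreal (indicator ?Y z * (f z)\<^sup>2)"
    by (auto simp: F_def indicator_def)
  qed
  also have "... = ennreal (cint ?Y (%z. (f z)\<^sup>2))"
   by (rule nn_cint) (use cY[OF fc] in auto)
  also have "... \<le> ennreal (4 * real m * (\<Sum>k=1..m. (2 * \<rho>) ^ (2 * k) * cint ?Y (jet k f)))"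
   using \<rho> by (intro ennreal_leI point_poincare[OF m \<Omega>(1) Y\<Omega> f y(2)]) simp
  also have "4 * real m * (\<Sum>k=1..m. (2 * \<rho>) ^ (2 * k) * cint ?Y (jet k f)) = cint ?Y g"
   unfolding g_def cint_cmult by (subst cint_sum) (auto intro!: continuous_intros jc simp: cint_cmult)
  also have "ennreal (cint ?Y g) = (\<integral>\<^sup>+z. ennreal (indicator ?Y z * g z) \<partial>lborel)"
   by (rule nn_cint[symmetric]) (use cY[OF gc] g0 in auto)
  also have "... \<le> (\<integral>\<^sup>+z. ?G x z \<partial>lborel)"
  proof (rule nn_integral_mono)
   fix z
   show "ennreal (indicator ?Y z * g z) \<le> ?G x z"
    using YX XK by (auto simp: G_def indicator_def)
  qed
  finally show ?thesis .
 qed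
 define V where "V = (%t. unit_ball_vol (real CARD('d)) * t ^ CARD('d))"
 have Vb: "emeasure lborel (cball (x::real^'d) t) = ennreal (V t)" if "t > 0" for x t
  using emeasure_cball[of t x] that by (simp add: V_def)
 have V0: "V \<rho> > 0" using \<rho> by (simp add: V_def unit_ball_vol_pos)
 have V3: "V (3 * \<rho>) = 3 ^ CARD('d) * V \<rho>" by (simp add: V_def power_mult_distrib)
 have swap: "(\<integral>\<^sup>+x. \<integral>\<^sup>+z. indicator ?A x * (if dist x z \<le> t then H z else 0) \<partial>lborel \<partial>lborel) =
   (\<integral>\<^sup>+z. \<integral>\<^sup>+x. indicator ?A x * (if dist x z \<le> t then H z else 0) \<partial>lborel \<partial>lborel)"
  if [measurable]: "H \<in> borel_measurable borel" for H :: "real^'d => ennreal" and t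
 proof -
  have [measurable]: "?A \<in> sets borel" by (simp add: compact_imp_closed)
  show ?thesis by (rule lborel_pair.Fubini'[symmetric]) measurable
 qed
 have Am [measurable]: "?A \<in> sets borel" by (simp add: compact_imp_closed)
 \<comment> \<open>V(\<rho>) is the measure of the centres within distance \<rho> of a given z, so
   averaging counts all z with equal weight. On the other side the centres within 3\<rho> count, and
   the quotient of the two volumes is the factor 3^d.\<close>
 have "ennreal (V \<rho>) * ennreal (cint ?K0 (%z. (f z)\<^sup>2)) = ennreal (V \<rho>) * (\<integral>\<^sup>+z. ennreal (indicator ?K0 z * (f z)\<^sup>2) \<partial>lborel)"
  using \<rho> continuous_on_subset[OF fc box_nhd_mono] by (subst nn_cint) auto
 also have "... = (\<integral>\<^sup>+z. ennreal (V \<rho>) * ennreal (indicator ?K0 z * (f z)\<^sup>2) \<partial>lborel)"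
  using \<rho> borel_measurable_restrict[of ?K0, OF _ continuous_on_subset[OF fc box_nhd_mono]]
  by (subst nn_integral_cmult) auto
 also have "... \<le> (\<integral>\<^sup>+z. \<integral>\<^sup>+x. indicator ?A x * ?F x z \<partial>lborel \<partial>lborel)"
 proof (rule nn_integral_mono)
  fix z
  show "ennreal (V \<rho>) * ennreal (indicator ?K0 z * (f z)\<^sup>2) \<le> (\<integral>\<^sup>+x. indicator ?A x * ?F x z \<partial>lborel)"
  proof (cases "z \<in> ?K0")
   case True
   have "ennreal (V \<rho>) * ennreal (indicator ?K0 z * (f z)\<^sup>2) = F z * emeasure lborel (cball z \<rho>)"
    using True box_nhd_mono[of s "s + 4 * \<rho>" x0] \<rho> Vb[OF \<rho>] by (auto simp: F_def mult.commute)
   also have "... = (\<integral>\<^sup>+x. F z * indicator (cball z \<rho>) x \<partial>lborel)"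
    by (subst nn_integral_cmult_indicator) auto
   also have "... \<le> (\<integral>\<^sup>+x. indicator ?A x * ?F x z \<partial>lborel)"
   proof (rule nn_integral_mono)
    fix x
    have "x \<in> ?A" if "dist z x \<le> \<rho>" using cb[OF True, of \<rho>] that by auto
    then show "F z * indicator (cball z \<rho>) x \<le> indicator ?A x * ?F x z"
     by (simp add: indicator_def dist_commute)
   qed
   finally show ?thesis .
  qed simp
 qed
 also have "... = (\<integral>\<^sup>+x. \<integral>\<^sup>+z. indicator ?A x * ?F x z \<partial>lborel \<partial>lborel)"
  by (rule swap[symmetric]) measurable
 also have "... \<le> (\<integral>\<^sup>+x. \<integral>\<^sup>+z. indicator ?A x * ?G x z \<partial>lborel \<partial>lborel)"
 proof (rule nn_integral_mono)
  fix x
  show "(\<integral>\<^sup>+z. indicator ?A x * ?F x z \<partial>lborel) \<le> (\<integral>\<^sup>+z. indicator ?A x * ?G x z \<partial>lborel)"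
   using local[of x] by (cases "x \<in> ?A") auto
 qed
 also have "... = (\<integral>\<^sup>+z. \<integral>\<^sup>+x. indicator ?A x * ?G x z \<partial>lborel \<partial>lborel)"
  by (rule swap) measurable
 also have "... \<le> (\<integral>\<^sup>+z. ennreal (V (3 * \<rho>)) * G z \<partial>lborel)"
 proof (rule nn_integral_mono)
  fix z
  have "(\<integral>\<^sup>+x. indicator ?A x * ?G x z \<partial>lborel) \<le> (\<integral>\<^sup>+x. G z * indicator (cball z (3 * \<rho>)) x \<partial>lborel)"
   by (intro nn_integral_mono) (auto simp: indicator_def dist_commute)
  also have "... = G z * emeasure lborel (cball z (3 * \<rho>))" by (subst nn_integral_cmult_indicator) auto
  finally show "(\<integral>\<^sup>+x. indicator ?A x * ?G x z \<partial>lborel) \<le> ennreal (V (3 * \<rho>)) * G z"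
   using Vb[of "3 * \<rho>" z] \<rho> by (simp add: mult.commute)
 qed
 also have "... = ennreal (V (3 * \<rho>)) * (\<integral>\<^sup>+z. G z \<partial>lborel)"
  by (rule nn_integral_cmult) measurable
 also have "(\<integral>\<^sup>+z. G z \<partial>lborel) = ennreal (cint ?K2 g)"
  unfolding G_def by (rule nn_cint[OF K2(1) gc g0])
 finally have "ennreal (V \<rho>) * ennreal (cint ?K0 (%z. (f z)\<^sup>2)) \<le> ennreal (V (3 * \<rho>)) * ennreal (cint ?K2 g)" .
 then have "V \<rho> * cint ?K0 (%z. (f z)\<^sup>2) \<le> V (3 * \<rho>) * cint ?K2 g"
  using V0 V3 cint_nonneg[of ?K0 "%z. (f z)\<^sup>2"] cint_nonneg[of ?K2 g] g0
  by (simp add: ennreal_mult[symmetric] less_imp_le)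
 then have "V \<rho> * cint ?K0 (%z. (f z)\<^sup>2) \<le> V \<rho> * (3 ^ CARD('d) * cint ?K2 g)" unfolding V3 by (simp add: mult_ac)
 then have "cint ?K0 (%z. (f z)\<^sup>2) \<le> 3 ^ CARD('d) * cint ?K2 g" using V0 by simp
 also have "cint ?K2 g = 4 * real m * (\<Sum>k=1..m. (2 * \<rho>) ^ (2 * k) * cint ?K2 (jet k f))"
  unfolding g_def cint_cmult
  by (subst cint_sum[OF K2(1)]) (auto intro!: continuous_intros jet_cont_K[OF K2 \<Omega>(1) f] simp: cint_cmult)
 finally show ?thesis .
qed

section \<open>Positive definite matrices, and boxes in the coordinate space\<close>

lemma matrix_inv_mult:
 fixes A :: "real^'d^'d::finite"
 assumes "invertible A"
 shows "A ** matrix_inv A = mat 1" "matrix_inv A ** A = mat 1"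
 using someI_ex[OF assms[unfolded invertible_def]] unfolding matrix_inv_def by auto

definition posdef :: "real^'d^'d::finite => bool" where
 "posdef G \<longleftrightarrow> transpose G = G \<and> (\<forall>v. v \<noteq> 0 --> v \<bullet> (G *v v) > 0)"

lemma posdef_invertible: "posdef G ==> invertible G"
proof -
 assume G: "posdef G"
 have "G *v x = 0 ==> x = 0" for x
  using G unfolding posdef_def by (metis inner_zero_right less_irrefl)
 then have "\<exists>B. B ** G = mat 1" using matrix_left_invertible_ker by blast
 then show ?thesis using invertible_left_inverse by blast
qed

text \<open>The segment from the identity to G consists of positive definite, hence invertible,
  matrices. The determinant is continuous along it, never 0 and equal to 1 at the start, so it
  cannot change sign.\<close>

lemma posdef_det_pos:
 fixes G :: "real^'d^'d::finite"
 assumes G: "posdef G"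
 shows "det G > 0"
proof (rule ccontr)
 assume neg: "\<not> det G > 0"
 define M where "M = (%t. (1 - t) *\<^sub>R mat 1 + t *\<^sub>R G)"
 have pd: "det (M t) \<noteq> 0" if "0 \<le> t" "t \<le> 1" for t
 proof -
  have "v \<bullet> (M t *v v) > 0" if "v \<noteq> 0" for v
  proof -
   have "v \<bullet> (M t *v v) = (1 - t) * (v \<bullet> v) + t * (v \<bullet> (G *v v))"
    by (simp add: M_def matrix_vector_mult_add_rdistrib scaleR_matrix_vector_assoc[symmetric] inner_add_right)
   moreover have "v \<bullet> v > 0" "v \<bullet> (G *v v) > 0" using that G by (auto simp: posdef_def)
   ultimately show ?thesis using \<open>0 \<le> t\<close> \<open>t \<le> 1\<close>
    by (cases "t = 0") (auto intro!: add_nonneg_pos mult_pos_pos)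
  qed
  then have "M t *v x = 0 ==> x = 0" for x by (metis inner_zero_right less_irrefl)
  then have "\<exists>B. B ** M t = mat 1" using matrix_left_invertible_ker by blast
  then show ?thesis using invertible_left_inverse invertible_det_nz by blast
 qed
 have "continuous_on {0..1} (%t. det (M t))"
  unfolding det_def M_def by (intro continuous_intros)
 moreover have "det (M 1) \<le> 0" "0 \<le> det (M 0)" using neg by (auto simp: M_def)
 ultimately obtain t where "0 \<le> t" "t \<le> 1" "det (M t) = 0"
  using IVT2'[of "%t. det (M t)" 1 0 0] by auto
 then show False using pd by blast
qed

lemma posdef_inverse:
 fixes G :: "real^'d^'d::finite"
 assumes G: "posdef G"
 shows "posdef (matrix_inv G)"
proof -
 have inv: "invertible G" by (rule posdef_invertible[OF G])
 have GI: "G ** matrix_inv G = mat 1" "matrix_inv G ** G = mat 1"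
  using matrix_inv_mult[OF inv] by auto
 have "transpose (matrix_inv G) ** G = mat 1"
  using arg_cong[OF GI(1), of transpose] G by (simp add: matrix_transpose_mul posdef_def transpose_mat)
 then have "transpose (matrix_inv G) = matrix_inv G"
  by (metis GI(1) matrix_mul_assoc matrix_mul_lid matrix_mul_rid)
 moreover have "v \<bullet> (matrix_inv G *v v) > 0" if "v \<noteq> 0" for v
 proof -
  define u where "u = matrix_inv G *v v"
  have vu: "G *v u = v" by (simp add: u_def matrix_vector_mul_assoc GI)
  then have "u \<noteq> 0" using that by auto
  then have "u \<bullet> (G *v u) > 0" using G by (simp add: posdef_def)
  then show ?thesis unfolding vu u_def[symmetric] by (simp add: inner_commute)
 qed
 ultimately show ?thesis by (simp add: posdef_def)
qed

lemma inner_matrix_sum: "v \<bullet> (A *v u) = (\<Sum>i\<in>UNIV. \<Sum>j\<in>UNIV. A $ i $ j * v $ i * u $ j)"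
 for A :: "real^'d^'d::finite"
 by (simp add: inner_vec_def matrix_vector_mult_def sum_distrib_left mult_ac)

text \<open>Cramer's rule shows the entries of the inverse as quotients of determinants, from which
  smooth dependence on the matrix is immediate.\<close>

lemma matrix_inv_cramer:
 fixes G :: "real^'d^'d::finite"
 assumes "invertible G"
 shows "matrix_inv G $ k $ j = det (\<chi> i l. if l = k then (axis j 1 :: real^'d) $ i else G $ i $ l) / det G"
proof -
 have "G *v (matrix_inv G *v axis j 1) = axis j 1"
  using matrix_inv_mult[OF assms] by (simp add: matrix_vector_mul_assoc)
 then have 1: "matrix_inv G *v axis j 1 = (\<chi> k. det (\<chi> i l. if l = k then (axis j 1 :: real^'d) $ i else G $ i $ l) / det G)"
  using cramer[of G "matrix_inv G *v axis j 1" "axis j 1"] assms invertible_det_nz by blast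
 have 2: "matrix_inv G $ k $ j = (matrix_inv G *v axis j 1) $ k"
  by (simp add: matrix_vector_mult_basis column_def)
 show ?thesis unfolding 2 1 by simp
qed

lemma smooth_on_det:
 fixes A :: "'a::real_normed_vector => real^'d^'d::finite"
 assumes "open S" "\<And>i j. smooth_on S (%x. A x $ i $ j)"
 shows "smooth_on S (%x. det (A x))"
 unfolding det_def by (intro smooth_on_sum smooth_on_mult smooth_on_prod assms smooth_on_const)

lemma smooth_on_matrix_inv:
 fixes A :: "'a::real_normed_vector => real^'d^'d::finite"
 assumes S: "open S" and A: "\<And>i j. smooth_on S (%x. A x $ i $ j)" and inv: "\<And>x. x \<in> S ==> invertible (A x)"
 shows "smooth_on S (%x. matrix_inv (A x) $ k $ j)"
proof -
 have "smooth_on S (%x. det (\<chi> i l. if l = k then (axis j 1 :: real^'d) $ i else A x $ i $ l) / det (A x))"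
 proof (intro smooth_on_divide smooth_on_det S A)
  fix i l
  show "smooth_on S (%x. (\<chi> i l. if l = k then (axis j 1 :: real^'d) $ i else A x $ i $ l) $ i $ l)"
   using A by (cases "l = k") auto
 qed (use inv invertible_det_nz in blast)
 then show ?thesis
  using smooth_on_cong[OF S, of "%x. matrix_inv (A x) $ k $ j"] matrix_inv_cramer[OF inv] by simp
qed

text \<open>The metric on covectors is invariant: gradients transform with the transposed Jacobian,
  and if G is the pull-back of G' then the inverse forms agree on transformed covectors. J is
  invertible because det G is not 0.\<close>

lemma pullback_inverse_form:
 fixes G G' J :: "real^'d^'d::finite"
 assumes G: "posdef G" and G': "posdef G'" and J: "G = transpose J ** G' ** J"
 shows "(transpose J *v a) \<bullet> (matrix_inv G *v (transpose J *v b)) = a \<bullet> (matrix_inv G' *v b)"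
proof -
 have "det J \<noteq> 0" using posdef_det_pos[OF G] J by (auto simp: det_mul)
 then have "invertible J" using invertible_det_nz by blast
 then obtain J' where J': "J ** J' = mat 1" using invertible_def by blast
 define y where "y = matrix_inv G' *v b"
 have y: "G' *v y = b"
  using matrix_inv_mult[OF posdef_invertible[OF G']] by (simp add: y_def matrix_vector_mul_assoc)
 define x where "x = J' *v y"
 have x: "J *v x = y" by (simp add: x_def matrix_vector_mul_assoc J')
 have "G *v x = transpose J *v b"
  by (simp add: J matrix_vector_mul_assoc[symmetric] x y)
 then have "matrix_inv G *v (transpose J *v b) = x"
  using matrix_inv_mult[OF posdef_invertible[OF G]] by (metis matrix_vector_mul_assoc matrix_vector_mul_lid)
 then show ?thesis
  by (metis x y_def dot_lmul_matrix transpose_matrix_vector)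
qed

text \<open>By continuity h stays above half its value at x0 on a small ball, which has positive
  volume.\<close>

lemma cint_pos:
 fixes h :: "real^'d::finite => real"
 assumes K: "compact K" and U: "open U" "U \<subseteq> K" "x0 \<in> U" and h: "continuous_on K h" "\<And>x. x \<in> K ==> h x \<ge> 0" "h x0 > 0"
 shows "cint K h > 0"
proof -
 have "continuous_on U h" using h(1) U(2) continuous_on_subset by blast
 then have "open (U \<inter> h -` {h x0 / 2 <..})" using U(1) by (intro continuous_open_preimage) auto
 moreover have "x0 \<in> U \<inter> h -` {h x0 / 2 <..}" using U(3) h(3) by auto
 ultimately obtain e where e: "e > 0" "cball x0 e \<subseteq> U \<inter> h -` {h x0 / 2 <..}"
  using open_contains_cball by blast
 have "0 < h x0 / 2 * measure lborel (cball x0 e)"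
  using h(3) e(1) content_cball_pos[of e x0] by simp
 also have "... = cint (cball x0 e) (%x. h x0 / 2)"
  unfolding cint_def set_lebesgue_integral_def by (simp add: measure_completion)
 also have "... \<le> cint (cball x0 e) h"
  using e(2) U(2) by (intro cint_mono continuous_on_subset[OF h(1)]) (auto simp: less_imp_le)
 also have "... \<le> cint K h" using e(2) U(2) by (intro cint_subset_mono K h) auto
 finally show ?thesis .
qed

lemma open_contains_box_nhd:
 fixes x0 :: "real^'d::finite"
 assumes "open S" "x0 \<in> S"
 shows "\<exists>r>0. box_nhd x0 r \<subseteq> S"
proof -
 obtain e where e: "e > 0" "ball x0 e \<subseteq> S" using assms open_contains_ball by blast
 define r where "r = e / (2 * real CARD('d))"
 have r: "r > 0" using e by (simp add: r_def)
 have "box_nhd x0 r \<subseteq> ball x0 e"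
 proof
  fix x assume x: "x \<in> box_nhd x0 r"
  have "norm (x - x0) \<le> (\<Sum>i\<in>UNIV. \<bar>(x - x0) $ i\<bar>)" by (rule norm_le_l1_cart)
  also have "... \<le> (\<Sum>i\<in>(UNIV::'d set). r)" using x by (intro sum_mono) (simp add: box_nhd_def)
  also have "... = e / 2" by (simp add: r_def)
  finally show "x \<in> ball x0 e" using e(1) by (simp add: dist_norm norm_minus_commute)
 qed
 then show ?thesis using r e(2) by blast
qed

definition box_open :: "real^'d::finite => real => (real^'d) set" where
 "box_open x0 s = {x. \<forall>i. \<bar>x $ i - x0 $ i\<bar> < s}"

lemma open_box_open [simp]: "open (box_open x0 s)"
proof -
 have "box_open x0 s = box (x0 - vec s) (x0 + vec s)"
  by (auto simp: box_open_def mem_box_cart abs_less_iff algebra_simps)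
 then show ?thesis by (simp add: open_box)
qed

lemma box_open_sub: "box_open x0 s \<subseteq> box_nhd x0 s" "s < t ==> box_nhd x0 s \<subseteq> box_open x0 t"
 by (auto simp: box_open_def box_nhd_def less_imp_le intro: le_less_trans)

lemma center_in_box [simp]: "s \<ge> 0 ==> x0 \<in> box_nhd x0 s" "s > 0 ==> x0 \<in> box_open x0 s"
 by (auto simp: box_open_def box_nhd_def)

subsection \<open>The Riemannian manifold in charts\<close>

locale riem_space =
 fixes R :: "('a::metric_space, 'd::finite) riem" and \<mu> :: "'a measure"
 assumes mfd: "riemannian_manifold R" and cpt: "compact (UNIV :: 'a set)" and vol: "riemannian_volume R \<mu>"
begin

definition img :: "('a, 'd) chart => (real^'d) set" where "img c = coord c ` cdom c"
definition dens :: "('a, 'd) chart => real^'d => real" where "dens c x = sqrt (det (gram R c x))"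
definition ginv :: "('a, 'd) chart => 'd => 'd => real^'d => real" where
 "ginv c i j x = matrix_inv (gram R c x) $ i $ j"

abbreviation "smf \<equiv> smooth_function R"
abbreviation "\<Delta> \<equiv> laplace_beltrami R"

lemma chart_homeo: "c \<in> atlas R ==> homeomorphism (cdom c) (img c) (coord c) (param c)"
 and chart_open: "c \<in> atlas R ==> open (cdom c)" "c \<in> atlas R ==> open (img c)"
 and chart_gram: "c \<in> atlas R ==> smooth_on (img c) (gram R c)"
 and chart_posdef: "c \<in> atlas R ==> x \<in> img c ==> posdef (gram R c x)"
 using mfd unfolding riemannian_manifold_def img_def posdef_def by blast+

lemma chart_inv: "c \<in> atlas R ==> x \<in> img c ==> coord c (param c x) = x"
  "c \<in> atlas R ==> p \<in> cdom c ==> param c (coord c p) = p"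
  "c \<in> atlas R ==> x \<in> img c ==> param c x \<in> cdom c"
  "c \<in> atlas R ==> p \<in> cdom c ==> coord c p \<in> img c"
 using chart_homeo[of c] unfolding homeomorphism_def by auto

lemma chart_cont: "c \<in> atlas R ==> continuous_on (cdom c) (coord c)" "c \<in> atlas R ==> continuous_on (img c) (param c)"
 using chart_homeo[of c] unfolding homeomorphism_def by auto

lemma chart_ex: "\<exists>c\<in>atlas R. p \<in> cdom c"
 using mfd unfolding riemannian_manifold_def by blast

lemma chart_at_in: "chart_at R p \<in> atlas R" "p \<in> cdom (chart_at R p)"
proof -
 have "\<exists>c. c \<in> atlas R \<and> p \<in> cdom c" using chart_ex by blast
 from someI_ex[OF this] show "chart_at R p \<in> atlas R" "p \<in> cdom (chart_at R p)"
  unfolding chart_at_def by auto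
qed

lemma elliptic_chart: 
 assumes c: "c \<in> atlas R"
 shows "elliptic_op (img c) (dens c) (ginv c)"
proof
 have g: "smooth_on (img c) (%x. gram R c x $ i $ j)" for i j
  by (intro smooth_on_component chart_open(2) chart_gram c)
 note pd = chart_posdef[OF c]
 show "open (img c)" by (rule chart_open(2)[OF c])
 show "smooth_on (img c) (dens c)"
  unfolding dens_def[abs_def] by (intro smooth_on_sqrt smooth_on_det chart_open c g posdef_det_pos pd)
 show "smooth_on (img c) (ginv c i j)" for i j
  unfolding ginv_def[abs_def] by (intro smooth_on_matrix_inv chart_open c g posdef_invertible pd)
 show "dens c x > 0" if "x \<in> img c" for x using posdef_det_pos[OF pd[OF that]] by (simp add: dens_def)
 show "ginv c i j x = ginv c j i x" if "x \<in> img c" for i j x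
 proof -
  have "Finite_Cartesian_Product.transpose (matrix_inv (gram R c x)) $ i $ j = matrix_inv (gram R c x) $ i $ j"
   using posdef_inverse[OF pd[OF that]] by (simp add: posdef_def)
  then show ?thesis by (simp add: ginv_def Finite_Cartesian_Product.transpose_def)
 qed
 show "(\<Sum>i\<in>UNIV. \<Sum>j\<in>UNIV. ginv c i j x * v $ i * v $ j) > 0" if "x \<in> img c" "v \<noteq> 0" for x v
  using posdef_inverse[OF pd[OF that(1)]] that(2) by (simp add: posdef_def ginv_def inner_matrix_sum)
qed

abbreviation cLap :: "('a, 'd) chart => (real^'d => real) => real^'d => real" where
 "cLap c \<equiv> elliptic_op.Lap (dens c) (ginv c)"
abbreviation cGam :: "('a, 'd) chart => (real^'d => real) => (real^'d => real) => real^'d => real" where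
 "cGam c \<equiv> elliptic_op.Gam (ginv c)"

lemma laplace_chart_at:
 "\<Delta> f p = cLap (chart_at R p) (f \<circ> param (chart_at R p)) (coord (chart_at R p) p)"
 unfolding laplace_beltrami_def Let_def elliptic_op.Lap_def[OF elliptic_chart[OF chart_at_in(1)]] dens_def ginv_def ..

lemma smf_chart: "smf f ==> c \<in> atlas R ==> smooth_on (img c) (f \<circ> param c)"
 unfolding smooth_function_def img_def by blast

lemma smfI: "(\<And>c. c \<in> atlas R ==> smooth_on (img c) (%x. f (param c x))) ==> smf f"
 unfolding smooth_function_def img_def o_def by blast

lemma smf_chart': "smf f ==> c \<in> atlas R ==> smooth_on (img c) (%x. f (param c x))"
 using smf_chart unfolding o_def .

lemma smf_const: "smf (%x. k)" by (rule smfI) simp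
lemma smf_add: 
 assumes "smf f" "smf g" shows "smf (%x. f x + g x)"
proof (rule smfI)
 fix c assume c: "c \<in> atlas R"
 show "smooth_on (img c) (%x. f (param c x) + g (param c x))"
  by (rule smooth_on_add[OF chart_open(2)[OF c] smf_chart'[OF assms(1) c] smf_chart'[OF assms(2) c]])
qed

lemma smf_diff: 
 assumes "smf f" "smf g" shows "smf (%x. f x - g x)"
proof (rule smfI)
 fix c assume c: "c \<in> atlas R"
 show "smooth_on (img c) (%x. f (param c x) - g (param c x))"
  by (rule smooth_on_diff[OF chart_open(2)[OF c] smf_chart'[OF assms(1) c] smf_chart'[OF assms(2) c]])
qed

lemma smf_mult: 
 assumes "smf f" "smf g" shows "smf (%x. f x * g x)"
proof (rule smfI)
 fix c assume c: "c \<in> atlas R"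
 show "smooth_on (img c) (%x. f (param c x) * g (param c x))"
  by (rule smooth_on_mult[OF chart_open(2)[OF c] smf_chart'[OF assms(1) c] smf_chart'[OF assms(2) c]])
qed

lemma smf_cmult: "smf g ==> smf (%x. k * g x)"
 by (rule smf_mult[OF smf_const])
lemma smf_sum: 
 assumes "\<And>i. i \<in> I ==> smf (f i)" shows "smf (%x. \<Sum>i\<in>I. f i x)"
proof (rule smfI)
 fix c assume c: "c \<in> atlas R"
 show "smooth_on (img c) (%x. \<Sum>i\<in>I. f i (param c x))"
  by (rule smooth_on_sum[OF chart_open(2)[OF c] smf_chart'[OF assms c]])
qed

lemma smf_continuous: "smf f ==> continuous_on UNIV f"
proof (rule continuous_at_imp_continuous_on, intro ballI)
 fix p assume f: "smf f"
 obtain c where c: "c \<in> atlas R" "p \<in> cdom c" using chart_ex by blast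
 have "continuous_on (cdom c) (%q. (f \<circ> param c) (coord c q))"
  using chart_inv(4)[OF c(1)]
  by (intro continuous_on_compose2[OF smooth_on_continuous[OF smf_chart[OF f c(1)]] chart_cont(1)[OF c(1)]]) auto
 then have "continuous_on (cdom c) f"
  using chart_inv(2)[OF c(1)] by (simp cong: continuous_on_cong)
 then show "isCont f p" using c chart_open(1)[OF c(1)] continuous_on_eq_continuous_at by blast
qed

lemma open_chart_image:
 assumes c: "c \<in> atlas R" and V: "open V"
 shows "open (coord c ` (cdom c \<inter> V))"
proof -
 have "coord c ` (cdom c \<inter> V) = img c \<inter> param c -` V"
  using chart_inv[OF c] by (force simp: img_def)
 then show ?thesis using continuous_open_preimage[OF chart_cont(2)[OF c] chart_open(2)[OF c] V] by simp
qed

text \<open>The change of coordinates. The factor \<open>id\<close> is kept so that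
  \<open>smooth_map R id\<close> and \<open>preserves_metric R id\<close> apply to it
  literally.\<close>

definition trans :: "('a, 'd) chart => ('a, 'd) chart => real^'d => real^'d" where
 "trans c c' = coord c' \<circ> id \<circ> param c"

lemma smooth_trans:
 assumes "c \<in> atlas R" "c' \<in> atlas R"
 shows "smooth_on (coord c ` (cdom c \<inter> cdom c')) (trans c c')" "open (coord c ` (cdom c \<inter> cdom c'))"
proof -
 have "smooth_map R id" using mfd unfolding riemannian_manifold_def by blast
 then show "smooth_on (coord c ` (cdom c \<inter> cdom c')) (trans c c')"
  unfolding smooth_map_def trans_def using assms by simp
 show "open (coord c ` (cdom c \<inter> cdom c'))" by (rule open_chart_image[OF assms(1) chart_open(1)[OF assms(2)]])
qed

lemma trans_derivative:
 assumes c: "c \<in> atlas R" and c': "c' \<in> atlas R" and p: "p \<in> cdom c" "p \<in> cdom c'"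
 shows "(trans c c' has_derivative frechet_derivative (trans c c') (at (coord c p))) (at (coord c p))"
 using smooth_on_differentiable[OF smooth_trans(1)[OF c c'], of "coord c p"] p frechet_derivative_works by blast

lemma trans_gram:
 assumes c: "c \<in> atlas R" and c': "c' \<in> atlas R" and p: "p \<in> cdom c" "p \<in> cdom c'"
 defines "J \<equiv> jacobian (trans c c') (at (coord c p))"
 shows "gram R c (coord c p) = transpose J ** gram R c' (coord c' p) ** J"
proof -
 have pm: "preserves_metric R id" using mfd unfolding riemannian_manifold_def by blast
 have "gram R c (coord c p) = transpose J ** gram R c' (coord c' (id p)) ** J"
  unfolding J_def trans_def
  by (rule pm[unfolded preserves_metric_def Let_def, rule_format, OF c c']) (use p in auto)
 then show ?thesis by (simp only: id_apply)
qed

lemma compact_param_image: "c \<in> atlas R ==> compact K ==> K \<subseteq> img c ==> compact (param c ` K)"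
 using compact_continuous_image[OF continuous_on_subset[OF chart_cont(2)]] by blast

text \<open>Extension by zero of a function given in coordinates; it transports cut-offs from a
  chart to the manifold.\<close>

definition lift :: "('a, 'd) chart => (real^'d => real) => 'a => real" where
 "lift c \<eta> p = (if p \<in> cdom c then \<eta> (coord c p) else 0)"

lemma lift_param: "c \<in> atlas R ==> x \<in> img c ==> lift c \<eta> (param c x) = \<eta> x"
 using chart_inv by (simp add: lift_def)

lemma lift_outside:
 assumes c: "c \<in> atlas R" and z: "\<And>x. x \<in> img c ==> x \<notin> K ==> \<eta> x = 0" and p: "p \<notin> param c ` K"
 shows "lift c \<eta> p = 0"
proof (cases "p \<in> cdom c")
 case True
 have "coord c p \<notin> K" using p chart_inv(2)[OF c True] by (metis imageI)
 then show ?thesis using z[OF chart_inv(4)[OF c True]] True by (simp add: lift_def)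
qed (simp add: lift_def)

text \<open>Near a point of the chart domain the lift is \<eta> composed with a transition map. Near
  any other point it vanishes, because the image of the compact set K is closed and lies inside the
  chart domain.\<close>

lemma smf_lift:
 assumes c: "c \<in> atlas R" and eta: "smooth_on (img c) \<eta>" and K: "compact K" "K \<subseteq> img c"
  and z: "\<And>x. x \<in> img c ==> x \<notin> K ==> \<eta> x = 0"
 shows "smf (lift c \<eta>)"
proof (rule smfI, rule smooth_on_openI)
 fix c' x assume c': "c' \<in> atlas R" and x: "x \<in> img c'"
 define p where "p = param c' x"
 have p: "p \<in> cdom c'" "coord c' p = x" using chart_inv[OF c'] x by (auto simp: p_def)
 show "\<exists>U. open U \<and> x \<in> U \<and> smooth_on U (%x. lift c \<eta> (param c' x))"
 proof (cases "p \<in> cdom c")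
  case True
  define U where "U = coord c' ` (cdom c' \<inter> cdom c)"
  have U: "open U" unfolding U_def by (rule smooth_trans(2)[OF c' c])
  have "smooth_on U (%x. \<eta> (trans c' c x))"
   by (rule smooth_on_compose[OF U chart_open(2)[OF c] _ _ eta])
    (use smooth_trans(1)[OF c' c] chart_inv[OF c'] chart_inv[OF c] in \<open>auto simp: U_def trans_def o_def\<close>)
  moreover have "lift c \<eta> (param c' y) = \<eta> (trans c' c y)" if "y \<in> U" for y
   using that chart_inv[OF c'] by (auto simp: U_def lift_def trans_def)
  ultimately have "smooth_on U (%x. lift c \<eta> (param c' x))"
   using smooth_on_cong[OF U, of "%x. lift c \<eta> (param c' x)"] by simp
  moreover have "x \<in> U" using p True by (auto simp: U_def)
  ultimately show ?thesis using U by blast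
 next
  case False
  define U where "U = coord c' ` (cdom c' \<inter> - (param c ` K))"
  have "open (- (param c ` K))" using compact_imp_closed[OF compact_param_image[OF c K]] by auto
  then have U: "open U" unfolding U_def by (rule open_chart_image[OF c'])
  have "lift c \<eta> (param c' y) = 0" if "y \<in> U" for y
  proof -
   have "param c' y \<notin> param c ` K" using that chart_inv[OF c'] by (auto simp: U_def)
   then show ?thesis by (intro lift_outside[OF c, of K]) (use z in auto)
  qed
  then have "smooth_on U (%x. lift c \<eta> (param c' x))"
   using smooth_on_cong[OF U, of "%x. lift c \<eta> (param c' x)" "%x. 0"] by simp
  moreover have "p \<notin> param c ` K" using False K chart_inv(3)[OF c] by auto
  then have "x \<in> U" using p by (auto simp: U_def)
  ultimately show ?thesis using U by blast
 qed
qed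

text \<open>\<open>param c\<close> is an arbitrary inverse outside \<open>img c\<close>. Setting the
  value to 0 there makes functions supported in the chart vanish off K on the whole coordinate
  space, as integration by parts requires.\<close>

definition loc :: "('a, 'd) chart => ('a => real) => real^'d => real" where
 "loc c f x = (if x \<in> img c then f (param c x) else 0)"

lemma smooth_loc: "c \<in> atlas R ==> smf f ==> smooth_on (img c) (loc c f)"
 using smooth_on_cong[OF chart_open(2), of c "loc c f" "%x. f (param c x)"] smf_chart'[of f c] by (simp add: loc_def)

lemma param_in_image:
 assumes c: "c \<in> atlas R" and x: "x \<in> img c" and K: "K \<subseteq> img c"
 shows "param c x \<in> param c ` K \<longleftrightarrow> x \<in> K"
proof
 assume "param c x \<in> param c ` K"
 then obtain y where y: "y \<in> K" "param c x = param c y" by (rule imageE)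
 have "x = coord c (param c x)" by (rule chart_inv(1)[OF c x, symmetric])
 also have "... = coord c (param c y)" by (rule arg_cong[OF y(2)])
 also have "... = y" using chart_inv(1)[OF c, of y] y(1) K by blast
 finally show "x \<in> K" using y(1) by blast
qed (rule imageI)

lemma loc_zero:
 assumes c: "c \<in> atlas R" and K: "K \<subseteq> img c" and z: "\<And>p. p \<notin> param c ` K ==> f p = 0" and x: "x \<notin> K"
 shows "loc c f x = 0"
 using z[of "param c x"] param_in_image[OF c _ K, of x] x by (simp add: loc_def)

section \<open>The Riemannian volume in charts\<close>

lemma sets_mu [measurable_cong]: "sets \<mu> = sets borel"
 using vol unfolding riemannian_volume_def by blast

lemma space_mu [simp]: "space \<mu> = UNIV"
 using sets_eq_imp_space_eq[OF sets_mu] by simp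

lemma vol_chart:
 assumes "c \<in> atlas R" "B \<in> sets borel" "B \<subseteq> cdom c"
 shows "emeasure \<mu> B = (\<integral>\<^sup>+x. ennreal (dens c x) * indicator (coord c ` B) x \<partial>lborel)"
 using vol assms unfolding riemannian_volume_def dens_def by blast

text \<open>A Borel measurable version of \<open>param c\<close>: constant off the open set
  \<open>img c\<close>, where \<open>param c\<close> itself is uncontrolled.\<close>

definition cpar :: "('a, 'd) chart => real^'d => 'a" where
 "cpar c x = (if x \<in> img c then param c x else undefined)"

lemma cpar_measurable: 
 assumes c: "c \<in> atlas R" shows "cpar c \<in> borel_measurable borel"
 unfolding cpar_def
 by (rule borel_measurable_continuous_on_if) (use chart_open[OF c] chart_cont[OF c] in auto)

text \<open>The volume is prescribed only through its values on Borel subsets of chart domains.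
  Agreement on sets upgrades this to an identity of measures, so that integrals over a chart become
  weighted Lebesgue integrals.\<close>

lemma chart_measure:
 assumes c: "c \<in> atlas R"
 shows "distr (density lborel (%x. ennreal (indicator (img c) x * dens c x))) borel (cpar c) = density \<mu> (indicator (cdom c))"
proof (rule measure_eqI)
 note [measurable] = cpar_measurable[OF c]
 have [measurable]: "(%x. indicator (img c) x * dens c x) \<in> borel_measurable borel"
  using borel_measurable_continuous_on_indicator[of "img c" "dens c"] chart_open(2)[OF c]
   smooth_on_continuous[OF elliptic_op.sm_w[OF elliptic_chart[OF c]]] by simp
 have [measurable]: "cdom c \<in> sets borel" using chart_open(1)[OF c] by simp
 fix B assume "B \<in> sets (distr (density lborel (%x. ennreal (indicator (img c) x * dens c x))) borel (cpar c))"
 then have B [measurable]: "B \<in> sets borel" by simp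
 have "emeasure (distr (density lborel (%x. ennreal (indicator (img c) x * dens c x))) borel (cpar c)) B
   = (\<integral>\<^sup>+x. ennreal (indicator (img c) x * dens c x) * indicator (cpar c -` B) x \<partial>lborel)"
  by (subst emeasure_distr, simp_all, subst emeasure_density) (simp_all add: measurable_sets_borel[OF cpar_measurable[OF c] B])
 also have "... = (\<integral>\<^sup>+x. ennreal (dens c x) * indicator (coord c ` (cdom c \<inter> B)) x \<partial>lborel)"
 proof (rule nn_integral_cong)
  fix x
  have "x \<in> coord c ` (cdom c \<inter> B) \<longleftrightarrow> x \<in> img c \<and> cpar c x \<in> B"
   using chart_inv[OF c] by (force simp: cpar_def)
  then show "ennreal (indicator (img c) x * dens c x) * indicator (cpar c -` B) x = ennreal (dens c x) * indicator (coord c ` (cdom c \<inter> B)) x"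
   by (simp add: indicator_def)
 qed
 also have "... = emeasure \<mu> (cdom c \<inter> B)"
  by (rule vol_chart[OF c, symmetric]) auto
 also have "... = emeasure (density \<mu> (indicator (cdom c))) B"
  by (subst emeasure_density) (auto simp: sets_mu indicator_inter_arith[symmetric] nn_integral_indicator)
 finally show "emeasure (distr (density lborel (%x. ennreal (indicator (img c) x * dens c x))) borel (cpar c)) B
   = emeasure (density \<mu> (indicator (cdom c))) B" .
qed (simp add: sets_mu)

lemma chart_integral:
 assumes c: "c \<in> atlas R" and K: "compact K" "K \<subseteq> img c" and h: "continuous_on K h"
 defines "F \<equiv> %p. indicator (param c ` K) p * h (coord c p)"
 shows "integrable \<mu> F" "(\<integral>p. F p \<partial>\<mu>) = cint K (%x. dens c x * h x)"
proof -
 note [measurable] = cpar_measurable[OF c]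
 have dc: "continuous_on K (dens c)"
  using smooth_on_continuous[OF elliptic_op.sm_w[OF elliptic_chart[OF c]]] K(2) continuous_on_subset by blast
 have d0: "dens c x \<ge> 0" if "x \<in> img c" for x
  using elliptic_op.w_pos[OF elliptic_chart[OF c] that] by simp
 have [measurable]: "(%x. indicator (img c) x * dens c x) \<in> borel_measurable borel"
  using borel_measurable_continuous_on_indicator[of "img c" "dens c"] chart_open(2)[OF c]
   smooth_on_continuous[OF elliptic_op.sm_w[OF elliptic_chart[OF c]]] by simp
 have [measurable]: "cdom c \<in> sets borel" using chart_open(1)[OF c] by simp
 have pK: "param c ` K \<subseteq> cdom c" using K chart_inv(3)[OF c] by auto
 have F [measurable]: "F \<in> borel_measurable borel"
 proof -
  have "continuous_on (param c ` K) (%p. h (coord c p))"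
   using K chart_inv(1)[OF c] pK by (intro continuous_on_compose2[OF h] continuous_on_subset[OF chart_cont(1)[OF c]]) auto
  then show ?thesis
   using borel_measurable_continuous_on_indicator[of "param c ` K" "%p. h (coord c p)"]
    compact_imp_closed[OF compact_param_image[OF c K]] by (simp add: F_def)
 qed
 have FT: "indicator (img c) x * dens c x * F (cpar c x) = indicator K x * (dens c x * h x)" for x
 proof (cases "x \<in> K")
  case True
  then show ?thesis using K chart_inv(1)[OF c] by (auto simp: F_def cpar_def indicator_def)
 next
  case False
  then show ?thesis using param_in_image[OF c _ K(2), of x] by (auto simp: F_def cpar_def indicator_def)
 qed
 have i: "integrable lborel (%x. indicator K x * (dens c x * h x))"
  using cint_integrable[OF K(1), of "%x. dens c x * h x"] dc h by (auto simp: set_integrable_def intro: continuous_on_mult)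
 have M: "F \<in> borel_measurable (distr (density lborel (%x. ennreal (indicator (img c) x * dens c x))) borel (cpar c))"
  by simp
 have nn: "AE x in lborel. 0 \<le> indicator (img c) x * dens c x" using d0 by (auto simp: indicator_def)
 have "integrable (density \<mu> (indicator (cdom c))) F" "(\<integral>p. F p \<partial>density \<mu> (indicator (cdom c))) = cint K (%x. dens c x * h x)"
  unfolding chart_measure[OF c, symmetric] using i nn
  by (simp_all add: integrable_distr_eq integral_distr integrable_real_density integral_real_density FT cint_def set_lebesgue_integral_def)
 moreover have "density \<mu> (indicator (cdom c)) = density \<mu> (%p. ennreal (indicator (cdom c) p))"
  by (intro arg_cong2[of _ _ _ _ density] refl ext) (simp add: indicator_def)
 moreover have "indicator (cdom c) p * F p = F p" for p
  using pK by (auto simp: F_def indicator_def)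
 moreover have "F \<in> borel_measurable \<mu>" "(indicator (cdom c) :: _ => real) \<in> borel_measurable \<mu>"
  by measurable
 ultimately show "integrable \<mu> F" "(\<integral>p. F p \<partial>\<mu>) = cint K (%x. dens c x * h x)"
  by (simp_all add: integrable_real_density integral_real_density)
qed

lemma chart_integral':
 assumes c: "c \<in> atlas R" and K: "compact K" "K \<subseteq> img c" and h: "continuous_on K (%x. F (param c x))"
  and z: "\<And>p. p \<notin> param c ` K ==> F p = 0"
 shows "integrable \<mu> F" "(\<integral>p. F p \<partial>\<mu>) = cint K (%x. dens c x * F (param c x))"
proof -
 have "param c (coord c p) = p" if "p \<in> param c ` K" for p
  using that K chart_inv(2,3)[OF c] by auto
 then have "(%p. indicator (param c ` K) p * F (param c (coord c p))) = F"
  using z by (auto simp: fun_eq_iff indicator_def)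
 then show "integrable \<mu> F" "(\<integral>p. F p \<partial>\<mu>) = cint K (%x. dens c x * F (param c x))"
  using chart_integral[OF c K h] by simp_all
qed

end

context elliptic_op begin

lemma Lap_add:
 assumes u: "smooth_on \<Omega> u" and v: "smooth_on \<Omega> v" and x: "x \<in> \<Omega>"
 shows "Lap (%x. u x + v x) x = Lap u x + Lap v x"
proof -
 have p: "pd j (%x. u x + v x) y = pd j u y + pd j v y" if "y \<in> \<Omega>" for j y
  using that u v by (intro partial_deriv_add diffble)
 have pp: "pd i (pd j (%x. u x + v x)) x =
   pd i (pd j u) x + pd i (pd j v) x" for i j
 proof -
  have "pd i (pd j (%x. u x + v x)) x = pd i (%y. pd j u y + pd j v y) x"
   by (rule partial_deriv_cong[OF op x p])
  also have "... = pd i (pd j u) x + pd i (pd j v) x"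
   by (intro partial_deriv_add diffble[OF smooth_on_partial x] u v)
  finally show ?thesis .
 qed
 show ?thesis
  unfolding Lap_nondiv[OF smooth_on_add[OF op u v] x] Lap_nondiv[OF u x] Lap_nondiv[OF v x] pp p[OF x]
  by (simp add: sum.distrib algebra_simps)
qed

lemma Lap_const: "Lap (%x. k) x = 0"
proof -
 have "pd j (%x. k) = (%x. 0 :: real)" for j :: 'd by (rule ext) simp
 then show ?thesis by (simp add: Lap_def)
qed

lemma Lap_cmult:
 assumes u: "smooth_on \<Omega> u" and x: "x \<in> \<Omega>"
 shows "Lap (%x. k * u x) x = k * Lap u x"
 using Lap_mult[OF smooth_on_const u x, of k] by (simp add: Lap_const Gam_def)

end

section \<open>Chart independence of the Laplacian and the product of gradients\<close>

context riem_space begin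

text \<open>By the chain rule the coordinate gradients are related by the transposed Jacobian of the
  transition map, so \<open>pullback_inverse_form\<close> applies. In contrast to the Laplacian,
  only first derivatives of the transition map occur.\<close>

lemma cGam_invariant:
 assumes c: "c \<in> atlas R" and c': "c' \<in> atlas R" and p: "p \<in> cdom c" "p \<in> cdom c'" and f: "smf f" and g: "smf g"
 shows "cGam c (f \<circ> param c) (g \<circ> param c) (coord c p) = cGam c' (f \<circ> param c') (g \<circ> param c') (coord c' p)"
proof -
 define x where "x = coord c p"
 define \<phi> where "\<phi> = trans c c'"
 define U where "U = coord c ` (cdom c \<inter> cdom c')"
 note U = smooth_trans(2)[OF c c', folded U_def]
 have xU: "x \<in> U" using p by (auto simp: U_def x_def)
 have \<phi>x: "\<phi> x = coord c' p" using chart_inv[OF c] p by (simp add: \<phi>_def trans_def x_def)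
 define J where "J = jacobian \<phi> (at x)"
 note G = trans_gram[OF c c' p, folded x_def \<phi>_def, folded J_def, folded \<phi>x]
 have grad: "(\<chi> i. pd i (h \<circ> param c) x) = transpose J *v (\<chi> i. pd i (h \<circ> param c') (\<phi> x))"
  if h: "smf h" for h
 proof -
  have x': "\<phi> x \<in> img c'" using \<phi>x p chart_inv(4)[OF c'] by simp
  have dh: "(h \<circ> param c') differentiable (at (\<phi> x))"
   by (rule smooth_on_differentiable[OF smf_chart[OF h c'] x'])
  have "((%y. (h \<circ> param c') (\<phi> y)) has_derivative
    (%v. \<Sum>k\<in>UNIV. frechet_derivative \<phi> (at x) v $ k * pd k (h \<circ> param c') (\<phi> x))) (at x)"
   by (rule has_derivative_compose[OF trans_derivative[OF c c' p, folded x_def \<phi>_def] has_derivative_partial[OF dh]])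
  then have "pd i (%y. (h \<circ> param c') (\<phi> y)) x =
    (\<Sum>k\<in>UNIV. frechet_derivative \<phi> (at x) (axis i 1) $ k * pd k (h \<circ> param c') (\<phi> x))" for i
   by (rule partial_deriv_eqI)
  moreover have "pd i (h \<circ> param c) x = pd i (%y. (h \<circ> param c') (\<phi> y)) x" for i
   by (rule partial_deriv_cong[OF U xU]) (use chart_inv[OF c] chart_inv[OF c'] in \<open>auto simp: U_def \<phi>_def trans_def\<close>)
  ultimately show ?thesis
   by (simp add: vec_eq_iff matrix_vector_mult_def Finite_Cartesian_Product.transpose_def J_def jacobian_def matrix_def)
 qed
 have form: "cGam c u v y = (\<chi> i. pd i u y) \<bullet> (matrix_inv (gram R c y) *v (\<chi> i. pd i v y))"
  if "c \<in> atlas R" for c u v y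
  unfolding elliptic_op.Gam_def[OF elliptic_chart[OF that]] inner_matrix_sum ginv_def by simp
 show ?thesis
  unfolding form[OF c] form[OF c'] x_def[symmetric] \<phi>x[symmetric] grad[OF f] grad[OF g]
  by (rule pullback_inverse_form[OF chart_posdef[OF c] chart_posdef[OF c'] G])
   (use p \<phi>x chart_inv(4)[OF c] chart_inv(4)[OF c'] in \<open>auto simp: x_def\<close>)
qed

definition supported :: "('a, 'd) chart => (real^'d) set => ('a => real) => bool" where
 "supported c K f \<longleftrightarrow> smf f \<and> (\<forall>p. p \<notin> param c ` K --> f p = 0)"

text \<open>The right hand side is already known not to depend on the chart. This is the bridge from
  the invariance of first order terms to that of the second order operator.\<close>

lemma chart_weak_form:
 assumes c: "c \<in> atlas R" and K: "compact K" "K \<subseteq> img c" and f: "smf f" and g: "supported c K g"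
 shows "integrable \<mu> (%p. indicator (param c ` K) p * (g p * cLap c (f \<circ> param c) (coord c p)))" (is "integrable \<mu> ?F")
  "(\<integral>p. indicator (param c ` K) p * (g p * cLap c (f \<circ> param c) (coord c p)) \<partial>\<mu>) =
   - (\<integral>p. indicator (param c ` K) p * cGam c (g \<circ> param c) (f \<circ> param c) (coord c p) \<partial>\<mu>)" (is "_ = - ?D")
proof -
 have g: "smf g" and z: "\<And>p. p \<notin> param c ` K ==> g p = 0" using g by (auto simp: supported_def)
 note E = elliptic_chart[OF c] and fc = smf_chart[OF f c] and gl = smooth_loc[OF c g] and o = chart_open(2)[OF c]
 have F: "?F = (%p. indicator (param c ` K) p * (loc c g (coord c p) * cLap c (f \<circ> param c) (coord c p)))"
  using K chart_inv[OF c] by (auto simp: fun_eq_iff indicator_def loc_def)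
 have h: "continuous_on K (%x. loc c g x * cLap c (f \<circ> param c) x)"
  by (intro continuous_on_mult cont_K[OF K o] gl elliptic_op.smooth_Lap[OF E fc])
 have cg: "cGam c (loc c g) (f \<circ> param c) x = cGam c (g \<circ> param c) (f \<circ> param c) x" if "x \<in> img c" for x
 proof -
  have "pd i (loc c g) x = pd i (g \<circ> param c) x" for i
   by (rule partial_deriv_cong[OF o that]) (simp add: loc_def)
  then show ?thesis by (simp add: elliptic_op.Gam_def[OF E])
 qed
 show "integrable \<mu> ?F"
  unfolding F by (rule chart_integral(1)[OF c K h])
 have "cint K (%x. dens c x * (loc c g x * cLap c (f \<circ> param c) x)) = - cint K (%x. dens c x * cGam c (loc c g) (f \<circ> param c) x)"
  by (rule elliptic_op.weak_form[OF E K gl loc_zero[OF c K(2) z] fc])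
 also have "cint K (%x. dens c x * cGam c (loc c g) (f \<circ> param c) x) = cint K (%x. dens c x * cGam c (g \<circ> param c) (f \<circ> param c) x)"
  using K(2) cg by (intro cint_cong) auto
 also have "... = ?D"
  by (rule chart_integral(2)[OF c K, symmetric]) (rule cont_K[OF K o elliptic_op.smooth_Gam[OF E smf_chart[OF g c] fc]])
 finally show "(\<integral>p. ?F p \<partial>\<mu>) = - ?D"
  unfolding F chart_integral(2)[OF c K h] .
qed

text \<open>Chart independence of the Laplacian: both coordinate expressions represent
 \<open>- \<integral> \<langle>dg, df\<rangle> d\<mu>\<close> when tested against a bump function \<open>g\<close>.\<close>

lemma laplace_invariant_aux:
 assumes c: "c \<in> atlas R" and c': "c' \<in> atlas R" and p0: "p0 \<in> cdom c" "p0 \<in> cdom c'" and f: "smf f"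
 shows "\<not> cLap c (f \<circ> param c) (coord c p0) > cLap c' (f \<circ> param c') (coord c' p0)"
proof
 assume gt: "cLap c (f \<circ> param c) (coord c p0) > cLap c' (f \<circ> param c') (coord c' p0)"
 define x0 where "x0 = coord c p0"
 define \<phi> where "\<phi> = coord c' \<circ> param c"
 define U where "U = coord c ` (cdom c \<inter> cdom c')"
 have U: "open U" unfolding U_def by (rule open_chart_image[OF c chart_open(1)[OF c']])
 have Uc: "U \<subseteq> img c" using chart_inv(4)[OF c] by (auto simp: U_def)
 have pU: "param c x \<in> cdom c'" if "x \<in> U" for x using that chart_inv[OF c] by (auto simp: U_def)
 have \<phi>U: "\<phi> x \<in> img c'" "param c' (\<phi> x) = param c x" if "x \<in> U" for x
  using pU[OF that] chart_inv[OF c'] by (auto simp: \<phi>_def)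
 have \<phi>c: "continuous_on U \<phi>"
  unfolding \<phi>_def using Uc pU
  by (intro continuous_on_compose continuous_on_subset[OF chart_cont(2)[OF c]] continuous_on_subset[OF chart_cont(1)[OF c']]) auto
 note E = elliptic_chart[OF c] and E' = elliptic_chart[OF c']
 note fc = smf_chart[OF f c] and fc' = smf_chart[OF f c']
 define D where "D = (%x. cLap c (f \<circ> param c) x - cLap c' (f \<circ> param c') (\<phi> x))"
 have Dc: "continuous_on U D"
  unfolding D_def using \<phi>U(1)
  by (intro continuous_on_diff continuous_on_subset[OF smooth_on_continuous[OF elliptic_op.smooth_Lap[OF E fc]] Uc]
    continuous_on_compose2[OF smooth_on_continuous[OF elliptic_op.smooth_Lap[OF E' fc']] \<phi>c]) auto
 have "open (U \<inter> D -` {0<..})" by (rule continuous_open_preimage[OF Dc U]) simp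
 moreover have x0U: "x0 \<in> U" using p0 by (auto simp: U_def x0_def)
 moreover have "D x0 > 0" using gt chart_inv(2)[OF c p0(1)] by (simp add: D_def \<phi>_def x0_def)
 ultimately obtain r where r: "r > 0" "box_nhd x0 r \<subseteq> U \<inter> D -` {0<..}"
  using open_contains_box_nhd[of "U \<inter> D -` {0<..}" x0] by auto
 define K where "K = box_nhd x0 r"
 have K: "compact K" "K \<subseteq> img c" "K \<subseteq> U" using r Uc by (auto simp: K_def)
 define K' where "K' = \<phi> ` K"
 have K': "compact K'" "K' \<subseteq> img c'"
  unfolding K'_def using K \<phi>U(1) by (auto intro!: compact_continuous_image continuous_on_subset[OF \<phi>c])
 have KK: "param c ` K = param c' ` K'" unfolding K'_def image_image using \<phi>U(2) K(3) by (intro image_cong) auto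
 define \<eta> where "\<eta> = cutoff x0 (r/2) 1"
 have \<eta>0: "\<eta> x = 0" if "x \<notin> K" for x
  unfolding \<eta>_def by (rule cutoff_eq_0) (use that r in \<open>auto simp: K_def\<close>)
 have \<eta>s: "smooth_on (img c) \<eta>" unfolding \<eta>_def by (rule smooth_on_subset[OF smooth_on_cutoff]) simp
 define g where "g = lift c \<eta>"
 have g: "smf g" unfolding g_def by (rule smf_lift[OF c \<eta>s K(1,2) \<eta>0])
 have gz: "g p = 0" if "p \<notin> param c ` K" for p
  unfolding g_def by (rule lift_outside[OF c \<eta>0 that])
 \<comment> \<open>The same test function is supported in both charts over one compact set of the
   manifold, so that the two weak forms can be compared.\<close>
 have "supported c K g" "supported c' K' g" using g gz KK by (auto simp: supported_def)
 note w = chart_weak_form[OF c K(1,2) f this(1)] and w' = chart_weak_form[OF c' K' f this(2), folded KK]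
 have pK: "p \<in> cdom c" "p \<in> cdom c'" if "p \<in> param c ` K" for p using that pU K chart_inv(3)[OF c] by auto
 let ?L = "%b p. indicator (param c ` K) p * (g p * cLap b (f \<circ> param b) (coord b p))"
 have "indicator (param c ` K) p * cGam c (g \<circ> param c) (f \<circ> param c) (coord c p) =
   indicator (param c ` K) p * cGam c' (g \<circ> param c') (f \<circ> param c') (coord c' p)" for p
  using cGam_invariant[OF c c' pK g f] by (cases "p \<in> param c ` K") simp_all
 then have "(\<integral>p. ?L c p \<partial>\<mu>) = (\<integral>p. ?L c' p \<partial>\<mu>)"
  unfolding w(2) w'(2) by (simp only:)
 then have "0 = (\<integral>p. ?L c p - ?L c' p \<partial>\<mu>)"
  by (subst Bochner_Integration.integral_diff[OF w(1) w'(1)]) (simp only: diff_self)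
 also have "(%p. ?L c p - ?L c' p) = (%p. indicator (param c ` K) p * (\<eta> (coord c p) * D (coord c p)))"
  using pK chart_inv(2)[OF c] by (auto simp: fun_eq_iff indicator_def g_def lift_def D_def \<phi>_def algebra_simps)
 also have "(\<integral>p. indicator (param c ` K) p * (\<eta> (coord c p) * D (coord c p)) \<partial>\<mu>) = cint K (%x. dens c x * (\<eta> x * D x))"
  by (rule chart_integral(2)[OF c K(1,2)])
   (intro continuous_on_mult cont_K[OF K(1,2) chart_open(2)[OF c]] \<eta>s continuous_on_subset[OF Dc K(3)])
 finally have "0 = cint K (%x. dens c x * (\<eta> x * D x))" .
 moreover have "cint K (%x. dens c x * (\<eta> x * D x)) > 0"
 proof (rule cint_pos[OF K(1) open_box_open[of x0 r]])
  show "box_open x0 r \<subseteq> K" "x0 \<in> box_open x0 r" using r(1) box_open_sub by (auto simp: K_def)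
  show "continuous_on K (%x. dens c x * (\<eta> x * D x))"
   by (intro continuous_on_mult cont_K[OF K(1,2) chart_open(2)[OF c]] elliptic_op.sm_w[OF E] \<eta>s continuous_on_subset[OF Dc K(3)])
  show "0 \<le> dens c x * (\<eta> x * D x)" if "x \<in> K" for x
   using that r K(2) elliptic_op.w_pos[OF E, of x] cutoff_bounds(1) by (auto simp: K_def \<eta>_def less_imp_le intro!: mult_nonneg_nonneg)
  have "\<eta> x0 = 1" unfolding \<eta>_def by (rule cutoff_eq_1) (use r in auto)
  then show "0 < dens c x0 * (\<eta> x0 * D x0)"
   using \<open>D x0 > 0\<close> elliptic_op.w_pos[OF E, of x0] x0U Uc by auto
 qed
 ultimately show False by simp
qed

lemma laplace_chart:
 assumes c: "c \<in> atlas R" and p: "p \<in> cdom c" and f: "smf f"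
 shows "\<Delta> f p = cLap c (f \<circ> param c) (coord c p)"
 unfolding laplace_chart_at
 using laplace_invariant_aux[OF c chart_at_in(1) p chart_at_in(2) f] laplace_invariant_aux[OF chart_at_in(1) c chart_at_in(2) p f]
 by linarith

lemma laplace_param: "c \<in> atlas R ==> x \<in> img c ==> smf f ==> \<Delta> f (param c x) = cLap c (f \<circ> param c) x"
 using laplace_chart[of c "param c x" f] chart_inv by simp

lemma smf_laplace:
 assumes f: "smf f" shows "smf (\<Delta> f)"
proof (rule smfI)
 fix c assume c: "c \<in> atlas R"
 show "smooth_on (img c) (%x. \<Delta> f (param c x))"
  using smooth_on_cong[OF chart_open(2)[OF c], of "%x. \<Delta> f (param c x)"] laplace_param[OF c _ f]
   elliptic_op.smooth_Lap[OF elliptic_chart[OF c] smf_chart[OF f c]] by simp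
qed

lemma laplace_add:
 assumes "smf f" "smf g" shows "\<Delta> (%x. f x + g x) p = \<Delta> f p + \<Delta> g p"
proof -
 obtain c where c: "c \<in> atlas R" "p \<in> cdom c" using chart_ex by blast
 show ?thesis
  using elliptic_op.Lap_add[OF elliptic_chart[OF c(1)] smf_chart[OF assms(1) c(1)] smf_chart[OF assms(2) c(1)] chart_inv(4)[OF c]]
  by (simp add: laplace_chart[OF c] assms smf_add o_def)
qed

lemma laplace_cmult:
 assumes "smf f" shows "\<Delta> (%x. k * f x) p = k * \<Delta> f p"
proof -
 obtain c where c: "c \<in> atlas R" "p \<in> cdom c" using chart_ex by blast
 show ?thesis
  using elliptic_op.Lap_cmult[OF elliptic_chart[OF c(1)] smf_chart[OF assms(1) c(1)] chart_inv(4)[OF c]]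
  by (simp add: laplace_chart[OF c] assms smf_cmult o_def)
qed

lemma laplace_const: "\<Delta> (%x. k) p = 0"
 using laplace_cmult[OF smf_const[of 1], of 0 p] laplace_cmult[OF smf_const[of 0], of 0 p]
  laplace_chart_at[of "%x. k" p] elliptic_op.Lap_const[OF elliptic_chart[OF chart_at_in(1)]] by (simp add: o_def)

lemma laplace_sum:
 assumes "\<And>i. i \<in> I ==> smf (f i)"
 shows "\<Delta> (%x. \<Sum>i\<in>I. f i x) p = (\<Sum>i\<in>I. \<Delta> (f i) p)"
 using assms
proof (induction I rule: infinite_finite_induct)
 case (insert i I)
 then show ?case using laplace_add[of "f i" "%x. \<Sum>i\<in>I. f i x" p] smf_sum[of I f] by simp
qed (auto simp: laplace_const)

lemma laplace_local:
 assumes U: "open U" "p \<in> U" "\<And>q. q \<in> U ==> f q = g q"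
 shows "\<Delta> f p = \<Delta> g p"
proof -
 let ?c = "chart_at R p"
 note c = chart_at_in
 have o: "open (coord ?c ` (cdom ?c \<inter> U))" by (rule open_chart_image[OF c(1) U(1)])
 show ?thesis unfolding laplace_chart_at
  by (rule elliptic_op.Lap_cong[OF elliptic_chart[OF c(1)] o])
   (use U c(2) chart_inv[OF c(1)] in auto)
qed

text \<open>The inner product of the gradients, recovered from the defect in the Leibniz rule. The
  definition mentions no chart; smoothness and symmetry can be read off from it.\<close>

definition Gamma :: "('a => real) => ('a => real) => 'a => real" where
 "Gamma f g p = (\<Delta> (%x. f x * g x) p - f p * \<Delta> g p - g p * \<Delta> f p) / 2"

lemma Gamma_chart:
 assumes c: "c \<in> atlas R" "p \<in> cdom c" and f: "smf f" and g: "smf g"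
 shows "Gamma f g p = cGam c (f \<circ> param c) (g \<circ> param c) (coord c p)"
 using elliptic_op.Lap_mult[OF elliptic_chart[OF c(1)] smf_chart[OF f c(1)] smf_chart[OF g c(1)] chart_inv(4)[OF c]]
 by (simp add: Gamma_def laplace_chart[OF c] f g smf_mult o_def chart_inv(2)[OF c])

lemma Gamma_nonneg: assumes f: "smf f" shows "Gamma f f p \<ge> 0"
proof -
 obtain c where c: "c \<in> atlas R" "p \<in> cdom c" using chart_ex by blast
 show ?thesis unfolding Gamma_chart[OF c f f]
  by (rule elliptic_op.Gam_nonneg[OF elliptic_chart[OF c(1)] chart_inv(4)[OF c]])
qed

lemma smf_Gamma: assumes "smf f" "smf g" shows "smf (Gamma f g)"
proof -
 have "smf (%p. (1/2) * (\<Delta> (%x. f x * g x) p - f p * \<Delta> g p - g p * \<Delta> f p))"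
  by (rule smf_cmult[OF smf_diff[OF smf_diff[OF smf_laplace[OF smf_mult] smf_mult[OF _ smf_laplace]] smf_mult[OF _ smf_laplace]]]) (use assms in auto)
 then show ?thesis by (simp add: Gamma_def[abs_def])
qed

lemma Gamma_sym: "Gamma f g p = Gamma g f p"
 by (simp add: Gamma_def mult.commute)

end

section \<open>Localisation by finitely many charts, and Green's formula\<close>

context riem_space begin

lemma smf_divide:
 assumes f: "smf f" and g: "smf g" and nz: "\<And>p. g p \<noteq> 0"
 shows "smf (%x. f x / g x)"
proof (rule smfI)
 fix c assume c: "c \<in> atlas R"
 show "smooth_on (img c) (%x. f (param c x) / g (param c x))"
  by (rule smooth_on_divide[OF chart_open(2)[OF c] smf_chart'[OF f c] smf_chart'[OF g c] nz])
qed

lemma laplace_loc: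
 assumes c: "c \<in> atlas R" and x: "x \<in> img c" and f: "smf f"
 shows "cLap c (loc c f) x = \<Delta> f (param c x)"
 unfolding laplace_param[OF c x f]
 by (rule elliptic_op.Lap_cong[OF elliptic_chart[OF c] chart_open(2)[OF c] x]) (simp add: loc_def)

lemma Gamma_loc:
 assumes c: "c \<in> atlas R" and x: "x \<in> img c" and f: "smf f" and g: "smf g"
 shows "cGam c (loc c f) (loc c g) x = Gamma f g (param c x)"
proof -
 have "pd i (loc c h) x = pd i (h \<circ> param c) x" for i h
  by (rule partial_deriv_cong[OF chart_open(2)[OF c] x]) (simp add: loc_def)
 then have "cGam c (loc c f) (loc c g) x = cGam c (f \<circ> param c) (g \<circ> param c) x"
  by (simp add: elliptic_op.Gam_def[OF elliptic_chart[OF c]])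
 also have "... = Gamma f g (param c x)"
  using Gamma_chart[OF c chart_inv(3)[OF c x] f g] chart_inv(1)[OF c x] by simp
 finally show ?thesis .
qed

lemma laplace_zero_outside:
 assumes c: "c \<in> atlas R" and K: "compact K" "K \<subseteq> img c" and z: "\<And>p. p \<notin> param c ` K ==> f p = 0"
  and p: "p \<notin> param c ` K"
 shows "\<Delta> f p = 0"
proof -
 have o: "open (- (param c ` K))" using compact_imp_closed[OF compact_param_image[OF c K]] by auto
 have "\<Delta> f p = \<Delta> (%x. 0) p" by (rule laplace_local[OF o]) (use p z in auto)
 then show ?thesis using laplace_const by simp
qed

lemma smf_cont_chart:
 assumes c: "c \<in> atlas R" and K: "compact K" "K \<subseteq> img c" and f: "smf f"
 shows "continuous_on K (%x. f (param c x))"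
 by (rule cont_K[OF K chart_open(2)[OF c] smf_chart'[OF f c]])

lemma green_local:
 assumes c: "c \<in> atlas R" and K: "compact K" "K \<subseteq> img c" and f: "supported c K f" and g: "smf g"
 shows "(\<integral>p. f p * \<Delta> g p \<partial>\<mu>) = - (\<integral>p. Gamma f g p \<partial>\<mu>)" "integrable \<mu> f"
proof -
 have f': "smf f" and z: "\<And>p. p \<notin> param c ` K ==> f p = 0" using f by (auto simp: supported_def)
 note lz = laplace_zero_outside[OF c K]
 show "integrable \<mu> f" by (rule chart_integral'(1)[OF c K smf_cont_chart[OF c K f'] z])
 have d: "p \<in> cdom c" if "p \<in> param c ` K" for p using that K chart_inv(3)[OF c] by auto
 have zg: "Gamma f g p = 0" if "p \<notin> param c ` K" for p
  unfolding Gamma_def using lz[OF z that] lz[of "%x. f x * g x", OF _ that] z that by simp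
 have "f p * \<Delta> g p = indicator (param c ` K) p * (f p * cLap c (g \<circ> param c) (coord c p))" for p
  using z laplace_chart[OF c d g, of p] by (cases "p \<in> param c ` K") simp_all
 moreover have "Gamma f g p = indicator (param c ` K) p * cGam c (f \<circ> param c) (g \<circ> param c) (coord c p)" for p
  using zg Gamma_chart[OF c d f' g, of p] by (cases "p \<in> param c ` K") simp_all
 ultimately show "(\<integral>p. f p * \<Delta> g p \<partial>\<mu>) = - (\<integral>p. Gamma f g p \<partial>\<mu>)" using chart_weak_form(2)[OF c K g f] by (simp only:)
qed

text \<open>The boxes of half-width r are meant to cover the manifold. The room up to 8 r keeps the
  enlarged boxes of half-width 2 r and 3 r, which carry the cut-offs and the interior estimates,
  inside the same chart.\<close>

definition patch :: "('a, 'd) chart => real^'d => real => bool" where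
 "patch c x0 r \<longleftrightarrow> c \<in> atlas R \<and> r > 0 \<and> box_nhd x0 (8 * r) \<subseteq> img c"

definition in_patch :: "'a => ('a, 'd) chart => real^'d => real => bool" where
 "in_patch p c x0 r \<longleftrightarrow> p \<in> cdom c \<and> coord c p \<in> box_nhd x0 r"

lemma patch_sub: "patch c x0 r ==> s \<le> 8 * r ==> box_nhd x0 s \<subseteq> img c"
 using box_nhd_mono unfolding patch_def by blast

text \<open>Compactness is applied to the open boxes; membership is then recorded with the closed
  ones, on which functions are integrated.\<close>

lemma finite_patches:
 "\<exists>P. finite P \<and> (\<forall>(c, x0, r)\<in>P. patch c x0 r) \<and> (\<forall>p. \<exists>(c, x0, r)\<in>P. in_patch p c x0 r)"
proof -
 have "\<exists>c x0 r. patch c x0 r \<and> p \<in> cdom c \<and> coord c p \<in> box_open x0 r" for p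
 proof -
  obtain c where c: "c \<in> atlas R" "p \<in> cdom c" using chart_ex by blast
  obtain r where r: "r > 0" "box_nhd (coord c p) r \<subseteq> img c"
   using open_contains_box_nhd[OF chart_open(2)[OF c(1)] chart_inv(4)[OF c]] by blast
  have "patch c (coord c p) (r / 8)" using r c by (simp add: patch_def)
  moreover have "coord c p \<in> box_open (coord c p) (r / 8)" using r by simp
  ultimately show ?thesis using c by blast
 qed
 then have "\<forall>p. \<exists>t. case t of (c, x0, r) => patch c x0 r \<and> p \<in> cdom c \<and> coord c p \<in> box_open x0 r" by auto
 from choice[OF this] obtain T where T: "\<And>p. case T p of (c, x0, r) => patch c x0 r \<and> p \<in> cdom c \<and> coord c p \<in> box_open x0 r"
  by blast
 define O' where "O' = (%p. case T p of (c, x0, r) => cdom c \<inter> coord c -` box_open x0 r)"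
 have op: "open (O' p)" for p
 proof -
  obtain c x0 r where t: "T p = (c, x0, r)" by (cases "T p") auto
  then have "c \<in> atlas R" using T[of p] by (simp add: patch_def)
  then show ?thesis using continuous_open_preimage[OF chart_cont(1) chart_open(1) open_box_open] t by (simp add: O'_def)
 qed
 have pO: "p \<in> O' p" for p using T[of p] by (cases "T p") (auto simp: O'_def)
 obtain Q where Q: "finite Q" "UNIV \<subseteq> (\<Union>p\<in>Q. O' p)"
  using compactE_image[OF cpt, of UNIV O'] op pO by (metis UNIV_I UN_I subsetI)
 show ?thesis
 proof (intro exI[of _ "T ` Q"] conjI allI)
  show "\<forall>(c, x0, r)\<in>T ` Q. patch c x0 r" using T by (fastforce split: prod.splits)
  fix p
  obtain q where q: "q \<in> Q" "p \<in> O' q" using Q by blast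
  obtain c x0 r where t: "T q = (c, x0, r)" by (cases "T q") auto
  then have "in_patch p c x0 r" using q(2) box_open_sub(1) by (auto simp: O'_def in_patch_def)
  then show "\<exists>(c, x0, r)\<in>T ` Q. in_patch p c x0 r" using q(1) t by (metis (mono_tags, lifting) case_prodI image_eqI)
 qed (use Q in simp)
qed

definition patches :: "(('a, 'd) chart \<times> (real^'d) \<times> real) set" where
 "patches = (SOME P. finite P \<and> (\<forall>(c, x0, r)\<in>P. patch c x0 r) \<and> (\<forall>p. \<exists>(c, x0, r)\<in>P. in_patch p c x0 r))"

lemma patches: "finite patches" "\<forall>(c, x0, r)\<in>patches. patch c x0 r" "\<forall>p. \<exists>(c, x0, r)\<in>patches. in_patch p c x0 r"
 using someI_ex[OF finite_patches] unfolding patches_def[symmetric] by blast+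

text \<open>The pieces are \<open>b\<^sub>t f / \<Sum>b\<^sub>t\<close> for cut-off functions \<open>b\<^sub>t\<close> of the patches.\<close>

lemma smf_decompose:
 assumes f: "smf f"
 shows "\<exists>(P :: (('a, 'd) chart \<times> (real^'d) \<times> real) set) F. finite P \<and> f = (%p. \<Sum>t\<in>P. F t p) \<and>
  (\<forall>t\<in>P. \<exists>c K. c \<in> atlas R \<and> compact K \<and> K \<subseteq> img c \<and> supported c K (F t))"
proof -
 define P where "P = patches"
 note P = patches[folded P_def]
 define b where "b = (%(c, x0, r). lift c (cutoff x0 r 1))"
 have bs: "\<exists>c K. c \<in> atlas R \<and> compact K \<and> K \<subseteq> img c \<and> supported c K (b t)" if "t \<in> P" for t
 proof -
  obtain c x0 r where t: "t = (c, x0, r)" by (cases t) auto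
  have pt: "patch c x0 r" using P(2) that t by blast
  then have c: "c \<in> atlas R" and r: "r > 0" by (simp_all add: patch_def)
  have K: "compact (box_nhd x0 (2 * r))" "box_nhd x0 (2 * r) \<subseteq> img c" using patch_sub[OF pt, of "2 * r"] r by auto
  have cz: "cutoff x0 r 1 x = 0" if "x \<notin> box_nhd x0 (2 * r)" for x using cutoff_eq_0[of r x x0 1] that r by simp
  have "smf (b t)" unfolding t b_def prod.case
   by (rule smf_lift[OF c smooth_on_subset[OF smooth_on_cutoff subset_UNIV] K cz])
  moreover have "b t p = 0" if "p \<notin> param c ` box_nhd x0 (2 * r)" for p
   unfolding t b_def prod.case by (rule lift_outside[OF c cz that])
  ultimately show ?thesis using c K by (intro exI[of _ c] exI[of _ "box_nhd x0 (2 * r)"]) (simp add: supported_def)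
 qed
 have bn: "b t p \<ge> 0" for t p by (cases t) (auto simp: b_def lift_def cutoff_bounds)
 define s where "s = (%p. \<Sum>t\<in>P. b t p)"
 have sp: "s p > 0" for p
 proof -
  obtain c x0 r where t: "(c, x0, r) \<in> P" "in_patch p c x0 r" using P(3) by blast
  have "r > 0" using P(2) t(1) by (auto simp: patch_def)
  then have "b (c, x0, r) p = 1" using t(2) cutoff_eq_1[of r "coord c p" x0 1] by (simp add: b_def lift_def in_patch_def)
  moreover have "b (c, x0, r) p \<le> s p" unfolding s_def by (rule member_le_sum[OF t(1)]) (use bn P in auto)
  ultimately show ?thesis by simp
 qed
 have "smf (b t)" if "t \<in> P" for t using bs[OF that] by (auto simp: supported_def)
 then have "smf (%p. f p / s p)" unfolding s_def
  by (intro smf_divide[OF f smf_sum]) (use less_imp_neq[OF sp] in \<open>auto simp: s_def\<close>)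
 then have sf: "supported c K (%p. b t p * (f p / s p))" if "supported c K (b t)" for c K t
  using that smf_mult[of "b t" "%p. f p / s p"] by (simp add: supported_def)
 have "(\<Sum>t\<in>P. b t p * (f p / s p)) = f p" for p
  unfolding sum_distrib_right[symmetric] using sp[of p] by (simp add: s_def)
 moreover have "\<exists>c K. c \<in> atlas R \<and> compact K \<and> K \<subseteq> img c \<and> supported c K (%p. b t p * (f p / s p))" if "t \<in> P" for t
  using bs[OF that] sf by blast
 ultimately show ?thesis using P(1) by (intro exI[of _ P] exI[of _ "%t p. b t p * (f p / s p)"]) simp
qed

lemma smf_integrable: assumes f: "smf f" shows "integrable \<mu> f"
proof -
 from smf_decompose[OF f] obtain P :: "(('a, 'd) chart \<times> (real^'d) \<times> real) set" and F where P: "finite P" "f = (%p. \<Sum>t\<in>P. F t p)"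
  "\<forall>t\<in>P. \<exists>c K. c \<in> atlas R \<and> compact K \<and> K \<subseteq> img c \<and> supported c K (F t)" by (elim exE conjE)
 have "integrable \<mu> (F t)" if "t \<in> P" for t
  using bspec[OF P(3) that] by (elim exE conjE) (rule green_local(2)[OF _ _ _ _ smf_const])
 then show ?thesis unfolding P(2) by (rule Bochner_Integration.integrable_sum)
qed

text \<open>\<open>Gamma\<close> is linear in its first argument, so the decomposition of f into
  pieces supported in single charts reduces the claim to \<open>green_local\<close>, without any
  condition on g beyond smoothness.\<close>

lemma green: assumes f: "smf f" and g: "smf g" shows "(\<integral>p. f p * \<Delta> g p \<partial>\<mu>) = - (\<integral>p. Gamma f g p \<partial>\<mu>)"
proof -
 from smf_decompose[OF f] obtain P :: "(('a, 'd) chart \<times> (real^'d) \<times> real) set" and F where P: "finite P" "f = (%p. \<Sum>t\<in>P. F t p)"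
  "\<forall>t\<in>P. \<exists>c K. c \<in> atlas R \<and> compact K \<and> K \<subseteq> img c \<and> supported c K (F t)" by (elim exE conjE)
 have F: "smf (F t)" if "t \<in> P" for t using bspec[OF P(3) that] by (auto simp: supported_def)
 have G: "Gamma f g p = (\<Sum>t\<in>P. Gamma (F t) g p)" for p
 proof -
  have "\<Delta> (%x. (\<Sum>t\<in>P. F t x) * g x) p = (\<Sum>t\<in>P. \<Delta> (%x. F t x * g x) p)"
   unfolding sum_distrib_right by (rule laplace_sum) (use F g smf_mult in blast)
  moreover have "\<Delta> (%x. \<Sum>t\<in>P. F t x) p = (\<Sum>t\<in>P. \<Delta> (F t) p)" by (rule laplace_sum) (use F in blast)
  ultimately show ?thesis
   unfolding P(2) Gamma_def sum_divide_distrib[symmetric] sum_subtractf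
   by (simp add: sum_distrib_left sum_distrib_right)
 qed
 have "(\<integral>p. f p * \<Delta> g p \<partial>\<mu>) = (\<integral>p. (\<Sum>t\<in>P. F t p * \<Delta> g p) \<partial>\<mu>)"
  unfolding P(2) by (simp add: sum_distrib_right)
 also have "... = (\<Sum>t\<in>P. \<integral>p. F t p * \<Delta> g p \<partial>\<mu>)"
  by (rule Bochner_Integration.integral_sum, rule smf_integrable, rule smf_mult) (use F smf_laplace[OF g] in auto)
 also have "... = (\<Sum>t\<in>P. - (\<integral>p. Gamma (F t) g p \<partial>\<mu>))"
 proof (intro sum.cong refl)
  fix t assume "t \<in> P"
  from bspec[OF P(3) this] show "(\<integral>p. F t p * \<Delta> g p \<partial>\<mu>) = - (\<integral>p. Gamma (F t) g p \<partial>\<mu>)"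
   by (elim exE conjE) (rule green_local(1)[OF _ _ _ _ g])
 qed
 also have "... = - (\<integral>p. (\<Sum>t\<in>P. Gamma (F t) g p) \<partial>\<mu>)"
  unfolding sum_negf
  by (subst Bochner_Integration.integral_sum, rule smf_integrable, rule smf_Gamma) (use F g in auto)
 finally show ?thesis unfolding G .
qed

lemma green_sym: assumes "smf f" "smf g" shows "(\<integral>p. f p * \<Delta> g p \<partial>\<mu>) = (\<integral>p. \<Delta> f p * g p \<partial>\<mu>)"
 using green[OF assms] green[OF assms(2,1)] Gamma_sym[of f g] by (simp add: mult.commute)

lemma finite_measure_mu: "finite_measure \<mu>"
proof
 have "integrable \<mu> (%p. 1 :: real)" by (rule smf_integrable[OF smf_const])
 then show "emeasure \<mu> (space \<mu>) \<noteq> \<infinity>"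
  by (simp add: integrable_iff_bounded less_top)
qed

lemma continuous_integrable:
 assumes f: "continuous_on UNIV f" shows "integrable \<mu> (f :: 'a => real)"
proof -
 interpret finite_measure \<mu> by (rule finite_measure_mu)
 obtain B where "B > 0" "\<forall>x\<in>UNIV. \<bar>f x\<bar> \<le> B" using compact_continuous_bound[OF cpt f] by (elim exE conjE)
 then show ?thesis
  using borel_measurable_continuous_onI[OF f] by (intro integrable_const_bound[of _ B]) (auto simp: measurable_cong_sets[OF sets_mu refl])
qed

lemma continuous_pos_integral:
 assumes f: "continuous_on UNIV (f :: 'a => real)" "\<And>x. f x \<ge> 0" "f x0 > 0"
 shows "(\<integral>x. f x \<partial>\<mu>) > 0"
proof -
 obtain c where c: "c \<in> atlas R" "x0 \<in> cdom c" using chart_ex by blast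
 define y0 where "y0 = coord c x0"
 obtain r where r: "r > 0" "box_nhd y0 r \<subseteq> img c"
  using open_contains_box_nhd[OF chart_open(2)[OF c(1)] chart_inv(4)[OF c]] unfolding y0_def by blast
 have K: "compact (box_nhd y0 r)" "box_nhd y0 r \<subseteq> img c" using r by auto
 have fc: "continuous_on (box_nhd y0 r) (%x. f (param c x))"
  by (rule continuous_on_compose2[OF f(1) continuous_on_subset[OF chart_cont(2)[OF c(1)] K(2)]]) simp
 have ci: "continuous_on (box_nhd y0 r) (%x. dens c x * f (param c x))"
  by (rule continuous_on_mult[OF cont_K[OF K chart_open(2)[OF c(1)] elliptic_op.sm_w[OF elliptic_chart[OF c(1)]]] fc])
 note dp = elliptic_op.w_pos[OF elliptic_chart[OF c(1)]]
 have "0 < cint (box_nhd y0 r) (%x. dens c x * f (param c x))"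
 proof (rule cint_pos[OF K(1) open_box_open[of y0 r] _ _ ci])
  show "y0 \<in> box_open y0 r" using r by simp
  show "0 \<le> dens c x * f (param c x)" if "x \<in> box_nhd y0 r" for x using dp[of x] that K f(2) by (auto intro!: mult_nonneg_nonneg simp: less_imp_le subset_iff)
  have "y0 \<in> img c" using chart_inv(4)[OF c] by (simp add: y0_def)
  then show "0 < dens c y0 * f (param c y0)" using dp[of y0] f(3) chart_inv(2)[OF c] by (simp add: y0_def)
 qed (use box_open_sub in blast)
 also have "... = (\<integral>p. indicator (param c ` box_nhd y0 r) p * f (param c (coord c p)) \<partial>\<mu>)"
  by (rule chart_integral(2)[OF c(1) K fc, symmetric])
 also have "... \<le> (\<integral>p. f p \<partial>\<mu>)"
 proof (rule integral_mono[OF chart_integral(1)[OF c(1) K fc] continuous_integrable[OF f(1)]])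
  fix p
  show "indicator (param c ` box_nhd y0 r) p * f (param c (coord c p)) \<le> f p"
  proof (cases "p \<in> param c ` box_nhd y0 r")
   case True
   then have "p \<in> cdom c" using K chart_inv(3)[OF c(1)] by auto
   then show ?thesis using True chart_inv(2)[OF c(1)] by simp
  qed (use f in simp)
 qed
 finally show ?thesis .
qed

text \<open>The volume charges every neighbourhood of a point, so a nonzero value of a continuous
  function gives a positive integral of its modulus. This turns almost everywhere identities into
  pointwise ones.\<close>

lemma continuous_AE_0:
 assumes f: "continuous_on UNIV (f :: 'a => real)" and ae: "AE x in \<mu>. f x = 0"
 shows "f x = 0"
proof (rule ccontr)
 assume "f x \<noteq> 0"
 then have "(\<integral>x. \<bar>f x\<bar> \<partial>\<mu>) > 0" by (intro continuous_pos_integral[of _ x] continuous_intros f) auto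
 moreover have "(\<integral>x. \<bar>f x\<bar> \<partial>\<mu>) = 0" by (rule integral_eq_zero_AE) (use ae in auto)
 ultimately show False by simp
qed

end

subsection \<open>Spectral expansion\<close>

lemma integrable_mult_L2:
 fixes f g :: "'a => real"
 assumes [measurable]: "f \<in> borel_measurable M" "g \<in> borel_measurable M"
  and f: "integrable M (%x. (f x)\<^sup>2)" and g: "integrable M (%x. (g x)\<^sup>2)"
 shows "integrable M (%x. f x * g x)"
proof (rule Bochner_Integration.integrable_bound)
 show "integrable M (%x. (f x)\<^sup>2 + (g x)\<^sup>2)" using f g by simp
 have "\<bar>f x * g x\<bar> \<le> (f x)\<^sup>2 + (g x)\<^sup>2" for x
  using sum_squares_bound[of "\<bar>f x\<bar>" "\<bar>g x\<bar>"] abs_ge_zero[of "f x * g x"]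
  unfolding abs_mult power2_abs by linarith
 then show "AE x in M. norm (f x * g x) \<le> norm ((f x)\<^sup>2 + (g x)\<^sup>2)" by simp
qed measurable

lemma integral_cauchy_schwarz:
 fixes f g :: "'a => real"
 assumes [measurable]: "f \<in> borel_measurable M" "g \<in> borel_measurable M"
  and f: "integrable M (%x. (f x)\<^sup>2)" and g: "integrable M (%x. (g x)\<^sup>2)"
 shows "(\<integral>x. f x * g x \<partial>M)\<^sup>2 \<le> (\<integral>x. (f x)\<^sup>2 \<partial>M) * (\<integral>x. (g x)\<^sup>2 \<partial>M)"
proof -
 define a where "a = (\<integral>x. (f x)\<^sup>2 \<partial>M)"
 define b where "b = (\<integral>x. f x * g x \<partial>M)"
 define c where "c = (\<integral>x. (g x)\<^sup>2 \<partial>M)"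
 have fg: "integrable M (%x. f x * g x)" by (rule integrable_mult_L2) (use f g in measurable)
 have q: "0 \<le> a * t\<^sup>2 + 2 * b * t + c" for t
 proof -
  have "0 \<le> (\<integral>x. (t * f x + g x)\<^sup>2 \<partial>M)" by simp
  also have "... = (\<integral>x. t\<^sup>2 * (f x)\<^sup>2 + 2 * t * (f x * g x) + (g x)\<^sup>2 \<partial>M)"
   by (rule Bochner_Integration.integral_cong) (auto simp: power2_sum power_mult_distrib algebra_simps)
  also have "... = t\<^sup>2 * a + 2 * t * b + c"
   using f g fg by (simp add: a_def b_def c_def)
  also have "... = a * t\<^sup>2 + 2 * b * t + c" by (simp add: algebra_simps)
  finally show ?thesis .
 qed
 have "b\<^sup>2 \<le> a * c"
 proof (cases "a = 0")
  case True
  have "b = 0"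
  proof (rule ccontr)
   assume "b \<noteq> 0"
   then show False using q[of "- (c + 1) / (2 * b)"] True by (simp add: field_simps)
  qed
  then show ?thesis using True by simp
 next
  case False
  then have a: "a > 0" using q unfolding a_def by (simp add: less_le)
  have "0 \<le> a * (a * (- b / a)\<^sup>2 + 2 * b * (- b / a) + c)" using q[of "- b / a"] a by (intro mult_nonneg_nonneg) auto
  also have "... = a * c - b\<^sup>2" using a by (simp add: field_simps power2_eq_square)
  finally show ?thesis by simp
 qed
 then show ?thesis by (simp add: a_def b_def c_def)
qed

locale spectral_space = riem_space R \<mu> for R :: "('a::metric_space, 'd::finite) riem" and \<mu> :: "'a measure" +
 fixes \<psi> :: "nat => 'a => real" and ev :: "nat => real"
 assumes eb: "laplace_eigenbasis R \<mu> \<psi> ev"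
begin

abbreviation "contM \<equiv> continuous_on (UNIV :: 'a set)"

lemma smf_psi: "smf (\<psi> j)" and laplace_psi: "\<Delta> (\<psi> j) x = ev j * \<psi> j x"
 and psi_orth: "(\<integral>x. \<psi> i x * \<psi> j x \<partial>\<mu>) = (if i = j then 1 else 0)"
 using eb unfolding laplace_eigenbasis_def by blast+

lemma psi_complete:
 assumes "f \<in> borel_measurable \<mu>" "integrable \<mu> (%x. (f x)\<^sup>2)" "\<And>j. (\<integral>x. f x * \<psi> j x \<partial>\<mu>) = 0"
 shows "AE x in \<mu>. f x = 0"
 using eb assms unfolding laplace_eigenbasis_def by blast

lemma cont_psi: "contM (\<psi> j)" by (rule smf_continuous[OF smf_psi])

lemma cont_meas: "contM f ==> f \<in> borel_measurable \<mu>" for f :: "'a => real"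
 using borel_measurable_continuous_onI by (simp add: measurable_cong_sets[OF sets_mu refl])

lemma cont_int: "contM f ==> integrable \<mu> f" for f :: "'a => real" by (rule continuous_integrable)

definition cf :: "('a => real) => nat => real" where "cf f i = (\<integral>x. f x * \<psi> i x \<partial>\<mu>)"

definition psum :: "(nat => real) => nat => 'a => real" where "psum a n x = (\<Sum>i<n. a i * \<psi> i x)"

lemma cont_psum: "contM (psum a n)" unfolding psum_def by (intro continuous_intros cont_psi)

lemma integral_mult_psum:
 assumes f: "contM f" shows "(\<integral>x. f x * psum a n x \<partial>\<mu>) = (\<Sum>i<n. a i * cf f i)"
proof -
 have "(\<integral>x. f x * psum a n x \<partial>\<mu>) = (\<integral>x. (\<Sum>i<n. a i * (f x * \<psi> i x)) \<partial>\<mu>)"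
  by (simp add: psum_def sum_distrib_left mult_ac)
 also have "... = (\<Sum>i<n. \<integral>x. a i * (f x * \<psi> i x) \<partial>\<mu>)"
  by (rule Bochner_Integration.integral_sum) (intro cont_int continuous_intros f cont_psi)
 finally show ?thesis by (simp add: cf_def)
qed

lemma cf_psum: "cf (psum a n) j = (if j < n then a j else 0)"
proof -
 have "cf (psum a n) j = (\<integral>x. \<psi> j x * psum a n x \<partial>\<mu>)" by (simp add: cf_def mult.commute)
 also have "... = (\<Sum>i<n. a i * (if i = j then 1 else 0))"
  unfolding integral_mult_psum[OF cont_psi] cf_def psi_orth by (intro sum.cong) auto
 also have "... = (if j < n then a j else 0)"
  by (simp add: if_distrib[where f="%z. _ * z"] cong: if_cong)
 finally show ?thesis .
qed

lemma psum_diff_sq: "n \<le> m ==> (\<integral>x. (psum a m x - psum a n x)\<^sup>2 \<partial>\<mu>) = (\<Sum>i\<in>{n..<m}. (a i)\<^sup>2)"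
proof -
 assume nm: "n \<le> m"
 define b where "b = (%i. if i < n then 0 else a i)"
 have d: "psum a m x - psum a n x = psum b m x" for x
 proof -
  have "{..<m} = {..<n} \<union> {n..<m}" "{..<n} \<inter> {n..<m} = {}" using nm by auto
  then have "(\<Sum>i<m. h i) = (\<Sum>i<n. h i) + (\<Sum>i\<in>{n..<m}. h i)" for h :: "nat => real"
   using sum.union_disjoint[of "{..<n}" "{n..<m}" h] by simp
  then show ?thesis by (simp add: psum_def b_def)
 qed
 have "(\<integral>x. (psum a m x - psum a n x)\<^sup>2 \<partial>\<mu>) = (\<integral>x. psum b m x * psum b m x \<partial>\<mu>)" unfolding d by (simp add: power2_eq_square)
 also have "... = (\<Sum>i<m. b i * b i)" unfolding integral_mult_psum[OF cont_psum] cf_psum by simp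
 also have "... = (\<Sum>i\<in>{n..<m}. (a i)\<^sup>2)"
  by (rule sum.mono_neutral_cong_right) (auto simp: b_def power2_eq_square)
 finally show ?thesis .
qed

lemma bessel_id:
 assumes f: "contM f"
 shows "(\<integral>x. (f x - psum (cf f) n x)\<^sup>2 \<partial>\<mu>) = (\<integral>x. (f x)\<^sup>2 \<partial>\<mu>) - (\<Sum>i<n. (cf f i)\<^sup>2)"
proof -
 let ?S = "psum (cf f) n"
 have "(\<integral>x. (f x - ?S x)\<^sup>2 \<partial>\<mu>) = (\<integral>x. (f x)\<^sup>2 - 2 * (f x * ?S x) + (?S x - psum (cf f) 0 x)\<^sup>2 \<partial>\<mu>)"
  by (rule Bochner_Integration.integral_cong) (auto simp: power2_diff psum_def[of _ 0] algebra_simps)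
 also have "... = (\<integral>x. (f x)\<^sup>2 - 2 * (f x * ?S x) \<partial>\<mu>) + (\<integral>x. (?S x - psum (cf f) 0 x)\<^sup>2 \<partial>\<mu>)"
  by (intro Bochner_Integration.integral_add cont_int continuous_intros f cont_psum)
 also have "(\<integral>x. (f x)\<^sup>2 - 2 * (f x * ?S x) \<partial>\<mu>) = (\<integral>x. (f x)\<^sup>2 \<partial>\<mu>) - (\<integral>x. 2 * (f x * ?S x) \<partial>\<mu>)"
  by (intro Bochner_Integration.integral_diff cont_int continuous_intros f cont_psum)
 also have "(\<integral>x. 2 * (f x * ?S x) \<partial>\<mu>) = 2 * (\<Sum>i<n. (cf f i)\<^sup>2)"
  unfolding Bochner_Integration.integral_mult_right_zero integral_mult_psum[OF f] by (simp add: power2_eq_square)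
 also have "(\<integral>x. (?S x - psum (cf f) 0 x)\<^sup>2 \<partial>\<mu>) = (\<Sum>i<n. (cf f i)\<^sup>2)"
  unfolding psum_diff_sq[OF le0] by (simp add: atLeast0LessThan)
 finally show ?thesis by simp
qed

lemma bessel: assumes f: "contM f" shows "summable (%i. (cf f i)\<^sup>2)"
proof (rule summableI_nonneg_bounded)
 fix n
 have "0 \<le> (\<integral>x. (f x - psum (cf f) n x)\<^sup>2 \<partial>\<mu>)" by simp
 then show "(\<Sum>i<n. (cf f i)\<^sup>2) \<le> (\<integral>x. (f x)\<^sup>2 \<partial>\<mu>)" unfolding bessel_id[OF f] by simp
qed simp

text \<open>The partial sums are Cauchy in \<open>L\<^sub>2\<close>; their almost everywhere limit along a subsequence has the
 same coefficients as \<open>f\<close>, hence equals \<open>f\<close> by completeness of the system.\<close>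

lemma parseval:
 assumes f: "contM f"
 shows "(%i. (cf f i)\<^sup>2) sums (\<integral>x. (f x)\<^sup>2 \<partial>\<mu>)"
proof -
 define a where "a = cf f"
 define S where "S = psum a"
 define A where "A = (\<Sum>i. (a i)\<^sup>2)"
 have sa: "summable (%i. (a i)\<^sup>2)" unfolding a_def by (rule bessel[OF f])
 define V where "V = (\<integral>x. 1 \<partial>\<mu>) + (1::real)"
 have V: "V > 0" unfolding V_def by (simp add: add_nonneg_pos)
 define tail where "tail = (%n. A - (\<Sum>i<n. (a i)\<^sup>2))"
 have tail0: "tail \<longlonglongrightarrow> 0"
 proof -
  have "tail \<longlonglongrightarrow> A - A" unfolding tail_def A_def
   by (intro tendsto_diff tendsto_const summable_LIMSEQ sa)
  then show ?thesis by simp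
 qed
 have dS: "(\<integral>x. (S i x - S n x)\<^sup>2 \<partial>\<mu>) \<le> tail n" if "n \<le> i" for n i
 proof -
  have "(\<Sum>k<i. (a k)\<^sup>2) \<le> A" unfolding A_def by (rule sum_le_suminf[OF sa]) auto
  moreover have "{..<i} = {..<n} \<union> {n..<i}" "{..<n} \<inter> {n..<i} = {}" using that by auto
  then have "(\<Sum>k<i. (a k)\<^sup>2) = (\<Sum>k<n. (a k)\<^sup>2) + (\<Sum>k\<in>{n..<i}. (a k)\<^sup>2)"
   using sum.union_disjoint[of "{..<n}" "{n..<i}" "%k. (a k)\<^sup>2"] by simp
  ultimately show ?thesis unfolding S_def psum_diff_sq[OF that] tail_def by linarith
 qed
 have Sc: "contM (S n)" for n unfolding S_def by (rule cont_psum)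
 have Sm [measurable]: "S n \<in> borel_measurable \<mu>" for n by (rule cont_meas[OF Sc])
 \<comment> \<open>Cauchy-Schwarz against the constant 1 passes from mean square to mean
   convergence, for which an almost everywhere Cauchy subsequence is available. The volume is
   enlarged by 1 in V to have a positive constant to divide by.\<close>
 have L1: "(\<integral>x. norm (S i x - S j x) \<partial>\<mu>)\<^sup>2 \<le> V * (\<integral>x. (S i x - S j x)\<^sup>2 \<partial>\<mu>)" for i j
 proof -
  have "(\<integral>x. \<bar>S i x - S j x\<bar> * 1 \<partial>\<mu>)\<^sup>2 \<le> (\<integral>x. \<bar>S i x - S j x\<bar>\<^sup>2 \<partial>\<mu>) * (\<integral>x. (1::real)\<^sup>2 \<partial>\<mu>)"
   by (rule integral_cauchy_schwarz) (intro cont_meas cont_int continuous_intros Sc)+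
  also have "... \<le> (\<integral>x. \<bar>S i x - S j x\<bar>\<^sup>2 \<partial>\<mu>) * V" by (rule mult_left_mono) (simp_all add: V_def)
  finally show ?thesis by (simp add: mult.commute)
 qed
 have cau: "\<exists>N. \<forall>i\<ge>N. \<forall>j\<ge>N. (\<integral>x. norm (S i x - S j x) \<partial>\<mu>) < e" if e: "e > 0" for e
 proof -
  have "eventually (%n. tail n < e\<^sup>2 / (V * 4)) sequentially"
   using order_tendstoD(2)[OF tail0, of "e\<^sup>2 / (V * 4)"] e V by simp
  then obtain N where N: "tail N < e\<^sup>2 / (V * 4)" using eventually_sequentially by auto
  have h: "(\<integral>x. norm (S i x - S N x) \<partial>\<mu>) < e / 2" if "i \<ge> N" for i
  proof (rule power_less_imp_less_base[of _ 2])
   have "(\<integral>x. norm (S i x - S N x) \<partial>\<mu>)\<^sup>2 \<le> V * tail N"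
    using L1[of i N] mult_left_mono[OF dS[OF that], of V] V by linarith
   also have "... < V * (e\<^sup>2 / (V * 4))" by (rule mult_strict_left_mono[OF N V])
   also have "... = (e / 2)\<^sup>2" using V by (simp add: power_divide)
   finally show "(\<integral>x. norm (S i x - S N x) \<partial>\<mu>)\<^sup>2 < (e / 2)\<^sup>2" .
  qed (use e in simp)
  have "(\<integral>x. norm (S i x - S j x) \<partial>\<mu>) < e" if "i \<ge> N" "j \<ge> N" for i j
  proof -
   have "(\<integral>x. norm (S i x - S j x) \<partial>\<mu>) \<le> (\<integral>x. norm (S i x - S N x) + norm (S j x - S N x) \<partial>\<mu>)"
   proof (rule integral_mono)
    show "integrable \<mu> (%x. norm (S i x - S j x))" "integrable \<mu> (%x. norm (S i x - S N x) + norm (S j x - S N x))"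
     by (intro cont_int continuous_intros Sc)+
   qed simp
   also have "... = (\<integral>x. norm (S i x - S N x) \<partial>\<mu>) + (\<integral>x. norm (S j x - S N x) \<partial>\<mu>)"
    by (intro Bochner_Integration.integral_add cont_int continuous_intros Sc)
   finally show ?thesis using h[OF that(1)] h[OF that(2)] by linarith
  qed
  then show ?thesis by blast
 qed
 obtain r where r: "strict_mono r" "AE x in \<mu>. Cauchy (%i. S (r i) x)"
  using cauchy_L1_AE_cauchy_subseq[of \<mu> S, OF cont_int[OF Sc] cau] by auto
 define g where "g = (%x. lim (%i. S (r i) x))"
 have gm [measurable]: "g \<in> borel_measurable \<mu>" unfolding g_def by (rule borel_measurable_lim_metric) measurable
 have conv: "AE x in \<mu>. (%i. S (r i) x) \<longlonglongrightarrow> g x"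
  using r(2) by eventually_elim (simp add: g_def real_Cauchy_convergent convergent_LIMSEQ_iff[symmetric])
 \<comment> \<open>Fatou's lemma carries the bound for differences of partial sums over to the limit
   function g, which is only known to be measurable so far.\<close>
 have fat: "(\<integral>\<^sup>+x. ennreal ((g x - S n x)\<^sup>2) \<partial>\<mu>) \<le> ennreal (tail n)" for n
 proof -
  have "(\<integral>\<^sup>+x. ennreal ((g x - S n x)\<^sup>2) \<partial>\<mu>) = (\<integral>\<^sup>+x. liminf (%i. ennreal ((S (r i) x - S n x)\<^sup>2)) \<partial>\<mu>)"
  proof (rule nn_integral_cong_AE)
   show "AE x in \<mu>. ennreal ((g x - S n x)\<^sup>2) = liminf (%i. ennreal ((S (r i) x - S n x)\<^sup>2))"
    using conv
   proof eventually_elim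
    case (elim x)
    have "(%i. ennreal ((S (r i) x - S n x)\<^sup>2)) \<longlonglongrightarrow> ennreal ((g x - S n x)\<^sup>2)"
     by (intro tendsto_intros elim)
    then show ?case using lim_imp_Liminf[OF sequentially_bot] by metis
   qed
  qed
  also have "... \<le> liminf (%i. \<integral>\<^sup>+x. ennreal ((S (r i) x - S n x)\<^sup>2) \<partial>\<mu>)"
   by (rule nn_integral_liminf) measurable
  also have "... \<le> ennreal (tail n)"
  proof (rule Liminf_le[OF sequentially_bot])
   show "eventually (%i. (\<integral>\<^sup>+x. ennreal ((S (r i) x - S n x)\<^sup>2) \<partial>\<mu>) \<le> ennreal (tail n)) sequentially"
    unfolding eventually_sequentially
   proof (intro exI[of _ n] allI impI)
    fix i assume "n \<le> i"
    then have "n \<le> r i" using strict_mono_imp_increasing[OF r(1), of i] by linarith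
    have "(\<integral>\<^sup>+x. ennreal ((S (r i) x - S n x)\<^sup>2) \<partial>\<mu>) = ennreal (\<integral>x. (S (r i) x - S n x)\<^sup>2 \<partial>\<mu>)"
     by (rule nn_integral_eq_integral) (intro cont_int continuous_intros Sc, simp)
    then show "(\<integral>\<^sup>+x. ennreal ((S (r i) x - S n x)\<^sup>2) \<partial>\<mu>) \<le> ennreal (tail n)"
     using dS[OF \<open>n \<le> r i\<close>] by (simp add: ennreal_leI)
   qed
  qed
  finally show ?thesis .
 qed
 have gi: "integrable \<mu> (%x. (g x - S n x)\<^sup>2)" "(\<integral>x. (g x - S n x)\<^sup>2 \<partial>\<mu>) \<le> tail n" for n
 proof -
  have t0: "tail n \<ge> 0" using dS[of n n] by simp
  show i: "integrable \<mu> (%x. (g x - S n x)\<^sup>2)"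
   using fat[of n] by (intro integrableI_bounded) (auto simp: le_less_trans[OF _ ennreal_less_top])
  have "ennreal (\<integral>x. (g x - S n x)\<^sup>2 \<partial>\<mu>) \<le> ennreal (tail n)"
   using fat[of n] nn_integral_eq_integral[OF i] by simp
  then show "(\<integral>x. (g x - S n x)\<^sup>2 \<partial>\<mu>) \<le> tail n" using t0 by simp
 qed
 have g2: "integrable \<mu> (%x. (g x)\<^sup>2)" using gi(1)[of 0] by (simp add: S_def psum_def)
 have fm [measurable]: "f \<in> borel_measurable \<mu>" by (rule cont_meas[OF f])
 have f2: "integrable \<mu> (%x. (f x)\<^sup>2)" by (intro cont_int continuous_intros f)
 have pm [measurable]: "\<psi> j \<in> borel_measurable \<mu>" for j by (rule cont_meas[OF cont_psi])
 have p2: "integrable \<mu> (%x. (\<psi> j x)\<^sup>2)" for j by (intro cont_int continuous_intros cont_psi)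
 have gp: "integrable \<mu> (%x. g x * \<psi> j x)" for j by (rule integrable_mult_L2[OF gm pm g2 p2])
 have gpsi: "(\<integral>x. g x * \<psi> j x \<partial>\<mu>) = a j" for j
 proof -
  \<comment> \<open>For n > j the partial sum has the exact coefficient a j, so the error is a
    coefficient of g - S n and is at most the square root of the tail. The left hand side does not
    depend on n.\<close>
  have b: "((\<integral>x. g x * \<psi> j x \<partial>\<mu>) - a j)\<^sup>2 \<le> tail n" if "n > j" for n
  proof -
   have "(\<integral>x. S n x * \<psi> j x \<partial>\<mu>) = a j" using cf_psum[of a n j] that by (simp add: cf_def S_def)
   moreover have "(\<integral>x. (g x - S n x) * \<psi> j x \<partial>\<mu>) = (\<integral>x. g x * \<psi> j x \<partial>\<mu>) - (\<integral>x. S n x * \<psi> j x \<partial>\<mu>)"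
    unfolding left_diff_distrib by (intro Bochner_Integration.integral_diff gp cont_int continuous_intros Sc cont_psi)
   moreover have "(\<integral>x. (g x - S n x) * \<psi> j x \<partial>\<mu>)\<^sup>2 \<le> (\<integral>x. (g x - S n x)\<^sup>2 \<partial>\<mu>) * (\<integral>x. (\<psi> j x)\<^sup>2 \<partial>\<mu>)"
    by (rule integral_cauchy_schwarz[OF _ pm gi(1) p2]) measurable
   moreover have "(\<integral>x. (\<psi> j x)\<^sup>2 \<partial>\<mu>) = 1" using psi_orth[of j j] by (simp add: power2_eq_square)
   ultimately show ?thesis using gi(2)[of n] by simp
  qed
  have "((\<integral>x. g x * \<psi> j x \<partial>\<mu>) - a j)\<^sup>2 \<le> 0"
   by (rule tendsto_lowerbound[OF tail0]) (use eventually_mono[OF eventually_gt_at_top[of j] b] in auto)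
  then show ?thesis by simp
 qed
 have "AE x in \<mu>. f x - g x = 0"
 proof (rule psi_complete)
  show "(%x. f x - g x) \<in> borel_measurable \<mu>" by measurable
  have "integrable \<mu> (%x. (f x)\<^sup>2 - 2 * (f x * g x) + (g x)\<^sup>2)"
   using f2 g2 integrable_mult_L2[OF fm gm f2 g2] by simp
  then show "integrable \<mu> (%x. (f x - g x)\<^sup>2)" by (simp add: power2_diff algebra_simps)
  fix j
  have "(\<integral>x. (f x - g x) * \<psi> j x \<partial>\<mu>) = (\<integral>x. f x * \<psi> j x \<partial>\<mu>) - (\<integral>x. g x * \<psi> j x \<partial>\<mu>)"
   unfolding left_diff_distrib by (intro Bochner_Integration.integral_diff gp cont_int continuous_intros f cont_psi)
  then show "(\<integral>x. (f x - g x) * \<psi> j x \<partial>\<mu>) = 0" using gpsi by (simp add: a_def cf_def)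
 qed
 then have fg: "AE x in \<mu>. f x = g x" by simp
 have "(\<integral>x. (f x)\<^sup>2 \<partial>\<mu>) - (\<Sum>i<n. (a i)\<^sup>2) \<le> tail n" for n
 proof -
  have "(\<integral>x. (f x - S n x)\<^sup>2 \<partial>\<mu>) = (\<integral>x. (g x - S n x)\<^sup>2 \<partial>\<mu>)"
   by (rule integral_cong_AE) (use fg in \<open>auto elim: eventually_mono\<close>)
  then show ?thesis using gi(2)[of n] bessel_id[OF f, of n] by (simp add: S_def a_def)
 qed
 then have "(\<integral>x. (f x)\<^sup>2 \<partial>\<mu>) \<le> A" by (simp add: tail_def)
 moreover have "A \<le> (\<integral>x. (f x)\<^sup>2 \<partial>\<mu>)"
  unfolding A_def
 proof (rule suminf_le_const[OF sa])
  fix n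
  have "0 \<le> (\<integral>x. (f x - psum (cf f) n x)\<^sup>2 \<partial>\<mu>)" by simp
  then show "(\<Sum>i<n. (a i)\<^sup>2) \<le> (\<integral>x. (f x)\<^sup>2 \<partial>\<mu>)" unfolding bessel_id[OF f] a_def by simp
 qed
 ultimately have "A = (\<integral>x. (f x)\<^sup>2 \<partial>\<mu>)" by simp
 then show ?thesis using summable_sums[OF sa] by (simp add: A_def a_def)
qed

lemma cf_add: "contM f ==> contM g ==> cf (%x. f x + g x) i = cf f i + cf g i"
 unfolding cf_def distrib_right by (intro Bochner_Integration.integral_add cont_int continuous_intros cont_psi)

lemma cf_diff: "contM f ==> contM g ==> cf (%x. f x - g x) i = cf f i - cf g i"
 unfolding cf_def left_diff_distrib by (intro Bochner_Integration.integral_diff cont_int continuous_intros cont_psi)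

lemma cf_cmult: "cf (%x. k * f x) i = k * cf f i"
 unfolding cf_def by (simp add: mult.assoc)

lemma cf_sum: "(\<And>k. k \<in> I ==> contM (f k)) ==> cf (%x. \<Sum>k\<in>I. f k x) i = (\<Sum>k\<in>I. cf (f k) i)"
 unfolding cf_def sum_distrib_right by (intro Bochner_Integration.integral_sum cont_int continuous_intros cont_psi)

lemma cf_psi: "cf (\<psi> j) i = (if i = j then 1 else 0)"
 unfolding cf_def psi_orth by auto

lemma parseval2:
 assumes f: "contM f" and g: "contM g"
 shows "(%i. cf f i * cf g i) sums (\<integral>x. f x * g x \<partial>\<mu>)"
proof -
 have 1: "(%i. (cf f i + cf g i)\<^sup>2) sums (\<integral>x. (f x + g x)\<^sup>2 \<partial>\<mu>)"
  using parseval[of "%x. f x + g x"] cf_add[OF f g] f g by (simp add: continuous_on_add)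
 have 2: "(%i. (cf f i - cf g i)\<^sup>2) sums (\<integral>x. (f x - g x)\<^sup>2 \<partial>\<mu>)"
  using parseval[of "%x. f x - g x"] cf_diff[OF f g] f g by (simp add: continuous_on_diff)
 have "(%i. ((cf f i + cf g i)\<^sup>2 - (cf f i - cf g i)\<^sup>2) / 4) sums (((\<integral>x. (f x + g x)\<^sup>2 \<partial>\<mu>) - (\<integral>x. (f x - g x)\<^sup>2 \<partial>\<mu>)) / 4)"
  by (intro sums_divide sums_diff 1 2)
 moreover have "((cf f i + cf g i)\<^sup>2 - (cf f i - cf g i)\<^sup>2) / 4 = cf f i * cf g i" for i
  by (simp add: power2_sum power2_diff)
 moreover have "(\<integral>x. (f x + g x)\<^sup>2 \<partial>\<mu>) - (\<integral>x. (f x - g x)\<^sup>2 \<partial>\<mu>) = (\<integral>x. (f x + g x)\<^sup>2 - (f x - g x)\<^sup>2 \<partial>\<mu>)"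
  by (rule Bochner_Integration.integral_diff[symmetric]) (intro cont_int continuous_intros f g)+
 moreover have "(\<integral>x. (f x + g x)\<^sup>2 - (f x - g x)\<^sup>2 \<partial>\<mu>) = (\<integral>x. 4 * (f x * g x) \<partial>\<mu>)"
  by (rule Bochner_Integration.integral_cong) (auto simp: power2_sum power2_diff)
 ultimately show ?thesis by simp
qed

end

subsection \<open>Spectral and Sobolev norms\<close>

lemma quadratic_form_le:
 fixes a :: "'d::finite => 'd => real"
 shows "(\<Sum>i\<in>UNIV. \<Sum>j\<in>UNIV. a i j * v i * v j) \<le> (\<Sum>i\<in>UNIV. \<Sum>j\<in>UNIV. \<bar>a i j\<bar>) * (\<Sum>i\<in>UNIV. (v i)\<^sup>2)"
proof -
 let ?S = "\<Sum>i\<in>UNIV. (v i)\<^sup>2"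
 have S: "(v i)\<^sup>2 \<le> ?S" for i by (rule member_le_sum) auto
 have "a i j * v i * v j \<le> \<bar>a i j\<bar> * ?S" for i j
 proof -
  have "a i j * v i * v j \<le> \<bar>a i j\<bar> * (\<bar>v i\<bar> * \<bar>v j\<bar>)"
   by (simp only: abs_mult[symmetric] mult.assoc[symmetric] abs_ge_self)
  also have "\<bar>v i\<bar> * \<bar>v j\<bar> \<le> ?S" using sum_squares_bound[of "\<bar>v i\<bar>" "\<bar>v j\<bar>"] S[of i] S[of j] by simp
  finally show ?thesis by (simp add: mult_left_mono)
 qed
 then show ?thesis by (simp add: sum_distrib_right sum_mono)
qed

context spectral_space begin

lemma cf_laplace: assumes f: "smf f" shows "cf (\<Delta> f) i = ev i * cf f i"
proof -
 have "cf (\<Delta> f) i = (\<integral>x. f x * \<Delta> (\<psi> i) x \<partial>\<mu>)"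
  unfolding cf_def green_sym[OF f smf_psi] ..
 also have "... = (\<integral>x. ev i * (f x * \<psi> i x) \<partial>\<mu>)" by (simp add: laplace_psi mult_ac)
 finally show ?thesis by (simp add: cf_def)
qed

lemma ev_le_0: "ev i \<le> 0"
proof -
 have "ev i = (\<integral>x. \<psi> i x * \<Delta> (\<psi> i) x \<partial>\<mu>)"
 proof -
  have "(\<integral>x. \<psi> i x * \<Delta> (\<psi> i) x \<partial>\<mu>) = (\<integral>x. ev i * (\<psi> i x * \<psi> i x) \<partial>\<mu>)" by (simp add: laplace_psi mult_ac)
  then show ?thesis using psi_orth[of i i] by simp
 qed
 also have "... = - (\<integral>x. Gamma (\<psi> i) (\<psi> i) x \<partial>\<mu>)" by (rule green[OF smf_psi smf_psi])
 also have "... \<le> 0" using Gamma_nonneg[OF smf_psi] by (simp add: Bochner_Integration.integral_nonneg)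
 finally show ?thesis .
qed

text \<open>The eigenvalues of 1 - \<Delta>. The shift makes them at least 1, so that the spectral
  norms increase with the order.\<close>

definition mu :: "nat => real" where "mu i = 1 - ev i"

lemma mu_ge_1: "mu i \<ge> 1" using ev_le_0[of i] by (simp add: mu_def)

definition T :: "('a => real) => 'a => real" where "T f x = f x - \<Delta> f x"

lemma smf_T: "smf f ==> smf (T f)"
 unfolding T_def[abs_def] by (rule smf_diff[OF _ smf_laplace])

lemma cf_T: "smf f ==> cf (T f) i = mu i * cf f i"
 unfolding T_def[abs_def] by (simp add: cf_diff smf_continuous smf_laplace cf_laplace mu_def algebra_simps)

lemma smf_T_pow: "smf f ==> smf ((T ^^ j) f)" by (induction j) (auto intro: smf_T)

lemma cf_T_pow: "smf f ==> cf ((T ^^ j) f) i = mu i ^ j * cf f i"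
 by (induction j) (auto simp: cf_T smf_T_pow)

text \<open>The squared Sobolev norm of order j in spectral form: the quadratic form of (1 -
  \<Delta>)^j. The series converges by Parseval's identity for f and
  \<open>(T ^^ j) f\<close>.\<close>

definition H :: "nat => ('a => real) => real" where "H j f = (\<Sum>i. mu i ^ j * (cf f i)\<^sup>2)"

lemma H_sums: assumes f: "smf f" shows "(%i. mu i ^ j * (cf f i)\<^sup>2) sums (\<integral>x. (T ^^ j) f x * f x \<partial>\<mu>)"
 using parseval2[OF smf_continuous[OF smf_T_pow[OF f, of j]] smf_continuous[OF f]]
 by (simp add: cf_T_pow[OF f] power2_eq_square mult.assoc)

lemma H_summable: "smf f ==> summable (%i. mu i ^ j * (cf f i)\<^sup>2)"
 using H_sums sums_summable by blast

lemma H_term_nonneg: "mu i ^ j * (cf f i)\<^sup>2 \<ge> 0" using mu_ge_1[of i] by simp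

lemma H_nonneg: "smf f ==> H j f \<ge> 0"
 unfolding H_def by (intro suminf_nonneg H_summable H_term_nonneg)

lemma H_0: "smf f ==> H 0 f = (\<integral>x. (f x)\<^sup>2 \<partial>\<mu>)"
 unfolding H_def using sums_unique[OF H_sums[of f 0]] by (simp add: power2_eq_square)

lemma H_1: assumes f: "smf f" shows "H 1 f = (\<integral>x. (f x)\<^sup>2 + Gamma f f x \<partial>\<mu>)"
proof -
 have "H 1 f = (\<integral>x. T f x * f x \<partial>\<mu>)" unfolding H_def using sums_unique[OF H_sums[OF f, of 1]] by simp
 also have "... = (\<integral>x. (f x)\<^sup>2 - f x * \<Delta> f x \<partial>\<mu>)" by (simp add: T_def power2_eq_square algebra_simps)
 also have "... = (\<integral>x. (f x)\<^sup>2 \<partial>\<mu>) - (\<integral>x. f x * \<Delta> f x \<partial>\<mu>)"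
  by (intro Bochner_Integration.integral_diff cont_int continuous_intros smf_continuous f smf_laplace)
 also have "... = (\<integral>x. (f x)\<^sup>2 \<partial>\<mu>) + (\<integral>x. Gamma f f x \<partial>\<mu>)" by (simp add: green[OF f f])
 also have "... = (\<integral>x. (f x)\<^sup>2 + Gamma f f x \<partial>\<mu>)"
  by (intro Bochner_Integration.integral_add[symmetric] cont_int continuous_intros smf_continuous smf_Gamma f)
 finally show ?thesis .
qed

lemma H_SS: "smf f ==> H (j + 2) f = H j (T f)"
 unfolding H_def by (intro suminf_cong) (simp add: cf_T power_add power2_eq_square mult_ac)

lemma H_mono: assumes f: "smf f" and jk: "j \<le> k" shows "H j f \<le> H k f"
 unfolding H_def by (intro suminf_le H_summable f mult_right_mono power_increasing jk mu_ge_1) simp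

lemma H_laplace: assumes f: "smf f" shows "H j (\<Delta> f) \<le> H (j + 2) f"
 unfolding H_def
proof (intro suminf_le H_summable smf_laplace f)
 fix i
 have "(ev i)\<^sup>2 \<le> (mu i)\<^sup>2" using ev_le_0[of i] by (intro abs_le_square_iff[THEN iffD1]) (simp add: mu_def)
 then have "mu i ^ j * ((ev i)\<^sup>2 * (cf f i)\<^sup>2) \<le> mu i ^ j * ((mu i)\<^sup>2 * (cf f i)\<^sup>2)"
  using mu_ge_1[of i] by (intro mult_left_mono mult_right_mono) auto
 then show "mu i ^ j * (cf (\<Delta> f) i)\<^sup>2 \<le> mu i ^ (j + 2) * (cf f i)\<^sup>2"
  unfolding cf_laplace[OF f] power_mult_distrib power_add by (simp only: mult.assoc)
qed

lemma cint_le_integral: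
 assumes c: "c \<in> atlas R" and K: "compact K" "K \<subseteq> img c" and F: "contM F" "\<And>x. F x \<ge> (0::real)"
 shows "cint K (%x. dens c x * F (param c x)) \<le> (\<integral>x. F x \<partial>\<mu>)"
proof -
 have fc: "continuous_on K (%x. F (param c x))"
  by (rule continuous_on_compose2[OF F(1) continuous_on_subset[OF chart_cont(2)[OF c] K(2)]]) simp
 have "cint K (%x. dens c x * F (param c x)) = (\<integral>p. indicator (param c ` K) p * F (param c (coord c p)) \<partial>\<mu>)"
  by (rule chart_integral(2)[OF c K fc, symmetric])
 also have "... \<le> (\<integral>p. F p \<partial>\<mu>)"
 proof (rule integral_mono[OF chart_integral(1)[OF c K fc] cont_int[OF F(1)]])
  fix p
  show "indicator (param c ` K) p * F (param c (coord c p)) \<le> F p"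
  proof (cases "p \<in> param c ` K")
   case True
   then have "p \<in> cdom c" using K chart_inv(3)[OF c] by auto
   then show ?thesis using True chart_inv(2)[OF c] by simp
  qed (use F in simp)
 qed
 finally show ?thesis .
qed

lemma dens_bounds:
 assumes c: "c \<in> atlas R" and K: "compact K" "K \<subseteq> img c"
 shows "\<exists>B>0. \<forall>x\<in>K. dens c x \<le> B \<and> 1 \<le> B * dens c x"
proof -
 note E = elliptic_chart[OF c]
 note dp = elliptic_op.w_pos[OF E]
 have c1: "continuous_on K (dens c)" by (rule cont_K[OF K chart_open(2)[OF c] elliptic_op.sm_w[OF E]])
 have c2: "continuous_on K (%x. 1 / dens c x)"
  by (intro continuous_intros c1) (use dp K(2) less_irrefl in fastforce)
 from compact_continuous_bound[OF K(1) c1] obtain B1 where B1: "B1 > 0" "\<forall>x\<in>K. \<bar>dens c x\<bar> \<le> B1" by (elim exE conjE)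
 from compact_continuous_bound[OF K(1) c2] obtain B2 where B2: "B2 > 0" "\<forall>x\<in>K. \<bar>1 / dens c x\<bar> \<le> B2" by (elim exE conjE)
 have "dens c x \<le> B1 + B2 \<and> 1 \<le> (B1 + B2) * dens c x" if "x \<in> K" for x
 proof -
  have d: "dens c x > 0" using dp that K by blast
  have "dens c x \<le> B1" "1 / dens c x \<le> B2" using B1 B2 that d by force+
  then have "1 \<le> B2 * dens c x" using d by (simp add: field_simps)
  moreover have "0 \<le> B1 * dens c x" using B1 d by simp
  ultimately show ?thesis using \<open>dens c x \<le> B1\<close> B2(1) by (simp add: distrib_right)
 qed
 then show ?thesis using B1 B2 by (intro exI[of _ "B1 + B2"]) auto
qed

lemma local_bound_0:
 assumes c: "c \<in> atlas R" and K: "compact K" "K \<subseteq> img c"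
 shows "dominated smf (%f. sob 0 K (loc c f)) (H 0)"
proof -
 note o = chart_open(2)[OF c] and E = elliptic_chart[OF c]
 from dens_bounds[OF c K] obtain B where B: "B > 0" "\<forall>x\<in>K. dens c x \<le> B \<and> 1 \<le> B * dens c x" by (elim exE conjE)
 show ?thesis
 proof (rule dominatedI[of B])
  fix f assume f: "smf f"
  have "sob 0 K (loc c f) = cint K (%x. (loc c f x)\<^sup>2)" by (rule sob_0[OF K o])
  also have "... \<le> cint K (%x. B * (dens c x * (f (param c x))\<^sup>2))"
  proof (rule cint_mono[OF K(1)])
   show "continuous_on K (%x. (loc c f x)\<^sup>2)" "continuous_on K (%x. B * (dens c x * (f (param c x))\<^sup>2))"
    by (intro continuous_intros cont_K[OF K o] smooth_loc[OF c f] smf_chart'[OF f c] elliptic_op.sm_w[OF E])+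
   fix x assume x: "x \<in> K"
   have "1 * (f (param c x))\<^sup>2 \<le> B * dens c x * (f (param c x))\<^sup>2" using B(2) x by (intro mult_right_mono) auto
   then show "(loc c f x)\<^sup>2 \<le> B * (dens c x * (f (param c x))\<^sup>2)" using x K by (auto simp: loc_def mult.assoc)
  qed
  also have "... \<le> B * H 0 f"
   unfolding cint_cmult H_0[OF f] using B(1)
   by (intro mult_left_mono cint_le_integral[OF c K] continuous_intros smf_continuous f) auto
  finally show "sob 0 K (loc c f) \<le> B * H 0 f" .
 qed (use B in simp)
qed

text \<open>No regularity theory is needed at order one: \<open>H 1\<close> is the integral of f^2
  plus \<open>Gamma f f\<close>, and coercivity of the inverse metric on K bounds the coordinate
  gradient by the latter. Together with order 0 it starts the induction in steps of two.\<close>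

lemma local_bound_1:
 assumes c: "c \<in> atlas R" and K: "compact K" "K \<subseteq> img c"
 shows "dominated smf (%f. sob 1 K (loc c f)) (H 1)"
proof -
 note o = chart_open(2)[OF c] and E = elliptic_chart[OF c]
 from dens_bounds[OF c K] obtain B where B: "B > 0" "\<forall>x\<in>K. dens c x \<le> B \<and> 1 \<le> B * dens c x" by (elim exE conjE)
 from elliptic_op.coercive[OF E K] obtain c0 where c0: "c0 > 0"
  and co: "\<forall>x\<in>K. \<forall>v :: 'd => real. c0 * (\<Sum>i\<in>UNIV. (v i)\<^sup>2) \<le> dens c x * (\<Sum>i\<in>UNIV. \<Sum>j\<in>UNIV. ginv c i j x * v i * v j)"
  by (elim exE conjE)
 define D where "D = B + 1 / c0"
 have D: "D > 0" using B c0 by (simp add: D_def add_pos_pos)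
 show ?thesis
 proof (rule dominatedI[of D])
  fix f assume f: "smf f"
  have "sob 1 K (loc c f) \<le> cint K (%x. D * (dens c x * ((f (param c x))\<^sup>2 + Gamma f f (param c x))))"
   unfolding sob_def
  proof (rule cint_mono[OF K(1)])
   show "continuous_on K (sjet 1 1 (loc c f))" by (rule sjet_cont_K[OF K o smooth_loc[OF c f]])
   show "continuous_on K (%x. D * (dens c x * ((f (param c x))\<^sup>2 + Gamma f f (param c x))))"
    by (intro continuous_intros cont_K[OF K o] smf_chart'[OF f c] smf_chart'[OF smf_Gamma[OF f f] c] elliptic_op.sm_w[OF E])
   fix x assume x: "x \<in> K"
   then have xi: "x \<in> img c" using K by blast
   have d: "dens c x > 0" by (rule elliptic_op.w_pos[OF E xi])
   have G: "Gamma f f (param c x) \<ge> 0" by (rule Gamma_nonneg[OF f])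
   have "c0 * (\<Sum>i\<in>UNIV. (pd i (loc c f) x)\<^sup>2) \<le> dens c x * Gamma f f (param c x)"
    using co[rule_format, OF x, of "%i. pd i (loc c f) x"] Gamma_loc[OF c xi f f]
    by (simp add: elliptic_op.Gam_def[OF E])
   then have 1: "(\<Sum>i\<in>UNIV. (pd i (loc c f) x)\<^sup>2) \<le> 1 / c0 * (dens c x * Gamma f f (param c x))"
    using c0 by (simp add: field_simps)
   have "1 * (f (param c x))\<^sup>2 \<le> B * dens c x * (f (param c x))\<^sup>2" using B(2) x by (intro mult_right_mono) auto
   then have 2: "(loc c f x)\<^sup>2 \<le> B * (dens c x * (f (param c x))\<^sup>2)" using xi by (auto simp: loc_def mult.assoc)
   have 3: "0 \<le> B * (dens c x * Gamma f f (param c x))" "0 \<le> 1 / c0 * (dens c x * (f (param c x))\<^sup>2)"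
    using B(1) c0 d G by auto
   have "sjet 1 1 (loc c f) x = (loc c f x)\<^sup>2 + (\<Sum>i\<in>UNIV. (pd i (loc c f) x)\<^sup>2)" by simp
   also have "... \<le> D * (dens c x * ((f (param c x))\<^sup>2 + Gamma f f (param c x)))"
    using 1 2 3 unfolding D_def distrib_left distrib_right by linarith
   finally show "sjet 1 1 (loc c f) x \<le> D * (dens c x * ((f (param c x))\<^sup>2 + Gamma f f (param c x)))" .
  qed
  also have "... \<le> D * H 1 f"
   unfolding cint_cmult H_1[OF f] using D Gamma_nonneg[OF f]
   by (intro mult_left_mono cint_le_integral[OF c K] continuous_intros smf_continuous smf_Gamma f) auto
  finally show "sob 1 K (loc c f) \<le> D * H 1 f" .
 qed (use D in simp)
qed

text \<open>The interior estimate trades two orders of differentiation for one Laplacian.\<close>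

lemma local_bound:
 assumes c: "c \<in> atlas R" and st: "0 < s" "s < t" "box_nhd x0 t \<subseteq> img c"
 shows "dominated smf (%f. sob j (box_nhd x0 s) (loc c f)) (H j)"
 using st
proof (induction j arbitrary: s t rule: less_induct)
 case (less j)
 note c' = c
 have K: "compact (box_nhd x0 s)" "box_nhd x0 s \<subseteq> img c" using less.prems box_nhd_mono[of s t x0] by auto
 consider "j = 0" | "j = 1" | n where "j = n + 2" by (cases j; cases "j - 1") auto
 then show ?case
 proof cases
  case 1 then show ?thesis using local_bound_0[OF c K] by simp
 next
  case 2 then show ?thesis using local_bound_1[OF c K] by simp
 next
  case (3 n)
  note o = chart_open(2)[OF c] and E = elliptic_chart[OF c]
  \<comment> \<open>Intermediate radii s < s1 < s2 < t: the cut-off is 1 up to s1 and vanishes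
    beyond s2, and between s2 and t there is room left for the induction hypothesis.\<close>
  define s1 where "s1 = s + (t - s) / 4"
  define s2 where "s2 = s + (t - s) / 2"
  have ss: "0 < s1" "s < s1" "s1 < s2" "0 < s2" "s2 < t" using less.prems(1,2) by (simp_all add: s1_def s2_def field_simps)
  define h where "h = s2 - s1"
  define \<eta> where "\<eta> = cutoff x0 h (s1 / h)"
  have h: "h > 0" "s1 / h * h = s1" "(s1 / h + 1) * h = s2" using ss by (auto simp: h_def field_simps)
  have K': "compact (box_nhd x0 s2)" "box_nhd x0 s2 \<subseteq> img c" using less.prems ss box_nhd_mono[of s2 t x0] by auto
  let ?L = "%f. sob n (box_nhd x0 s2) (cLap c f)" and ?M = "sob (n + 1) (box_nhd x0 s2)"
  have I: "dominated (smooth_on (img c)) (%f. sob (n + 2) (box_nhd x0 s) f) (%f. ?L f + ?M f)"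
  proof (rule elliptic_op.interior_estimate[OF E K' K(1), of "box_open x0 s1" \<eta>])
   show "box_nhd x0 s \<subseteq> box_open x0 s1" using ss box_open_sub(2) by blast
   show "box_open x0 s1 \<subseteq> box_nhd x0 s2" using box_open_sub(1)[of x0 s1] box_nhd_mono[of s1 s2 x0] ss by auto
   show "smooth_on UNIV \<eta>" unfolding \<eta>_def by (rule smooth_on_cutoff)
   show "\<eta> x = 1" if "x \<in> box_open x0 s1" for x
    unfolding \<eta>_def using that box_open_sub(1)[of x0 s1] h by (intro cutoff_eq_1) auto
   show "\<eta> x = 0" if "x \<notin> box_nhd x0 s2" for x
    unfolding \<eta>_def using that h by (intro cutoff_eq_0) auto
  qed simp
  have IH: "dominated smf (%f. sob i (box_nhd x0 s2) (loc c f)) (H i)" if "i < j" for i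
   by (rule less.IH[OF that]) (use ss less.prems in auto)
  have eq: "?L (loc c f) = sob n (box_nhd x0 s2) (loc c (\<Delta> f))" if "smf f" for f
   by (rule sob_cong[OF K' o]) (simp add: laplace_loc[OF c _ that] loc_def)
  have "dominated smf (%f. sob n (box_nhd x0 s2) (loc c (\<Delta> f))) (H j)"
   unfolding 3 by (rule dominated_trans_le[OF dominated_comp[where \<phi>=\<Delta>, OF IH smf_laplace] H_laplace]) (simp_all add: 3)
  then have 1: "dominated smf (%f. ?L (loc c f)) (H j)" by (rule dominated_le_trans[OF eq_refl[OF eq], rotated])
  have 2: "dominated smf (%f. ?M (loc c f)) (H j)"
   by (rule dominated_trans_le[OF IH H_mono]) (simp_all add: 3)
  show ?thesis
   unfolding 3 by (rule dominated_trans[OF dominated_comp[where \<phi>="loc c", OF I smooth_loc[OF c]] dominated_add[OF 1 2, unfolded 3]])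
 qed
qed

lemma zero_outside_T:
 assumes c: "c \<in> atlas R" and K: "compact K" "K \<subseteq> img c" and z: "\<And>p. p \<notin> param c ` K ==> f p = 0"
  and p: "p \<notin> param c ` K"
 shows "T f p = 0"
 unfolding T_def using z[OF p] laplace_zero_outside[OF c K z p] by simp

text \<open>The converse comparison, for functions supported in one chart. Here no elliptic estimate
  is involved: T = 1 - \<Delta> preserves the support and costs two orders in coordinates, while
  \<open>H_SS\<close> trades T for two spectral orders, down to the orders 0 and 1.\<close>

lemma spectral_le_sob:
 assumes c: "c \<in> atlas R" and K: "compact K" "K \<subseteq> img c"
 shows "dominated (supported c K) (H j) (%f. sob j K (loc c f))"
proof (induction j rule: less_induct)
 case (less j)
 note o = chart_open(2)[OF c] and E = elliptic_chart[OF c]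
 from dens_bounds[OF c K] obtain B where B: "B > 0" "\<forall>x\<in>K. dens c x \<le> B \<and> 1 \<le> B * dens c x" by (elim exE conjE)
 have lf: "loc c f x = f (param c x)" if "x \<in> K" for x f using that K by (auto simp: loc_def)
 consider "j = 0" | "j = 1" | n where "j = n + 2" by (cases j; cases "j - 1") auto
 then show ?case
 proof cases
  case 1
  show ?thesis
  proof (rule dominatedI[of B])
   fix f assume "supported c K f"
   then have f: "smf f" and z: "\<forall>p. p \<notin> param c ` K --> f p = 0" by (auto simp: supported_def)
   have "H 0 f = cint K (%x. dens c x * (f (param c x))\<^sup>2)"
    unfolding H_0[OF f]
    by (rule chart_integral'(2)[OF c K]) (use z in \<open>auto intro!: continuous_intros smf_cont_chart[OF c K f]\<close>)
   also have "... \<le> cint K (%x. B * (loc c f x)\<^sup>2)"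
   proof (rule cint_mono[OF K(1)])
    fix x assume x: "x \<in> K"
    show "dens c x * (f (param c x))\<^sup>2 \<le> B * (loc c f x)\<^sup>2"
     unfolding lf[OF x] using B(2) x by (intro mult_right_mono) auto
   qed (intro continuous_intros cont_K[OF K o] smooth_loc[OF c f] smf_chart'[OF f c] elliptic_op.sm_w[OF E])+
   finally show "H j f \<le> B * sob j K (loc c f)" unfolding 1 sob_0[OF K o] cint_cmult .
  qed (use B in simp)
 next
  case 2
  define A where "A = (%x. \<Sum>i\<in>UNIV. \<Sum>j\<in>UNIV. \<bar>ginv c i j x\<bar>)"
  have "continuous_on K A" unfolding A_def by (intro continuous_intros cont_K[OF K o] elliptic_op.sm_a[OF E])
  from compact_continuous_bound[OF K(1) this] obtain M where M: "M > 0" "\<forall>x\<in>K. \<bar>A x\<bar> \<le> M" by (elim exE conjE)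
  define D where "D = B * (1 + M)"
  have D: "D > 0" using B M by (simp add: D_def)
  show ?thesis
  proof (rule dominatedI[of D])
   fix f assume "supported c K f"
   then have f: "smf f" and z: "\<forall>p. p \<notin> param c ` K --> f p = 0" by (auto simp: supported_def)
   have zG: "Gamma f f p = 0" if "p \<notin> param c ` K" for p
    unfolding Gamma_def using laplace_zero_outside[OF c K z[rule_format] that] laplace_zero_outside[OF c K _ that, of "%x. f x * f x"] z that by simp
   have "H 1 f = cint K (%x. dens c x * ((f (param c x))\<^sup>2 + Gamma f f (param c x)))"
    unfolding H_1[OF f]
    by (rule chart_integral'(2)[OF c K]) (use z zG in \<open>auto intro!: continuous_intros smf_cont_chart[OF c K f] smf_cont_chart[OF c K smf_Gamma[OF f f]]\<close>)
   also have "... \<le> cint K (%x. D * sjet 1 1 (loc c f) x)"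
   proof (rule cint_mono[OF K(1)])
    fix x assume x: "x \<in> K"
    then have xi: "x \<in> img c" using K by blast
    define p where "p = (%i. pd i (loc c f) x)"
    define S where "S = (\<Sum>i\<in>UNIV. (p i)\<^sup>2)"
    have "Gamma f f (param c x) = (\<Sum>i\<in>UNIV. \<Sum>j\<in>UNIV. ginv c i j x * p i * p j)"
     unfolding Gamma_loc[OF c xi f f, symmetric] elliptic_op.Gam_def[OF E] p_def ..
    also have "... \<le> A x * S" unfolding A_def S_def by (rule quadratic_form_le)
    also have "... \<le> M * S"
    proof -
     have "A x \<le> M" using bspec[OF M(2) x] by linarith
     moreover have "S \<ge> 0" unfolding S_def by (intro sum_nonneg) simp
     ultimately show ?thesis by (rule mult_right_mono)
    qed
    finally have G: "Gamma f f (param c x) \<le> M * S" .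
    have sj: "sjet 1 1 (loc c f) x = (f (param c x))\<^sup>2 + S" using lf[OF x] by (simp add: S_def p_def)
    have S0: "S \<ge> 0" unfolding S_def by (intro sum_nonneg) simp
    have "dens c x * ((f (param c x))\<^sup>2 + Gamma f f (param c x)) \<le> B * ((f (param c x))\<^sup>2 + M * S)"
     using B x G Gamma_nonneg[OF f] elliptic_op.w_pos[OF E xi] by (intro mult_mono) auto
    also have "... \<le> B * ((1 + M) * ((f (param c x))\<^sup>2 + S))"
     using B(1) M(1) S0 by (intro mult_left_mono) (auto simp: algebra_simps)
    finally show "dens c x * ((f (param c x))\<^sup>2 + Gamma f f (param c x)) \<le> D * sjet 1 1 (loc c f) x"
     unfolding sj D_def by (simp add: mult.assoc)
   qed (intro continuous_intros cont_K[OF K o] sjet_cont_K[OF K o] smooth_loc[OF c f] smf_chart'[OF f c] smf_chart'[OF smf_Gamma[OF f f] c] elliptic_op.sm_w[OF E])+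
   finally show "H j f \<le> D * sob j K (loc c f)" unfolding 2 sob_def cint_cmult .
  qed (use D in simp)
 next
  case (3 n)
  have sm: "smooth_on (img c) (loc c f)" "smooth_on (img c) (cLap c (loc c f))" if "supported c K f" for f
   using that smooth_loc[OF c, of f] elliptic_op.smooth_Lap[OF E] by (auto simp: supported_def)
  have N: "dominated (supported c K) (%f. sob n K (%x. - 1 * cLap c (loc c f) x)) (%f. sob (n + 2) K (loc c f))"
   by (rule dominated_trans[OF dominated_comp[where \<phi>="%f. cLap c (loc c f)", OF sob_mult[OF K o smooth_on_const] sm(2)]
    dominated_comp[where \<phi>="loc c", OF elliptic_op.sob_Lap[OF E K] sm(1)]])
  have "dominated (supported c K) (%f. sob n K (%x. loc c f x + - 1 * cLap c (loc c f) x)) (%f. sob (n + 2) K (loc c f))"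
  proof (rule dominated_sob_add[OF K o sm(1) _ _ N])
   show "smooth_on (img c) (%x. - 1 * cLap c (loc c f) x)" if "supported c K f" for f
    by (intro smooth_on_mult[OF o] smooth_on_const sm that)
   show "dominated (supported c K) (%f. sob n K (loc c f)) (%f. sob (n + 2) K (loc c f))"
    by (intro dominated_le sob_mono[OF K o] sm) auto
  qed
  then have TL: "dominated (supported c K) (%f. sob n K (loc c (T f))) (%f. sob (n + 2) K (loc c f))"
  proof (rule dominated_le_trans[rotated])
   fix f assume "supported c K f"
   then show "sob n K (loc c (T f)) \<le> sob n K (%x. loc c f x + - 1 * cLap c (loc c f) x)"
    by (intro eq_refl sob_cong[OF K o]) (auto simp: laplace_loc[OF c] loc_def T_def supported_def)
  qed
  have "dominated (supported c K) (%f. H n (T f)) (%f. sob n K (loc c (T f)))"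
  proof (rule dominated_comp[where \<phi>=T, OF less.IH])
   show "supported c K (T f)" if "supported c K f" for f
    using that zero_outside_T[OF c K, of f] smf_T[of f] by (auto simp: supported_def)
  qed (simp add: 3)
  then have "dominated (supported c K) (%f. H n (T f)) (%f. sob (n + 2) K (loc c f))" by (rule dominated_trans[OF _ TL])
  then show ?thesis unfolding 3 by (rule dominated_le_trans[rotated]) (simp add: H_SS[symmetric] supported_def)
 qed
qed

end

subsection \<open>Riemannian distance and coordinates\<close>

text \<open>The covector p is G u for u = G^(-1) p, so its pairing with v is the G-inner product of
  u and v: the inverse matrix gives the dual norm.\<close>

lemma posdef_cauchy_schwarz:
 fixes G :: "real^'d^'d::finite"
 assumes G: "posdef G"
 shows "\<bar>p \<bullet> v\<bar> \<le> sqrt (p \<bullet> (matrix_inv G *v p)) * sqrt (v \<bullet> (G *v v))"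
proof -
 define u where "u = matrix_inv G *v p"
 have Gu: "G *v u = p" unfolding u_def using matrix_inv_mult[OF posdef_invertible[OF G]] by (simp add: matrix_vector_mul_assoc)
 have sy: "a \<bullet> (G *v b) = (G *v a) \<bullet> b" for a b
  using G dot_lmul_matrix[of a G b] by (metis posdef_def transpose_matrix_vector)
 have psd: "a \<bullet> (G *v a) \<ge> 0" for a using G by (cases "a = 0") (auto simp: posdef_def less_imp_le)
 define A where "A = u \<bullet> (G *v u)"
 define B where "B = p \<bullet> v"
 define C where "C = v \<bullet> (G *v v)"
 have q: "0 \<le> A + 2 * t * B + t\<^sup>2 * C" for t
 proof -
  have "0 \<le> (u + t *\<^sub>R v) \<bullet> (G *v (u + t *\<^sub>R v))" by (rule psd)
  also have "... = A + t * (u \<bullet> (G *v v)) + t * (v \<bullet> (G *v u)) + t\<^sup>2 * C"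
   by (simp add: A_def C_def matrix_vector_right_distrib matrix_vector_mult_scaleR inner_add_left inner_add_right power2_eq_square algebra_simps)
  also have "u \<bullet> (G *v v) = B" using sy[of u v] by (simp add: Gu B_def)
  also have "v \<bullet> (G *v u) = B" by (simp add: Gu B_def inner_commute)
  finally show ?thesis by (simp add: algebra_simps)
 qed
 have "B\<^sup>2 \<le> A * C"
 proof (cases "v = 0")
  case False
  then have C: "C > 0" using G by (simp add: C_def posdef_def)
  have "0 \<le> C * (A + 2 * (- B / C) * B + (- B / C)\<^sup>2 * C)" using q[of "- B / C"] C by (intro mult_nonneg_nonneg) auto
  also have "... = A * C - B\<^sup>2" using C by (simp add: field_simps power2_eq_square)
  finally show ?thesis by simp
 qed (simp add: B_def C_def)
 then have "sqrt (B\<^sup>2) \<le> sqrt (A * C)" by (rule real_sqrt_le_mono)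
 moreover have "A = p \<bullet> (matrix_inv G *v p)" by (simp add: A_def Gu u_def[symmetric] inner_commute)
 ultimately show ?thesis by (simp add: B_def C_def real_sqrt_mult)
qed

context riem_space begin

lemma Gamma_grad:
 assumes c: "c \<in> atlas R" "p \<in> cdom c" and f: "smf f"
 shows "Gamma f f p = (\<chi> i. pd i (f \<circ> param c) (coord c p)) \<bullet>
  (matrix_inv (gram R c (coord c p)) *v (\<chi> i. pd i (f \<circ> param c) (coord c p)))"
 unfolding Gamma_chart[OF c f f] elliptic_op.Gam_def[OF elliptic_chart[OF c(1)]] inner_matrix_sum ginv_def by simp

lemma trans_metric:
 assumes c: "c \<in> atlas R" and c': "c' \<in> atlas R" and p: "p \<in> cdom c" "p \<in> cdom c'"
 defines "v' \<equiv> %v. frechet_derivative (trans c c') (at (coord c p)) v"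
 shows "v \<bullet> (gram R c (coord c p) *v v) = v' v \<bullet> (gram R c' (coord c' p) *v v' v)"
proof -
 define J where "J = jacobian (trans c c') (at (coord c p))"
 have lin: "linear (frechet_derivative (trans c c') (at (coord c p)))"
  using has_derivative_linear[OF trans_derivative[OF c c' p]] .
 have Jv: "J *v v = v' v" unfolding J_def jacobian_def v'_def using lin by (simp add: matrix_works linear_matrix_vector_mul_eq)
 have "v \<bullet> (gram R c (coord c p) *v v) = v \<bullet> (transpose J *v (gram R c' (coord c' p) *v (J *v v)))"
  unfolding trans_gram[OF c c' p] J_def by (simp add: matrix_vector_mul_assoc[symmetric])
 also have "... = (J *v v) \<bullet> (gram R c' (coord c' p) *v (J *v v))"
  by (metis dot_lmul_matrix inner_commute transpose_matrix_vector)
 finally show ?thesis unfolding Jv .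
qed

section \<open>Lengths of curves\<close>

context
 fixes a b :: real and \<gamma> :: "real => 'a"
 assumes ab: "a < b" and arc: "C1_arc R a b \<gamma>"
begin

lemma arc_cont: "continuous_on {a..b} \<gamma>" using arc by (simp add: C1_arc_def)

lemma arc_deriv:
 assumes c: "c \<in> atlas R" and t: "t \<in> {a..b}" "\<gamma> t \<in> cdom c"
 shows "((coord c \<circ> \<gamma>) has_vector_derivative vector_derivative (coord c \<circ> \<gamma>) (at t within {a..b})) (at t within {a..b})"
proof -
 obtain D where "((coord c \<circ> \<gamma>) has_vector_derivative D t) (at t within {a..b})"
  using arc c t unfolding C1_arc_def by blast
 then show ?thesis using vector_derivative_works differentiableI_vector by blast
qed

lemma arc_deriv_cont:
 assumes c: "c \<in> atlas R"
 shows "continuous_on {t\<in>{a..b}. \<gamma> t \<in> cdom c} (%t. vector_derivative (coord c \<circ> \<gamma>) (at t within {a..b}))"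
proof -
 obtain D where D: "continuous_on {t\<in>{a..b}. \<gamma> t \<in> cdom c} D"
  "\<forall>t\<in>{t\<in>{a..b}. \<gamma> t \<in> cdom c}. ((coord c \<circ> \<gamma>) has_vector_derivative D t) (at t within {a..b})"
  using arc c unfolding C1_arc_def by blast
 have "vector_derivative (coord c \<circ> \<gamma>) (at t within {a..b}) = D t" if "t \<in> {t\<in>{a..b}. \<gamma> t \<in> cdom c}" for t
 proof -
  have "((coord c \<circ> \<gamma>) has_vector_derivative D t) (at t within cbox a b)" using D(2) that by auto
  then show ?thesis using vector_derivative_within_cbox[OF ab, of t "coord c \<circ> \<gamma>" "D t"] that by auto
 qed
 then show ?thesis by (intro iffD2[OF continuous_on_cong[OF refl] D(1)])
qed

lemma arc_near:
 assumes c: "c \<in> atlas R" and t: "t \<in> {a..b}" "\<gamma> t \<in> cdom c"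
 shows "\<exists>e>0. \<forall>s\<in>{a..b}. dist s t < e --> \<gamma> s \<in> cdom c"
proof -
 obtain r where r: "r > 0" "ball (\<gamma> t) r \<subseteq> cdom c" using open_contains_ball chart_open(1)[OF c] t by blast
 obtain e where "e > 0" "\<forall>s\<in>{a..b}. dist s t < e --> dist (\<gamma> s) (\<gamma> t) < r"
  using arc_cont t r unfolding continuous_on_iff by metis
 then show ?thesis using r(2) by (intro exI[of _ e]) (auto simp: dist_commute)
qed

text \<open>The open set W allows the composed function to be given by the chart formula only near
  the point; this covers both a change of chart and a globally defined function.\<close>

lemma arc_chain:
 fixes g :: "real^'d => 'b::real_normed_vector"
 assumes c: "c \<in> atlas R" and t: "t \<in> {a..b}" "\<gamma> t \<in> cdom c"
  and g: "(g has_derivative g') (at (coord c (\<gamma> t)))"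
  and h: "\<And>s. s \<in> {a..b} ==> \<gamma> s \<in> cdom c ==> \<gamma> s \<in> W ==> h s = g (coord c (\<gamma> s))" and W: "open W" "\<gamma> t \<in> W"
 shows "(h has_vector_derivative g' (vector_derivative (coord c \<circ> \<gamma>) (at t within {a..b}))) (at t within {a..b})"
proof -
 have "((g \<circ> (coord c \<circ> \<gamma>)) has_vector_derivative g' (vector_derivative (coord c \<circ> \<gamma>) (at t within {a..b}))) (at t within {a..b})"
  by (rule vector_derivative_diff_chain_within[OF arc_deriv[OF c t]]) (use g has_derivative_at_withinI in force)
 moreover obtain e where e: "e > 0" "\<forall>s\<in>{a..b}. dist s t < e --> \<gamma> s \<in> cdom c" using arc_near[OF c t] by (elim exE conjE)
 moreover obtain r where r: "r > 0" "ball (\<gamma> t) r \<subseteq> W" using open_contains_ball W by blast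
 moreover obtain e' where e': "e' > 0" "\<forall>s\<in>{a..b}. dist s t < e' --> dist (\<gamma> s) (\<gamma> t) < r"
  using arc_cont t r unfolding continuous_on_iff by metis
 have eq: "(g \<circ> (coord c \<circ> \<gamma>)) s = h s" if "s \<in> {a..b}" "dist s t < min e e'" for s
  using h[OF that(1)] e e' that r(2) by (auto simp: dist_commute subset_iff)
 ultimately show ?thesis
  unfolding has_vector_derivative_def
  using has_derivative_transform_within[of "g \<circ> (coord c \<circ> \<gamma>)" _ t "{a..b}" "min e e'" h] t(1) e e' by simp
qed

lemma speed_chart:
 assumes c: "c \<in> atlas R" and t: "t \<in> {a..b}" "\<gamma> t \<in> cdom c"
 shows "speed R a b \<gamma> t = (let v = vector_derivative (coord c \<circ> \<gamma>) (at t within {a..b}) in sqrt (v \<bullet> (gram R c (coord c (\<gamma> t)) *v v)))"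
proof -
 let ?c = "chart_at R (\<gamma> t)"
 let ?v = "vector_derivative (coord c \<circ> \<gamma>) (at t within {a..b})"
 note c' = chart_at_in[of "\<gamma> t"]
 have "((coord ?c \<circ> \<gamma>) has_vector_derivative frechet_derivative (trans c ?c) (at (coord c (\<gamma> t))) ?v) (at t within {a..b})"
  by (rule arc_chain[OF c t trans_derivative[OF c c'(1) t(2) c'(2)], where W="cdom ?c"])
   (use chart_inv(2)[OF c] chart_open(1)[OF c'(1)] c'(2) in \<open>auto simp: trans_def\<close>)
 then have "vector_derivative (coord ?c \<circ> \<gamma>) (at t within {a..b}) = frechet_derivative (trans c ?c) (at (coord c (\<gamma> t))) ?v"
  using vector_derivative_within_cbox[OF ab, of t "coord ?c \<circ> \<gamma>"] t(1) by simp
 then show ?thesis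
  unfolding speed_def Let_def using trans_metric[OF c c'(1) t(2) c'(2), of ?v] by simp
qed

text \<open>\<open>speed\<close> uses a chart selected anew at every parameter, so continuity cannot
  be read off. Near a given t the chart chosen at t is kept fixed, and \<open>speed_chart\<close>
  shows that the value is the same.\<close>

lemma speed_continuous: "continuous_on {a..b} (speed R a b \<gamma>)"
 unfolding continuous_on_eq_continuous_within
proof
 fix t assume t: "t \<in> {a..b}"
 let ?c = "chart_at R (\<gamma> t)"
 note c = chart_at_in[of "\<gamma> t"]
 define V where "V = {s\<in>{a..b}. \<gamma> s \<in> cdom ?c}"
 define v where "v = (%s. vector_derivative (coord ?c \<circ> \<gamma>) (at s within {a..b}))"
 have gc: "continuous_on (img ?c) (gram R ?c)" by (rule smooth_on_continuous[OF chart_gram[OF c(1)]])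
 have vc: "continuous_on V v" unfolding V_def v_def by (rule arc_deriv_cont[OF c(1)])
 have cc: "continuous_on V (%s. coord ?c (\<gamma> s))"
  by (rule continuous_on_compose2[OF chart_cont(1)[OF c(1)] continuous_on_subset[OF arc_cont]]) (auto simp: V_def)
 have gv: "continuous_on V (%s. gram R ?c (coord ?c (\<gamma> s)))"
  by (rule continuous_on_compose2[OF gc cc]) (use chart_inv(4)[OF c(1)] in \<open>auto simp: V_def\<close>)
 have "continuous_on V (%s. sqrt (v s \<bullet> (gram R ?c (coord ?c (\<gamma> s)) *v v s)))"
  unfolding inner_matrix_sum by (intro continuous_intros gv vc)
 moreover have "speed R a b \<gamma> s = sqrt (v s \<bullet> (gram R ?c (coord ?c (\<gamma> s)) *v v s))" if "s \<in> V" for s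
  using speed_chart[OF c(1), of s] that by (simp add: V_def v_def Let_def)
 ultimately have sV: "continuous_on V (speed R a b \<gamma>)" by (simp cong: continuous_on_cong)
 have tV: "t \<in> V" using t c(2) by (simp add: V_def)
 obtain e where e: "e > 0" "\<forall>s\<in>{a..b}. dist s t < e --> \<gamma> s \<in> cdom ?c" using arc_near[OF c(1) t c(2)] by (elim exE conjE)
 have "continuous (at t within V) (speed R a b \<gamma>)" using sV tV by (simp add: continuous_on_eq_continuous_within)
 moreover have "at t within V = at t within {a..b}"
  by (rule at_within_nhd[of t "ball t e"]) (use e in \<open>auto simp: V_def dist_commute\<close>)
 ultimately show "continuous (at t within {a..b}) (speed R a b \<gamma>)" by (simp add: continuous_within)
qed

lemma speed_nonneg: "t \<in> {a..b} ==> speed R a b \<gamma> t \<ge> 0"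
 unfolding speed_def Let_def
 using chart_posdef[OF chart_at_in(1) chart_inv(4)[OF chart_at_in]]
 by (intro real_sqrt_ge_zero) (metis inner_zero_left less_imp_le order_refl posdef_def)

lemma arc_length_nonneg: "arc_length R a b \<gamma> \<ge> 0"
 unfolding arc_length_def using speed_nonneg by (intro integral_nonneg integrable_continuous_real speed_continuous)

text \<open>The derivative of F along the curve is the pairing of dF with the velocity, at most the
  norm of dF times the speed; the former is the square root of \<open>Gamma F F\<close>.\<close>

lemma arc_lipschitz:
 assumes F: "smf F" and L: "L \<ge> 0" "\<And>p. Gamma F F p \<le> L\<^sup>2"
 shows "\<bar>F (\<gamma> b) - F (\<gamma> a)\<bar> \<le> L * arc_length R a b \<gamma>"
proof -
 define d where "d = (%t. let c = chart_at R (\<gamma> t) in \<Sum>i\<in>UNIV. vector_derivative (coord c \<circ> \<gamma>) (at t within {a..b}) $ i * pd i (F \<circ> param c) (coord c (\<gamma> t)))"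
 have der: "((%t. F (\<gamma> t)) has_vector_derivative d t) (at t within {a..b})" if t: "t \<in> {a..b}" for t
 proof -
  let ?c = "chart_at R (\<gamma> t)"
  note c = chart_at_in[of "\<gamma> t"]
  have "((F \<circ> param ?c) has_derivative (%v. \<Sum>i\<in>UNIV. v $ i * pd i (F \<circ> param ?c) (coord ?c (\<gamma> t)))) (at (coord ?c (\<gamma> t)))"
   by (rule has_derivative_partial[OF smooth_on_differentiable[OF smf_chart[OF F c(1)] chart_inv(4)[OF c]]])
  from arc_chain[OF c(1) t c(2) this, where W=UNIV and h="%t. F (\<gamma> t)"] show ?thesis
   using chart_inv(2)[OF c(1)] by (simp add: d_def Let_def)
 qed
 have I: "(d has_integral (F (\<gamma> b) - F (\<gamma> a))) {a..b}"
  by (rule fundamental_theorem_of_calculus) (use ab der in auto)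
 have bd: "norm (d t) \<le> L * speed R a b \<gamma> t" if t: "t \<in> {a..b}" for t
 proof -
  let ?c = "chart_at R (\<gamma> t)"
  note c = chart_at_in[of "\<gamma> t"]
  define v where "v = vector_derivative (coord ?c \<circ> \<gamma>) (at t within {a..b})"
  define p where "p = (\<chi> i. pd i (F \<circ> param ?c) (coord ?c (\<gamma> t)))"
  have "d t = p \<bullet> v" by (simp add: d_def Let_def p_def v_def inner_vec_def mult.commute)
  then have "norm (d t) \<le> sqrt (p \<bullet> (matrix_inv (gram R ?c (coord ?c (\<gamma> t))) *v p)) * sqrt (v \<bullet> (gram R ?c (coord ?c (\<gamma> t)) *v v))"
   using posdef_cauchy_schwarz[OF chart_posdef[OF c(1) chart_inv(4)[OF c]], of p v] by simp
  also have "p \<bullet> (matrix_inv (gram R ?c (coord ?c (\<gamma> t))) *v p) = Gamma F F (\<gamma> t)"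
   unfolding p_def by (rule Gamma_grad[OF c F, symmetric])
  also have "sqrt (v \<bullet> (gram R ?c (coord ?c (\<gamma> t)) *v v)) = speed R a b \<gamma> t"
   by (simp add: speed_def Let_def v_def)
  also have "sqrt (Gamma F F (\<gamma> t)) * speed R a b \<gamma> t \<le> L * speed R a b \<gamma> t"
   using L real_sqrt_le_mono[OF L(2), of "\<gamma> t"] speed_nonneg[OF t] by (intro mult_right_mono) auto
  finally show ?thesis .
 qed
 have "norm (integral {a..b} d) \<le> integral {a..b} (%t. L * speed R a b \<gamma> t)"
  by (rule integral_norm_bound_integral[OF has_integral_integrable[OF I] _ bd])
   (intro integrable_continuous_real continuous_intros speed_continuous)
 then show ?thesis unfolding arc_length_def using integral_unique[OF I] by simp
qed

end

lemma curve_lengths_nonneg: "l \<in> curve_lengths R x y ==> l \<ge> 0"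
 unfolding curve_lengths_def using arc_length_nonneg by (auto intro!: sum_nonneg)

lemma curve_lipschitz:
 assumes l: "l \<in> curve_lengths R x y" and F: "smf F" and L: "L \<ge> 0" "\<And>p. Gamma F F p \<le> L\<^sup>2"
 shows "\<bar>F x - F y\<bar> \<le> L * l"
proof -
 obtain n :: nat and t \<gamma> where *: "l = (\<Sum>i<n. arc_length R (t i) (t (Suc i)) \<gamma>)" "\<gamma> (t 0) = x" "\<gamma> (t n) = y"
  "\<forall>i<n. t i < t (Suc i) \<and> C1_arc R (t i) (t (Suc i)) \<gamma>"
  using l unfolding curve_lengths_def by blast
 have "F y - F x = (\<Sum>i<n. F (\<gamma> (t (Suc i))) - F (\<gamma> (t i)))"
  using sum_lessThan_telescope[of "%i. F (\<gamma> (t i))" n] *(2,3) by simp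
 then have "\<bar>F x - F y\<bar> \<le> (\<Sum>i<n. \<bar>F (\<gamma> (t (Suc i))) - F (\<gamma> (t i))\<bar>)"
  using sum_abs[of "%i. F (\<gamma> (t (Suc i))) - F (\<gamma> (t i))" "{..<n}"] by (simp add: abs_minus_commute)
 also have "... \<le> (\<Sum>i<n. L * arc_length R (t i) (t (Suc i)) \<gamma>)"
  by (intro sum_mono arc_lipschitz[OF _ _ F L]) (use *(4) in auto)
 finally show ?thesis by (simp add: *(1) sum_distrib_left)
qed

text \<open>The distance of points without a joining curve is the unspecified constant \<open>Inf {}\<close>; such pairs
 are covered by the boundedness of \<open>F\<close>.\<close>

lemma smf_lipschitz:
 assumes F: "smf F"
 shows "\<exists>L>0. \<forall>x y. \<bar>F x - F y\<bar> \<le> L * dist x y"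
proof -
 from compact_continuous_bound[OF cpt smf_continuous[OF smf_Gamma[OF F F]]] obtain B where B: "B > 0" "\<forall>p\<in>UNIV. \<bar>Gamma F F p\<bar> \<le> B" by (elim exE conjE)
 from compact_continuous_bound[OF cpt smf_continuous[OF F]] obtain M where M: "M > 0" "\<forall>p\<in>UNIV. \<bar>F p\<bar> \<le> M" by (elim exE conjE)
 define L where "L = sqrt B"
 have L: "L > 0" "L\<^sup>2 = B" using B(1) by (auto simp: L_def)
 have G: "Gamma F F p \<le> L\<^sup>2" for p using B(2) L(2) by (auto simp: abs_le_iff)
 define K where "K = (if Inf ({}::real set) > 0 then 2 * M / Inf {} else 0)"
 have K: "K \<ge> 0" using M(1) by (simp add: K_def)
 have d: "dist x y = Inf (curve_lengths R x y)" for x y using mfd unfolding riemannian_manifold_def by blast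
 have "\<bar>F x - F y\<bar> \<le> (L + K) * dist x y" for x y
 proof (cases "curve_lengths R x y = {}")
  case True
  show ?thesis
  proof (cases "x = y")
   case False
   then have "dist x y > 0" by simp
   then have i: "Inf ({}::real set) > 0" using d[of x y] True by simp
   have "\<bar>F x - F y\<bar> \<le> 2 * M" using bspec[OF M(2), of x] bspec[OF M(2), of y] by simp
   also have "... = K * dist x y" using i d[of x y] True by (simp add: K_def)
   also have "... \<le> (L + K) * dist x y" using L by (intro mult_right_mono) auto
   finally show ?thesis .
  qed simp
 next
  case False
  have "\<bar>F x - F y\<bar> / L \<le> l" if "l \<in> curve_lengths R x y" for l
   using curve_lipschitz[OF that F _ G] L(1) by (simp add: field_simps)
  then have "\<bar>F x - F y\<bar> / L \<le> dist x y" unfolding d by (rule cInf_greatest[OF False])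
  then have "\<bar>F x - F y\<bar> \<le> L * dist x y" using L(1) by (simp add: field_simps)
  also have "... \<le> (L + K) * dist x y" using K by (intro mult_right_mono) auto
  finally show ?thesis .
 qed
 then show ?thesis using L K by (intro exI[of _ "L + K"]) auto
qed

text \<open>Boxes are convex, so the straight coordinate segment is an admissible curve; its speed
  is bounded through the entries of the Gram matrix on the box.\<close>

lemma dist_le_coord:
 assumes c: "c \<in> atlas R" and K: "box_nhd x0 s \<subseteq> img c"
 shows "\<exists>C>0. \<forall>x\<in>box_nhd x0 s. \<forall>y\<in>box_nhd x0 s. dist (param c x) (param c y) \<le> C * norm (x - y)"
proof -
 let ?K = "box_nhd x0 s"
 define A where "A = (%x. \<Sum>i\<in>UNIV. \<Sum>j\<in>UNIV. \<bar>gram R c x $ i $ j\<bar>)"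
 have "continuous_on ?K A" unfolding A_def
  by (intro continuous_intros continuous_on_subset[OF smooth_on_continuous[OF chart_gram[OF c]] K])
 from compact_continuous_bound[OF compact_box_nhd this] obtain B where B: "B > 0" "\<forall>x\<in>?K. \<bar>A x\<bar> \<le> B" by (elim exE conjE)
 have "dist (param c x) (param c y) \<le> sqrt B * norm (x - y)" if x: "x \<in> ?K" and y: "y \<in> ?K" for x y
 proof -
  define v where "v = y - x"
  define \<gamma> where "\<gamma> = (%t. param c (x + t *\<^sub>R v))"
  have seg: "x + t *\<^sub>R v \<in> ?K" if "t \<in> {0..1}" for t
  proof -
   have "convex ?K" by (simp add: box_nhd_cbox)
   then have "(1 - t) *\<^sub>R x + t *\<^sub>R y \<in> ?K" using x y that by (simp add: convex_alt)
   moreover have "(1 - t) *\<^sub>R x + t *\<^sub>R y = x + t *\<^sub>R v" by (simp add: v_def algebra_simps)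
   ultimately show ?thesis by simp
  qed
  have segi: "x + t *\<^sub>R v \<in> img c" if "t \<in> {0..1}" for t using seg[OF that] K by blast
  have cg: "coord c (\<gamma> t) = x + t *\<^sub>R v" "\<gamma> t \<in> cdom c" if "t \<in> {0..1}" for t
   using chart_inv[OF c] segi[OF that] by (auto simp: \<gamma>_def)
  have lin: "((%t. x + t *\<^sub>R v) has_vector_derivative v) (at t within S)" for t S
   by (auto intro!: derivative_eq_intros simp: has_vector_derivative_def)
  have gcont: "continuous_on {0..1} \<gamma>" unfolding \<gamma>_def
   by (rule continuous_on_compose2[OF chart_cont(2)[OF c]]) (use segi in \<open>auto intro!: continuous_intros\<close>)
  \<comment> \<open>A derivative is required in every chart of the atlas, not only in c; it is
    obtained by composing the segment with the transition map.\<close>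
  have C1: "C1_arc R 0 1 \<gamma>"
   unfolding C1_arc_def
  proof (intro conjI ballI gcont)
   fix c' assume c': "c' \<in> atlas R"
   let ?U = "coord c ` (cdom c \<inter> cdom c')"
   define V where "V = {t\<in>{0..1}. \<gamma> t \<in> cdom c'}"
   define D where "D = (%t. frechet_derivative (trans c c') (at (x + t *\<^sub>R v)) v)"
   have inU: "x + t *\<^sub>R v \<in> ?U" if "t \<in> V" for t using that cg[of t] by (auto simp: V_def image_iff intro!: bexI[of _ "\<gamma> t"])
   have "continuous_on V D" unfolding D_def
    by (rule continuous_on_compose2[OF smooth_on_continuous[OF smooth_on_frechet[OF smooth_trans(1)[OF c c']]]])
     (use inU in \<open>auto intro!: continuous_intros\<close>)
   moreover have "((coord c' \<circ> \<gamma>) has_vector_derivative D t) (at t within {0..1})" if t: "t \<in> V" for t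
   proof -
    have "(trans c c' has_derivative frechet_derivative (trans c c') (at (x + t *\<^sub>R v))) (at (x + t *\<^sub>R v))"
     using smooth_on_differentiable[OF smooth_trans(1)[OF c c'] inU[OF t]] by (simp only: frechet_derivative_works)
    then have "((trans c c' \<circ> (%t. x + t *\<^sub>R v)) has_vector_derivative D t) (at t within {0..1})"
     unfolding D_def by (rule vector_derivative_diff_chain_within[OF lin has_derivative_at_withinI])
    moreover have "(trans c c' \<circ> (%t. x + t *\<^sub>R v)) = coord c' \<circ> \<gamma>" by (simp add: trans_def \<gamma>_def fun_eq_iff)
    ultimately show ?thesis by simp
   qed
   ultimately show "\<exists>D. continuous_on {t \<in> {0..1}. \<gamma> t \<in> cdom c'} D \<and>
    (\<forall>t\<in>{t \<in> {0..1}. \<gamma> t \<in> cdom c'}. ((coord c' \<circ> \<gamma>) has_vector_derivative D t) (at t within {0..1}))"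
    unfolding V_def by blast
  qed
  have sp: "speed R 0 1 \<gamma> t \<le> sqrt B * norm v" if t: "t \<in> {0..1}" for t
  proof -
   have "((%t. x + t *\<^sub>R v) has_vector_derivative v) (at t within {0..1})" by (rule lin)
   then have "((coord c \<circ> \<gamma>) has_vector_derivative v) (at t within {0..1})"
    by (rule has_vector_derivative_transform[rotated -1]) (use t cg in auto)
   then have vd: "vector_derivative (coord c \<circ> \<gamma>) (at t within {0..1}) = v"
    using vector_derivative_within_cbox[of 0 1 t "coord c \<circ> \<gamma>" v] t by simp
   have "v \<bullet> (gram R c (x + t *\<^sub>R v) *v v) \<le> B * (norm v)\<^sup>2"
   proof -
    have "v \<bullet> (gram R c (x + t *\<^sub>R v) *v v) \<le> A (x + t *\<^sub>R v) * (\<Sum>i\<in>UNIV. (v $ i)\<^sup>2)"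
     unfolding inner_matrix_sum A_def by (rule quadratic_form_le)
    also have "(\<Sum>i\<in>UNIV. (v $ i)\<^sup>2) = (norm v)\<^sup>2"
     unfolding power2_norm_eq_inner by (simp add: inner_vec_def power2_eq_square)
    also have "A (x + t *\<^sub>R v) * (norm v)\<^sup>2 \<le> B * (norm v)\<^sup>2" using bspec[OF B(2) seg[OF t]] by (intro mult_right_mono) auto
    finally show ?thesis .
   qed
   then have "sqrt (v \<bullet> (gram R c (x + t *\<^sub>R v) *v v)) \<le> sqrt (B * (norm v)\<^sup>2)" by (rule real_sqrt_le_mono)
   then show ?thesis using speed_chart[OF _ C1 c t cg(2)[OF t]] by (simp add: Let_def vd cg(1)[OF t] real_sqrt_mult)
  qed
  have "arc_length R 0 1 \<gamma> \<le> integral {0..1} (%t::real. sqrt B * norm v)"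
   unfolding arc_length_def
   by (intro integral_le integrable_continuous_real speed_continuous[OF _ C1] continuous_intros sp) auto
  also have "... = sqrt B * norm v" by simp
  finally have al: "arc_length R 0 1 \<gamma> \<le> sqrt B * norm v" .
  have mem: "arc_length R 0 1 \<gamma> \<in> curve_lengths R (param c x) (param c y)"
   unfolding curve_lengths_def
   by (rule CollectI, rule exI[of _ 1], rule exI[of _ real], rule exI[of _ \<gamma>])
    (use C1 in \<open>simp add: \<gamma>_def v_def\<close>)
  have "dist (param c x) (param c y) = Inf (curve_lengths R (param c x) (param c y))"
   using mfd unfolding riemannian_manifold_def by blast
  also have "... \<le> arc_length R 0 1 \<gamma>"
   by (rule cInf_lower[OF mem]) (use curve_lengths_nonneg in \<open>auto simp: bdd_below_def\<close>)
  finally show ?thesis using al by (simp add: v_def norm_minus_commute)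
 qed
 then show ?thesis using B(1) by (intro exI[of _ "sqrt B"]) auto
qed

text \<open>Curves may leave the chart, so the bound comes from globally defined smooth functions,
  which are Lipschitz for the distance. The cut-off \<eta>1 is 1 at x and 0 outside the box of
  half-width u, hence a point closer than 1/L0 still lies in the chart; there \<eta>2 is 1, and the
  cut-off coordinate functions recover the coordinates.\<close>

lemma coord_le_dist:
 assumes c: "c \<in> atlas R" and st: "0 < s" "s < t" "box_nhd x0 t \<subseteq> img c"
 shows "\<exists>C>0. \<exists>\<delta>>0. \<forall>x\<in>box_nhd x0 s. \<forall>\<xi>. dist (param c x) \<xi> < \<delta> -->
  \<xi> \<in> cdom c \<and> coord c \<xi> \<in> box_nhd x0 t \<and> norm (x - coord c \<xi>) \<le> C * dist (param c x) \<xi>"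
proof -
 define u where "u = (s + t) / 2"
 have u: "0 < u" "s < u" "u < t" using st by (simp_all add: u_def)
 have sub: "box_nhd x0 s \<subseteq> img c" "box_nhd x0 u \<subseteq> img c"
  using st u box_nhd_mono[of s t x0] box_nhd_mono[of u t x0] by auto
 define \<eta>1 where "\<eta>1 = cutoff x0 (u - s) (s / (u - s))"
 define \<eta>2 where "\<eta>2 = cutoff x0 (t - u) (u / (t - u))"
 have h1: "u - s > 0" "s / (u - s) * (u - s) = s" "(s / (u - s) + 1) * (u - s) = u" using u by (simp_all add: field_simps)
 have h2: "t - u > 0" "u / (t - u) * (t - u) = u" "(u / (t - u) + 1) * (t - u) = t" using u by (simp_all add: field_simps)
 have e1: "\<eta>1 x = 1" if "x \<in> box_nhd x0 s" for x unfolding \<eta>1_def using that h1 by (intro cutoff_eq_1) auto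
 have e1': "\<eta>1 x = 0" if "x \<notin> box_nhd x0 u" for x unfolding \<eta>1_def using that h1 by (intro cutoff_eq_0) auto
 have e2: "\<eta>2 x = 1" if "x \<in> box_nhd x0 u" for x unfolding \<eta>2_def using that h2 by (intro cutoff_eq_1) auto
 have e2': "\<eta>2 x = 0" if "x \<notin> box_nhd x0 t" for x unfolding \<eta>2_def using that h2 by (intro cutoff_eq_0) auto
 have sm: "smooth_on (img c) \<eta>1" "smooth_on (img c) \<eta>2" unfolding \<eta>1_def \<eta>2_def by (rule smooth_on_subset[OF smooth_on_cutoff], simp)+
 have F0: "smf (lift c \<eta>1)" by (rule smf_lift[OF c sm(1) compact_box_nhd sub(2)]) (use e1' in auto)
 let ?g = "%i x. \<eta>2 x * x $ i"
 have "smooth_on (img c) (?g i)" for i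
  by (intro smooth_on_mult chart_open(2)[OF c] sm smooth_on_component smooth_on_linear bounded_linear_ident)
 then have Fi: "smf (lift c (?g i))" for i
  by (rule smf_lift[OF c _ compact_box_nhd st(3)]) (use e2' in auto)
 from smf_lipschitz[OF F0] obtain L0 where L0: "L0 > 0" "\<forall>x y. \<bar>lift c \<eta>1 x - lift c \<eta>1 y\<bar> \<le> L0 * dist x y" by (elim exE conjE)
 have "\<forall>i. \<exists>L>0. \<forall>x y. \<bar>lift c (?g i) x - lift c (?g i) y\<bar> \<le> L * dist x y"
  using smf_lipschitz[OF Fi] by simp
 from choice[OF this] obtain L where L: "\<forall>i. L i > 0 \<and> (\<forall>x y. \<bar>lift c (?g i) x - lift c (?g i) y\<bar> \<le> L i * dist x y)" ..
 show ?thesis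
 proof (rule exI[of _ "\<Sum>i\<in>UNIV. L i"], intro conjI exI[of _ "1 / L0"] ballI allI impI)
  show "(\<Sum>i\<in>UNIV. L i) > 0" using L by (intro sum_pos) auto
  show "1 / L0 > 0" using L0 by simp
  fix x \<xi> assume x: "x \<in> box_nhd x0 s" and d: "dist (param c x) \<xi> < 1 / L0"
  have xi: "x \<in> img c" using x sub by blast
  have p1: "lift c \<eta>1 (param c x) = 1" using lift_param[OF c xi, of \<eta>1] e1[OF x] by simp
  have "\<bar>1 - lift c \<eta>1 \<xi>\<bar> < 1"
   using L0(2)[rule_format, of "param c x" \<xi>] d L0(1) p1 by (simp add: field_simps)
  then have "lift c \<eta>1 \<xi> \<noteq> 0" by auto
  then have in1: "\<xi> \<in> cdom c" and in2: "coord c \<xi> \<in> box_nhd x0 u"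
   using e1' by (auto simp: lift_def split: if_splits)
  show "\<xi> \<in> cdom c" by (rule in1)
  show "coord c \<xi> \<in> box_nhd x0 t" using in2 box_nhd_mono[of u t x0] u by auto
  have xu: "x \<in> box_nhd x0 u" using x box_nhd_mono[of s u x0] u by auto
  have "\<bar>(x - coord c \<xi>) $ i\<bar> \<le> L i * dist (param c x) \<xi>" for i
  proof -
   have "lift c (?g i) (param c x) = x $ i" using lift_param[OF c xi] e2[OF xu] by simp
   moreover have "lift c (?g i) \<xi> = coord c \<xi> $ i" using in1 e2[OF in2] by (simp add: lift_def)
   moreover have "\<bar>lift c (?g i) (param c x) - lift c (?g i) \<xi>\<bar> \<le> L i * dist (param c x) \<xi>"
    using spec[OF L, of i] by simp
   ultimately show ?thesis by simp
  qed
  then have "(\<Sum>i\<in>UNIV. \<bar>(x - coord c \<xi>) $ i\<bar>) \<le> (\<Sum>i\<in>UNIV. L i * dist (param c x) \<xi>)" by (intro sum_mono)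
  then show "norm (x - coord c \<xi>) \<le> (\<Sum>i\<in>UNIV. L i) * dist (param c x) \<xi>"
   using norm_le_l1_cart[of "x - coord c \<xi>"] by (simp add: sum_distrib_right)
 qed
qed

end

subsection \<open>Functions with dense zeros\<close>

text \<open>Absorbs the intermediate orders of the Poincare inequality. Up to t0 the sum is at most
  1/2; beyond t0 every lower power is at most a constant times t^m.\<close>

lemma sum_powers_le:
 fixes C :: real
 assumes C: "C \<ge> 0"
 shows "\<exists>D>0. \<forall>t\<ge>0. C * (\<Sum>k=1..m. t ^ k) \<le> 1 / 2 + D * t ^ m"
proof -
 \<comment> \<open>Chosen so that C m t0 \<le> 1/2, with 1 added in the denominator to cover C = 0
   or m = 0.\<close>
 define t0 where "t0 = 1 / (2 * C * real m + 1)"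
 have t0: "0 < t0" "t0 \<le> 1" "C * (real m * t0) \<le> 1 / 2"
 proof -
  have "0 \<le> C * real m" using C by simp
  then show "0 < t0" "t0 \<le> 1" "C * (real m * t0) \<le> 1 / 2" by (simp_all add: t0_def divide_le_eq add_nonneg_pos mult.assoc)
 qed
 define D where "D = C * real m / t0 ^ m + 1"
 have D: "D > 0" using C t0 by (simp add: D_def add_nonneg_pos)
 have "C * (\<Sum>k=1..m. t ^ k) \<le> 1 / 2 + D * t ^ m" if t: "t \<ge> 0" for t
 proof (cases "t \<le> t0")
  case True
  have "t ^ k \<le> t0" if "k \<in> {1..m}" for k
  proof -
   have "t ^ k \<le> t ^ 1" by (rule power_decreasing) (use that t True t0 in auto)
   then show ?thesis using True by simp
  qed
  then have "(\<Sum>k=1..m. t ^ k) \<le> (\<Sum>k=1..m. t0)" by (rule sum_mono)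
  then have "C * (\<Sum>k=1..m. t ^ k) \<le> C * (real m * t0)" using C by (intro mult_left_mono) auto
  also have "... \<le> 1 / 2 + D * t ^ m" using t0(3) D t by (simp add: add_increasing2)
  finally show ?thesis .
 next
  case False
  have "t ^ k \<le> t ^ m / t0 ^ m" if k: "k \<in> {1..m}" for k
  proof -
   have "t ^ k * t0 ^ m \<le> t ^ k * t0 ^ (m - k)"
    by (intro mult_left_mono power_decreasing) (use t t0 in auto)
   also have "... \<le> t ^ k * t ^ (m - k)"
    by (intro mult_left_mono power_mono) (use t t0 False in auto)
   also have "... = t ^ m" using k by (simp add: power_add[symmetric])
   finally show ?thesis using t0 by (simp add: field_simps)
  qed
  then have "(\<Sum>k=1..m. t ^ k) \<le> (\<Sum>k=1..m. t ^ m / t0 ^ m)" by (rule sum_mono)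
  then have "C * (\<Sum>k=1..m. t ^ k) \<le> C * (real m * (t ^ m / t0 ^ m))" using C by (intro mult_left_mono) auto
  also have "... \<le> 1 / 2 + D * t ^ m" using t by (simp add: D_def field_simps)
  finally show ?thesis .
 qed
 then show ?thesis using D by blast
qed

text \<open>One constant for finitely many patches, provided that enlarging the constant weakens the
  claim. A threshold h0 can be hidden in the same constant as 1/C.\<close>

lemma uniform_constant:
 fixes A :: "real => 't => bool"
 assumes P: "finite P" and ex: "\<And>t. t \<in> P ==> \<exists>C>0. A C t"
  and mono: "\<And>C C' t. A C t ==> 0 < C ==> C \<le> C' ==> A C' t"
 shows "\<exists>C>0. \<forall>t\<in>P. A C t"
proof -
 from bchoice[of P "%t C. C > 0 \<and> A C t"] ex obtain f where f: "\<forall>t\<in>P. f t > 0 \<and> A (f t) t" by auto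
 have "f t \<le> 1 + (\<Sum>t\<in>P. f t)" if "t \<in> P" for t
  using member_le_sum[OF that _ P, of f] f by (smt (verit) DiffD1)
 moreover have "0 \<le> (\<Sum>t\<in>P. f t)" using f by (intro sum_nonneg) (auto intro: less_imp_le)
 ultimately show ?thesis using f mono by (intro exI[of _ "1 + (\<Sum>t\<in>P. f t)"]) auto
qed

context spectral_space begin

text \<open>The class for which the low order terms can be absorbed. Differences of two interpolants
  of the same data belong to it, with the density h of the data sites.\<close>

definition sampled :: "real => ('a => real) => real => bool" where
 "sampled h0 v h \<longleftrightarrow> smf v \<and> 0 < h \<and> h \<le> h0 \<and> (\<forall>p. \<exists>q. dist p q \<le> h \<and> v q = 0)"

lemma sampled_mono: "sampled h v h' ==> h \<le> h0 ==> sampled h0 v h'"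
 by (simp add: sampled_def)

lemma patchD:
 assumes "patch c x0 r"
 shows "c \<in> atlas R" "r > 0" "open (img c)" "s \<le> 8 * r ==> box_nhd x0 s \<subseteq> img c"
  "compact (box_nhd x0 (2 * r))" "box_nhd x0 (2 * r) \<subseteq> img c"
 using assms patch_sub[OF assms] chart_open(2) by (auto simp: patch_def)

lemma jet_bound:
 assumes p: "patch c x0 r"
 shows "\<exists>C>0. \<forall>k\<le>m. \<forall>f B. smf f --> compact B --> B \<subseteq> box_nhd x0 (2 * r) --> cint B (jet k (loc c f)) \<le> C * H k f"
proof -
 note c = patchD(1)[OF p] and r = patchD(2)[OF p]
 have st: "0 < 2 * r" "2 * r < 3 * r" "box_nhd x0 (3 * r) \<subseteq> img c" using r patchD(4)[OF p] by auto
 have "\<exists>C>0. \<forall>k\<in>{..m}. \<forall>f. smf f --> sob k (box_nhd x0 (2 * r)) (loc c f) \<le> C * H k f"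
  using local_bound[OF c st, unfolded dominated_def] mult_right_mono[OF _ H_nonneg]
  by (intro uniform_constant) (auto intro: order_trans)
 then obtain C where C: "C > 0" "\<forall>k\<in>{..m}. \<forall>f. smf f --> sob k (box_nhd x0 (2 * r)) (loc c f) \<le> C * H k f" by (elim exE conjE)
 have "cint B (jet k (loc c f)) \<le> C * H k f" if *: "smf f" "compact B" "B \<subseteq> box_nhd x0 (2 * r)" "k \<le> m" for k f B
 proof -
  note s = smooth_loc[OF c *(1)] and K = patchD(5,6,3)[OF p]
  have "cint B (jet k (loc c f)) \<le> cint (box_nhd x0 (2 * r)) (jet k (loc c f))"
   by (intro cint_subset_mono * K jet_cont_K[OF K] s) simp
  also have "... \<le> sob k (box_nhd x0 (2 * r)) (loc c f)" unfolding sob_def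
   by (intro cint_mono K jet_cont_K[OF K] sjet_cont_K[OF K] s jet_le_sjet) simp
  also have "... \<le> C * H k f" using C * by simp
  finally show ?thesis .
 qed
 then show ?thesis using C(1) by (intro exI[of _ C] conjI allI impI)
qed

text \<open>Zeros that are h-dense for the distance are C1 h-dense in coordinates, and none of them
  escapes from the chart once h is below the threshold of \<open>coord_le_dist\<close>. So
  \<open>averaged_poincare\<close> applies with \<rho> = C1 h.\<close>

lemma poincare_local:
 assumes m: "CARD('d) < 2 * m" and p: "patch c x0 r"
 shows "\<exists>C>0. \<exists>h0>0. \<forall>v h. sampled h0 v h -->
  cint (box_nhd x0 r) (%x. (loc c v x)\<^sup>2) \<le> C * (\<Sum>k=1..m. h ^ (2 * k) * H k v)"
proof -
 note c = patchD(1)[OF p] and r = patchD(2)[OF p]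
 have st: "0 < 2 * r" "2 * r < 3 * r" "box_nhd x0 (3 * r) \<subseteq> img c" using r patchD(4)[OF p] by auto
 from coord_le_dist[OF c st] obtain C1 \<delta> where C1: "C1 > 0" "\<delta> > 0"
  and cd: "\<forall>x\<in>box_nhd x0 (2 * r). \<forall>\<xi>. dist (param c x) \<xi> < \<delta> -->
   \<xi> \<in> cdom c \<and> coord c \<xi> \<in> box_nhd x0 (3 * r) \<and> norm (x - coord c \<xi>) \<le> C1 * dist (param c x) \<xi>" by (elim exE conjE)
 from jet_bound[OF p, of m] obtain B where B: "B > 0" and jb: "\<forall>k\<le>m. \<forall>f K. smf f --> compact K --> K \<subseteq> box_nhd x0 (2 * r) --> cint K (jet k (loc c f)) \<le> B * H k f"
  by (elim exE conjE)
 \<comment> \<open>Dominates (2 C1)^(2k) for all k \<le> m at once; the summand 1 makes the powers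
   increasing.\<close>
 define G where "G = (1 + 2 * C1) ^ (2 * m)"
 have G: "G > 0" using C1 by (simp add: G_def)
 \<comment> \<open>The first entry keeps the zeros in the chart, the second gives \<rho> \<le> r/4,
   so that the enlarged box r + 4\<rho> stays within 2 r.\<close>
 define h0 where "h0 = min (\<delta> / 2) (r / (4 * C1))"
 have h0: "h0 > 0" "h0 < \<delta>" "C1 * h0 \<le> r / 4" using C1 r by (auto simp: h0_def min_def field_simps)
 define C where "C = 3 ^ CARD('d) * (4 * real m) * (G * B)"
 have C: "C > 0" using G B m by (simp add: C_def)
 have "cint (box_nhd x0 r) (%x. (loc c v x)\<^sup>2) \<le> C * (\<Sum>k=1..m. h ^ (2 * k) * H k v)"
  if "sampled h0 v h" for v h
 proof -
  have v: "smf v" and h: "0 < h" "h \<le> h0" and z: "\<forall>p. \<exists>q. dist p q \<le> h \<and> v q = 0" using that by (auto simp: sampled_def)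
  define \<rho> where "\<rho> = C1 * h"
  have rho: "\<rho> > 0" "\<rho> \<le> r / 4" using C1 h order_trans[OF mult_left_mono[OF h(2)] h0(3)] by (auto simp: \<rho>_def)
  have sub: "box_nhd x0 (r + 4 * \<rho>) \<subseteq> box_nhd x0 (2 * r)" using rho by (intro box_nhd_mono) auto
  have ze: "\<exists>y. dist x y \<le> \<rho> \<and> loc c v y = 0" if x: "x \<in> box_nhd x0 (r + \<rho>)" for x
  proof -
   have x2: "x \<in> box_nhd x0 (2 * r)" using x box_nhd_mono[of "r + \<rho>" "2 * r" x0] rho by auto
   obtain q where q: "dist (param c x) q \<le> h" "v q = 0" using z by blast
   have "dist (param c x) q < \<delta>" using q(1) h h0 by simp
   with cd x2 have *: "q \<in> cdom c" "norm (x - coord c q) \<le> C1 * dist (param c x) q" by auto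
   have "dist x (coord c q) \<le> \<rho>" using order_trans[OF *(2) mult_left_mono[OF q(1)]] C1
    by (simp add: \<rho>_def dist_norm)
   moreover have "loc c v (coord c q) = 0" using q(2) chart_inv[OF c] *(1) by (simp add: loc_def)
   ultimately show ?thesis by blast
  qed
  have "cint (box_nhd x0 r) (%x. (loc c v x)\<^sup>2) \<le> 3 ^ CARD('d) *
   (4 * real m * (\<Sum>k=1..m. (2 * \<rho>) ^ (2 * k) * cint (box_nhd x0 (r + 4 * \<rho>)) (jet k (loc c v))))"
   by (rule averaged_poincare[OF m patchD(3)[OF p] _ smooth_loc[OF c v] rho(1) ze]) (use sub patchD(6)[OF p] in auto)
  also have "... \<le> 3 ^ CARD('d) * (4 * real m * (\<Sum>k=1..m. G * h ^ (2 * k) * (B * H k v)))"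
  proof (intro mult_left_mono sum_mono mult_mono)
   fix k assume k: "k \<in> {1..m}"
   show "cint (box_nhd x0 (r + 4 * \<rho>)) (jet k (loc c v)) \<le> B * H k v" using jb k v sub by simp
   have "(2 * \<rho>) ^ (2 * k) = (2 * C1) ^ (2 * k) * h ^ (2 * k)" by (simp add: \<rho>_def power_mult_distrib mult.assoc)
   also have "(2 * C1) ^ (2 * k) \<le> (1 + 2 * C1) ^ (2 * k)" by (rule power_mono) (use C1 in auto)
   also have "... \<le> G" unfolding G_def by (rule power_increasing) (use C1 k in auto)
   finally show "(2 * \<rho>) ^ (2 * k) \<le> G * h ^ (2 * k)" using h by simp
  qed (use G h in \<open>auto intro!: cint_nonneg\<close>)
  also have "... = C * (\<Sum>k=1..m. h ^ (2 * k) * H k v)" by (simp add: C_def sum_distrib_left mult_ac)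
  finally show ?thesis .
 qed
 then show ?thesis using C h0(1) by (intro exI[of _ C] conjI exI[of _ h0] allI impI)
qed

lemma integral_le_patches:
 fixes P :: "(('a, 'd) chart \<times> (real^'d) \<times> real) set" and F :: "'a => real"
 assumes P: "finite P" "\<forall>(c, x0, r)\<in>P. patch c x0 r" "\<forall>p. \<exists>(c, x0, r)\<in>P. in_patch p c x0 r"
  and F: "contM F" "\<And>x. F x \<ge> (0::real)"
 shows "(\<integral>x. F x \<partial>\<mu>) \<le> (\<Sum>(c, x0, r)\<in>P. cint (box_nhd x0 r) (%x. dens c x * F (param c x)))"
proof -
 define g :: "('a, 'd) chart \<times> (real^'d) \<times> real => 'a => real" where "g = (%(c, x0, r) p. indicator (param c ` box_nhd x0 r) p * F (param c (coord c p)) :: real)"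
 have g: "integrable \<mu> (g t)" "(\<integral>p. g t p \<partial>\<mu>) = (case t of (c, x0, r) => cint (box_nhd x0 r) (%x. dens c x * F (param c x)))"
  if t: "t \<in> P" for t
 proof -
  obtain c x0 r where tt: "t = (c, x0, r)" by (cases t) auto
  then have p: "patch c x0 r" using P(2) t by auto
  note c = patchD(1)[OF p]
  have K: "box_nhd x0 r \<subseteq> img c" using patchD(4)[OF p, of r] patchD(2)[OF p] by simp
  have fc: "continuous_on (box_nhd x0 r) (%x. F (param c x))"
   by (rule continuous_on_compose2[OF F(1) continuous_on_subset[OF chart_cont(2)[OF c] K]]) simp
  from chart_integral[OF c compact_box_nhd K fc] show "integrable \<mu> (g t)"
   "(\<integral>p. g t p \<partial>\<mu>) = (case t of (c, x0, r) => cint (box_nhd x0 r) (%x. dens c x * F (param c x)))"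
   by (simp_all add: g_def tt)
 qed
 have gn: "g t p \<ge> 0" for t p using F(2) by (auto simp: g_def split: prod.split)
 have "(\<integral>x. F x \<partial>\<mu>) \<le> (\<integral>x. (\<Sum>t\<in>P. g t x) \<partial>\<mu>)"
 proof (rule integral_mono[OF cont_int[OF F(1)]])
  show "integrable \<mu> (%x. \<Sum>t\<in>P. g t x)" using g(1) by simp
  fix p
  obtain t where t: "t \<in> P" "case t of (c, x0, r) => in_patch p c x0 r" using P(3) by blast
  obtain c x0 r where tt: "t = (c, x0, r)" by (cases t) auto
  have "patch c x0 r" using P(2) t(1) tt by auto
  then have c: "c \<in> atlas R" by (rule patchD(1))
  have ip: "p \<in> cdom c" "coord c p \<in> box_nhd x0 r" using t tt by (auto simp: in_patch_def)
  have pp: "param c (coord c p) = p" using chart_inv[OF c] ip by simp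
  then have "p \<in> param c ` box_nhd x0 r" using ip(2) by (metis imageI)
  then have "g t p = F p" by (simp add: g_def tt pp)
  then show "F p \<le> (\<Sum>t\<in>P. g t p)" using member_le_sum[of t P "%t. g t p"] t(1) P(1) gn by simp
 qed
 also have "... = (\<Sum>t\<in>P. (\<integral>x. g t x \<partial>\<mu>))" using g(1) by simp
 also have "... = (\<Sum>(c, x0, r)\<in>P. cint (box_nhd x0 r) (%x. dens c x * F (param c x)))" by (rule sum.cong[OF refl g(2)])
 finally show ?thesis .
qed

text \<open>The local inequalities are summed over the patches. Constant and threshold of each patch
  are merged into a single C with threshold 1/C, which makes the claim monotone in C as
  \<open>uniform_constant\<close> requires.\<close>

lemma poincare_global:
 assumes m: "CARD('d) < 2 * m"
 shows "\<exists>C>0. \<exists>h0>0. \<forall>v h. sampled h0 v h --> H 0 v \<le> C * (\<Sum>k=1..m. h ^ (2 * k) * H k v)"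
proof -
 define P where "P = patches"
 note P = patches[folded P_def]
 define S where "S = (%v h. \<Sum>k=1..m. h ^ (2 * k) * H k v)"
 have S: "S v h \<ge> 0" if "sampled h0 v h" for v h h0 unfolding S_def using that
  by (intro sum_nonneg mult_nonneg_nonneg H_nonneg) (auto simp: sampled_def)
 define F where "F = (%v (c, x0, r). cint (box_nhd x0 r) (%x. dens c x * (v (param c x))\<^sup>2))"
 have "\<exists>C>0. \<forall>t\<in>P. \<forall>v h. sampled (1 / C) v h --> F v t \<le> C * S v h"
 proof (rule uniform_constant[OF P(1)])
  fix t assume tP: "t \<in> P"
  obtain c x0 r where t: "t = (c, x0, r)" by (cases t)
  have p: "patch c x0 r" using P(2) tP t by auto
  note c = patchD(1)[OF p]
  have K: "box_nhd x0 r \<subseteq> img c" using patchD(4)[OF p, of r] patchD(2)[OF p] by simp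
  from poincare_local[OF m p] obtain C h0 where C: "C > 0" "h0 > 0"
   and b: "\<forall>v h. sampled h0 v h --> cint (box_nhd x0 r) (%x. (loc c v x)\<^sup>2) \<le> C * S v h"
   unfolding S_def by (elim exE conjE)
  from dens_bounds[OF c compact_box_nhd K] obtain B where B: "B > 0" "\<forall>x\<in>box_nhd x0 r. dens c x \<le> B \<and> 1 \<le> B * dens c x" by (elim exE conjE)
  define D where "D = B * C + 1 / h0"
  have D: "D > 0" "B * C \<le> D" "1 / D \<le> h0" using B C by (auto simp: D_def add_pos_pos field_simps)
  have "F v t \<le> D * S v h" if s: "sampled (1 / D) v h" for v h
  proof -
   have v: "smf v" using s by (simp add: sampled_def)
   have "F v t = cint (box_nhd x0 r) (%x. dens c x * (loc c v x)\<^sup>2)"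
    unfolding F_def t prod.case by (rule cint_cong) (use K in \<open>auto simp: loc_def\<close>)
   also have "... \<le> cint (box_nhd x0 r) (%x. B * (loc c v x)\<^sup>2)"
    by (intro cint_mono compact_box_nhd continuous_intros cont_K[OF compact_box_nhd K patchD(3)[OF p]]
     smooth_loc[OF c v] elliptic_op.sm_w[OF elliptic_chart[OF c]] mult_right_mono) (use B in auto)
   also have "... = B * cint (box_nhd x0 r) (%x. (loc c v x)\<^sup>2)" by (rule cint_cmult)
   also have "... \<le> B * (C * S v h)" by (intro mult_left_mono b[rule_format] sampled_mono[OF s D(3)]) (use B in auto)
   also have "... \<le> D * S v h" using mult_right_mono[OF D(2) S[OF s]] by (simp add: mult.assoc)
   finally show ?thesis .
  qed
  then show "\<exists>C>0. \<forall>v h. sampled (1 / C) v h --> F v t \<le> C * S v h" using D(1) by blast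
 next
  fix C C' t assume a: "\<forall>v h. sampled (1 / C) v h --> F v t \<le> C * S v h" and C: "0 < C" "C \<le> C'"
  have "F v t \<le> C' * S v h" if s: "sampled (1 / C') v h" for v h
   using a[rule_format, OF sampled_mono[OF s]] C mult_right_mono[OF C(2) S[OF s]] by (simp add: frac_le)
  then show "\<forall>v h. sampled (1 / C') v h --> F v t \<le> C' * S v h" by blast
 qed
 then obtain C where C: "C > 0" "\<forall>t\<in>P. \<forall>v h. sampled (1 / C) v h --> F v t \<le> C * S v h" by (elim exE conjE)
 have "H 0 v \<le> (C * card P + 1) * S v h" if s: "sampled (1 / C) v h" for v h
 proof -
  have v: "smf v" using s by (simp add: sampled_def)
  have "H 0 v = (\<integral>x. (v x)\<^sup>2 \<partial>\<mu>)" by (rule H_0[OF v])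
  also have "... \<le> (\<Sum>(c, x0, r)\<in>P. cint (box_nhd x0 r) (%x. dens c x * (v (param c x))\<^sup>2))"
   by (rule integral_le_patches[OF P]) (intro continuous_intros smf_continuous[OF v], simp)
  also have "... = (\<Sum>t\<in>P. F v t)" unfolding F_def ..
  also have "... \<le> (\<Sum>t\<in>P. C * S v h)" by (rule sum_mono) (use C(2) s in auto)
  also have "... \<le> (C * card P + 1) * S v h" using S[OF s] by (simp add: algebra_simps)
  finally show ?thesis .
 qed
 then show ?thesis using C(1) unfolding S_def
  by (intro exI[of _ "C * card P + 1"] conjI exI[of _ "1 / C"] allI impI) (auto simp: add_nonneg_pos)
qed

text \<open>In spectral form the Poincare inequality compares sums over eigenvalues. With t = h^2 mu
  the right hand side is at most 1/2 + D t^m termwise, and the half is absorbed by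
  \<open>H 0 v\<close>. The orders in between follow from t^j \<le> 1 + t^m.\<close>

lemma sampling:
 assumes m: "CARD('d) < 2 * m"
 shows "\<exists>C>0. \<exists>h0>0. \<forall>v h. sampled h0 v h --> (\<forall>j\<le>m. h ^ (2 * j) * H j v \<le> C * (h ^ (2 * m) * H m v))"
proof -
 from poincare_global[OF m] obtain C h0 where C: "C > 0" "h0 > 0"
  and b: "\<forall>v h. sampled h0 v h --> H 0 v \<le> C * (\<Sum>k=1..m. h ^ (2 * k) * H k v)"
  by (elim exE conjE)
 from sum_powers_le[of C m] C obtain D where D: "D > 0" "\<forall>t\<ge>0. C * (\<Sum>k=1..m. t ^ k) \<le> 1 / 2 + D * t ^ m" by auto
 have "h ^ (2 * j) * H j v \<le> (2 * D + 1) * (h ^ (2 * m) * H m v)"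
  if vh: "sampled h0 v h" and j: "j \<le> m" for v h j
 proof -
  have v: "smf v" using vh by (simp add: sampled_def)
  \<comment> \<open>The dimensionless frequency: h^(2k) \<open>H k v\<close> is the sum of its k-th
    powers against the squared coefficients.\<close>
  define t where "t = (%i. h\<^sup>2 * mu i)"
  define e where "e = (%i. (cf v i)\<^sup>2)"
  have t: "t i \<ge> 0" for i using mu_ge_1[of i] by (simp add: t_def)
  have s: "(%i. t i ^ k * e i) sums (h ^ (2 * k) * H k v)" for k
  proof -
   have "(%i. h ^ (2 * k) * (mu i ^ k * e i)) sums (h ^ (2 * k) * H k v)"
    unfolding H_def e_def by (intro sums_mult summable_sums H_summable v)
   then show ?thesis by (simp add: t_def power_mult_distrib power_mult mult.assoc)
  qed
  have e: "e i \<ge> 0" for i by (simp add: e_def)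
  have s0: "e sums H 0 v" using s[of 0] by simp
  have "H 0 v \<le> C * (\<Sum>k=1..m. h ^ (2 * k) * H k v)" using b vh by simp
  also have "... \<le> 1 / 2 * H 0 v + D * (h ^ (2 * m) * H m v)"
  proof (rule sums_le)
   show "(%i. C * (\<Sum>k=1..m. t i ^ k * e i)) sums (C * (\<Sum>k=1..m. h ^ (2 * k) * H k v))"
    by (intro sums_mult sums_sum s)
   show "(%i. 1 / 2 * e i + D * (t i ^ m * e i)) sums (1 / 2 * H 0 v + D * (h ^ (2 * m) * H m v))"
    by (intro sums_add sums_mult s s0)
   fix i
   have "C * (\<Sum>k=1..m. t i ^ k) * e i \<le> (1 / 2 + D * t i ^ m) * e i"
    using D(2) t e by (intro mult_right_mono) auto
   then show "C * (\<Sum>k=1..m. t i ^ k * e i) \<le> 1 / 2 * e i + D * (t i ^ m * e i)"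
    by (simp add: sum_distrib_right sum_distrib_left algebra_simps)
  qed
  finally have a0: "H 0 v \<le> 2 * D * (h ^ (2 * m) * H m v)" by simp
  have "h ^ (2 * j) * H j v \<le> H 0 v + h ^ (2 * m) * H m v"
  proof (rule sums_le[OF _ s sums_add[OF s0 s]])
   fix i
   have "t i ^ j \<le> 1 + t i ^ m"
   proof (cases "t i \<le> 1")
    case True
    then show ?thesis using t[of i] power_le_one[of "t i" j] zero_le_power[of "t i" m] by linarith
   next
    case False
    then have "t i ^ j \<le> t i ^ m" by (intro power_increasing[OF j]) simp
     then show ?thesis by simp
   qed
   then show "t i ^ j * e i \<le> e i + t i ^ m * e i" using mult_right_mono[OF _ e[of i]] by (simp add: algebra_simps) (metis distrib_left mult.commute mult.right_neutral)
  qed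
  then show ?thesis using a0 by (simp add: algebra_simps)
 qed
 then show ?thesis using C(2) D(1) by (intro exI[of _ "2 * D + 1"] conjI exI[of _ h0] allI impI) auto
qed

text \<open>Sobolev's embedding as a consequence of \<open>point_poincare\<close>: F - F(y) vanishes
  at y and has the same derivatives of positive order as F. So the constant F(y), averaged over a
  ball of fixed radius, is bounded by F and its jets.\<close>

lemma sup_bound_local:
 assumes m: "CARD('d) < 2 * m" and p: "patch c x0 r"
 shows "\<exists>C>0. \<forall>f. smf f --> (\<forall>p. in_patch p c x0 r --> (f p)\<^sup>2 \<le> C * H m f)"
proof -
 note c = patchD(1)[OF p] and r = patchD(2)[OF p] and o = patchD(3)[OF p] and K = patchD(6)[OF p]
 from jet_bound[OF p, of m] obtain B where B: "B > 0" and jb: "\<forall>k\<le>m. \<forall>f K. smf f --> compact K --> K \<subseteq> box_nhd x0 (2 * r) --> cint K (jet k (loc c f)) \<le> B * H k f"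
  by (elim exE conjE)
 define V where "V = measure lborel (cball (0 :: real^'d) r)"
 have V: "V > 0" using r by (simp add: V_def content_cball unit_ball_vol_pos)
 define M where "M = 2 * B + 2 * (4 * real m * (\<Sum>k=1..m. r ^ (2 * k) * B))"
 have M: "M > 0" unfolding M_def using B r by (intro add_pos_nonneg mult_nonneg_nonneg sum_nonneg) (auto intro: less_imp_le)
 have "(f q)\<^sup>2 \<le> M / V * H m f" if f: "smf f" and q: "in_patch q c x0 r" for f q
 proof -
  define y where "y = coord c q"
  define a where "a = f q"
  define F where "F = loc c f"
  define g where "g = (%x. F x - a)"
  let ?B = "cball y r"
  have y: "y \<in> box_nhd x0 r" and qc: "q \<in> cdom c" using q by (auto simp: in_patch_def y_def)
  have bsub: "?B \<subseteq> box_nhd x0 (2 * r)"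
  proof
   fix z assume z: "z \<in> ?B"
   have "\<bar>z $ i - x0 $ i\<bar> \<le> 2 * r" for i
   proof -
    have "\<bar>(y - z) $ i\<bar> \<le> r" using component_le_norm_cart[of "y - z" i] z by (simp add: dist_norm)
    moreover have "\<bar>y $ i - x0 $ i\<bar> \<le> r" using y by (simp add: box_nhd_def)
    ultimately show ?thesis by simp
   qed
   then show "z \<in> box_nhd x0 (2 * r)" by (simp add: box_nhd_def)
  qed
  have Bi: "?B \<subseteq> img c" using bsub K by auto
  have sF: "smooth_on (img c) F" unfolding F_def by (rule smooth_loc[OF c f])
  have sg: "smooth_on (img c) g" unfolding g_def by (intro smooth_on_diff o sF smooth_on_const)
  have Fy: "F y = a" using chart_inv[OF c] qc by (simp add: F_def loc_def y_def a_def)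
  have jg: "jet k g x = jet k F x" if "k \<in> {1..m}" "x \<in> ?B" for k x
  proof -
   have "k \<noteq> 0" using that by simp
   then obtain n where k: "k = Suc n" using not0_implies_Suc by blast
   have pd: "pd i g z = pd i F z" if "z \<in> img c" for z i
    unfolding g_def using partial_deriv_diff[OF smooth_on_differentiable[OF sF that], of "%x. a" i] by simp
   have "x \<in> img c" using that Bi by blast
   then have "jet n (pd i g) x = jet n (pd i F) x" for i
    by (rule jet_cong[OF o]) (rule pd)
   then show ?thesis unfolding k by simp
  qed
  have cj: "cint ?B (jet k F) \<le> B * H m f" if "k \<le> m" for k
   unfolding F_def by (rule order_trans[OF jb[rule_format, OF that f compact_cball bsub] mult_left_mono[OF H_mono[OF f that]]]) (use B in simp)
  have "a\<^sup>2 * V = cint ?B (%x. a\<^sup>2)" using r by (simp add: cint_def set_lebesgue_integral_def V_def content_cball)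
  also have "... \<le> cint ?B (%x. 2 * (F x)\<^sup>2 + 2 * (g x)\<^sup>2)"
  proof (intro cint_mono compact_cball continuous_intros cont_K[OF compact_cball Bi o] sF sg)
   fix x
   have "0 \<le> (F x + g x)\<^sup>2" by simp
   then show "a\<^sup>2 \<le> 2 * (F x)\<^sup>2 + 2 * (g x)\<^sup>2" by (simp add: g_def power2_eq_square algebra_simps)
  qed
  also have "... = 2 * cint ?B (%x. (F x)\<^sup>2) + 2 * cint ?B (%x. (g x)\<^sup>2)"
   unfolding cint_cmult[symmetric] by (intro cint_add compact_cball continuous_intros cont_K[OF compact_cball Bi o] sF sg)
  also have "cint ?B (%x. (g x)\<^sup>2) \<le> 4 * real m * (\<Sum>k=1..m. r ^ (2 * k) * cint ?B (jet k g))"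
   by (rule point_poincare[OF m o Bi sg _ r]) (simp add: g_def Fy)
  also have "... = 4 * real m * (\<Sum>k=1..m. r ^ (2 * k) * cint ?B (jet k F))"
   by (intro arg_cong2[where f="(*)"] refl sum.cong cint_cong jg)
  also have "... \<le> 4 * real m * (\<Sum>k=1..m. r ^ (2 * k) * (B * H m f))"
   using r by (intro mult_left_mono sum_mono cj) auto
  also have "cint ?B (%x. (F x)\<^sup>2) \<le> B * H m f"
   using cj[of 0] by (simp add: jet.simps(1)[abs_def])
  finally have "a\<^sup>2 * V \<le> M * H m f" by (simp add: M_def algebra_simps sum_distrib_left)
  then show ?thesis using V by (simp add: a_def field_simps)
 qed
 then show ?thesis using M V by (intro exI[of _ "M / V"]) auto
qed

lemma sup_bound:
 assumes m: "CARD('d) < 2 * m"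
 shows "\<exists>C>0. \<forall>f. smf f --> (\<forall>p. (f p)\<^sup>2 \<le> C * H m f)"
proof -
 define P where "P = patches"
 note P = patches[folded P_def]
 have "\<exists>C>0. \<forall>(c, x0, r)\<in>P. \<forall>f. smf f --> (\<forall>p. in_patch p c x0 r --> (f p)\<^sup>2 \<le> C * H m f)"
  by (rule uniform_constant[OF P(1)])
   (use P(2) sup_bound_local[OF m] in \<open>auto intro: order_trans[OF _ mult_right_mono[OF _ H_nonneg]]\<close>)
 then obtain C where C: "C > 0" "\<forall>(c, x0, r)\<in>P. \<forall>f. smf f --> (\<forall>p. in_patch p c x0 r --> (f p)\<^sup>2 \<le> C * H m f)" by (elim exE conjE)
 have "(f p)\<^sup>2 \<le> C * H m f" if "smf f" for f p
  using P(3)[rule_format, of p] C(2) that by (force split: prod.splits)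
 then show ?thesis using C(1) by blast
qed

end

subsection \<open>The energy form\<close>

lemma poly_leading_bound:
 fixes P :: "real poly"
 assumes m: "degree P = m" "m \<ge> 1"
 shows "\<exists>S\<ge>0. \<forall>x\<ge>1. \<bar>poly P x - coeff P m * x ^ m\<bar> \<le> S * x ^ (m - 1)"
proof -
 define S where "S = (\<Sum>i<m. \<bar>coeff P i\<bar>)"
 have "\<bar>poly P x - coeff P m * x ^ m\<bar> \<le> S * x ^ (m - 1)" if x: "x \<ge> 1" for x
 proof -
  have "poly P x = (\<Sum>i<m. coeff P i * x ^ i) + coeff P m * x ^ m"
   unfolding poly_altdef m(1) by (simp add: lessThan_Suc_atMost[symmetric])
  then have "\<bar>poly P x - coeff P m * x ^ m\<bar> \<le> (\<Sum>i<m. \<bar>coeff P i * x ^ i\<bar>)" by simp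
  also have "... \<le> (\<Sum>i<m. \<bar>coeff P i\<bar> * x ^ (m - 1))"
  proof (rule sum_mono)
   fix i assume "i \<in> {..<m}"
   then have "x ^ i \<le> x ^ (m - 1)" using x by (intro power_increasing) auto
   then show "\<bar>coeff P i * x ^ i\<bar> \<le> \<bar>coeff P i\<bar> * x ^ (m - 1)" using x by (simp add: abs_mult mult_left_mono)
  qed
  finally show ?thesis by (simp add: S_def sum_distrib_right)
 qed
 moreover have "S \<ge> 0" by (simp add: S_def sum_nonneg)
 ultimately show ?thesis by blast
qed

text \<open>If the leading coefficient is positive, large x are governed by it and small x by the
  constant D. If it is negative, positivity off the finite set J confines all x i to a bounded
  range, where a large D suffices.\<close>

lemma poly_coercive:
 fixes P :: "real poly"
 assumes m: "degree P = m" "m \<ge> 1" and x: "\<And>i::nat. x i \<ge> 1" and J: "finite J" "\<And>i. i \<notin> J ==> poly P (x i) > 0"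
 shows "\<exists>c>0. \<exists>D\<ge>0. \<forall>i. c * x i ^ m - D \<le> poly P (x i)"
proof -
 from poly_leading_bound[OF m] obtain S where S: "S \<ge> 0" and b: "\<forall>x\<ge>1. \<bar>poly P x - coeff P m * x ^ m\<bar> \<le> S * x ^ (m - 1)" by (elim exE conjE)
 define a where "a = coeff P m"
 have a: "a \<noteq> 0" using m leading_coeff_0_iff[of P] by (auto simp: a_def)
 have pw: "x i ^ m = x i * x i ^ (m - 1)" for i using m(2) by (cases m) auto
 have pp: "x i ^ (m - 1) > 0" for i using x[of i] by simp
 have bi: "a * x i ^ m - S * x i ^ (m - 1) \<le> poly P (x i)" "poly P (x i) \<le> a * x i ^ m + S * x i ^ (m - 1)" for i
  using b[rule_format, OF x[of i]] by (auto simp: a_def abs_le_iff)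
 show ?thesis
 proof (cases "a > 0")
  case True
  define D where "D = S * (2 * S / a) ^ (m - 1)"
  have "a / 2 * x i ^ m - D \<le> poly P (x i)" for i
  proof -
   have "S * x i ^ (m - 1) \<le> a / 2 * x i ^ m + D"
   proof (cases "x i \<le> 2 * S / a")
    case le: True
    have "S * x i ^ (m - 1) \<le> D" unfolding D_def using x[of i] le S by (intro mult_left_mono power_mono) auto
    moreover have "0 \<le> a / 2 * x i ^ m" using True x[of i] by simp
    ultimately show ?thesis by simp
   next
    case False
    then have "S \<le> a / 2 * x i" using True by (simp add: field_simps)
    then have "S * x i ^ (m - 1) \<le> a / 2 * x i * x i ^ (m - 1)" using pp[of i] by (intro mult_right_mono) auto
    moreover have "D \<ge> 0" using S True by (simp add: D_def)
    ultimately show ?thesis by (simp add: pw mult.assoc)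
   qed
   then show ?thesis using bi(1)[of i] by simp
  qed
  moreover have "D \<ge> 0" using S True by (simp add: D_def)
  ultimately show ?thesis using True by (intro exI[of _ "a / 2"] conjI exI[of _ D]) auto
 next
  case False
  then have a': "a < 0" using a by simp
  \<comment> \<open>P (x i) > 0 is incompatible with a negative leading term that outweighs the
    remainder.\<close>
  have bd: "x i \<le> S / - a" if "i \<notin> J" for i
  proof -
   have "0 < a * x i ^ m + S * x i ^ (m - 1)" using J(2)[OF that] bi(2)[of i] by simp
   also have "... = (a * x i + S) * x i ^ (m - 1)" by (simp add: pw algebra_simps)
   finally have "0 < a * x i + S" using pp[of i] by (metis zero_less_mult_pos2)
   then show ?thesis using a' by (simp add: field_simps)
  qed
  define M where "M = S / - a + (\<Sum>i\<in>J. x i)"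
  have M: "x i \<le> M" for i
  proof (cases "i \<in> J")
   case True
   then have "x i \<le> (\<Sum>i\<in>J. x i)" using x J(1) by (intro member_le_sum) (auto intro: order_trans[of 0 1])
   then show ?thesis using divide_nonneg_neg[OF S a'] by (simp add: M_def)
  next
   case False
   have "(\<Sum>i\<in>J. x i) \<ge> 0" using x by (intro sum_nonneg) (auto intro: order_trans[of 0 1])
   then show ?thesis using bd[OF False] by (simp add: M_def)
  qed
  define D where "D = M ^ m + \<bar>a\<bar> * M ^ m + S * M ^ (m - 1)"
  have "1 * x i ^ m - D \<le> poly P (x i)" for i
  proof -
   have 1: "x i ^ m \<le> M ^ m" "x i ^ (m - 1) \<le> M ^ (m - 1)" using x[of i] M[of i] by (auto intro!: power_mono)
   have "- a * x i ^ m \<le> \<bar>a\<bar> * M ^ m" using 1(1) a' by (simp add: mult_left_mono)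
   moreover have "S * x i ^ (m - 1) \<le> S * M ^ (m - 1)" using 1(2) S by (rule mult_left_mono)
   ultimately show ?thesis using bi(1)[of i] 1(1) by (simp add: D_def)
  qed
  moreover have "D \<ge> 0" using S M[of 0] x[of 0] by (simp add: D_def)
  ultimately show ?thesis by (intro exI[of _ 1] conjI exI[of _ D]) auto
 qed
qed

locale polyharmonic_space = spectral_space R \<mu> \<psi> ev
 for R :: "('a::metric_space, 'd::finite) riem" and \<mu> :: "'a measure" and \<psi> :: "nat => 'a => real" and ev :: "nat => real" +
 fixes J :: "nat set" and Q :: "real poly" and k :: "'a => 'a => real" and m :: nat
 assumes kernel: "polyharmonic_kernel R \<mu> \<psi> ev J Q k" and deg: "degree Q = m" and dim: "CARD('d) < 2 * m"
  and ann: "\<And>p x. p \<in> eigenspan \<psi> J ==> poly_laplace R Q p x = 0"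
begin

lemma fin_J: "finite J" and pos: "j \<notin> J ==> poly Q (ev j) > 0" and cont_kernel: "continuous_on UNIV (%(x, y). k x y)"
 using kernel by (auto simp: polyharmonic_kernel_def)

lemma m_ge_1: "m \<ge> 1" using dim by (cases m) auto

abbreviation "L \<equiv> poly_laplace R Q"
definition q :: "nat => real" where "q j = poly Q (ev j)"

lemma smf_laplace_pow: "smf f ==> smf ((\<Delta> ^^ j) f)" by (induction j) (auto intro: smf_laplace)

lemma cf_laplace_pow: "smf f ==> cf ((\<Delta> ^^ j) f) i = ev i ^ j * cf f i"
 by (induction j) (auto simp: cf_laplace smf_laplace_pow)

lemma smf_L: "smf f ==> smf (L f)"
 unfolding poly_laplace_def[abs_def] by (intro smf_sum smf_cmult smf_laplace_pow)

lemma cf_L: assumes f: "smf f" shows "cf (L f) i = q i * cf f i"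
proof -
 have "cf (L f) i = (\<Sum>j\<le>degree Q. cf (%x. coeff Q j * (\<Delta> ^^ j) f x) i)"
  unfolding poly_laplace_def[abs_def]
  by (rule cf_sum) (intro continuous_intros smf_continuous smf_laplace_pow f)
 also have "... = (\<Sum>j\<le>degree Q. coeff Q j * (ev i ^ j * cf f i))" by (simp add: cf_cmult cf_laplace_pow f)
 finally show ?thesis by (simp add: q_def poly_altdef sum_distrib_left mult_ac)
qed

lemma laplace_pow_zero:
 assumes U: "open U" "\<And>p. p \<in> U ==> f p = 0"
 shows "p \<in> U ==> (\<Delta> ^^ j) f p = 0"
proof (induction j arbitrary: p)
 case (Suc j)
 have "\<Delta> ((\<Delta> ^^ j) f) p = \<Delta> (%x. 0) p" by (rule laplace_local[OF U(1) Suc.prems]) (rule Suc.IH)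
 then show ?case by (simp add: laplace_const)
qed (use U in simp)

lemma L_zero: "open U ==> (\<And>p. p \<in> U ==> f p = 0) ==> p \<in> U ==> L f p = 0"
 unfolding poly_laplace_def using laplace_pow_zero[of U f p] by simp

text \<open>\<psi> j lies in the annihilated space and is an eigenfunction of L with eigenvalue q j.
  With positivity off J this makes the energy semidefinite on all smooth functions, not only on a
  complement of \<open>PJ\<close>.\<close>

lemma q_J: assumes j: "j \<in> J" shows "q j = 0"
proof -
 have "\<psi> j = (%x. \<Sum>i\<in>J. (if i = j then 1 else 0) * \<psi> i x)" using j fin_J by (simp add: if_distrib[where f="%z. z * _"] cong: if_cong)
 then have "\<psi> j \<in> eigenspan \<psi> J" unfolding eigenspan_def by (intro CollectI exI[of _ "%i. if i = j then 1 else 0"] conjI TrueI)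
 then have "L (\<psi> j) = (%x. 0)" using ann by blast
 then show ?thesis using cf_L[OF smf_psi, of j j] by (simp add: cf_psi) (simp add: cf_def)
qed

lemma q_pos: "j \<notin> J ==> q j > 0" using pos by (simp add: q_def)
lemma q_nonneg: "q j \<ge> 0" using q_J[of j] q_pos[of j] by (cases "j \<in> J") auto

text \<open>The integral form shows locality: since L is a differential operator, the energy of a
  pair sees only the overlap of supports. The spectral form \<open>E_sums\<close> shows symmetry and
  nonnegativity.\<close>

definition E :: "('a => real) => ('a => real) => real" where "E f g = (\<integral>x. f x * L g x \<partial>\<mu>)"

lemma E_sums: assumes f: "smf f" and g: "smf g" shows "(%i. q i * cf f i * cf g i) sums E f g"
 using parseval2[OF smf_continuous[OF f] smf_continuous[OF smf_L[OF g]]] by (simp add: cf_L g E_def mult_ac)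

lemma E_sym: "smf f ==> smf g ==> E f g = E g f"
 using E_sums[of f g] E_sums[of g f] by (simp add: mult_ac sums_unique2)

lemma E_add: assumes "smf f" "smf g" "smf u" shows "E f (%x. g x + u x) = E f g + E f u"
proof -
 have "(%i. q i * cf f i * cf (%x. g x + u x) i) sums (E f g + E f u)"
  using sums_add[OF E_sums[OF assms(1,2)] E_sums[OF assms(1,3)]] assms by (simp add: cf_add smf_continuous algebra_simps)
 then show ?thesis using E_sums[OF assms(1) smf_add[OF assms(2,3)]] sums_unique2 by blast
qed

lemma E_cmult: assumes "smf f" "smf g" shows "E f (%x. t * g x) = t * E f g"
proof -
 have "(%i. q i * cf f i * cf (%x. t * g x) i) sums (t * E f g)"
  using sums_mult[OF E_sums[OF assms], of t] by (simp add: cf_cmult mult_ac)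
 then show ?thesis using E_sums[OF assms(1) smf_cmult[OF assms(2)]] sums_unique2 by blast
qed

lemma E_add_left: "smf f ==> smf g ==> smf u ==> E (%x. g x + u x) f = E g f + E u f"
 using E_add[of f g u] E_sym[of f] smf_add[of g u] by simp
lemma E_cmult_left: "smf f ==> smf g ==> E (%x. t * g x) f = t * E g f"
 using E_cmult[of f g t] E_sym[of f] smf_cmult[of g t] by simp

lemma E_comb:
 assumes f: "smf f" and g: "smf g"
 shows "E (%x. f x + t * g x) (%x. f x + t * g x) = E f f + 2 * t * E f g + t\<^sup>2 * E g g"
proof -
 note tg = smf_cmult[OF g, of t]
 note h = smf_add[OF f tg]
 have "E (%x. f x + t * g x) (%x. f x + t * g x) = E (%x. f x + t * g x) f + t * E (%x. f x + t * g x) g"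
  unfolding E_add[OF h f tg] E_cmult[OF h g] ..
 also have "E (%x. f x + t * g x) f = E f f + t * E f g"
  unfolding E_add_left[OF f f tg] E_cmult_left[OF f g] E_sym[OF g f] ..
 also have "E (%x. f x + t * g x) g = E f g + t * E g g"
  unfolding E_add_left[OF g f tg] E_cmult_left[OF g g] ..
 finally show ?thesis by (simp add: power2_eq_square algebra_simps)
qed

lemma E_nonneg: assumes f: "smf f" shows "E f f \<ge> 0"
proof (rule sums_le[OF _ sums_zero E_sums[OF f f]])
 show "0 \<le> q i * cf f i * cf f i" for i using q_nonneg[of i] by (simp add: mult.assoc)
qed

lemma E_upper: "dominated smf (%f. E f f) (H m)"
proof -
 define C where "C = (\<Sum>j\<le>m. \<bar>coeff Q j\<bar>) + 1"
 have b: "q i \<le> C * mu i ^ m" for i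
 proof -
  have e: "\<bar>ev i\<bar> \<le> mu i" using ev_le_0[of i] by (simp add: mu_def)
  have "q i \<le> (\<Sum>j\<le>m. \<bar>coeff Q j\<bar> * mu i ^ m)"
   unfolding q_def poly_altdef deg
  proof (rule sum_mono)
   fix j assume j: "j \<in> {..m}"
   have "\<bar>ev i\<bar> ^ j \<le> mu i ^ j" using e by (intro power_mono) auto
   also have "... \<le> mu i ^ m" using mu_ge_1[of i] j by (intro power_increasing) auto
   finally have "\<bar>coeff Q j\<bar> * \<bar>ev i\<bar> ^ j \<le> \<bar>coeff Q j\<bar> * mu i ^ m" by (intro mult_left_mono) auto
   then show "coeff Q j * ev i ^ j \<le> \<bar>coeff Q j\<bar> * mu i ^ m"
    using abs_ge_self[of "coeff Q j * ev i ^ j"] by (simp add: abs_mult power_abs)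
  qed
  also have "... \<le> C * mu i ^ m" using mu_ge_1[of i] by (simp add: C_def sum_distrib_right[symmetric] algebra_simps)
  finally show ?thesis .
 qed
 show ?thesis
 proof (rule dominatedI[of C], simp add: C_def add_nonneg_pos sum_nonneg, rule sums_le[OF _ E_sums])
  fix f assume f: "smf f"
  then show "smf f" .
  show "(%i. C * (mu i ^ m * (cf f i)\<^sup>2)) sums (C * H m f)" unfolding H_def by (intro sums_mult summable_sums H_summable f)
  show "q i * cf f i * cf f i \<le> C * (mu i ^ m * (cf f i)\<^sup>2)" for i
   using mult_right_mono[OF b[of i], of "(cf f i)\<^sup>2"] by (simp add: power2_eq_square mult_ac)
 qed
qed

text \<open>The substitution ev = 1 - mu turns q into a polynomial of the same degree in mu \<ge> 1,
  where \<open>poly_coercive\<close> applies.\<close>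

lemma q_lower: "\<exists>c>0. \<exists>D\<ge>0. \<forall>i. c * mu i ^ m - D \<le> q i"
proof -
 define P where "P = pcompose Q [:1, - 1:]"
 have P: "poly P (mu i) = q i" for i by (simp add: P_def poly_pcompose mu_def q_def)
 have d: "degree P = m" by (simp add: P_def deg degree_pcompose)
 show ?thesis using poly_coercive[OF d m_ge_1 mu_ge_1 fin_J] q_pos by (simp add: P)
qed

text \<open>The energy controls \<open>H m\<close> up to a multiple of \<open>H 0\<close>. By
  \<open>sampling\<close>, h-dense zeros make \<open>H 0 v\<close> at most a multiple of h^(2m)
  \<open>H m v\<close>, so for small h the defect is absorbed; a second use of
  \<open>sampling\<close> gives the intermediate orders.\<close>

lemma coercive: "\<exists>C>0. \<exists>h0>0. \<forall>v h. sampled h0 v h -->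
  H m v \<le> C * E v v \<and> (\<forall>j\<le>m. h ^ (2 * j) * H j v \<le> C * (h ^ (2 * m) * E v v))"
proof -
 from q_lower obtain c D where c: "c > 0" "D \<ge> 0" "\<forall>i. c * mu i ^ m - D \<le> q i" by (elim exE conjE)
 from sampling[OF dim] obtain S h0 where S: "S > 0" "h0 > 0"
  and s: "\<forall>v h. sampled h0 v h --> (\<forall>j\<le>m. h ^ (2 * j) * H j v \<le> S * (h ^ (2 * m) * H m v))"
  by (elim exE conjE)
 \<comment> \<open>The last entry gives D S h1 \<le> c/2, so half of the leading term survives the
   defect; D + 1 guards against D = 0.\<close>
 define h1 where "h1 = min h0 (min 1 (c / (2 * (D + 1) * S)))"
 have h1: "h1 > 0" "h1 \<le> h0" "h1 \<le> 1" "D * S * h1 \<le> c / 2"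
 proof -
  show "h1 > 0" "h1 \<le> h0" "h1 \<le> 1" using S c by (auto simp: h1_def)
  have "D * S * h1 \<le> (D + 1) * S * (c / (2 * (D + 1) * S))"
   using S c \<open>h1 > 0\<close> by (intro mult_mono) (auto simp: h1_def)
  also have "... = c / 2"
  proof -
   have "X * (c / (2 * X)) = c / 2" if "X > 0" for X :: real using that by simp
   from this[of "(D + 1) * S"] show ?thesis using S c by (simp only: mult.assoc mult_pos_pos add_nonneg_pos zero_less_one)
  qed
  finally show "D * S * h1 \<le> c / 2" .
 qed
 have HE: "H m v \<le> 2 / c * E v v" if vh: "sampled h1 v h" for v h
 proof -
  have v: "smf v" and h: "0 < h" "h \<le> h1" using vh by (auto simp: sampled_def)
  have "c * H m v - D * H 0 v \<le> E v v"
  proof (rule sums_le[OF _ _ E_sums[OF v v]])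
   have "(%i. c * (mu i ^ m * (cf v i)\<^sup>2) - D * (mu i ^ 0 * (cf v i)\<^sup>2)) sums (c * H m v - D * H 0 v)"
    unfolding H_def by (intro sums_diff sums_mult summable_sums H_summable v)
   then show "(%i. c * (mu i ^ m * (cf v i)\<^sup>2) - D * (cf v i)\<^sup>2) sums (c * H m v - D * H 0 v)" by simp
   show "c * (mu i ^ m * (cf v i)\<^sup>2) - D * (cf v i)\<^sup>2 \<le> q i * cf v i * cf v i" for i
    using mult_right_mono[OF spec[OF c(3), of i], of "(cf v i)\<^sup>2"] by (simp add: algebra_simps power2_eq_square)
  qed
  moreover have "D * H 0 v \<le> c / 2 * H m v"
  proof -
   have "H 0 v \<le> S * (h ^ (2 * m) * H m v)" using s[rule_format, OF sampled_mono[OF vh h1(2)], of 0] by simp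
   also have "h ^ (2 * m) \<le> h ^ 1" using h h1 m_ge_1 by (intro power_decreasing) auto
   also have "h ^ 1 \<le> h1" using h by simp
   finally have "D * H 0 v \<le> D * (S * (h1 * H m v))" using S c H_nonneg[OF v] by (simp add: mult_left_mono mult_right_mono)
   also have "... = D * S * h1 * H m v" by simp
   also have "... \<le> c / 2 * H m v" using h1(4) H_nonneg[OF v] by (rule mult_right_mono)
   finally show ?thesis .
  qed
  ultimately show ?thesis using c(1) by (simp add: field_simps)
 qed
 define C where "C = 2 / c + S * (2 / c)"
 have "H m v \<le> C * E v v" "h ^ (2 * j) * H j v \<le> C * (h ^ (2 * m) * E v v)"
  if vh: "sampled h1 v h" and j: "j \<le> m" for v h j
 proof -
  have v: "smf v" and h: "0 < h" using vh by (auto simp: sampled_def)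
  have e: "0 \<le> E v v" by (rule E_nonneg[OF v])
  show "H m v \<le> C * E v v" using HE[OF vh] e S c(1) by (simp add: C_def algebra_simps add_increasing2)
  have "h ^ (2 * j) * H j v \<le> S * (h ^ (2 * m) * H m v)" using s sampled_mono[OF vh h1(2)] j by simp
  also have "... \<le> S * (h ^ (2 * m) * (2 / c * E v v))" using S h by (intro mult_left_mono HE[OF vh]) auto
  also have "... \<le> C * (h ^ (2 * m) * E v v)" using e c(1) h by (simp add: C_def algebra_simps)
  finally show "h ^ (2 * j) * H j v \<le> C * (h ^ (2 * m) * E v v)" .
 qed
 moreover have "C > 0" using S c by (simp add: C_def add_pos_pos)
 ultimately show ?thesis using h1(1) by (intro exI[of _ C] conjI exI[of _ h1] allI impI) auto
qed

end

subsection \<open>Cut-off families\<close>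

lemma sjet_outside:
 fixes F :: "real^'d::finite => real"
 assumes K: "closed K" "\<And>x. x \<notin> K ==> F x = 0" and x: "x \<notin> K"
 shows "sjet n h F x = 0"
proof -
 have "sjet n h F x = sjet n h (%x. 0 * (0::real)) x"
  by (rule sjet_cong[of "- K"]) (use K x in auto)
 also have "... = 0\<^sup>2 * sjet n h (%x. 0) x" by (rule sjet_cmult[OF open_UNIV smooth_on_const]) simp
 finally show ?thesis by simp
qed

lemma measure_box_nhd: "s \<ge> 0 ==> measure lborel (box_nhd (x0 :: real^'d::finite) s) = (2 * s) ^ CARD('d)"
 unfolding box_nhd_cbox by (subst content_cbox_cart) (auto simp: interval_ne_empty_cart)

lemma norm_box_nhd_le: "x \<in> box_nhd y s ==> norm (x - y) \<le> real CARD('d) * s" for x y :: "real^'d::finite"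
proof -
 assume x: "x \<in> box_nhd y s"
 have "norm (x - y) \<le> (\<Sum>i\<in>UNIV. \<bar>(x - y) $ i\<bar>)" by (rule norm_le_l1_cart)
 also have "... \<le> (\<Sum>i\<in>(UNIV :: 'd set). s)" by (rule sum_mono) (use x in \<open>simp add: box_nhd_def\<close>)
 finally show ?thesis by simp
qed

context polyharmonic_space begin

lemma supported_lift:
 assumes c: "c \<in> atlas R" and K: "compact K" "K \<subseteq> img c" and eta: "smooth_on UNIV \<eta>" "\<And>x. x \<notin> K ==> \<eta> x = 0"
 shows "supported c K (lift c \<eta>)"
 unfolding supported_def using smf_lift[OF c smooth_on_subset[OF eta(1)] K] eta(2) lift_outside[OF c, of K \<eta>] by auto

lemma energy_le_sob: "patch c x0 r ==> dominated (supported c (box_nhd x0 (2 * r))) (%f. E f f) (%f. sob m (box_nhd x0 (2 * r)) (loc c f))"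
 by (rule dominated_trans[OF dominated_comp[where \<phi>="%f. f", OF E_upper] spectral_le_sob[OF patchD(1,5,6)]])
  (simp_all add: supported_def)

text \<open>The transition width of the cut-off equals the density h of the zeros. In the jet scaled
  by h the cut-off is bounded by a universal constant, and \<open>coercive\<close> bounds each
  h^(2i) \<open>H i v\<close> by h^(2m) \<open>E v v\<close>; the common factor h^(2m) cancels,
  which leaves a constant free of h, y and \<kappa>.\<close>

lemma cutoff_energy:
 assumes p: "patch c x0 r"
 shows "\<exists>C>0. \<exists>h0>0. \<forall>v h y \<kappa>. sampled h0 v h --> box_nhd y ((\<kappa> + 1) * h) \<subseteq> box_nhd x0 (2 * r) -->
  E (%p. lift c (cutoff y h \<kappa>) p * v p) (%p. lift c (cutoff y h \<kappa>) p * v p) \<le> C * E v v"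
proof -
 define K where "K = box_nhd x0 (2 * r)"
 note c = patchD(1)[OF p] and K = patchD(5,6)[OF p, folded K_def] and o = patchD(3)[OF p]
 from jet_bound[OF p, of m] obtain B where B: "B > 0"
  and jb: "\<forall>k\<le>m. \<forall>f L. smf f --> compact L --> L \<subseteq> K --> cint L (jet k (loc c f)) \<le> B * H k f"
  unfolding K_def by (elim exE conjE)
 from energy_le_sob[OF p] obtain A where A: "A > 0" "\<forall>f. supported c K f --> E f f \<le> A * sob m K (loc c f)"
  unfolding dominated_def K_def by (elim exE conjE)
 from coercive obtain S h0 where S: "S > 0" "h0 > 0"
  and s: "\<forall>v h. sampled h0 v h --> H m v \<le> S * E v v \<and> (\<forall>j\<le>m. h ^ (2 * j) * H j v \<le> S * (h ^ (2 * m) * E v v))" by (elim exE conjE)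
 obtain b where b: "b > 0" "\<forall>h>0. \<forall>x0 \<kappa> (x::real^'d). sjet m h (cutoff x0 h \<kappa>) x \<le> b"
  using sjet_cutoff_le[of m] by (elim exE conjE)
 define D where "D = 5 ^ m * b * (real (Suc m) * (B * S))"
 have D: "D > 0" using b B S by (simp add: D_def)
 have "E (%p. lift c (cutoff y h \<kappa>) p * v p) (%p. lift c (cutoff y h \<kappa>) p * v p) \<le> A * D * E v v"
  if vh: "sampled (min h0 1) v h" and sub: "box_nhd y ((\<kappa> + 1) * h) \<subseteq> K" for v h y \<kappa>
 proof -
  have v: "smf v" and h: "0 < h" "h \<le> 1" and vh0: "sampled h0 v h" using vh by (auto simp: sampled_def)
  define \<eta> where "\<eta> = cutoff y h \<kappa>"
  define g where "g = (%p. lift c \<eta> p * v p)"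
  have se: "smooth_on UNIV \<eta>" unfolding \<eta>_def by (rule smooth_on_cutoff)
  have th: "supported c K (lift c \<eta>)"
   by (rule supported_lift[OF c K se]) (use cutoff_eq_0[OF h(1)] sub in \<open>auto simp: \<eta>_def\<close>)
  have g: "supported c K g" using th smf_mult[OF _ v] by (simp add: supported_def g_def)
  then have g': "smf g" by (simp add: supported_def)
  have lg: "loc c g x = \<eta> x * loc c v x" if "x \<in> img c" for x
   using that lift_param[OF c that, of \<eta>] by (simp add: loc_def g_def)
  note sv = smooth_loc[OF c v]
  have "h ^ (2 * m) * sjet m 1 (loc c g) x \<le> 5 ^ m * b * sjet m h (loc c v) x" if x: "x \<in> K" for x
  proof -
   have xi: "x \<in> img c" using x K by blast
   have "h ^ (2 * m) * sjet m 1 (loc c g) x \<le> sjet m h (loc c g) x" by (rule sjet_unit_le) (use h in auto)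
   also have "... = sjet m h (%x. \<eta> x * loc c v x) x" by (rule sjet_cong[OF o xi lg])
   also have "... \<le> 5 ^ m * sjet m h \<eta> x * sjet m h (loc c v) x"
    by (rule sjet_mult_le[OF o smooth_on_subset[OF se subset_UNIV] sv xi])
   also have "... \<le> 5 ^ m * b * sjet m h (loc c v) x"
    by (intro mult_right_mono mult_left_mono) (use b(2)[rule_format, OF h(1), of y \<kappa> x] in \<open>auto simp: \<eta>_def\<close>)
   finally show ?thesis .
  qed
  then have "h ^ (2 * m) * sob m K (loc c g) \<le> 5 ^ m * b * cint K (sjet m h (loc c v))"
   unfolding sob_def cint_cmult[symmetric]
   by (intro cint_mono K(1) continuous_intros sjet_cont_K[OF K o] smooth_loc[OF c g'] sv)
  also have "cint K (sjet m h (loc c v)) = cint K (%x. \<Sum>i\<le>m. h ^ (2 * i) * jet i (loc c v) x)"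
   by (rule cint_cong) (rule sjet_eq)
  also have "... = (\<Sum>i\<le>m. cint K (%x. h ^ (2 * i) * jet i (loc c v) x))"
   by (intro cint_sum K(1) continuous_intros jet_cont_K[OF K o] sv)
  also have "... \<le> (\<Sum>i\<le>m. B * (S * (h ^ (2 * m) * E v v)))"
  proof (rule sum_mono)
   fix i assume "i \<in> {..m}"
   then have i: "i \<le> m" by simp
   have "cint K (%x. h ^ (2 * i) * jet i (loc c v) x) \<le> h ^ (2 * i) * (B * H i v)"
    unfolding cint_cmult using jb[rule_format, OF i v K(1) order_refl] h by (intro mult_left_mono) auto
   also have "... = B * (h ^ (2 * i) * H i v)" by simp
   also have "... \<le> B * (S * (h ^ (2 * m) * E v v))" using s vh0 i B by (intro mult_left_mono) auto
   finally show "cint K (%x. h ^ (2 * i) * jet i (loc c v) x) \<le> B * (S * (h ^ (2 * m) * E v v))" .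
  qed
  finally have "h ^ (2 * m) * sob m K (loc c g) \<le> h ^ (2 * m) * (D * E v v)" using b(1) by (simp add: D_def mult_ac)
  then have "sob m K (loc c g) \<le> D * E v v" using h by (simp only: mult_le_cancel_left_pos zero_less_power)
  then have "A * sob m K (loc c g) \<le> A * (D * E v v)" using A(1) by (intro mult_left_mono) auto
  then have "E g g \<le> A * D * E v v" using A(2)[rule_format, OF g] by simp
  then show ?thesis by (simp add: g_def \<eta>_def)
 qed
 then show ?thesis using A D S unfolding K_def
  by (intro exI[of _ "A * D"] conjI exI[of _ "min h0 1"] allI impI) auto
qed

text \<open>Source of the exponent d - 2m: squared derivatives up to order m cost w^(-2m) for w
  \<le> 1, and the support has volume of order w^d.\<close>

lemma bump_energy:
 assumes p: "patch c x0 r"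
 shows "\<exists>C>0. \<forall>w y. 0 < w --> w \<le> 1 --> box_nhd y w \<subseteq> box_nhd x0 (2 * r) -->
  E (lift c (cutoff y w 0)) (lift c (cutoff y w 0)) \<le> C * (w ^ CARD('d) / w ^ (2 * m))"
proof -
 define K where "K = box_nhd x0 (2 * r)"
 note c = patchD(1)[OF p] and K = patchD(5,6)[OF p, folded K_def] and o = patchD(3)[OF p]
 from energy_le_sob[OF p] obtain A where A: "A > 0" "\<forall>f. supported c K f --> E f f \<le> A * sob m K (loc c f)"
  unfolding dominated_def K_def by (elim exE conjE)
 obtain b where b: "b > 0" "\<forall>h>0. \<forall>x0 \<kappa> (x::real^'d). sjet m h (cutoff x0 h \<kappa>) x \<le> b"
  using sjet_cutoff_le[of m] by (elim exE conjE)
 have "E (lift c (cutoff y w 0)) (lift c (cutoff y w 0)) \<le> A * (2 ^ CARD('d) * b) * (w ^ CARD('d) / w ^ (2 * m))"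
  if w: "0 < w" "w \<le> 1" and sub: "box_nhd y w \<subseteq> K" for w y
 proof -
  define \<eta> where "\<eta> = cutoff y w 0"
  have ew: "\<eta> x = 0" if "x \<notin> box_nhd y w" for x unfolding \<eta>_def by (rule cutoff_eq_0[OF w(1)]) (use that in auto)
  have se: "smooth_on UNIV \<eta>" unfolding \<eta>_def by (rule smooth_on_cutoff)
  have th: "supported c K (lift c \<eta>)" by (rule supported_lift[OF c K se]) (use ew sub in auto)
  have lg: "loc c (lift c \<eta>) x = \<eta> x" if "x \<in> img c" for x
   using that lift_param[OF c that, of \<eta>] by (simp add: loc_def)
  have sk: "continuous_on (box_nhd y w) (sjet m 1 \<eta>)" by (rule sjet_cont_K[OF compact_box_nhd subset_UNIV open_UNIV se])
  have "sob m K (loc c (lift c \<eta>)) = cint K (sjet m 1 \<eta>)" unfolding sob_def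
   by (rule cint_cong, rule sjet_cong[OF o _ lg]) (use K in auto)
  also have "... = cint (box_nhd y w) (sjet m 1 \<eta>)"
   by (rule cint_eq_support[OF sub]) (rule sjet_outside[OF compact_imp_closed[OF compact_box_nhd] ew])
  also have "... \<le> cint (box_nhd y w) (%x. b / w ^ (2 * m))"
  proof (intro cint_mono compact_box_nhd sk continuous_intros)
   fix x
   have "w ^ (2 * m) * sjet m 1 \<eta> x \<le> sjet m w \<eta> x" by (rule sjet_unit_le) (use w in auto)
   also have "... \<le> b" using b(2)[rule_format, OF w(1)] by (simp add: \<eta>_def)
   finally show "sjet m 1 \<eta> x \<le> b / w ^ (2 * m)" using w by (simp add: field_simps)
  qed
  also have "... = b / w ^ (2 * m) * (2 * w) ^ CARD('d)"
   using w measure_box_nhd[of w y] by (simp add: cint_def set_lebesgue_integral_def)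
  finally have "sob m K (loc c (lift c \<eta>)) \<le> 2 ^ CARD('d) * b * (w ^ CARD('d) / w ^ (2 * m))" by (simp add: power_mult_distrib mult_ac)
  then have "A * sob m K (loc c (lift c \<eta>)) \<le> A * (2 ^ CARD('d) * b * (w ^ CARD('d) / w ^ (2 * m)))"
   using A(1) by (intro mult_left_mono) auto
  then show ?thesis using A(2)[rule_format, OF th] by (simp add: \<eta>_def mult.assoc)
 qed
 then show ?thesis using A(1) b(1) unfolding K_def by (intro exI[of _ "A * (2 ^ CARD('d) * b)"]) auto
qed

definition is_bump :: "'a set => 'a => real => ('a => real) => bool" where
 "is_bump B \<zeta> b \<phi> \<longleftrightarrow> smf \<phi> \<and> \<phi> \<zeta> = 1 \<and> (\<forall>p. p \<notin> B --> \<phi> p = 0) \<and> E \<phi> \<phi> \<le> b"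

definition is_cutoff :: "'a set => 'a set => real => real => ('a => real) => bool" where
 "is_cutoff A B h C \<theta> \<longleftrightarrow> smf \<theta> \<and> (\<forall>p\<in>A. \<theta> p = 1) \<and> (\<forall>p. p \<notin> B --> \<theta> p = 0) \<and>
   (\<forall>v. sampled h v h --> E (%p. \<theta> p * v p) (%p. \<theta> p * v p) \<le> C * E v v)"

text \<open>All that the decay argument uses of charts; in the construction B s is the image of a
  coordinate cube of half-width s about \<zeta>. The one constant C bounds distances and energies,
  and 1/C the admissible radii, so the property weakens as C grows and the patches can share a
  constant.\<close>

definition cutoff_family :: "real => 'a => (real => 'a set) => bool" where
 "cutoff_family C \<zeta> B \<longleftrightarrow> mono B \<and>
   (\<forall>s. 0 \<le> s --> s \<le> 1 / C --> closed (B s) \<and> (\<forall>p\<in>B s. dist p \<zeta> \<le> C * s)) \<and>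
   (\<forall>w. 0 < w --> w \<le> 1 / C --> (\<exists>\<phi>. is_bump (B w) \<zeta> (C * (w ^ CARD('d) / w ^ (2 * m))) \<phi>)) \<and>
   (\<forall>s h. 0 \<le> s --> 0 < h --> s + h \<le> 1 / C --> (\<exists>\<theta>. is_cutoff (B s) (B (s + h)) h C \<theta>))"

lemma cutoff_family_mono:
 assumes B: "cutoff_family C \<zeta> B" and C: "0 < C" "C \<le> C'"
 shows "cutoff_family C' \<zeta> B"
proof -
 have i: "x \<le> 1 / C" if "x \<le> 1 / C'" for x using that C by (meson divide_left_mono less_le_trans mult_pos_pos order_trans zero_le_one)
 have "is_bump (B w) \<zeta> (C' * (w ^ CARD('d) / w ^ (2 * m))) \<phi>"
  if "is_bump (B w) \<zeta> (C * (w ^ CARD('d) / w ^ (2 * m))) \<phi>" "0 < w" for w \<phi>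
  using that mult_right_mono[OF C(2), of "w ^ CARD('d) / w ^ (2 * m)"] by (auto simp: is_bump_def)
 moreover have "is_cutoff A B h C' \<theta>" if t: "is_cutoff A B h C \<theta>" for A B h \<theta>
 proof (unfold is_cutoff_def, intro conjI allI impI)
  fix v assume v: "sampled h v h"
  show "E (%p. \<theta> p * v p) (%p. \<theta> p * v p) \<le> C' * E v v"
   by (rule order_trans[OF _ mult_right_mono[OF C(2) E_nonneg]]) (use t v in \<open>simp_all add: is_cutoff_def sampled_def\<close>)
 qed (use t in \<open>simp_all add: is_cutoff_def\<close>)
 moreover have "dist p \<zeta> \<le> C' * s" if "dist p \<zeta> \<le> C * s" "0 \<le> s" for p s
  using that mult_right_mono[OF C(2)] order_trans by blast
 ultimately show ?thesis using B i unfolding cutoff_family_def by meson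
qed

lemma cutoff_family_local:
 assumes p: "patch c x0 r"
 shows "\<exists>C>0. \<forall>\<zeta>. in_patch \<zeta> c x0 r --> (\<exists>B. cutoff_family C \<zeta> B)"
proof -
 define K where "K = box_nhd x0 (2 * r)"
 note c = patchD(1)[OF p] and r = patchD(2)[OF p] and K = patchD(5,6)[OF p, folded K_def]
 from cutoff_energy[OF p] obtain C1 h0 where C1: "C1 > 0" "h0 > 0"
  and ce: "\<forall>v h y \<kappa>. sampled h0 v h --> box_nhd y ((\<kappa> + 1) * h) \<subseteq> K -->
  E (%p. lift c (cutoff y h \<kappa>) p * v p) (%p. lift c (cutoff y h \<kappa>) p * v p) \<le> C1 * E v v" unfolding K_def by (elim exE conjE)
 from bump_energy[OF p] obtain C2 where C2: "C2 > 0"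
  and be: "\<forall>w y. 0 < w --> w \<le> 1 --> box_nhd y w \<subseteq> K -->
  E (lift c (cutoff y w 0)) (lift c (cutoff y w 0)) \<le> C2 * (w ^ CARD('d) / w ^ (2 * m))" unfolding K_def by (elim exE conjE)
 from dist_le_coord[OF c K(2)[unfolded K_def]] obtain C3 where C3: "C3 > 0" and
  dc: "\<forall>x\<in>K. \<forall>y\<in>K. dist (param c x) (param c y) \<le> C3 * norm (x - y)" unfolding K_def by (elim exE conjE)
 \<comment> \<open>A sum, so as to exceed every single constant; the reciprocals ensure that radii
   up to 1/C respect the threshold h0, the patch size r and the bound 1 of
   \<open>bump_energy\<close>.\<close>
 define C where "C = C1 + C2 + C3 * real CARD('d) + 1 / h0 + 1 / r + 1"
 have nn: "0 \<le> C3 * real CARD('d)" "0 < 1 / h0" "0 < 1 / r" using C3 C1 r by auto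
 have C: "C > 0" "C1 \<le> C" "C2 \<le> C" "C3 * real CARD('d) \<le> C" "1 / h0 \<le> C" "1 / r \<le> C" "1 \<le> C"
  unfolding C_def using C1 C2 nn by linarith+
 have iC: "x \<le> h0" "x \<le> r" "x \<le> 1" if "x \<le> 1 / C" for x
 proof -
  have "1 / C \<le> h0" "1 / C \<le> r" "1 / C \<le> 1" using C C1 r by (auto simp: field_simps)
  then show "x \<le> h0" "x \<le> r" "x \<le> 1" using that by linarith+
 qed
 have "\<exists>B. cutoff_family C \<zeta> B" if z: "in_patch \<zeta> c x0 r" for \<zeta>
 proof -
  define y where "y = coord c \<zeta>"
  have zc: "\<zeta> \<in> cdom c" and y: "y \<in> box_nhd x0 r" using z by (auto simp: in_patch_def y_def)
  have py: "param c y = \<zeta>" using chart_inv[OF c] zc by (simp add: y_def)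
  have bs: "box_nhd y s \<subseteq> K" if "s \<le> r" for s
  proof
   fix x assume x: "x \<in> box_nhd y s"
   have "\<bar>x $ i - x0 $ i\<bar> \<le> 2 * r" for i
   proof -
    have "\<bar>x $ i - y $ i\<bar> \<le> s" "\<bar>y $ i - x0 $ i\<bar> \<le> r" using x y by (auto simp: box_nhd_def)
    then show ?thesis using that by linarith
   qed
   then show "x \<in> K" by (simp add: K_def box_nhd_def)
  qed
  have yK: "y \<in> K" using bs[of 0] r by auto
  have yi: "y \<in> img c" using yK K by blast
  define B where "B = (%s. param c ` box_nhd y s)"
  show ?thesis unfolding cutoff_family_def
  proof (rule exI[of _ B], intro conjI allI impI)
   fix s assume s: "0 \<le> s" "s \<le> 1 / C"
   note bK = bs[OF iC(2)[OF s(2)]]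
   show "closed (B s)" unfolding B_def
    by (intro compact_imp_closed compact_param_image[OF c compact_box_nhd]) (use bK K in auto)
   show "\<forall>p\<in>B s. dist p \<zeta> \<le> C * s"
   proof
    fix p assume "p \<in> B s"
    then obtain x where x: "x \<in> box_nhd y s" "p = param c x" unfolding B_def by (rule imageE)
    have "dist p \<zeta> \<le> C3 * norm (x - y)" using dc x bK yK by (auto simp: py[symmetric])
    also have "... \<le> C3 * (real CARD('d) * s)" using C3 by (intro mult_left_mono norm_box_nhd_le x) auto
    also have "... \<le> C * s" using mult_right_mono[OF C(4) s(1)] by (simp add: mult.assoc)
    finally show "dist p \<zeta> \<le> C * s" .
   qed
  next
   show "mono B" unfolding B_def by (intro monoI image_mono box_nhd_mono)
  next
   fix w assume w: "0 < w" "w \<le> 1 / C"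
   note bK = bs[OF iC(2)[OF w(2)]]
   have e0: "cutoff y w 0 x = 0" if "x \<notin> box_nhd y w" for x by (rule cutoff_eq_0[OF w(1)]) (use that in auto)
   have "lift c (cutoff y w 0) \<zeta> = 1" using lift_param[OF c yi, of "cutoff y w 0"] cutoff_eq_1[OF w(1), of y y 0] by (simp add: py)
   then have "is_bump (B w) \<zeta> (C * (w ^ CARD('d) / w ^ (2 * m))) (lift c (cutoff y w 0))"
    using be[rule_format, OF w(1) iC(3)[OF w(2)] bK] mult_right_mono[OF C(3), of "w ^ CARD('d) / w ^ (2 * m)"] w
     supported_lift[OF c compact_box_nhd order_trans[OF bK K(2)] smooth_on_cutoff e0]
    by (simp add: is_bump_def supported_def B_def)
   then show "\<exists>\<phi>. is_bump (B w) \<zeta> (C * (w ^ CARD('d) / w ^ (2 * m))) \<phi>" by (intro exI)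
  next
   fix s h assume s: "0 \<le> s" "0 < h" "s + h \<le> 1 / C"
   note bK = bs[OF iC(2)[OF s(3)]]
   have k: "(s / h + 1) * h = s + h" "s / h * h = s" using s by (auto simp: field_simps)
   have e0: "cutoff y h (s / h) x = 0" if "x \<notin> box_nhd y (s + h)" for x by (rule cutoff_eq_0[OF s(2)]) (use that k in auto)
   have e1: "lift c (cutoff y h (s / h)) p = 1" if "p \<in> B s" for p
   proof -
    obtain x where x: "x \<in> box_nhd y s" "p = param c x" using \<open>p \<in> B s\<close> unfolding B_def by (rule imageE)
    have "x \<in> img c" using x(1) bK K(2) box_nhd_mono[of s "s + h" y] s by auto
    then show ?thesis using lift_param[OF c, of x] cutoff_eq_1[OF s(2), of x y "s / h"] x k by simp
   qed
   have hh: "h \<le> h0" using iC(1)[OF s(3)] s by simp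
   have "E (%p. lift c (cutoff y h (s / h)) p * v p) (%p. lift c (cutoff y h (s / h)) p * v p) \<le> C * E v v"
    if v: "sampled h v h" for v
    using ce[rule_format, OF sampled_mono[OF v hh], of y "s / h"] bK mult_right_mono[OF C(2) E_nonneg[of v]] v k by (simp add: sampled_def)
   then have "is_cutoff (B s) (B (s + h)) h C (lift c (cutoff y h (s / h)))"
    using e1 supported_lift[OF c compact_box_nhd order_trans[OF bK K(2)] smooth_on_cutoff e0]
    by (simp add: is_cutoff_def supported_def B_def)
   then show "\<exists>\<theta>. is_cutoff (B s) (B (s + h)) h C \<theta>" by (intro exI)
  qed
 qed
 then show ?thesis using C(1) by blast
qed

lemma cutoff_family_global: "\<exists>C\<ge>1. \<forall>\<zeta>. \<exists>B. cutoff_family C \<zeta> B"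
proof -
 define P where "P = patches"
 note P = patches[folded P_def]
 define A where "A = (%C (c, x0, r). \<forall>\<zeta>. in_patch \<zeta> c x0 r --> (\<exists>B. cutoff_family C \<zeta> B))"
 have "\<exists>C>0. \<forall>t\<in>P. A C t"
 proof (rule uniform_constant[OF P(1)])
  fix t assume "t \<in> P"
  then show "\<exists>C>0. A C t" using P(2) cutoff_family_local by (cases t) (auto simp: A_def)
 next
  fix C C' t assume "A C t" "0 < C" "C \<le> C'"
  then show "A C' t" using cutoff_family_mono by (cases t) (simp add: A_def, meson)
 qed
 then obtain C where C: "C > 0" "\<forall>t\<in>P. A C t" by (elim exE conjE)
 have "\<exists>B. cutoff_family (max C 1) \<zeta> B" for \<zeta>
 proof -
  have "\<exists>B. cutoff_family C \<zeta> B" using P(3)[rule_format, of \<zeta>] C(2) by (auto simp: A_def)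
  then show ?thesis using cutoff_family_mono[OF _ C(1), of \<zeta> _ "max C 1"] by auto
 qed
 then show ?thesis by (intro exI[of _ "max C 1"]) simp
qed

text \<open>Each step moves the approximant towards the near-minimiser \<open>s\<close> by a fixed fraction of the
 cut-off difference; its energy excess contracts while its support grows by one layer.\<close>

lemma local_interpolants:
 assumes C: "C \<ge> 1"
  and B: "\<And>s. 0 \<le> s ==> s \<le> r0 ==> closed (B s)" "mono B"
  and cut: "\<And>s. 0 \<le> s ==> s + h \<le> r0 ==> \<exists>\<theta>. is_cutoff (B s) (B (s + h)) h C \<theta>"
  and h: "h > 0" and X: "\<And>p. \<exists>q\<in>X. dist p q \<le> h"
  and s: "smf s" "\<And>x. x \<in> X ==> s x = d x" "E s s \<le> D + \<epsilon>"
  and f0: "smf f0" "\<And>x. x \<in> X ==> f0 x = d x" "\<And>p. p \<notin> B w ==> f0 p = 0" and w: "w \<ge> 0" and D: "D \<ge> 0" "\<epsilon> \<ge> 0"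
 shows "w + real n * h \<le> r0 ==> \<exists>f. smf f \<and> (\<forall>x\<in>X. f x = d x) \<and> (\<forall>p. p \<notin> B (w + real n * h) --> f p = 0) \<and>
  E f f - D \<le> (1 - 1 / C) ^ n * E f0 f0 + \<epsilon>"
proof (induction n)
 case 0
 show ?case using f0 D by (intro exI[of _ f0]) auto
next
 case (Suc n)
 \<comment> \<open>With \<tau> C = 1 the quadratic term \<tau>^2 E g g is at most \<tau> E v v. The
   new energy is then at most (1 - \<tau>) E f f + \<tau> E s s, which is the contraction by 1 -
   1/C.\<close>
 define \<tau> where "\<tau> = 1 / C"
 have tau: "\<tau> > 0" "\<tau> \<le> 1" "\<tau> * C = 1" using C by (auto simp: \<tau>_def)
 define u where "u = w + real n * h"
 have u: "0 \<le> u" "u + h \<le> r0" "w + real (Suc n) * h = u + h" using Suc.prems w h by (auto simp: u_def algebra_simps)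
 from Suc.IH u h obtain f where f: "smf f" "\<forall>x\<in>X. f x = d x" "\<forall>p. p \<notin> B u --> f p = 0" "E f f - D \<le> (1 - \<tau>) ^ n * E f0 f0 + \<epsilon>"
  by (auto simp: u_def \<tau>_def)
 from cut[OF u(1,2)] obtain \<theta> where t: "smf \<theta>" "\<forall>p\<in>B u. \<theta> p = 1" "\<forall>p. p \<notin> B (u + h) --> \<theta> p = 0"
  "\<forall>v. sampled h v h --> E (%p. \<theta> p * v p) (%p. \<theta> p * v p) \<le> C * E v v" unfolding is_cutoff_def by (elim exE conjE)
 define v where "v = (%p. s p - f p)"
 have v: "smf v" unfolding v_def by (rule smf_diff[OF s(1) f(1)])
 have vX: "v x = 0" if "x \<in> X" for x using that s(2) f(2) by (simp add: v_def)
 have zv: "sampled h v h" unfolding sampled_def using X vX v h by blast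
 define g where "g = (%p. \<theta> p * v p)"
 have g: "smf g" unfolding g_def by (rule smf_mult[OF t(1) v])
 have Eg: "E g g \<le> C * E v v" unfolding g_def using t(4) zv by simp
 \<comment> \<open>Off the closed set B u the function f vanishes on an open set, hence so does L f;
   on B u the cut-off is 1. So cutting off v does not change its pairing with f.\<close>
 have loc: "E f g = E f v"
 proof -
  have "L f p = 0" if "p \<notin> B u" for p
   by (rule L_zero[of "- B u"]) (use B(1)[of u] u h f(3) that in auto)
  then have "g p * L f p = v p * L f p" for p using t(2) by (cases "p \<in> B u") (auto simp: g_def)
  then have "E g f = E v f" unfolding E_def by (simp only:)
  then show ?thesis using E_sym[OF f(1)] g v by simp
 qed
 have "s = (%p. f p + 1 * v p)" by (simp add: v_def)
 then have Es: "E s s = E f f + 2 * E f v + E v v" using E_comb[OF f(1) v, of 1] by simp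
 define f' where "f' = (%p. f p + \<tau> * g p)"
 have f': "smf f'" unfolding f'_def by (rule smf_add[OF f(1) smf_cmult[OF g]])
 have "E f' f' = E f f + 2 * \<tau> * E f v + \<tau>\<^sup>2 * E g g" unfolding f'_def E_comb[OF f(1) g] loc ..
 also have "... \<le> E f f + 2 * \<tau> * E f v + \<tau>\<^sup>2 * (C * E v v)" using Eg by (intro add_left_mono mult_left_mono) auto
 also have "\<tau>\<^sup>2 * (C * E v v) = \<tau> * (\<tau> * C) * E v v" by (simp add: power2_eq_square)
 also have "E f f + 2 * \<tau> * E f v + \<tau> * (\<tau> * C) * E v v = E f f + \<tau> * (E s s - E f f)" unfolding tau(3) Es by (simp add: algebra_simps)
 finally have "E f' f' - D \<le> (1 - \<tau>) * (E f f - D) + \<tau> * (E s s - D)" by (simp add: algebra_simps)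
 also have "... \<le> (1 - \<tau>) * ((1 - \<tau>) ^ n * E f0 f0 + \<epsilon>) + \<tau> * \<epsilon>"
  using tau s(3) by (intro add_mono mult_left_mono f(4)) auto
 also have "... = (1 - \<tau>) ^ Suc n * E f0 f0 + \<epsilon>" by (simp add: algebra_simps)
 finally have "E f' f' - D \<le> (1 - \<tau>) ^ Suc n * E f0 f0 + \<epsilon>" .
 moreover have "f' x = d x" if "x \<in> X" for x using that f(2) vX by (simp add: f'_def g_def)
 moreover have "f' p = 0" if "p \<notin> B (u + h)" for p
 proof -
  have "p \<notin> B u" using that monoD[OF B(2), of u "u + h"] h by auto
  then show ?thesis using that f(3) t(3) by (simp add: f'_def g_def)
 qed
 ultimately show ?case unfolding u(3) using f' by (intro exI[of _ f']) (auto simp: \<tau>_def)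
qed

end

subsection \<open>The kernel and its functionals\<close>

lemma summable_CS:
 fixes a b :: "nat => real"
 assumes a: "\<And>n. (\<Sum>i<n. (a i)\<^sup>2) \<le> A" and b: "\<And>n. (\<Sum>i<n. (b i)\<^sup>2) \<le> B" and s: "(%i. a i * b i) sums S"
 shows "S\<^sup>2 \<le> A * B"
proof -
 have A: "A \<ge> 0" using a[of 0] by simp
 have bd: "(\<Sum>i<n. a i * b i)\<^sup>2 \<le> A * B" for n
 proof -
  have "(\<Sum>i<n. a i * b i)\<^sup>2 \<le> (\<Sum>i<n. (a i)\<^sup>2) * (\<Sum>i<n. (b i)\<^sup>2)" by (rule Cauchy_Schwarz_ineq_sum)
  also have "... \<le> A * B" by (intro mult_mono a b A sum_nonneg) auto
  finally show ?thesis .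
 qed
 have "(%n. (\<Sum>i<n. a i * b i)\<^sup>2) \<longlonglongrightarrow> S\<^sup>2" using s unfolding sums_def by (rule tendsto_power)
 then show ?thesis by (rule LIMSEQ_le_const2) (simp add: bd)
qed

text \<open>The alternative of linear algebra on finitely many points: either the data are attained
  by the linear space S, or a functional kills S but not the data. Induction on the points,
  splitting off a function with value 1 at the new point if there is one.\<close>

lemma finite_separation:
 fixes S :: "('a => real) set" and d :: "'a => real"
 assumes X: "finite X" and S: "(%x. 0) \<in> S" "\<And>u v t. u \<in> S ==> v \<in> S ==> (%x. u x + t * v x) \<in> S"
 shows "(\<exists>v\<in>S. \<forall>x\<in>X. v x = d x) \<or> (\<exists>B. (\<forall>v\<in>S. (\<Sum>x\<in>X. B x * v x) = 0) \<and> (\<Sum>x\<in>X. B x * d x) \<noteq> 0)"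
 using X S
proof (induction X arbitrary: S d rule: finite_induct)
 case empty
 then show ?case by blast
next
 case (insert x F)
 have upd: "(\<Sum>y\<in>insert x F. (B(x := b)) y * v y) = b * v x + (\<Sum>y\<in>F. B y * v y)" for B v :: "'a => real" and b
  using insert.hyps by (simp add: sum.insert) (rule sum.cong, auto)
 show ?case
 proof (cases "\<exists>v\<in>S. v x \<noteq> 0")
  case True
  then obtain v1 where v1: "v1 \<in> S" "v1 x \<noteq> 0" by blast
  define v0 where "v0 = (%y. 0 + (1 / v1 x) * v1 y)"
  have v0: "v0 \<in> S" unfolding v0_def by (rule insert.prems(2)[OF insert.prems(1) v1(1)])
  have v01: "v0 x = 1" using v1(2) by (simp add: v0_def)
  note v0 = v0 v01
  define S' where "S' = {v\<in>S. v x = 0}"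
  define d' where "d' = (%y. d y - d x * v0 y)"
  have S'0: "(%x. 0) \<in> S'" using insert.prems(1) by (simp add: S'_def)
  have S'1: "(%x. u x + t * v x) \<in> S'" if "u \<in> S'" "v \<in> S'" for u v t
   using that insert.prems(2)[of u v t] by (simp add: S'_def)
  from insert.IH[of S' d', OF S'0 S'1]
  consider v where "v \<in> S'" "\<forall>y\<in>F. v y = d' y" | B where "\<forall>v\<in>S'. (\<Sum>y\<in>F. B y * v y) = 0" "(\<Sum>y\<in>F. B y * d' y) \<noteq> 0" by blast
  then show ?thesis
  proof cases
   case 1
   then have "(%y. v y + d x * v0 y) \<in> S" using insert.prems(2)[of v v0 "d x"] v0 by (simp add: S'_def)
   moreover have "\<forall>y\<in>insert x F. v y + d x * v0 y = d y" using 1 v0 by (simp add: S'_def d'_def)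
   ultimately show ?thesis by (intro disjI1 bexI[of _ "%y. v y + d x * v0 y"])
  next
   case 2
   \<comment> \<open>The weight at the new point is chosen so that the functional kills v0 as well;
     S is spanned by v0 and the functions vanishing at x.\<close>
   define b where "b = - (\<Sum>y\<in>F. B y * v0 y)"
   have "(\<Sum>y\<in>insert x F. (B(x := b)) y * v y) = 0" if v: "v \<in> S" for v
   proof -
    have "(%y. v y + (- v x) * v0 y) \<in> S'" using insert.prems(2)[OF v v0(1), of "- v x"] v0 by (simp add: S'_def)
    from bspec[OF 2(1) this] have "(\<Sum>y\<in>F. B y * (v y + (- v x) * v0 y)) = 0" .
    then show ?thesis unfolding upd by (simp add: b_def algebra_simps sum.distrib sum_subtractf sum_distrib_left)
   qed
   moreover have "(\<Sum>y\<in>insert x F. (B(x := b)) y * d y) \<noteq> 0"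
    unfolding upd using 2(2) by (simp add: b_def d'_def algebra_simps sum_subtractf sum_distrib_left)
   ultimately show ?thesis by (intro disjI2 exI[of _ "B(x := b)"] conjI ballI)
  qed
 next
  case False
  then have z: "v x = 0" if "v \<in> S" for v using that by blast
  show ?thesis
  proof (cases "d x = 0")
   case True
   from insert.IH[of S d, OF insert.prems(1,2)]
   consider v where "v \<in> S" "\<forall>y\<in>F. v y = d y" | B where "\<forall>v\<in>S. (\<Sum>y\<in>F. B y * v y) = 0" "(\<Sum>y\<in>F. B y * d y) \<noteq> 0" by blast
   then show ?thesis
   proof cases
    case 1
    then show ?thesis using z[of v] True by (intro disjI1 bexI[of _ v]) auto
   next
    case 2
    then show ?thesis by (intro disjI2 exI[of _ "B(x := 0)"]) (simp only: upd, simp)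
   qed
  next
   case False
   then show ?thesis by (intro disjI2 exI[of _ "(%_. 0)(x := 1)"]) (simp only: upd, simp add: z)
  qed
 qed
qed

section \<open>Eigenvalue growth and the eigenfunction expansion of the kernel\<close>

context polyharmonic_space begin

lemma smf_psum: "smf (psum a n)" unfolding psum_def[abs_def] by (intro smf_sum smf_cmult smf_psi)

text \<open>The embedding is tested on the function with coefficients \<psi> i x / mu i ^ m,
  extremal for evaluation at x: its value at x and its squared norm are the same number S, so S^2
  \<le> C S.\<close>

lemma psi_sup_sum: "\<exists>C>0. \<forall>x n. (\<Sum>i<n. (\<psi> i x)\<^sup>2 / mu i ^ m) \<le> C"
proof -
 from sup_bound[OF dim] obtain C where C: "C > 0" "\<forall>f. smf f --> (\<forall>p. (f p)\<^sup>2 \<le> C * H m f)" by (elim exE conjE)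
 have mp: "mu i ^ m > 0" for i using mu_ge_1[of i] by simp
 have "(\<Sum>i<n. (\<psi> i x)\<^sup>2 / mu i ^ m) \<le> C" for x n
 proof -
  define a where "a = (%i. \<psi> i x / mu i ^ m)"
  define S where "S = (\<Sum>i<n. (\<psi> i x)\<^sup>2 / mu i ^ m)"
  have S0: "S \<ge> 0" unfolding S_def using mp by (intro sum_nonneg divide_nonneg_nonneg) (auto intro: less_imp_le)
  have "psum a n x = S" by (simp add: psum_def a_def S_def power2_eq_square)
  moreover have "H m (psum a n) = S"
  proof -
   have "H m (psum a n) = (\<Sum>i<n. mu i ^ m * (cf (psum a n) i)\<^sup>2)"
    unfolding H_def by (rule suminf_finite) (auto simp: cf_psum)
   also have "... = S" unfolding S_def
    by (rule sum.cong[OF refl]) (use mu_ge_1 mp in \<open>simp add: cf_psum a_def power2_eq_square less_imp_neq[symmetric]\<close>)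
   finally show ?thesis .
  qed
  ultimately have "S\<^sup>2 \<le> C * S" using C(2)[rule_format, OF smf_psum[of a n], of x] by simp
  then show ?thesis unfolding S_def[symmetric] using S0 C(1) by (cases "S = 0") (auto simp: power2_eq_square)
 qed
 then show ?thesis using C(1) by blast
qed

text \<open>Integrating \<open>psi_sup_sum\<close> over the manifold shows that the sum of mu^(-m)
  converges, so mu tends to infinity. Then c mu^m - D \<le> q yields the bound for all but finitely
  many j, and the remaining ones off J are settled by q > 0.\<close>

lemma mu_le_q: "\<exists>T>0. \<forall>j. j \<notin> J --> mu j ^ m \<le> T * q j"
proof -
 from psi_sup_sum obtain C where C: "C > 0" "\<forall>x n. (\<Sum>i<n. (\<psi> i x)\<^sup>2 / mu i ^ m) \<le> C" by (elim exE conjE)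
 have mp: "mu i ^ m > 0" for i using mu_ge_1[of i] by simp
 have "(\<Sum>i<n. 1 / mu i ^ m) \<le> (\<integral>x. C \<partial>\<mu>)" for n
 proof -
  have "(\<Sum>i<n. 1 / mu i ^ m) = (\<Sum>i<n. (\<integral>x. (\<psi> i x)\<^sup>2 / mu i ^ m \<partial>\<mu>))"
   using psi_orth by (simp add: power2_eq_square)
  also have "... = (\<integral>x. (\<Sum>i<n. (\<psi> i x)\<^sup>2 / mu i ^ m) \<partial>\<mu>)"
   by (rule Bochner_Integration.integral_sum[symmetric]) (intro cont_int continuous_intros cont_psi, use mp less_irrefl in metis)
  also have "... \<le> (\<integral>x. C \<partial>\<mu>)"
   by (intro integral_mono cont_int continuous_intros cont_psi) (use C mp less_irrefl in metis)+
  finally show ?thesis .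
 qed
 then have "summable (%i. 1 / mu i ^ m)" using mp by (intro summableI_nonneg_bounded) (auto intro: less_imp_le)
 then have lim: "(%i. 1 / mu i ^ m) \<longlonglongrightarrow> 0" by (rule summable_LIMSEQ_zero)
 from q_lower obtain c D where c: "c > 0" "D \<ge> 0" "\<forall>i. c * mu i ^ m - D \<le> q i" by (elim exE conjE)
 have "c / (2 * (D + 1)) > 0" using c by simp
 then obtain N where N: "\<forall>i\<ge>N. 1 / mu i ^ m < c / (2 * (D + 1))"
  using order_tendstoD(2)[OF lim] unfolding eventually_sequentially by blast
 define F where "F = {j. j < N \<and> j \<notin> J}"
 have fF: "finite F" by (simp add: F_def)
 define T where "T = (\<Sum>j\<in>F. mu j ^ m / q j) + 2 / c"
 have t: "0 \<le> mu j ^ m / q j" if "j \<in> F" for j using that q_pos[of j] mp[of j] by (simp add: F_def)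
 have s0: "(\<Sum>j\<in>F. mu j ^ m / q j) \<ge> 0" by (rule sum_nonneg[OF t])
 have "mu j ^ m \<le> T * q j" if j: "j \<notin> J" for j
 proof (cases "j < N")
  case True
  then have "mu j ^ m / q j \<le> (\<Sum>j\<in>F. mu j ^ m / q j)" using j by (intro member_le_sum fF t) (auto simp: F_def)
  also have "... \<le> T" using c by (simp add: T_def)
  finally show ?thesis using q_pos[OF j] by (simp add: field_simps)
 next
  case False
  then have "1 / mu j ^ m < c / (2 * (D + 1))" using N by simp
  then have "2 * (D + 1) < c * mu j ^ m" using mp[of j] c by (simp add: field_simps)
  moreover have "Y \<le> 2 * z" if "2 * (D + 1) < Y" "Y - D \<le> z" for Y z :: real using that by (simp add: algebra_simps)
  ultimately have "c * mu j ^ m \<le> 2 * q j" using spec[OF c(3), of j] by blast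
  then have "mu j ^ m \<le> 2 / c * q j" using c by (simp add: field_simps)
  also have "... \<le> T * q j" using s0 q_pos[OF j] by (intro mult_right_mono) (auto simp: T_def)
  finally show ?thesis .
 qed
 moreover have "T > 0" using s0 c by (simp add: T_def add_nonneg_pos)
 ultimately show ?thesis by blast
qed

text \<open>The eigenvalues of the Green operator: inverse to q off J, and 0 on J.\<close>

definition r :: "nat => real" where "r j = (if j \<in> J then 0 else 1 / q j)"

lemma r_nonneg: "r j \<ge> 0" using q_nonneg by (simp add: r_def)
lemma r_q: "j \<notin> J ==> r j * q j = 1" using q_pos[of j] by (simp add: r_def)

lemma r_sup_sum: "\<exists>C>0. \<forall>x n. (\<Sum>i<n. r i * (\<psi> i x)\<^sup>2) \<le> C"
proof -
 from psi_sup_sum obtain C where C: "C > 0" "\<forall>x n. (\<Sum>i<n. (\<psi> i x)\<^sup>2 / mu i ^ m) \<le> C" by (elim exE conjE)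
 from mu_le_q obtain T where T: "T > 0" "\<forall>j. j \<notin> J --> mu j ^ m \<le> T * q j" by (elim exE conjE)
 have mp: "mu i ^ m > 0" for i using mu_ge_1[of i] by simp
 have rb: "r i \<le> T / mu i ^ m" for i
  using T q_pos[of i] mp[of i] by (auto simp: r_def field_simps)
 have "(\<Sum>i<n. r i * (\<psi> i x)\<^sup>2) \<le> T * C" for x n
 proof -
  have "(\<Sum>i<n. r i * (\<psi> i x)\<^sup>2) \<le> (\<Sum>i<n. T * ((\<psi> i x)\<^sup>2 / mu i ^ m))"
   using mult_right_mono[OF rb, of "(\<psi> _ x)\<^sup>2"] by (intro sum_mono) auto
  also have "... = T * (\<Sum>i<n. (\<psi> i x)\<^sup>2 / mu i ^ m)" by (simp add: sum_distrib_left)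
  also have "... \<le> T * C" using C(2) T(1) by (intro mult_left_mono) auto
  finally show ?thesis .
 qed
 then show ?thesis using C(1) T(1) by (intro exI[of _ "T * C"]) auto
qed

lemma cont_k: "contM (k x)"
proof -
 have "continuous_on UNIV (%y. (x, y))" by (intro continuous_intros)
 from continuous_on_compose2[OF cont_kernel this] show ?thesis by simp
qed

lemma reproduce:
 assumes f: "smf f"
 shows "(%j. if j \<in> J then 0 else cf (k x) j * (q j * cf f j)) sums (f x - (\<Sum>j\<in>J. cf f j * \<psi> j x))"
proof -
 define p where "p = (%x. \<Sum>j\<in>J. cf f j * \<psi> j x)"
 have pe: "eigenproj \<mu> \<psi> J f = p" by (simp add: eigenproj_def p_def cf_def fun_eq_iff)
 have ps: "smf p" unfolding p_def by (intro smf_sum smf_cmult smf_psi)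
 have cp: "cf p i = (if i \<in> J then cf f i else 0)" for i
 proof -
  have "cf p i = (\<Sum>j\<in>J. cf f j * cf (\<psi> j) i)" unfolding p_def
   by (subst cf_sum) (auto intro!: continuous_intros cont_psi simp: cf_cmult)
  then show ?thesis using fin_J by (simp add: cf_psi if_distrib[where f="%z. _ * z"] cong: if_cong)
 qed
 define g where "g = (%x. f x - p x)"
 have g: "smf g" unfolding g_def by (rule smf_diff[OF f ps])
 have cg: "cf g i = (if i \<in> J then 0 else cf f i)" for i
  unfolding g_def using cf_diff[OF smf_continuous[OF f] smf_continuous[OF ps]] cp by simp
 have "f x = (\<integral>\<alpha>. k x \<alpha> * L g \<alpha> \<partial>\<mu>) + p x"
 proof -
  have "\<forall>f. smf f --> (\<forall>x. f x = (\<integral>\<alpha>. k x \<alpha> * L (%y. f y - eigenproj \<mu> \<psi> J f y) \<alpha> \<partial>\<mu>) + eigenproj \<mu> \<psi> J f x)"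
   using kernel unfolding polyharmonic_kernel_def by (elim conjE)
  from this[rule_format, OF f, of x] show ?thesis unfolding pe g_def .
 qed
 moreover have "(%j. cf (k x) j * cf (L g) j) sums (\<integral>\<alpha>. k x \<alpha> * L g \<alpha> \<partial>\<mu>)"
  by (rule parseval2[OF cont_k smf_continuous[OF smf_L[OF g]]])
 ultimately have "(%j. cf (k x) j * (q j * cf g j)) sums (f x - p x)" by (simp add: cf_L g)
 moreover have "(%j. cf (k x) j * (q j * cf g j)) = (%j. if j \<in> J then 0 else cf (k x) j * (q j * cf f j))"
  by (auto simp: cg fun_eq_iff)
 ultimately show ?thesis by (simp add: p_def)
qed

text \<open>The reproducing identity applied to the eigenfunction \<psi> j leaves a single term. On
  J the coefficients of the kernel remain undetermined.\<close>

lemma cf_kernel: assumes j: "j \<notin> J" shows "cf (k x) j = r j * \<psi> j x"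
proof -
 have "(%i. if i \<in> J then 0 else cf (k x) i * (q i * cf (\<psi> j) i)) = (%i. if i = j then cf (k x) j * q j else 0)"
  using j by (auto simp: cf_psi fun_eq_iff)
 moreover have "(\<Sum>i\<in>J. cf (\<psi> j) i * \<psi> i x) = 0" using j by (intro sum.neutral) (auto simp: cf_psi)
 ultimately have "(%i. if i = j then cf (k x) j * q j else 0) sums \<psi> j x" using reproduce[OF smf_psi[of j], of x] by simp
 from sums_unique2[OF sums_single[of j "%_. cf (k x) j * q j"] this] have "cf (k x) j * q j = \<psi> j x" .
 then show ?thesis using q_pos[OF j] j by (simp add: r_def field_simps)
qed

lemma expansion:
 assumes f: "smf f"
 shows "(%j. if j \<in> J then 0 else cf f j * \<psi> j x) sums (f x - (\<Sum>j\<in>J. cf f j * \<psi> j x))"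
proof -
 have "(if j \<in> J then 0 else cf (k x) j * (q j * cf f j)) = (if j \<in> J then 0 else cf f j * \<psi> j x)" for j
 proof (cases "j \<in> J")
  case False
  have "cf (k x) j * (q j * cf f j) = (r j * q j) * (cf f j * \<psi> j x)" by (simp add: cf_kernel[OF False])
  then show ?thesis using r_q[OF False] False by simp
 qed simp
 then show ?thesis using reproduce[OF f, of x] by presburger
qed

text \<open>For fixed x the series converges uniformly in y, so its sum G is continuous and has the
  right coefficients off J. Completeness and \<open>continuous_AE_0\<close> identify it with the
  kernel up to a part in \<open>PJ\<close>, which annihilating coefficients remove later.\<close>

lemma kernel_expansion: "(%j. r j * \<psi> j x * \<psi> j y) sums (k x y - (\<Sum>j\<in>J. cf (k x) j * \<psi> j y))"
proof -
 from r_sup_sum obtain C where C: "C > 0" "\<forall>x n. (\<Sum>i<n. r i * (\<psi> i x)\<^sup>2) \<le> C" by (elim exE conjE)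
 define e where "e = (%i. r i * \<psi> i x)"
 have sx: "summable (%i. r i * (\<psi> i x)\<^sup>2)"
  using C r_nonneg by (intro summableI_nonneg_bounded[where x=C]) auto
 have cs: "(\<Sum>i\<in>I. e i * \<psi> i y)\<^sup>2 \<le> (\<Sum>i\<in>I. r i * (\<psi> i x)\<^sup>2) * (\<Sum>i\<in>I. r i * (\<psi> i y)\<^sup>2)" for I y
 proof -
  have "(\<Sum>i\<in>I. e i * \<psi> i y) = (\<Sum>i\<in>I. (sqrt (r i) * \<psi> i x) * (sqrt (r i) * \<psi> i y))"
  proof (rule sum.cong[OF refl])
   fix i
   have "(sqrt (r i) * \<psi> i x) * (sqrt (r i) * \<psi> i y) = (sqrt (r i) * sqrt (r i)) * \<psi> i x * \<psi> i y" by (simp only: mult_ac)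
   then show "e i * \<psi> i y = (sqrt (r i) * \<psi> i x) * (sqrt (r i) * \<psi> i y)" using r_nonneg[of i] by (simp add: e_def)
  qed
  then show ?thesis
   using Cauchy_Schwarz_ineq_sum[of "%i. sqrt (r i) * \<psi> i x" "%i. sqrt (r i) * \<psi> i y" I] r_nonneg
   by (simp add: power_mult_distrib)
 qed
 \<comment> \<open>Cauchy-Schwarz with weights r: the factor in x is a tail of a convergent series,
   the factor in y is bounded uniformly by \<open>r_sup_sum\<close>.\<close>
 have unif: "uniformly_Cauchy_on UNIV (%n y. psum e n y)"
 proof (rule uniformly_Cauchy_onI')
  fix \<epsilon> :: real assume eps: "\<epsilon> > 0"
  have "\<epsilon>\<^sup>2 / (C + 1) > 0" using eps C by simp
  with sx obtain N where N: "\<forall>a\<ge>N. \<forall>b. norm (\<Sum>i\<in>{a..<b}. r i * (\<psi> i x)\<^sup>2) < \<epsilon>\<^sup>2 / (C + 1)"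
   unfolding summable_Cauchy by blast
  show "\<exists>M. \<forall>y\<in>UNIV. \<forall>a\<ge>M. \<forall>b>a. dist (psum e a y) (psum e b y) < \<epsilon>"
  proof (intro exI[of _ N] ballI allI impI)
   fix y :: 'a and a b :: nat assume ab: "N \<le> a" "a < b"
   define s where "s = (\<Sum>i\<in>{a..<b}. r i * (\<psi> i x)\<^sup>2)"
   have s: "0 \<le> s" "s < \<epsilon>\<^sup>2 / (C + 1)" using N[rule_format, OF ab(1), of b] r_nonneg by (auto simp: s_def intro!: sum_nonneg)
   have "psum e b y - psum e a y = (\<Sum>i\<in>{a..<b}. e i * \<psi> i y)"
    unfolding psum_def using ab sum_diff_nat_ivl[of 0 a b "%i. e i * \<psi> i y"] by (simp add: atLeast0LessThan)
   then have "(psum e b y - psum e a y)\<^sup>2 \<le> s * (\<Sum>i\<in>{a..<b}. r i * (\<psi> i y)\<^sup>2)" using cs[of y "{a..<b}"] by (simp add: s_def)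
   also have "(\<Sum>i\<in>{a..<b}. r i * (\<psi> i y)\<^sup>2) \<le> (\<Sum>i<b. r i * (\<psi> i y)\<^sup>2)" using r_nonneg by (intro sum_mono2) auto
   also have "... \<le> C + 1" using C(2)[rule_format, of y b] by linarith
   finally have "(psum e b y - psum e a y)\<^sup>2 \<le> s * (C + 1)" using s(1) by (simp add: mult_left_mono)
   also have "... < \<epsilon>\<^sup>2" using s(2) C(1) by (simp add: field_simps)
   finally have "\<bar>psum e b y - psum e a y\<bar> < \<epsilon>" using eps abs_le_square_iff[of \<epsilon> "psum e b y - psum e a y"] by auto
   then show "dist (psum e a y) (psum e b y) < \<epsilon>" by (simp add: dist_real_def abs_minus_commute)
  qed
 qed
 from Cauchy_uniformly_convergent[OF this] obtain G where G: "uniform_limit UNIV (%n y. psum e n y) G sequentially"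
  unfolding uniformly_convergent_on_def by blast
 have Gc: "contM G" by (rule uniform_limit_theorem[OF _ G]) (auto intro!: always_eventually cont_psum)
 have Gl: "(%n. psum e n y) \<longlonglongrightarrow> G y" for y using tendsto_uniform_limitI[OF G] by simp
 have bd: "\<bar>psum e n y\<bar> \<le> C" for n y
 proof -
  have "(psum e n y)\<^sup>2 \<le> (\<Sum>i<n. r i * (\<psi> i x)\<^sup>2) * (\<Sum>i<n. r i * (\<psi> i y)\<^sup>2)" unfolding psum_def by (rule cs)
  also have "... \<le> C * C" using C r_nonneg by (intro mult_mono sum_nonneg) auto
  finally have "(psum e n y)\<^sup>2 \<le> C\<^sup>2" by (simp add: power2_eq_square)
  then show ?thesis using C(1) abs_le_square_iff[of "psum e n y" C] by simp
 qed
 have cG: "cf G j = e j" for j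
 proof -
  have [measurable]: "G \<in> borel_measurable \<mu>" "\<psi> j \<in> borel_measurable \<mu>" "psum e n \<in> borel_measurable \<mu>" for n
   by (intro cont_meas Gc cont_psi cont_psum)+
  have "(%n. cf (psum e n) j) \<longlonglongrightarrow> cf G j" unfolding cf_def
  proof (rule integral_dominated_convergence[where w="%y. C * \<bar>\<psi> j y\<bar>"])
   show "integrable \<mu> (%y. C * \<bar>\<psi> j y\<bar>)" by (intro cont_int continuous_intros cont_psi)
   show "AE y in \<mu>. (%n. psum e n y * \<psi> j y) \<longlonglongrightarrow> G y * \<psi> j y" by (intro AE_I2 tendsto_intros Gl)
   show "AE y in \<mu>. norm (psum e n y * \<psi> j y) \<le> C * \<bar>\<psi> j y\<bar>" for n
    by (intro AE_I2) (auto simp: abs_mult intro!: mult_right_mono bd)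
  qed measurable
  moreover have "(%n. cf (psum e n) j) \<longlonglongrightarrow> e j"
   by (rule tendsto_eventually) (rule eventually_mono[OF eventually_gt_at_top[of j]], simp add: cf_psum)
  ultimately show ?thesis by (rule LIMSEQ_unique)
 qed
 define f where "f = (%y. k x y - (\<Sum>j\<in>J. cf (k x) j * \<psi> j y) - G y)"
 have fc: "contM f" unfolding f_def by (intro continuous_intros cont_k cont_psi Gc)
 have "cf f i = 0" for i
 proof -
  have "cf f i = cf (k x) i - cf (%y. \<Sum>j\<in>J. cf (k x) j * \<psi> j y) i - cf G i"
   unfolding f_def by (subst cf_diff, (intro continuous_intros cont_k cont_psi Gc)+)+ (rule refl)
  also have "cf (%y. \<Sum>j\<in>J. cf (k x) j * \<psi> j y) i = (\<Sum>j\<in>J. cf (k x) j * cf (\<psi> j) i)"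
   by (subst cf_sum) (auto intro!: continuous_intros cont_psi simp: cf_cmult)
  also have "... = (if i \<in> J then cf (k x) i else 0)" using fin_J by (simp add: cf_psi if_distrib[where f="%z. _ * z"] cong: if_cong)
  finally show ?thesis using cf_kernel[of i x] by (auto simp: cG e_def r_def)
 qed
 then have "AE y in \<mu>. f y = 0"
  by (intro psi_complete cont_meas cont_int continuous_intros fc) (simp add: cf_def)
 then have "f y = 0" by (rule continuous_AE_0[OF fc])
 then have "G y = k x y - (\<Sum>j\<in>J. cf (k x) j * \<psi> j y)" by (simp add: f_def)
 then show ?thesis using Gl[of y] by (simp add: sums_def psum_def e_def)
qed

end

section \<open>Point functionals annihilating the eigenspan\<close>

context polyharmonic_space begin

definition fn :: "'a set => ('a => real) => ('a => real) => real" where "fn X A g = (\<Sum>\<xi>\<in>X. A \<xi> * g \<xi>)"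

abbreviation "quad X A \<equiv> fn X A (%\<eta>. fn X A (k \<eta>))"

abbreviation "PJ \<equiv> eigenspan \<psi> J"

lemma fn_add: "fn X A (%x. f x + g x) = fn X A f + fn X A g"
 by (simp add: fn_def sum.distrib distrib_left)

lemma eigenspan_comb: assumes "p \<in> PJ" "p' \<in> PJ" shows "(%x. p x + t * p' x) \<in> PJ"
proof -
 obtain c c' where "p = (%x. \<Sum>j\<in>J. c j * \<psi> j x)" "p' = (%x. \<Sum>j\<in>J. c' j * \<psi> j x)"
  using assms unfolding eigenspan_def by blast
 then have "(%x. p x + t * p' x) = (%x. \<Sum>j\<in>J. (c j + t * c' j) * \<psi> j x)"
  by (simp add: fun_eq_iff sum.distrib sum_distrib_left distrib_right mult.assoc)
 then show ?thesis unfolding eigenspan_def by (intro CollectI exI[of _ "%j. c j + t * c' j"] conjI TrueI)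
qed

lemma eigenspan_0: "(%x. 0) \<in> PJ"
 unfolding eigenspan_def by (intro CollectI exI[of _ "%j. 0"]) simp

lemma eigenspan_smf: "p \<in> PJ ==> smf p"
 unfolding eigenspan_def by (auto intro!: smf_sum smf_cmult smf_psi)

lemma psi_eigenspan: assumes j: "j \<in> J" shows "\<psi> j \<in> PJ"
proof -
 have "\<psi> j = (%x. \<Sum>i\<in>J. (if i = j then 1 else 0) * \<psi> i x)" using j fin_J by (simp add: if_distrib[where f="%z. z * _"] cong: if_cong)
 then show ?thesis unfolding eigenspan_def by (intro CollectI exI[of _ "%i. if i = j then 1 else 0"] conjI TrueI)
qed

lemma E_eigenspan: "p \<in> PJ ==> E f p = 0"
 using ann by (simp add: E_def)

lemma E_step:
 assumes f: "smf f" and g: "smf g"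
 shows "E (%x. f x + t * g x) (%x. f x + t * g x) \<le> E f f + \<bar>t\<bar> * (E f f + E g g) + t\<^sup>2 * E g g"
proof -
 have "2 * E f g \<le> E f f + E g g" "- (2 * E f g) \<le> E f f + E g g"
  using E_nonneg[OF smf_add[OF f smf_cmult[OF g]], of "-1"] E_nonneg[OF smf_add[OF f smf_cmult[OF g]], of 1]
   E_comb[OF f g, of 1] E_comb[OF f g, of "-1"] by auto
 then have "\<bar>2 * E f g\<bar> \<le> E f f + E g g" by (simp add: abs_le_iff)
 then have "\<bar>t\<bar> * \<bar>2 * E f g\<bar> \<le> \<bar>t\<bar> * (E f f + E g g)" by (intro mult_left_mono) auto
 moreover have "2 * t * E f g \<le> \<bar>t\<bar> * \<bar>2 * E f g\<bar>" using abs_ge_self[of "t * (2 * E f g)"] by (simp add: abs_mult)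
 ultimately show ?thesis unfolding E_comb[OF f g] by linarith
qed

text \<open>Smooth functions that are Kronecker deltas on X are taken as given; they correct
  interpolation errors and recover single coefficients from a functional. \<open>bumps\<close>
  supplies them later, from the separation of the points.\<close>

context
 fixes X :: "'a set" and \<phi> :: "'a => 'a => real"
 assumes X: "finite X" and bump: "\<And>\<xi>. \<xi> \<in> X ==> smf (\<phi> \<xi>)" "\<And>\<xi> x. \<xi> \<in> X ==> x \<in> X ==> \<phi> \<xi> x = (if x = \<xi> then 1 else 0)"
begin

lemma fn_bump: "\<xi> \<in> X ==> fn X A (\<phi> \<xi>) = A \<xi>"
 using X bump(2) by (simp add: fn_def if_distrib[where f="%z. _ * z"] cong: if_cong)

context
 fixes A :: "'a => real"
 assumes A: "annihilates X A PJ"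
begin

lemma fn_eigenspan: "p \<in> PJ ==> fn X A p = 0"
 using A by (simp add: annihilates_def fn_def)

lemma fn_psi: "j \<in> J ==> fn X A (\<psi> j) = 0" by (rule fn_eigenspan[OF psi_eigenspan])

text \<open>The pointwise expansion of g converges off J, and the component of g in
  \<open>PJ\<close> is invisible to an annihilating functional.\<close>

lemma fn_smooth: assumes g: "smf g" shows "(%j. fn X A (\<psi> j) * cf g j) sums fn X A g"
proof -
 define p where "p = (%x. \<Sum>j\<in>J. cf g j * \<psi> j x)"
 have "p \<in> PJ" unfolding p_def eigenspan_def by blast
 then have "fn X A (%x. g x - p x) = fn X A g" using fn_eigenspan[of p] by (simp add: fn_def sum_subtractf right_diff_distrib)
 moreover have "(%j. \<Sum>\<xi>\<in>X. A \<xi> * (if j \<in> J then 0 else cf g j * \<psi> j \<xi>)) sums fn X A (%x. g x - p x)"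
  unfolding fn_def p_def by (intro sums_sum sums_mult expansion g)
 moreover have "(\<Sum>\<xi>\<in>X. A \<xi> * (if j \<in> J then 0 else cf g j * \<psi> j \<xi>)) = fn X A (\<psi> j) * cf g j" for j
  using fn_psi[of j] by (cases "j \<in> J") (simp_all add: fn_def sum_distrib_left sum_distrib_right mult_ac)
 ultimately show ?thesis by simp
qed

lemma fn_kernel: "(%j. r j * fn X A (\<psi> j) * \<psi> j x) sums fn X A (k x)"
proof -
 define p where "p = (%y. \<Sum>j\<in>J. cf (k x) j * \<psi> j y)"
 have "p \<in> PJ" unfolding p_def eigenspan_def by blast
 then have "fn X A (%y. k x y - p y) = fn X A (k x)" using fn_eigenspan[of p] by (simp add: fn_def sum_subtractf right_diff_distrib)
 moreover have "(%j. \<Sum>\<xi>\<in>X. A \<xi> * (r j * \<psi> j x * \<psi> j \<xi>)) sums fn X A (%y. k x y - p y)"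
  unfolding fn_def p_def by (intro sums_sum sums_mult kernel_expansion)
 moreover have "(\<Sum>\<xi>\<in>X. A \<xi> * (r j * \<psi> j x * \<psi> j \<xi>)) = r j * fn X A (\<psi> j) * \<psi> j x" for j
  by (simp add: fn_def sum_distrib_left sum_distrib_right mult_ac)
 ultimately show ?thesis by simp
qed

lemma fn_quad: "(%j. r j * (fn X A (\<psi> j))\<^sup>2) sums quad X A"
proof -
 have "(%j. \<Sum>\<eta>\<in>X. A \<eta> * (r j * fn X A (\<psi> j) * \<psi> j \<eta>)) sums quad X A"
  unfolding fn_def[of X A "%\<eta>. fn X A (k \<eta>)"] by (intro sums_sum sums_mult fn_kernel)
 moreover have "(\<Sum>\<eta>\<in>X. A \<eta> * (r j * fn X A (\<psi> j) * \<psi> j \<eta>)) = r j * (fn X A (\<psi> j))\<^sup>2" for j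
 proof -
  have "(\<Sum>\<eta>\<in>X. A \<eta> * (r j * fn X A (\<psi> j) * \<psi> j \<eta>)) = r j * fn X A (\<psi> j) * fn X A (\<psi> j)"
   unfolding fn_def[of X A "\<psi> j"] by (simp only: sum_distrib_left mult_ac)
  then show ?thesis by (simp add: power2_eq_square)
 qed
 ultimately show ?thesis by simp
qed

text \<open>Conditional positive definiteness. A vanishing form makes the functional zero on every
  \<psi> j, hence on all smooth functions, and the bump at \<xi> reads off the coefficient.\<close>

lemma fn_zero:
 assumes "quad X A = 0" "\<xi> \<in> X"
 shows "A \<xi> = 0"
proof -
 have s: "(%j. r j * (fn X A (\<psi> j))\<^sup>2) sums 0" using fn_quad assms(1) by simp
 have "r j * (fn X A (\<psi> j))\<^sup>2 = 0" for j
  using suminf_eq_zero_iff[OF sums_summable[OF s]] sums_unique[OF s] r_nonneg by simp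
 then have "j \<notin> J ==> fn X A (\<psi> j) = 0" for j using r_q[of j] by (metis mult_eq_0_iff zero_neq_one power_eq_0_iff)
 then have "fn X A (\<psi> j) = 0" for j using fn_psi[of j] by blast
 then have "(%j. 0 * cf (\<phi> \<xi>) j) sums fn X A (\<phi> \<xi>)" using fn_smooth[OF bump(1)[OF assms(2)]] by simp
 then show ?thesis using fn_bump[OF assms(2)] by (simp add: sums_iff)
qed

text \<open>The functional g |-> \<open>fn X A g - E f g\<close> has coefficients \<alpha> j - q j f
  j; the weights sqrt r and sqrt q split it into a pairing, and F is its squared dual norm. For the
  coefficients of the Lagrange function and f with the same data, F becomes
  \<open>E f f - A \<zeta>\<close>, so F \<ge> 0 makes \<open>A \<zeta>\<close> a lower bound for
  the energy.\<close>

lemma energy_cauchy_schwarz: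
 assumes f: "smf f" and g: "smf g"
 defines "F \<equiv> quad X A - 2 * fn X A f + E f f"
 shows "(fn X A g - E f g)\<^sup>2 \<le> F * E g g" "F \<ge> 0"
proof -
 define \<alpha> where "\<alpha> = (%j. fn X A (\<psi> j))"
 define a where "a = (%j. sqrt (r j) * (\<alpha> j - q j * cf f j))"
 define b where "b = (%j. sqrt (q j) * cf g j)"
 have aJ: "\<alpha> j = 0" "q j = 0" "r j = 0" if "j \<in> J" for j using that fn_psi q_J by (auto simp: \<alpha>_def r_def)
 have ab: "\<alpha> j * cf g j - q j * cf f j * cf g j = a j * b j" for j
 proof (cases "j \<in> J")
  case False
  have "a j * b j = (sqrt (r j) * sqrt (q j)) * ((\<alpha> j - q j * cf f j) * cf g j)" by (simp add: a_def b_def mult_ac)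
  also have "sqrt (r j) * sqrt (q j) = 1" using r_q[OF False] by (simp add: real_sqrt_mult[symmetric])
  finally show ?thesis by (simp add: algebra_simps)
 qed (simp add: aJ a_def)
 have "(%j. \<alpha> j * cf g j - q j * cf f j * cf g j) sums (fn X A g - E f g)"
  unfolding \<alpha>_def by (intro sums_diff fn_smooth E_sums f g)
 then have s: "(%j. a j * b j) sums (fn X A g - E f g)" by (simp add: ab)
 have a2: "r j * (\<alpha> j)\<^sup>2 - 2 * (\<alpha> j * cf f j) + q j * cf f j * cf f j = (a j)\<^sup>2" for j
 proof (cases "j \<in> J")
  case False
  have "(a j)\<^sup>2 = r j * (\<alpha> j - q j * cf f j)\<^sup>2" using r_nonneg by (simp add: a_def power_mult_distrib)
  also have "... = r j * (\<alpha> j)\<^sup>2 - 2 * ((r j * q j) * (\<alpha> j * cf f j)) + (r j * q j) * (q j * cf f j * cf f j)"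
   by (simp add: power2_eq_square algebra_simps)
  finally show ?thesis by (simp add: r_q[OF False])
 qed (simp add: aJ a_def)
 have "(%j. r j * (\<alpha> j)\<^sup>2 - 2 * (\<alpha> j * cf f j) + q j * cf f j * cf f j) sums F"
  unfolding F_def \<alpha>_def by (intro sums_add sums_diff sums_mult fn_quad fn_smooth E_sums f)
 then have sa: "(%j. (a j)\<^sup>2) sums F" by (simp add: a2)
 have sb: "(%j. (b j)\<^sup>2) sums E g g"
 proof -
  have "(b j)\<^sup>2 = q j * cf g j * cf g j" for j using q_nonneg[of j] by (simp add: b_def power_mult_distrib power2_eq_square)
  then show ?thesis using E_sums[OF g g] by simp
 qed
 have p: "(\<Sum>i<n. (c i)\<^sup>2) \<le> S" if "(%j. (c j)\<^sup>2) sums S" for c :: "nat => real" and S n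
  using sum_le_suminf[OF sums_summable[OF that], of "{..<n}"] sums_unique[OF that] by simp
 show "(fn X A g - E f g)\<^sup>2 \<le> F * E g g" by (rule summable_CS[OF p[OF sa] p[OF sb] s])
 show "F \<ge> 0" using p[OF sa, of 0] by simp
qed

text \<open>The kernel sum is replaced by truncations of its eigenfunction series, which are smooth
  with energy at most \<open>quad X A\<close>. Their interpolation errors tend to 0 at the finitely
  many points, and bumps correct them at a vanishing cost in energy.\<close>

lemma near_minimiser:
 assumes p: "p \<in> PJ" and u: "\<And>x. x \<in> X ==> kernel_sum k X A p x = d x" and eps: "\<epsilon> > 0"
 shows "\<exists>s. smf s \<and> (\<forall>x\<in>X. s x = d x) \<and> E s s \<le> quad X A + \<epsilon>"
proof -
 define D where "D = quad X A"
 define \<alpha> where "\<alpha> = (%j. fn X A (\<psi> j))"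
 define v where "v = (%N. psum (%j. r j * \<alpha> j) N)"
 define uN where "uN = (%N x. v N x + 1 * p x)"
 define e where "e = (%N x. uN N x - d x)"
 have ps: "smf p" by (rule eigenspan_smf[OF p])
 have vs: "smf (v N)" for N unfolding v_def by (rule smf_psum)
 have us: "smf (uN N)" for N unfolding uN_def by (rule smf_add[OF vs smf_cmult[OF ps]])
 have Eu: "E (uN N) (uN N) \<le> D" for N
 proof -
  have "E (uN N) (uN N) = E (v N) (v N)" unfolding uN_def E_comb[OF vs ps] using E_eigenspan[OF p] by simp
  also have "... \<le> D"
  proof (rule sums_le[OF _ E_sums[OF vs vs] fn_quad[folded D_def]])
   fix i
   have qr: "q i * (r i * \<alpha> i) * (r i * \<alpha> i) = r i * (\<alpha> i)\<^sup>2"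
    using r_q[of i] by (cases "i \<in> J") (simp_all add: r_def power2_eq_square field_simps)
   have "cf (v N) i = (if i < N then r i * \<alpha> i else 0)" by (simp add: v_def cf_psum)
   moreover have "0 \<le> r i * (\<alpha> i)\<^sup>2" by (intro mult_nonneg_nonneg r_nonneg zero_le_power2)
   ultimately have "q i * cf (v N) i * cf (v N) i \<le> r i * (\<alpha> i)\<^sup>2"
    by (cases "i < N") (simp_all only: if_True if_False qr mult_zero_right order_refl)
   then show "q i * cf (v N) i * cf (v N) i \<le> r i * (fn X A (\<psi> i))\<^sup>2" by (simp only: \<alpha>_def)
  qed
  finally show ?thesis .
 qed
 have e0: "(%N. e N x) \<longlonglongrightarrow> 0" if x: "x \<in> X" for x
 proof -
  have "(%N. v N x) \<longlonglongrightarrow> fn X A (k x)"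
   using fn_kernel[of x] unfolding sums_def by (simp add: v_def psum_def \<alpha>_def)
  then have "(%N. e N x) \<longlonglongrightarrow> fn X A (k x) + 1 * p x - d x" unfolding e_def uN_def by (intro tendsto_intros)
  moreover have "fn X A (k x) + p x = d x" using u[OF x] by (simp add: kernel_sum_def fn_def)
  ultimately show ?thesis by simp
 qed
 define s where "s = (%F N x. uN N x - (\<Sum>\<eta>\<in>F. e N \<eta> * \<phi> \<eta> x))"
 \<comment> \<open>The corrections are added one point at a time; a majorant b of the energies is
   carried along, since the energies themselves are not known to converge.\<close>
 have "\<exists>b. b \<longlonglongrightarrow> D \<and> (\<forall>N. smf (s F N) \<and> E (s F N) (s F N) \<le> b N)" if "F \<subseteq> X" for F
  using finite_subset[OF that X] that
 proof (induction F rule: finite_induct)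
  case empty
  then show ?case using us Eu by (intro exI[of _ "%_. D"]) (simp add: s_def)
 next
  case (insert \<eta> F)
  then obtain b where b: "b \<longlonglongrightarrow> D" "\<forall>N. smf (s F N) \<and> E (s F N) (s F N) \<le> b N" by auto
  have eta: "\<eta> \<in> X" using insert.prems by simp
  note ph = bump(1)[OF eta]
  define t where "t = (%N. - e N \<eta>)"
  have t0: "t \<longlonglongrightarrow> 0" using tendsto_minus[OF e0[OF eta]] by (simp add: t_def)
  have st: "s (insert \<eta> F) N = (%x. s F N x + t N * \<phi> \<eta> x)" for N
   using insert.hyps by (simp add: s_def t_def fun_eq_iff)
  define b' where "b' = (%N. b N + \<bar>t N\<bar> * (b N + E (\<phi> \<eta>) (\<phi> \<eta>)) + (t N)\<^sup>2 * E (\<phi> \<eta>) (\<phi> \<eta>))"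
  have "b' \<longlonglongrightarrow> D + \<bar>0\<bar> * (D + E (\<phi> \<eta>) (\<phi> \<eta>)) + 0\<^sup>2 * E (\<phi> \<eta>) (\<phi> \<eta>)"
   unfolding b'_def by (intro tendsto_intros b(1) t0)
  then have "b' \<longlonglongrightarrow> D" by simp
  moreover have "smf (s (insert \<eta> F) N) \<and> E (s (insert \<eta> F) N) (s (insert \<eta> F) N) \<le> b' N" for N
  proof
   have sm: "smf (s F N)" and le: "E (s F N) (s F N) \<le> b N" using b(2) by auto
   show "smf (s (insert \<eta> F) N)" unfolding st by (rule smf_add[OF sm smf_cmult[OF ph]])
   have "E (s (insert \<eta> F) N) (s (insert \<eta> F) N) \<le> E (s F N) (s F N) + \<bar>t N\<bar> * (E (s F N) (s F N) + E (\<phi> \<eta>) (\<phi> \<eta>)) + (t N)\<^sup>2 * E (\<phi> \<eta>) (\<phi> \<eta>)"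
    unfolding st by (rule E_step[OF sm ph])
   also have "... \<le> b' N" unfolding b'_def by (intro add_mono mult_left_mono le order_refl abs_ge_zero)
   finally show "E (s (insert \<eta> F) N) (s (insert \<eta> F) N) \<le> b' N" .
  qed
  ultimately show ?case by (intro exI[of _ b']) simp
 qed
 from this[OF order_refl] obtain b where b: "b \<longlonglongrightarrow> D" "\<forall>N. smf (s X N) \<and> E (s X N) (s X N) \<le> b N" by (elim exE conjE)
 have "eventually (%N. b N < D + \<epsilon>) sequentially" using order_tendstoD(2)[OF b(1), of "D + \<epsilon>"] eps by simp
 then obtain N where N: "b N < D + \<epsilon>" unfolding eventually_sequentially by blast
 have "s X N x = d x" if "x \<in> X" for x
  using X that bump(2) by (simp add: s_def e_def if_distrib[where f="%z. _ * z"] cong: if_cong)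
 moreover have "E (s X N) (s X N) \<le> D + \<epsilon>" using b(2) N by (meson less_imp_le order_trans)
 ultimately show ?thesis using b(2) unfolding D_def by (intro exI[of _ "s X N"]) auto
qed

end

text \<open>If some data were not attained, \<open>finite_separation\<close> would give a functional
  B killing all kernel sums. It kills \<open>PJ\<close>, so it annihilates; it kills its own kernel
  sum, so \<open>quad X B\<close> is 0; hence B = 0, a contradiction.\<close>

lemma interpolant_exists: "\<exists>A p. p \<in> PJ \<and> annihilates X A PJ \<and> (\<forall>x\<in>X. kernel_sum k X A p x = d x)"
proof -
 define S where "S = {kernel_sum k X A p | A p. p \<in> PJ \<and> annihilates X A PJ}"
 have S0: "(%x. 0) \<in> S" unfolding S_def
  by (intro CollectI exI[of _ "%_. 0"]) (simp add: kernel_sum_def fun_eq_iff eigenspan_0 annihilates_def)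
 have S1: "(%x. u x + t * v x) \<in> S" if uv: "u \<in> S" "v \<in> S" for u v t
 proof -
  obtain A p where u: "u = kernel_sum k X A p" "p \<in> PJ" "annihilates X A PJ"
   using uv(1) unfolding S_def mem_Collect_eq by (elim exE conjE)
  obtain B p' where v: "v = kernel_sum k X B p'" "p' \<in> PJ" "annihilates X B PJ"
   using uv(2) unfolding S_def mem_Collect_eq by (elim exE conjE)
  note * = u v
  have "(%x. u x + t * v x) = kernel_sum k X (%\<xi>. A \<xi> + t * B \<xi>) (%x. p x + t * p' x)"
   by (simp add: *(1,4) kernel_sum_def fun_eq_iff sum.distrib sum_distrib_left algebra_simps)
  moreover have "annihilates X (%\<xi>. A \<xi> + t * B \<xi>) PJ"
   unfolding annihilates_def
  proof
   fix y assume "y \<in> PJ"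
   then have "(\<Sum>\<xi>\<in>X. A \<xi> * y \<xi>) = 0" "(\<Sum>\<xi>\<in>X. B \<xi> * y \<xi>) = 0" using *(3,6) by (auto simp: annihilates_def)
   then show "(\<Sum>\<xi>\<in>X. (A \<xi> + t * B \<xi>) * y \<xi>) = 0" by (simp add: distrib_right sum.distrib mult.assoc sum_distrib_left[symmetric])
  qed
  ultimately show ?thesis unfolding S_def using eigenspan_comb[OF *(2,5), of t]
   by (intro CollectI exI[of _ "%\<xi>. A \<xi> + t * B \<xi>"] exI[of _ "%x. p x + t * p' x"] conjI)
 qed
 have "(\<exists>v\<in>S. \<forall>x\<in>X. v x = d x) \<or> (\<exists>B. (\<forall>v\<in>S. (\<Sum>x\<in>X. B x * v x) = 0) \<and> (\<Sum>x\<in>X. B x * d x) \<noteq> 0)"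
  using X S0 S1 by (rule finite_separation)
 then consider v where "v \<in> S" "\<forall>x\<in>X. v x = d x"
  | B where "\<forall>v\<in>S. (\<Sum>x\<in>X. B x * v x) = 0" "(\<Sum>x\<in>X. B x * d x) \<noteq> 0" by (elim disjE bexE exE conjE)
 then show ?thesis
 proof cases
  case 1
  then show ?thesis unfolding S_def by blast
 next
  case 2
  have z: "annihilates X (%_. 0) PJ" by (simp add: annihilates_def)
  have "p \<in> S" if "p \<in> PJ" for p
  proof -
   have "p = kernel_sum k X (%_. 0) p" by (simp add: kernel_sum_def fun_eq_iff)
   then show ?thesis unfolding S_def using that z by (intro CollectI exI[of _ "%_. 0"] exI[of _ p] conjI)
  qed
  then have B: "annihilates X B PJ" using 2(1) unfolding annihilates_def by simp
  have "kernel_sum k X B (%x. 0) \<in> S" unfolding S_def using B eigenspan_0 by blast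
  then have "fn X B (kernel_sum k X B (%x. 0)) = 0" using 2(1) unfolding fn_def by simp
  then have "quad X B = 0" by (simp add: fn_def kernel_sum_def)
  from fn_zero[OF B this] have "(\<Sum>x\<in>X. B x * d x) = 0" by simp
  then show ?thesis using 2(2) by simp
 qed
qed

text \<open>The difference has zero data on X. Pairing it with its own coefficients leaves the
  quadratic form, as the part in \<open>PJ\<close> is annihilated; so the coefficients agree by
  \<open>fn_zero\<close>, and unisolvence removes the rest.\<close>

lemma interpolant_unique:
 assumes unis: "\<And>p. p \<in> PJ ==> (\<And>x. x \<in> X ==> p x = 0) ==> p = (%x. 0)"
  and 1: "p \<in> PJ" "annihilates X A PJ" and 2: "p' \<in> PJ" "annihilates X A' PJ"
  and eq: "\<And>x. x \<in> X ==> kernel_sum k X A p x = kernel_sum k X A' p' x"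
 shows "kernel_sum k X A p = kernel_sum k X A' p'"
proof -
 define B where "B = (%\<xi>. A \<xi> - A' \<xi>)"
 define b where "b = (%x. p x + (-1) * p' x)"
 have b: "b \<in> PJ" unfolding b_def by (rule eigenspan_comb[OF 1(1) 2(1)])
 have B: "annihilates X B PJ" using 1(2) 2(2) by (simp add: annihilates_def B_def left_diff_distrib sum_subtractf)
 have diff: "kernel_sum k X A p x - kernel_sum k X A' p' x = fn X B (k x) + b x" for x
  by (simp add: kernel_sum_def fn_def B_def b_def left_diff_distrib sum_subtractf)
 have "fn X B (%x. fn X B (k x) + b x) = 0"
  unfolding fn_def[of X B "%x. fn X B (k x) + b x"] unfolding diff[symmetric] using eq by (intro sum.neutral ballI) simp
 then have "quad X B = 0" using fn_eigenspan[OF B b] by (simp add: fn_add)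
 from fn_zero[OF B this] have z: "fn X B g = 0" for g by (simp add: fn_def)
 have "b x = 0" if "x \<in> X" for x using eq[OF that] diff[of x] z by simp
 then have "b = (%x. 0)" using unis[OF b] by blast
 then show ?thesis using diff z by (simp add: fun_eq_iff)
qed

end

end

subsection \<open>Decay of the coefficients\<close>

context polyharmonic_space begin

text \<open>The width w is measured in coordinates; C w \<le> q0/2 keeps the support within metric
  distance q0/2, well short of any other point of X.\<close>

lemma bumps:
 assumes cf: "\<And>\<zeta>. \<exists>B. cutoff_family C \<zeta> B" and w: "0 < w" "w \<le> 1 / C" "C * w \<le> q0 / 2"
  and q0: "q0 > 0" "\<And>x y. x \<in> X ==> y \<in> X ==> x \<noteq> y ==> 2 * q0 \<le> dist x y"
 shows "\<exists>\<phi>. \<forall>\<xi>. is_bump (cball \<xi> (q0 / 2)) \<xi> (C * (w ^ CARD('d) / w ^ (2 * m))) (\<phi> \<xi>) \<and>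
  (\<xi> \<in> X --> (\<forall>x\<in>X. \<phi> \<xi> x = (if x = \<xi> then 1 else 0)))"
proof -
 have "\<exists>\<phi>. is_bump (cball \<xi> (q0 / 2)) \<xi> (C * (w ^ CARD('d) / w ^ (2 * m))) \<phi>" for \<xi>
 proof -
  obtain B where B: "cutoff_family C \<xi> B" using cf by blast
  then obtain \<phi> where \<phi>: "is_bump (B w) \<xi> (C * (w ^ CARD('d) / w ^ (2 * m))) \<phi>"
   unfolding cutoff_family_def using w(1,2) by blast
  have "dist p \<xi> \<le> C * w" if "p \<in> B w" for p using B w that unfolding cutoff_family_def by simp
  then have "B w \<subseteq> cball \<xi> (q0 / 2)" using w(3) by (fastforce simp: dist_commute)
  then show ?thesis using \<phi> unfolding is_bump_def by blast
 qed
 from choice[OF allI[OF this]] obtain \<phi> where \<phi>: "\<forall>\<xi>. is_bump (cball \<xi> (q0 / 2)) \<xi> (C * (w ^ CARD('d) / w ^ (2 * m))) (\<phi> \<xi>)" ..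
 have "\<phi> \<xi> x = (if x = \<xi> then 1 else 0)" if "\<xi> \<in> X" "x \<in> X" for \<xi> x
  using spec[OF \<phi>, of \<xi>] q0(2)[OF that] q0(1) by (auto simp: is_bump_def)
 then show ?thesis using \<phi> by (intro exI[of _ \<phi>]) simp
qed

text \<open>The functional with coefficients A is applied to the Lagrange function in two ways: the
  data pick out \<open>A \<zeta>\<close>, the kernel part gives the quadratic form, and the part in
  \<open>PJ\<close> is annihilated.\<close>

lemma lagrange_energy:
 assumes X: "finite X" "\<zeta> \<in> X" and A: "p \<in> PJ" "annihilates X A PJ"
  and u: "\<And>x. x \<in> X ==> kernel_sum k X A p x = (if x = \<zeta> then 1 else 0)"
 shows "quad X A = A \<zeta>"
proof -
 have "fn X A (kernel_sum k X A p) = fn X A (%\<eta>. fn X A (k \<eta>) + p \<eta>)"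
  unfolding kernel_sum_def[abs_def] fn_def ..
 also have "... = quad X A" using A by (simp add: fn_add annihilates_def fn_def)
 also have "fn X A (kernel_sum k X A p) = (\<Sum>x\<in>X. A x * (if x = \<zeta> then 1 else 0))"
  unfolding fn_def using u by (intro sum.cong) auto
 also have "... = A \<zeta>" using X by (simp add: if_distrib[where f="%z. _ * z"] cong: if_cong)
 finally show ?thesis by simp
qed

lemma lagrange_coefficients:
 assumes C: "C \<ge> 1" and cf: "\<And>\<zeta>. \<exists>B. cutoff_family C \<zeta> B"
  and X: "finite X" "\<zeta> \<in> X" and h: "h > 0" "\<And>p. \<exists>q\<in>X. dist p q \<le> h"
  and q0: "q0 > 0" "\<And>x y. x \<in> X ==> y \<in> X ==> x \<noteq> y ==> 2 * q0 \<le> dist x y"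
  and w: "0 < w" "C * w \<le> q0 / 2"
  and A: "p \<in> PJ" "annihilates X A PJ"
  and u: "\<And>x. x \<in> X ==> kernel_sum k X A p x = (if x = \<zeta> then 1 else 0)"
  and n: "w + real n * h \<le> 1 / C" and \<xi>: "\<xi> \<in> X" and nd: "C * (real n * h) \<le> dist \<xi> \<zeta> / 4"
 shows "\<bar>A \<xi>\<bar> \<le> C * (w ^ CARD('d) / w ^ (2 * m)) * exp (- (real n / (2 * C)))"
proof -
 define W where "W = C * (w ^ CARD('d) / w ^ (2 * m))"
 have W: "W > 0" using C w by (simp add: W_def)
 have C0: "C > 0" using C by simp
 have wC: "w \<le> 1 / C" using n h(1) by (smt (verit) mult_nonneg_nonneg of_nat_0_le_iff)
 have "\<exists>\<phi>. \<forall>\<xi>. is_bump (cball \<xi> (q0 / 2)) \<xi> W (\<phi> \<xi>) \<and> (\<xi> \<in> X --> (\<forall>x\<in>X. \<phi> \<xi> x = (if x = \<xi> then 1 else 0)))"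
  unfolding W_def by (rule bumps[OF cf w(1) wC w(2) q0(1)]) (rule q0(2))
 then obtain \<phi> where \<phi>: "\<forall>\<xi>. is_bump (cball \<xi> (q0 / 2)) \<xi> W (\<phi> \<xi>) \<and> (\<xi> \<in> X --> (\<forall>x\<in>X. \<phi> \<xi> x = (if x = \<xi> then 1 else 0)))" ..
 have bs: "smf (\<phi> \<xi>)" and be: "E (\<phi> \<xi>) (\<phi> \<xi>) \<le> W" and bz: "p \<notin> cball \<xi> (q0 / 2) ==> \<phi> \<xi> p = 0" for \<xi> p
  using \<phi> by (auto simp: is_bump_def)
 have bd: "\<phi> \<xi> x = (if x = \<xi> then 1 else 0)" if "\<xi> \<in> X" "x \<in> X" for \<xi> x using \<phi> that by blast
 note ctx = X(1) bs bd
 define d where "d = (%x. if x = \<zeta> then 1 else (0::real))"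
 have D: "quad X A = A \<zeta>" by (rule lagrange_energy[OF X A u])
 have D0: "A \<zeta> \<ge> 0"
  using sums_le[OF _ sums_zero fn_quad[OF ctx A(2)]] r_nonneg D by (simp add: mult_nonneg_nonneg)
 have fd: "fn X A f = A \<zeta>" if "\<forall>x\<in>X. f x = d x" for f
 proof -
  have "fn X A f = (\<Sum>x\<in>X. A x * (if x = \<zeta> then 1 else 0))" unfolding fn_def using that by (intro sum.cong) (auto simp: d_def)
  then show ?thesis using X by (simp add: if_distrib[where f="%z. _ * z"] cong: if_cong)
 qed
 have ecs: "(fn X A g - E f g)\<^sup>2 \<le> (E f f - A \<zeta>) * E g g" "A \<zeta> \<le> E f f" if "smf f" "\<forall>x\<in>X. f x = d x" "smf g" for f g
  using energy_cauchy_schwarz[OF ctx A(2) that(1,3)] D fd[OF that(2)] by simp_all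
 from cf[of \<zeta>, unfolded cutoff_family_def] obtain B where
  B: "mono B" "\<forall>s. 0 \<le> s --> s \<le> 1 / C --> closed (B s) \<and> (\<forall>p\<in>B s. dist p \<zeta> \<le> C * s)"
  "\<forall>w. 0 < w --> w \<le> 1 / C --> (\<exists>\<phi>. is_bump (B w) \<zeta> (C * (w ^ CARD('d) / w ^ (2 * m))) \<phi>)"
  "\<forall>s h. 0 \<le> s --> 0 < h --> s + h \<le> 1 / C --> (\<exists>\<theta>. is_cutoff (B s) (B (s + h)) h C \<theta>)"
  by (elim exE conjE)
 from B(3)[rule_format, OF w(1) wC] obtain f0 where f0: "smf f0" "f0 \<zeta> = 1" "\<forall>p. p \<notin> B w --> f0 p = 0" "E f0 f0 \<le> W"
  unfolding W_def is_bump_def by (elim exE conjE)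
 have f0d: "f0 x = d x" if "x \<in> X" for x
 proof (cases "x = \<zeta>")
  case False
  then have "dist x \<zeta> > C * w" using q0(2)[OF that X(2)] q0(1) w(2) by simp
  then have "x \<notin> B w" using B(2)[rule_format, OF less_imp_le[OF w(1)] wC] by auto
  then show ?thesis using f0(3) False by (simp add: d_def)
 qed (simp add: f0(2) d_def)
 show ?thesis
 proof (cases "\<xi> = \<zeta>")
  case True
  \<comment> \<open>For \<xi> = \<zeta> the distance is 0, which forces n = 0; the claim is then
    that \<open>A \<zeta>\<close> is at most the energy of the starting bump.\<close>
  then have "real n * h \<le> 0" using nd C0 by (simp add: mult_le_0_iff)
  then have "n = 0" using h(1) by (simp add: mult_le_0_iff)
  then show ?thesis using ecs(2)[OF f0(1) _ f0(1)] f0d f0(4) D0 True by (simp add: W_def)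
 next
  case False
  define t where "t = (1 - 1 / C) ^ n"
  have "(A \<xi>)\<^sup>2 \<le> t * W\<^sup>2"
  proof (rule field_le_epsilon)
   \<comment> \<open>The near-minimiser is only within \<epsilon> of the lower bound. Its error is
     not amplified by the iteration, and is multiplied by W in the end; hence the choice \<epsilon>
     = e / W.\<close>
   fix e :: real assume e: "e > 0"
   define \<epsilon> where "\<epsilon> = e / W"
   have eps: "\<epsilon> > 0" using e W by (simp add: \<epsilon>_def)
   from near_minimiser[OF ctx A(2,1), of d \<epsilon>] u eps obtain s where s: "smf s" "\<forall>x\<in>X. s x = d x" "E s s \<le> A \<zeta> + \<epsilon>"
    by (auto simp: d_def D)
   have "\<exists>f. smf f \<and> (\<forall>x\<in>X. f x = d x) \<and> (\<forall>p. p \<notin> B (w + real n * h) --> f p = 0) \<and> E f f - A \<zeta> \<le> (1 - 1 / C) ^ n * E f0 f0 + \<epsilon>"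
   proof (rule local_interpolants[where ?r0.0="1 / C" and s=s, OF C])
    show "closed (B s)" if "0 \<le> s" "s \<le> 1 / C" for s using B(2) that by blast
    show "\<exists>\<theta>. is_cutoff (B s) (B (s + h)) h C \<theta>" if "0 \<le> s" "s + h \<le> 1 / C" for s
     using B(4)[rule_format, OF that(1) h(1) that(2)] .
    show "E s s \<le> A \<zeta> + \<epsilon>" by (rule s(3))
    show "w + real n * h \<le> 1 / C" by (rule n)
   qed (use B(1) h s f0 f0d w D0 eps in auto)
   then obtain f where f: "smf f" "\<forall>x\<in>X. f x = d x" "\<forall>p. p \<notin> B (w + real n * h) --> f p = 0" "E f f - A \<zeta> \<le> t * E f0 f0 + \<epsilon>"
    unfolding t_def by (elim exE conjE)
   \<comment> \<open>The supports are disjoint. A point within q0/2 of \<xi> has distance at least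
     \<delta> - q0/2 from \<zeta>, where \<delta> = \<open>dist \<xi> \<zeta>\<close> \<ge> 2 q0,
     whereas f lives within q0/2 + \<delta>/4.\<close>
   have z: "f p * L (\<phi> \<xi>) p = 0" for p
   proof (cases "dist p \<xi> > q0 / 2")
    case True
    have "L (\<phi> \<xi>) p = 0"
     by (rule L_zero[of "- cball \<xi> (q0 / 2)"]) (use True bz in \<open>auto simp: dist_commute\<close>)
    then show ?thesis by simp
   next
    case far: False
    have "dist \<xi> \<zeta> \<le> dist p \<xi> + dist p \<zeta>" by (metis dist_commute dist_triangle)
    moreover have "2 * q0 \<le> dist \<xi> \<zeta>" by (rule q0(2)[OF \<xi> X(2) False])
    moreover have "C * (w + real n * h) \<le> q0 / 2 + dist \<xi> \<zeta> / 4" using w(2) nd by (simp add: distrib_left)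
    ultimately have "dist p \<zeta> > C * (w + real n * h)" using far q0(1) by linarith
    then have "p \<notin> B (w + real n * h)" using B(2)[rule_format, of "w + real n * h"] n w(1) h(1) by auto
    then show ?thesis using f(3) by simp
   qed
   have "E f (\<phi> \<xi>) = 0" unfolding E_def z by simp
   then have "(A \<xi>)\<^sup>2 \<le> (E f f - A \<zeta>) * E (\<phi> \<xi>) (\<phi> \<xi>)"
    using ecs(1)[OF f(1,2) bs, of \<xi>] fn_bump[OF ctx \<xi>] by simp
   also have "... \<le> (t * W + \<epsilon>) * W"
   proof (rule mult_mono[OF _ be])
    have t0: "t \<ge> 0" unfolding t_def using C by (intro zero_le_power) (simp add: field_simps)
    show "E f f - A \<zeta> \<le> t * W + \<epsilon>" using f(4) mult_left_mono[OF f0(4) t0] by linarith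
    show "0 \<le> t * W + \<epsilon>" using t0 W eps by simp
   qed (rule E_nonneg[OF bs])
   also have "... = t * W\<^sup>2 + e" using W by (simp add: \<epsilon>_def power2_eq_square algebra_simps)
   finally show "(A \<xi>)\<^sup>2 \<le> t * W\<^sup>2 + e" .
  qed
  \<comment> \<open>The contraction bounds the square of the coefficient, so extracting the root
    halves the rate 1/C.\<close>
  moreover have "t \<le> (exp (- (1 / C))) ^ n" unfolding t_def
   using exp_ge_add_one_self[of "- (1 / C)"] C by (intro power_mono) (auto simp: field_simps)
  moreover have "(exp (- (1 / C))) ^ n = (exp (- (real n / (2 * C))))\<^sup>2"
   by (simp add: exp_of_nat_mult[symmetric] power2_eq_square exp_add[symmetric])
  ultimately have "(A \<xi>)\<^sup>2 \<le> (exp (- (real n / (2 * C))))\<^sup>2 * W\<^sup>2"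
   by (metis mult_right_mono order_trans zero_le_power2)
  then have "(A \<xi>)\<^sup>2 \<le> (W * exp (- (real n / (2 * C))))\<^sup>2" by (simp only: power_mult_distrib mult.commute)
  then have "\<bar>A \<xi>\<bar> \<le> \<bar>W * exp (- (real n / (2 * C)))\<bar>" by (simp only: abs_le_square_iff)
  then show ?thesis unfolding W_def[symmetric] using W by (simp only: abs_of_pos mult_pos_pos exp_gt_zero)
 qed
qed

section \<open>Data sites, and the choice of the constants\<close>

lemma infinite_manifold: "infinite (UNIV :: 'a set)"
proof
 assume fin: "finite (UNIV :: 'a set)"
 obtain c where c: "c \<in> atlas R" "(undefined :: 'a) \<in> cdom c" using chart_ex by blast
 have "finite (img c)" unfolding img_def by (rule finite_imageI[OF finite_subset[OF subset_UNIV fin]])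
 moreover have "img c \<noteq> {}" using c by (auto simp: img_def)
 ultimately show False using finite_imp_not_open[of "img c"] chart_open(2)[OF c(1)] by blast
qed

lemma diameter_bound: "\<exists>D>0. \<forall>p q :: 'a. dist p q \<le> D"
proof -
 obtain x :: 'a and e where "\<forall>y\<in>UNIV. dist x y \<le> e" using compact_imp_bounded[OF cpt] unfolding bounded_def by blast
 then have e: "dist x y \<le> e" for y by simp
 have "dist p q \<le> 2 * e + 1" for p q :: 'a using dist_triangle2[of p q x] e[of p] e[of q] by (simp add: dist_commute)
 moreover have "2 * e + 1 > 0" using e[of x] by simp
 ultimately show ?thesis by blast
qed

lemma fill_distance:
 assumes X: "finite X" "X \<noteq> {}"
 shows "\<exists>q\<in>X. dist p q \<le> fill_distance X" "fill_distance (X :: 'a set) > 0"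
proof -
 obtain D where D: "\<forall>p q :: 'a. dist p q \<le> D" using diameter_bound by blast
 obtain x0 where x0: "x0 \<in> X" using X by blast
 have "infdist x X \<le> D" for x using infdist_le[OF x0, of x] D by (meson order_trans)
 then have bdd: "bdd_above (range (%x. infdist x X))" by (auto simp: bdd_above_def)
 have le: "infdist x X \<le> fill_distance X" for x unfolding fill_distance_def by (rule cSUP_upper[OF _ bdd]) simp
 have "infdist p X = Min (dist p ` X)" using X by (simp add: infdist_notempty cInf_eq_Min)
 moreover have "Min (dist p ` X) \<in> dist p ` X" using X by (intro Min_in) auto
 ultimately obtain q where "q \<in> X" "infdist p X = dist p q" by auto
 then show "\<exists>q\<in>X. dist p q \<le> fill_distance X" using le[of p] by auto
 obtain x where "x \<notin> X" using infinite_manifold X(1) by (metis UNIV_eq_I)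
 then have "infdist x X > 0" using infdist_pos_not_in_closed[OF finite_imp_closed[OF X(1)] X(2)] by blast
 then show "fill_distance X > 0" using le[of x] by simp
qed

lemma separation_radius:
 assumes X: "finite X" "\<zeta> \<in> X" "\<eta> \<in> X" "\<zeta> \<noteq> \<eta>"
 shows "separation_radius (X :: 'a set) > 0"
  and "x \<in> X ==> y \<in> X ==> x \<noteq> y ==> 2 * separation_radius X \<le> dist x y"
proof -
 define S where "S = {dist \<xi> \<zeta> | \<xi> \<zeta>. \<xi> \<in> X \<and> \<zeta> \<in> X \<and> \<xi> \<noteq> \<zeta>}"
 have fS: "finite S" by (rule finite_subset[of _ "(%(a, b). dist a b) ` (X \<times> X)"]) (use X(1) in \<open>auto simp: S_def\<close>)
 have S: "dist x y \<in> S" if "x \<in> X" "y \<in> X" "x \<noteq> y" for x y using that by (auto simp: S_def)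
 have s: "separation_radius X = Min S / 2" by (simp add: separation_radius_def S_def)
 have "Min S \<in> S" by (rule Min_in[OF fS]) (use S[OF X(2-4)] in auto)
 then show "separation_radius X > 0" unfolding s by (auto simp: S_def)
 show "2 * separation_radius X \<le> dist x y" if "x \<in> X" "y \<in> X" "x \<noteq> y" unfolding s using Min_le[OF fS S[OF that]] by simp
qed

text \<open>Elements of \<open>PJ\<close> have zero energy. If one vanishes on a dense enough set,
  \<open>coercive\<close> makes its norm of order m zero, and the embedding makes it zero
  everywhere.\<close>

lemma unisolvent:
 "\<exists>h0>0. \<forall>X p. finite X --> X \<noteq> {} --> fill_distance X \<le> h0 --> p \<in> PJ --> (\<forall>x\<in>X. p x = 0) --> p = (%x. 0)"
proof -
 from coercive obtain C h0 where C: "C > 0" "h0 > 0"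
  and co: "\<forall>v h. sampled h0 v h --> H m v \<le> C * E v v \<and> (\<forall>j\<le>m. h ^ (2 * j) * H j v \<le> C * (h ^ (2 * m) * E v v))" by (elim exE conjE)
 from sup_bound[OF dim] obtain S where S: "S > 0" "\<forall>f. smf f --> (\<forall>p. (f p)\<^sup>2 \<le> S * H m f)" by (elim exE conjE)
 have "p = (%x. 0)" if X: "finite X" "X \<noteq> {}" "fill_distance X \<le> h0" and p: "p \<in> PJ" "\<forall>x\<in>X. p x = 0" for X p
 proof -
  note f = fill_distance[OF X(1,2)]
  have "sampled h0 p (fill_distance X)" unfolding sampled_def using f p(2) X(3) eigenspan_smf[OF p(1)] by blast
  then have "H m p \<le> C * E p p" using co by blast
  then have "H m p \<le> 0" using E_eigenspan[OF p(1)] by simp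
  then have "S * H m p \<le> 0" using S(1) by (simp add: mult_le_0_iff)
  then have "(p x)\<^sup>2 \<le> 0" for x using S(2)[rule_format, OF eigenspan_smf[OF p(1)], of x] by linarith
  then show ?thesis by (simp add: fun_eq_iff)
 qed
 then show ?thesis using C(2) by blast
qed

lemma lagrange_decay:
 "\<exists>hstar>0. \<exists>\<nu>>0. \<exists>C>0. \<forall>\<rho>>0. \<forall>X.
   finite X \<and> fill_distance X / separation_radius X \<le> \<rho> \<and> fill_distance X \<le> hstar -->
   (\<forall>\<zeta>\<in>X. (\<exists>!u. is_lagrange k X PJ \<zeta> u) \<and>
    (\<forall>A p. p \<in> PJ \<and> annihilates X A PJ \<and> is_lagrange k X PJ \<zeta> (kernel_sum k X A p) -->
      (\<forall>\<xi>\<in>X. \<bar>A \<xi>\<bar> \<le> C * separation_radius X powi (int CARD('d) - 2 * int m) * exp (- \<nu> * dist \<xi> \<zeta> / fill_distance X))))"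
proof -
 from cutoff_family_global obtain C where C: "C \<ge> 1" and cf: "\<And>\<zeta>. \<exists>B. cutoff_family C \<zeta> B" by auto
 have C0: "C > 0" using C by simp
 from diameter_bound obtain D where D: "D > 0" "\<forall>p q :: 'a. dist p q \<le> D" by (elim exE conjE)
 from unisolvent obtain h0 where h0: "h0 > 0" and unis: "\<forall>X p. finite X --> X \<noteq> {} --> fill_distance X \<le> h0 --> p \<in> PJ --> (\<forall>x\<in>X. p x = 0) --> p = (%x. 0)"
  by (elim exE conjE)
 obtain a b :: 'a where ab: "a \<noteq> b" using infinite_manifold by (metis finite.emptyI finite_insert finite_subset insertI1 subsetI)
 \<comment> \<open>The first entry secures unisolvence; the second forces X to contain two distinct
   points, one near a and one near b, so that the separation radius is the minimum of a nonempty
   set.\<close>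
 define hstar where "hstar = min h0 (dist a b / 4)"
 \<comment> \<open>The bump width will be w = c2 q. The first entry gives C w \<le> q/2, the second
   w \<le> 1/(2C) because 2 q \<le> D: half of the admissible radii.\<close>
 define c2 where "c2 = min (1 / (2 * C)) (1 / (C * D))"
 \<comment> \<open>About \<kappa> \<delta>/h layers will be used, \<delta> being the distance of
   \<xi> and \<zeta>. The first entry keeps the support of the local interpolant away from \<xi>,
   the second keeps all layers within the other half 1/(2C) of the admissible radii.\<close>
 define \<kappa> where "\<kappa> = min (1 / (4 * C\<^sup>2)) (1 / (2 * C * D))"
 \<comment> \<open>The exponential factor pays for rounding the number of layers down to an
   integer.\<close>
 define K where "K = C * (c2 ^ CARD('d) / c2 ^ (2 * m)) * exp (1 / (2 * C))"
 define \<nu> where "\<nu> = \<kappa> / (2 * C)"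
 have hs: "hstar > 0" using h0 ab by (simp add: hstar_def)
 have c2: "c2 > 0" "c2 \<le> 1 / (2 * C)" "c2 \<le> 1 / (C * D)" using C0 D by (auto simp: c2_def)
 have ka: "\<kappa> > 0" "\<kappa> \<le> 1 / (4 * C\<^sup>2)" "\<kappa> \<le> 1 / (2 * C * D)" using C0 D by (auto simp: \<kappa>_def)
 have nu: "\<nu> > 0" using ka C0 by (simp add: \<nu>_def)
 have K: "K > 0" using c2 C0 by (simp add: K_def)
 show ?thesis
 proof (rule exI[of _ hstar], rule conjI[OF hs], rule exI[of _ \<nu>], rule conjI[OF nu], rule exI[of _ K], rule conjI[OF K],
   intro allI impI ballI conjI)
  fix X :: "'a set" and \<zeta> and \<rho> :: real
  assume "finite X \<and> fill_distance X / separation_radius X \<le> \<rho> \<and> fill_distance X \<le> hstar" and z: "\<zeta> \<in> X"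
  then have X: "finite X" "fill_distance X \<le> hstar" "\<zeta> \<in> X" by simp_all
  define h where "h = fill_distance X"
  define q0 where "q0 = separation_radius X"
  have ne: "X \<noteq> {}" using X(3) by blast
  have h: "h > 0" "\<And>p. \<exists>q\<in>X. dist p q \<le> h" "h \<le> h0" "4 * h \<le> dist a b"
   using fill_distance[OF X(1) ne] X(2) by (auto simp: h_def hstar_def)
  obtain \<eta> where \<eta>: "\<eta> \<in> X" "\<zeta> \<noteq> \<eta>"
  proof -
   obtain x y where xy: "x \<in> X" "dist a x \<le> h" "y \<in> X" "dist b y \<le> h" using h(2) by meson
   have "x \<noteq> y"
   proof
    assume "x = y"
    then have "dist a b \<le> 2 * h" using dist_triangle2[of a b x] xy by simp
    then show False using h(1,4) by linarith
   qed
   then show ?thesis using xy that by metis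
  qed
  note sep = separation_radius[OF X(1,3) \<eta>, folded q0_def]
  have qD: "2 * q0 \<le> D" using sep(2)[OF X(3) \<eta>] D(2) by (meson order_trans)
  define w where "w = c2 * q0"
  have w: "w > 0" "C * w \<le> q0 / 2" "w \<le> 1 / (2 * C)"
  proof -
   show "w > 0" using c2 sep by (simp add: w_def)
   have "C * w \<le> C * (1 / (2 * C) * q0)" unfolding w_def using c2 C0 sep by (intro mult_left_mono mult_right_mono) auto
   then show "C * w \<le> q0 / 2" using C by simp
   have "w \<le> 1 / (C * D) * (D / 2)" unfolding w_def using c2 C0 D sep qD by (intro mult_mono) auto
   also have "... = 1 / (2 * C)" using D by simp
   finally show "w \<le> 1 / (2 * C)" .
  qed
  have wC: "w \<le> 1 / C" using w(1,3) C by (simp add: field_simps)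
  have "\<exists>\<phi>. \<forall>\<xi>. is_bump (cball \<xi> (q0 / 2)) \<xi> (C * (w ^ CARD('d) / w ^ (2 * m))) (\<phi> \<xi>) \<and>
   (\<xi> \<in> X --> (\<forall>x\<in>X. \<phi> \<xi> x = (if x = \<xi> then 1 else 0)))"
   by (rule bumps[OF cf w(1) wC w(2) sep(1)]) (rule sep(2))
  then obtain \<phi> where \<phi>: "\<forall>\<xi>. is_bump (cball \<xi> (q0 / 2)) \<xi> (C * (w ^ CARD('d) / w ^ (2 * m))) (\<phi> \<xi>) \<and>
   (\<xi> \<in> X --> (\<forall>x\<in>X. \<phi> \<xi> x = (if x = \<xi> then 1 else 0)))" ..
  have bs: "smf (\<phi> \<xi>)" for \<xi> using \<phi> by (simp add: is_bump_def)
  have bd: "\<phi> \<xi> x = (if x = \<xi> then 1 else 0)" if "\<xi> \<in> X" "x \<in> X" for \<xi> x using \<phi> that by blast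
  have uni: "p = (%x. 0)" if "p \<in> PJ" "\<And>x. x \<in> X ==> p x = 0" for p using unis[rule_format, OF X(1) ne _ that] h(3) by (simp add: h_def)
  show "\<exists>!u. is_lagrange k X PJ \<zeta> u"
  proof -
   have "\<exists>A p. p \<in> PJ \<and> annihilates X A PJ \<and> (\<forall>x\<in>X. kernel_sum k X A p x = (if x = \<zeta> then 1 else 0))"
    by (rule interpolant_exists[OF X(1) bs]) (rule bd)
   then obtain A p where
    Ap: "p \<in> PJ" "annihilates X A PJ" "\<forall>x\<in>X. kernel_sum k X A p x = (if x = \<zeta> then 1 else 0)" by (elim exE conjE)
   show ?thesis
   proof (rule ex1I[of _ "kernel_sum k X A p"])
    show "is_lagrange k X PJ \<zeta> (kernel_sum k X A p)"
     unfolding is_lagrange_def kernel_space_def using Ap by blast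
    fix u assume u: "is_lagrange k X PJ \<zeta> u"
    then obtain A' p' where u': "u = kernel_sum k X A' p'" "p' \<in> PJ" "annihilates X A' PJ"
     unfolding is_lagrange_def kernel_space_def mem_Collect_eq by (elim exE conjE)
    have "kernel_sum k X A' p' x = kernel_sum k X A p x" if "x \<in> X" for x
     using u Ap(3) that unfolding u'(1) is_lagrange_def by simp
    then show "u = kernel_sum k X A p" unfolding u'(1)
     by (intro interpolant_unique[OF X(1) bs bd uni u'(2,3) Ap(1,2)])
   qed
  qed
  fix A p \<xi>
  assume "p \<in> PJ \<and> annihilates X A PJ \<and> is_lagrange k X PJ \<zeta> (kernel_sum k X A p)" and xi: "\<xi> \<in> X"
  then have A: "p \<in> PJ" "annihilates X A PJ" "is_lagrange k X PJ \<zeta> (kernel_sum k X A p)" by simp_all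
  define \<delta> where "\<delta> = dist \<xi> \<zeta>"
  define n where "n = nat \<lfloor>\<kappa> * \<delta> / h\<rfloor>"
  have d0: "\<kappa> * \<delta> / h \<ge> 0" using ka h by (simp add: \<delta>_def)
  have n: "real n \<le> \<kappa> * \<delta> / h" "\<kappa> * \<delta> / h \<le> real n + 1" using d0 unfolding n_def by linarith+
  have nh: "real n * h \<le> \<kappa> * \<delta>" using n(1) h(1) by (simp add: field_simps)
  have "\<kappa> * \<delta> \<le> 1 / (2 * C * D) * D" using ka C0 D by (intro mult_mono) (auto simp: \<delta>_def)
  also have "... = 1 / (2 * C)" using D by simp
  finally have n1: "w + real n * h \<le> 1 / C" using nh w(3) field_sum_of_halves[of "1 / C"] by simp
  have "C * (real n * h) \<le> C * (\<kappa> * \<delta>)" using nh C by (intro mult_left_mono) auto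
  also have "... \<le> C * (1 / (4 * C\<^sup>2) * \<delta>)" using ka C0 by (intro mult_left_mono mult_right_mono) (auto simp: \<delta>_def)
  also have "... = \<delta> / (4 * C)" using C by (simp add: power2_eq_square)
  also have "... \<le> \<delta> / 4" using C by (intro divide_left_mono) (auto simp: \<delta>_def)
  finally have n2: "C * (real n * h) \<le> dist \<xi> \<zeta> / 4" by (simp add: \<delta>_def)
  have "\<bar>A \<xi>\<bar> \<le> C * (w ^ CARD('d) / w ^ (2 * m)) * exp (- (real n / (2 * C)))"
   by (rule lagrange_coefficients[OF C cf X(1,3) h(1,2) sep w(1,2) A(1,2) _ n1 xi n2])
    (use A(3) in \<open>simp_all add: is_lagrange_def\<close>)
  also have "... \<le> C * (w ^ CARD('d) / w ^ (2 * m)) * (exp (1 / (2 * C)) * exp (- \<nu> * \<delta> / h))"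
  proof (rule mult_left_mono)
   have "- (real n / (2 * C)) \<le> 1 / (2 * C) + - \<nu> * \<delta> / h"
   proof -
    have "(\<kappa> * \<delta> / h) / (2 * C) \<le> (real n + 1) / (2 * C)" using n(2) C by (intro divide_right_mono) auto
    then show ?thesis by (simp add: \<nu>_def add_divide_distrib field_simps)
   qed
   then show "exp (- (real n / (2 * C))) \<le> exp (1 / (2 * C)) * exp (- \<nu> * \<delta> / h)" by (simp add: exp_add[symmetric])
  qed (use C w in auto)
  also have "w ^ CARD('d) / w ^ (2 * m) = c2 ^ CARD('d) / c2 ^ (2 * m) * q0 powi (int CARD('d) - 2 * int m)"
  proof -
   have "q0 powi (int CARD('d) - 2 * int m) = q0 ^ CARD('d) / q0 ^ (2 * m)"
    using power_int_diff[of q0 "int CARD('d)" "int (2 * m)", unfolded power_int_of_nat] sep(1) by simp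
   then show ?thesis by (simp add: w_def power_mult_distrib)
  qed
  finally show "\<bar>A \<xi>\<bar> \<le> K * separation_radius X powi (int CARD('d) - 2 * int m) * exp (- \<nu> * dist \<xi> \<zeta> / fill_distance X)"
   by (simp add: K_def \<delta>_def h_def q0_def mult_ac)
 qed
qed

end

theorem theorem4p3:
  fixes R :: "('a::metric_space, 'd::finite) riem"
    and \<mu> :: "'a measure"
    and \<psi> :: "nat \<Rightarrow> 'a \<Rightarrow> real"
    and ev :: "nat \<Rightarrow> real"
    and J :: "nat set"
    and Q :: "real poly"
    and m :: nat
    and k :: "'a \<Rightarrow> 'a \<Rightarrow> real"
  assumes "riemannian_manifold R"
    and "compact (UNIV :: 'a set)"
    and "two_point_homogeneous R"
    and "riemannian_volume R \<mu>"
    and "laplace_eigenbasis R \<mu> \<psi> ev"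
    and "polyharmonic_kernel R \<mu> \<psi> ev J Q k"
    and "degree Q = m"
    and "real m > real CARD('d) / 2"
    and "\<forall>p\<in>eigenspan \<psi> J. \<forall>x. poly_laplace R Q p x = 0"
  shows "\<exists>hstar>0. \<exists>\<nu>>0. \<exists>C>0. \<forall>\<rho>>0. \<forall>\<Xi> :: 'a set.
     finite \<Xi> \<and> fill_distance \<Xi> / separation_radius \<Xi> \<le> \<rho> \<and> fill_distance \<Xi> \<le> hstar \<longrightarrow>
     (\<forall>\<zeta>\<in>\<Xi>.
        (\<exists>!u. is_lagrange k \<Xi> (eigenspan \<psi> J) \<zeta> u) \<and>
        (\<forall>A p. p \<in> eigenspan \<psi> J \<and> annihilates \<Xi> A (eigenspan \<psi> J) \<and>
               is_lagrange k \<Xi> (eigenspan \<psi> J) \<zeta> (kernel_sum k \<Xi> A p) \<longrightarrow>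
           (\<forall>\<xi>\<in>\<Xi>. \<bar>A \<xi>\<bar> \<le>
              C * separation_radius \<Xi> powi (int CARD('d) - 2 * int m)
                * exp (- \<nu> * dist \<xi> \<zeta> / fill_distance \<Xi>))))"
proof -
  interpret polyharmonic_space R \<mu> \<psi> ev J Q k m
    by unfold_locales (use assms in \<open>simp_all add: field_simps\<close>)
  show ?thesis by (rule lagrange_decay)
qed

end
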